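(* Suppose that $0 < \inf_{x \in S} f(x) \leq \sup_{x \in S} f(x) < \infty$ and that the attractiveness function of the geometric preferential attachment (GPA) graph is $F = F_\gamma$ for some $\gamma > 1$. (i) For any $\nu \in (0,1)$ with $\nu > 2 - \gamma$, almost surely, for all $n$ sufficiently large, $$\max_{0 \leq i \leq n} \deg_n(i) \leq \exp\{ (\log n)^\nu \},$$ where $\deg_n(i)$ is the degree of vertex $i$ in the GPA graph $G_n$. (ii) Suppose that $\gamma > 3/2$. Then $\lim_{n \to \infty} \mathbb{P}[v_n = \eta_1(n)] = 1$ and the expected number of vertices in the GPA graph that are joined to a vertex other than their on-line nearest neighbour satisfies $$\lim_{n \to \infty} n^{-1} \mathbb{E} \sum_{i=1}^n \mathbf{1}\{ v_i \neq \eta_1(i) \} = 0 .$$ Moreover, for any $k \in \mathbb{N}$, $$\lim_{n \to \infty} n^{-1} N^{\mathrm{GPA}}_n(k) = \lim_{n \to \infty} n^{-1} \mathbb{E}[N^{\mathrm{GPA}}_n(k)] = \rho_k ,$$ the first limit equality holding in $L^1$, where $\rho_k$ is the limiting degree sequence for the on-line nearest-neighbour graph.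
   Context: Here $\mathbb{N} = \{1,2,\ldots\}$, $d \in \mathbb{N}$, and $\log x$ stands for $\max\{0, \log x\}$. $S \subset \mathbb{R}^d$ is compact, convex and of positive $d$-dimensional Lebesgue measure; $f$ is a probability density function supported on $S$; $X_0, X_1, \ldots$ are independent with density $f$; $\mathcal{X}_n = \{X_0,\ldots,X_n\}$. Write $\rho(x,y) = \|x-y\|$ for Euclidean distance. For $\gamma > 1$ and $r > 0$, $F_\gamma(r) := \exp\{(\log(1/r))^\gamma\}$ (so $F_\gamma(r) = 1$ for $r \geq 1$ by the convention on $\log$). GPA graph with attractiveness function $F : (0,\infty) \to (0,\infty)$: a random sequence of graphs $G_n = (V_n,E_n)$, $n \in \mathbb{N}$, with $V_n = \{0,1,\ldots,n\}$, vertex $i$ being located at $X_i$. $G_1$ consists of vertices $0,1$ joined by the single edge $(1,0)$ (so $v_1 = 0$). Given $G_n$ and the locations, vertex $n+1$ is added at $X_{n+1}$ together with one new edge $(n+1, v_{n+1})$, where $$\mathbb{P}[v_{n+1} = v \mid G_n, \mathcal{X}_{n+1}] = \frac{\deg_n(v) F(\rho(X_v, X_{n+1}))}{D_n(X_{n+1})}, \quad v \in V_n, \qquad D_n(x) := \sum_{v \in V_n} \deg_n(v) F(\rho(X_v,x)),$$ and $\deg_n(v)$ is the degree of $v$ in $G_n$ viewed as an undirected graph. $N^{\mathrm{GPA}}_n(k)$ is the number of vertices of $G_n$ with degree at least $k$. On-line nearest neighbour: $\eta_1(n) := \arg\min_{i \in \{0,\ldots,n-1\}} \rho(X_n,X_i)$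 (a.s. unique), $n \in \mathbb{N}$. Limiting degree sequence $\rho_k$ of the on-line nearest-neighbour graph (ONG): the ONG on $(X_0,\ldots,X_n)$ is the graph on $\{0,\ldots,n\}$ with edges $(i,\eta_1(i))$, $1 \leq i \leq n$; $\rho_k$ is the limit as $n \to \infty$ (a.s. and in $L^1$) of $n^{-1}$ times the number of vertices of (undirected) degree at least $k$ in it. Explicitly, $\rho_k = \mathbb{P}[\xi(0,U;\mathcal{H}) \geq k]$, where $\mathcal{H}$ is a unit-rate homogeneous Poisson point process on $\mathbb{R}^d \times [0,1]$, $U$ is uniform on $[0,1]$ independent of $\mathcal{H}$, $\mathcal{H}_u := \mathcal{H} \cap (\mathbb{R}^d \times [0,u])$, $B_x(y)$ is the open Euclidean ball with centre $y$ whose boundary includes $x$, and $$\xi(x,u;\mathcal{H}) := 1 + \sum_{(y,v) \in \mathcal{H},\, v > u} \mathbf{1}\{ \mathcal{H}_v \cap (B_x(y) \times [0,1]) = \{(y,v)\} \}.$$ *)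

theory Defs
  imports "HOL-Probability.Probability"
begin

section \<open>Trees grown by attaching one vertex at a time\<close>

text \<open>The graph at time \<open>n\<close> has vertices \<open>0, \<dots>, n\<close>; vertex \<open>i \<ge> 1\<close> is joined to the earlier
  vertex \<open>p i < i\<close>, so distinct \<open>i\<close> give distinct (two-element) edges.\<close>

definition attachment_edges :: "(nat \<Rightarrow> nat) \<Rightarrow> nat \<Rightarrow> nat set set" where
  "attachment_edges p n = (\<lambda>i. {i, p i}) ` {1..n}"

definition attachment_degree :: "(nat \<Rightarrow> nat) \<Rightarrow> nat \<Rightarrow> nat \<Rightarrow> nat" where
  "attachment_degree p n j = card {e \<in> attachment_edges p n. j \<in> e}"

definition num_degree_ge :: "(nat \<Rightarrow> nat) \<Rightarrow> nat \<Rightarrow> nat \<Rightarrow> nat" where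
  "num_degree_ge p n k = card {j \<in> {0..n}. k \<le> attachment_degree p n j}"

text \<open>Ties, which have probability zero for points with a density, are broken by the choice
  operator inside \<^const>\<open>arg_min_on\<close>.\<close>

definition online_nn :: "(nat \<Rightarrow> 'c::metric_space) \<Rightarrow> nat \<Rightarrow> nat" where
  "online_nn x n = arg_min_on (\<lambda>i. dist (x n) (x i)) {0..<n}"


section \<open>Geometric preferential attachment\<close>

text \<open>The truncation at \<open>0\<close> is the convention that \<open>log x\<close> means \<open>max {0, log x}\<close>. The value at
  \<open>r = 0\<close> is immaterial: two locations coincide with probability zero.\<close>

definition F_attract :: "real \<Rightarrow> real \<Rightarrow> real" where
  "F_attract \<gamma> r = exp ((max 0 (ln (1 / r))) powr \<gamma>)"

definition gpa_weight ::
    "(real \<Rightarrow> real) \<Rightarrow> (nat \<Rightarrow> 'c::metric_space) \<Rightarrow> (nat \<Rightarrow> nat) \<Rightarrow> nat \<Rightarrow> 'c \<Rightarrow> nat \<Rightarrow> real" where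
  "gpa_weight F x p n z j = real (attachment_degree p n j) * F (dist (x j) z)"

text \<open>The sigma-algebra generated by \<open>X\<^sub>0, \<dots>, X\<^sub>m\<close> and \<open>v\<^sub>1, \<dots>, v\<^sub>n\<close>.\<close>

definition history ::
    "'a measure \<Rightarrow> (nat \<Rightarrow> 'a \<Rightarrow> 'c::topological_space) \<Rightarrow> (nat \<Rightarrow> 'a \<Rightarrow> nat) \<Rightarrow> nat \<Rightarrow> nat \<Rightarrow> 'a measure"
  where
  "history M X v m n = sigma (space M)
     ({X i -` A \<inter> space M | i A. i \<le> m \<and> A \<in> sets borel} \<union>
      {v i -` B \<inter> space M | i B. 1 \<le> i \<and> i \<le> n})"

text \<open>Vertex \<open>i \<ge> 1\<close> arrives at \<open>X i\<close> and is joined to \<open>v i\<close>; the value \<open>v 0\<close> plays no role.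
  Locations are drawn afresh as vertices arrive: \<open>X\<^bsub>n+1\<^esub>\<close> is independent of the locations
  \<^emph>\<open>and\<close> the graph up to time \<open>n\<close>. Together with the law of the \<open>X i\<close> and the conditional law of
  \<open>v\<^bsub>n+1\<^esub>\<close> given the graph \<open>G\<^sub>n\<close> and \<open>X\<^sub>0, \<dots>, X\<^bsub>n+1\<^esub>\<close>, this determines the law of the process.\<close>

definition gpa_process ::
    "'a measure \<Rightarrow> (real \<Rightarrow> real) \<Rightarrow> (nat \<Rightarrow> 'a \<Rightarrow> 'c::metric_space) \<Rightarrow> (nat \<Rightarrow> 'a \<Rightarrow> nat) \<Rightarrow> bool" where
  "gpa_process M F X v \<longleftrightarrow>
     (\<forall>n. X n \<in> borel_measurable M) \<and>
     (\<forall>n\<ge>1. v n \<in> measurable M (count_space UNIV)) \<and>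
     (\<forall>\<omega>\<in>space M. v 1 \<omega> = 0) \<and>
     (\<forall>n\<ge>1. \<forall>\<omega>\<in>space M. v (Suc n) \<omega> \<in> {0..n}) \<and>
     (\<forall>n. prob_space.indep_set M (sets (vimage_algebra (space M) (X (Suc n)) borel))
            (sets (history M X v n n))) \<and>
     (\<forall>n\<ge>1. \<forall>j\<in>{0..n}. AE \<omega> in M.
        real_cond_exp M (history M X v (Suc n) n) (indicator {\<omega> \<in> space M. v (Suc n) \<omega> = j}) \<omega> =
          gpa_weight F (\<lambda>i. X i \<omega>) (\<lambda>i. v i \<omega>) n (X (Suc n) \<omega>) j /
          (\<Sum>i=0..n. gpa_weight F (\<lambda>i. X i \<omega>) (\<lambda>i. v i \<omega>) n (X (Suc n) \<omega>) i))"


section \<open>The limiting degree sequence of the on-line nearest-neighbour graph\<close>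

text \<open>A unit-rate homogeneous Poisson point process on a region \<open>A\<close>, as a random locally finite set.\<close>

definition unit_poisson_process ::
    "'b measure \<Rightarrow> 'c::euclidean_space set \<Rightarrow> ('b \<Rightarrow> 'c set) \<Rightarrow> bool" where
  "unit_poisson_process N A H \<longleftrightarrow>
     (\<forall>\<omega>\<in>space N. H \<omega> \<subseteq> A \<and> (\<forall>B. bounded B \<longrightarrow> finite (H \<omega> \<inter> B))) \<and>
     (\<forall>B\<in>sets borel. bounded B \<longrightarrow> B \<subseteq> A \<longrightarrow>
        (\<lambda>\<omega>. card (H \<omega> \<inter> B)) \<in> measurable N (count_space UNIV) \<and>
        (\<forall>m. measure N {\<omega> \<in> space N. card (H \<omega> \<inter> B) = m} =
               measure lborel B ^ m / fact m * exp (- measure lborel B))) \<and>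
     (\<forall>B :: nat \<Rightarrow> 'c set.
        (\<forall>i. B i \<in> sets borel \<and> bounded (B i) \<and> B i \<subseteq> A) \<longrightarrow> disjoint_family B \<longrightarrow>
        prob_space.indep_vars N (\<lambda>_. count_space UNIV) (\<lambda>i \<omega>. card (H \<omega> \<inter> B i)) UNIV)"

text \<open>The sigma-algebra generated by a random locally finite subset of \<open>A\<close>.\<close>

definition point_process_algebra ::
    "'b measure \<Rightarrow> 'c::euclidean_space set \<Rightarrow> ('b \<Rightarrow> 'c set) \<Rightarrow> 'b measure" where
  "point_process_algebra N A H = sigma (space N)
     {{\<omega> \<in> space N. card (H \<omega> \<inter> B) = m} | B m. B \<in> sets borel \<and> bounded B \<and> B \<subseteq> A}"

text \<open>\<open>B\<^sub>x(y)\<close> is \<^term>\<open>ball y (dist y x)\<close> and \<open>\<H>\<^sub>v\<close> is \<^term>\<open>H \<inter> (UNIV \<times> {0..v})\<close>. The sum is taken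
  in \<^typ>\<open>ennreal\<close>, so that an infinite number of terms equal to \<open>1\<close> gives \<open>\<infinity>\<close>.\<close>

definition ong_xi :: "'c::metric_space \<Rightarrow> real \<Rightarrow> ('c \<times> real) set \<Rightarrow> ennreal" where
  "ong_xi x u H = 1 +
     (\<Sum>\<^sub>\<infinity>(y, v)\<in>{(y, v) \<in> H. v > u}.
        of_bool ((H \<inter> (UNIV \<times> {0..v})) \<inter> (ball y (dist y x) \<times> {0..1}) = {(y, v)}))"

text \<open>\<open>N\<close> carries a unit-rate Poisson process \<open>H\<close> on \<open>\<real>\<^sup>d \<times> [0,1]\<close> and an independent \<open>U\<close>, uniform
  on \<open>[0,1]\<close>.\<close>

definition marked_poisson_setup ::
    "'b measure \<Rightarrow> ('b \<Rightarrow> ('c::euclidean_space \<times> real) set) \<Rightarrow> ('b \<Rightarrow> real) \<Rightarrow> bool" where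
  "marked_poisson_setup N H U \<longleftrightarrow>
     prob_space N \<and>
     unit_poisson_process N (UNIV \<times> {0..1}) H \<and>
     U \<in> borel_measurable N \<and>
     distr N borel U = uniform_measure lborel {0..1} \<and>
     prob_space.indep_set N (sets (vimage_algebra (space N) U borel))
       (sets (point_process_algebra N (UNIV \<times> {0..1}) H))"

text \<open>\<open>\<rho>\<^sub>k = P[\<xi>(0, U; \<H>) \<ge> k]\<close>, which is the almost sure and \<open>L\<^sup>1\<close> limit of
  \<open>num_degree_ge (online_nn x) n k / n\<close> over independent points \<open>x\<close> with density \<open>f\<close>; it is
  given by its explicit formula so that no limit is presupposed. It depends on \<open>(N, H, U)\<close> only through the joint
  law of \<open>(H, U)\<close>, which \<^const>\<open>marked_poisson_setup\<close> determines.\<close>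

definition ong_rho ::
    "'b measure \<Rightarrow> ('b \<Rightarrow> ('c::euclidean_space \<times> real) set) \<Rightarrow> ('b \<Rightarrow> real) \<Rightarrow> nat \<Rightarrow> real" where
  "ong_rho N H U k = measure N {\<omega> \<in> space N. ong_xi 0 (U \<omega>) (H \<omega>) \<ge> of_nat k}"

end

theory Submission
  imports Defs "HOL-Real_Asymp.Real_Asymp"
begin

text \<open>
  The attractiveness \<open>F\<^sub>\<gamma>\<close> increases so steeply near \<open>0\<close> that an arriving vertex only notices what is very
  close to it: for \<open>r \<le> l \<le> 1\<close>, convexity of the power gives
  \<open>F\<^sub>\<gamma> l / F\<^sub>\<gamma> r \<le> exp (- ln (l / r) (ln (1 / r))\<^bsup>\<gamma>-1\<^esup>)\<close> (\<open>F_attract_ratio\<close>). Everything about the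
  attachment graph follows by choosing the two scales \<open>r < l\<close>.

  \<^emph>\<open>Large degrees.\<close> Up to probability \<open>m\<^bsup>-2\<^esup>\<close> there is an older vertex within
  \<open>m\<^bsup>-1/d\<^esup> exp ((ln m)\<^bsup>\<theta>\<^esup>)\<close> of vertex \<open>m\<close>. A vertex that is further away by another factor
  \<open>exp ((ln m)\<^bsup>\<theta>\<^esup>)\<close> is handicapped by \<open>exp (- const (ln m)\<^bsup>\<theta>+\<gamma>-1\<^esup>)\<close>, which beats every power of \<open>m\<close> as soon as
  \<open>\<theta> > 2 - \<gamma>\<close>. So all but finitely many edges have length at most \<open>edge_scale \<theta> m\<close>
  (\<open>AE_short_edges\<close>), and the degree of a vertex is at most a constant plus the number of later
  points at that distance. The expected number of these is \<open>exp (O((ln n)\<^bsup>\<theta>\<^esup>))\<close>, and an exponential moment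
  bound makes it smaller than \<open>exp ((ln n)\<^bsup>\<nu>\<^esup>) / 2\<close> for all vertices at once, for any \<open>\<nu> > \<theta>\<close>
  (\<open>AE_max_degree_le\<close>).

  \<^emph>\<open>Nearest neighbours win.\<close> If \<open>\<gamma> > 3/2\<close> there is a \<open>\<nu>\<close> with \<open>2 - \<gamma> < \<nu> < \<gamma> - 1\<close>. With high
  probability no competitor is within a factor \<open>1 + (ln m)\<^bsup>-3k\<^esup>\<close> of the distance to the nearest neighbour,
  and then every competitor is handicapped by \<open>exp (- const (ln m)\<^bsup>\<gamma>-1-3k\<^esup>)\<close>. For small \<open>k\<close> this
  outweighs both the degrees, which are at most \<open>exp ((ln m)\<^bsup>\<nu>\<^esup>)\<close>, and the number of competitors
  within reach (\<open>misattached_prob_tendsto\<close>). Each edge that differs from the on-line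
  nearest-neighbour graph changes the degrees of at most two vertices in a comparison of the two graphs.

  \<^emph>\<open>The nearest-neighbour graph.\<close> Its degree sequence is compared with a local one, in which only
  edges shorter than \<open>r\<close> are counted, where \<open>r\<^bsup>d\<^esup> = L / n\<close>; a longer edge requires an isolated vertex, and
  on average there are at most \<open>n / (c L)\<close> of these. Replacing the arrival order by independent
  uniform times does not change the law of the local count, and makes its mean an integral over one
  point of the probability of an event about the other points in a window of radius \<open>2 r\<close>. In the window the density is
  almost constant on average, by \<open>L\<^sup>1\<close>-continuity of translations, and the number of points is almost
  Poisson, so the window looks like a Poisson process (\<open>hit_local_prob_close\<close>). An Efron-Stein
  inequality turns convergence of the mean into convergence in \<open>L\<^sup>1\<close> (\<open>sample_count_L1\<close>), and finally
  \<open>L\<close> tends to infinity (\<open>num_degree_ge_L1\<close>).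
\<close>

section \<open>Product measures\<close>

lemma (in prob_space) integral_unit_interval:
  fixes g :: "'a \<Rightarrow> real"
  assumes "\<And>z. 0 \<le> g z \<and> g z \<le> 1"
  shows "0 \<le> (\<integral>z. g z \<partial>M) \<and> (\<integral>z. g z \<partial>M) \<le> 1"
proof (cases "integrable M g")
  case True
  then show ?thesis using assms by (auto intro!: integral_nonneg_AE integral_le_const)
qed (simp add: not_integrable_integral_eq)

text \<open>Replace the factors one at a time: each replacement changes the integral of a function with
  values in \<open>[0,1]\<close> by at most \<open>\<Delta>\<close>.\<close>

lemma product_prob_close:
  fixes h :: "('i \<Rightarrow> 'a) \<Rightarrow> real"
  assumes "prob_space P" "prob_space Q" and PQ: "sets P = sets Q" and "finite I"
    and close: "\<And>g::'a \<Rightarrow> real. g \<in> borel_measurable P \<Longrightarrow> (\<And>z. 0 \<le> g z \<and> g z \<le> 1)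
      \<Longrightarrow> \<bar>(\<integral>z. g z \<partial>P) - (\<integral>z. g z \<partial>Q)\<bar> \<le> \<Delta>"
    and "h \<in> borel_measurable (\<Pi>\<^sub>M i\<in>I. P)" "\<And>w. 0 \<le> h w \<and> h w \<le> 1"
  shows "\<bar>(\<integral>w. h w \<partial>(\<Pi>\<^sub>M i\<in>I. P)) - (\<integral>w. h w \<partial>(\<Pi>\<^sub>M i\<in>I. Q))\<bar> \<le> real (card I) * \<Delta>"
  using \<open>finite I\<close> assms(6,7)
proof (induction I arbitrary: h rule: finite_induct)
  case empty
  then show ?case by (simp add: PiM_empty)
next
  case (insert i I)
  note [measurable_cong] = PQ
  interpret P: prob_space P by fact
  interpret Q: prob_space Q by fact
  interpret PP: product_prob_space "\<lambda>_::'i. P" by unfold_locales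
  interpret QQ: product_prob_space "\<lambda>_::'i. Q" by unfold_locales
  note [measurable] = insert.prems(1)
  have setsI: "sets (\<Pi>\<^sub>M i\<in>J. P) = sets (\<Pi>\<^sub>M i\<in>J. Q)" for J :: "'i set"
    by (intro sets_PiM_cong) (auto simp: PQ)
  note [measurable_cong] = setsI
  interpret PI: prob_space "\<Pi>\<^sub>M i\<in>I. P" by (intro prob_space_PiM) unfold_locales
  interpret QI: prob_space "\<Pi>\<^sub>M i\<in>I. Q" by (intro prob_space_PiM) unfold_locales
  interpret PJ: prob_space "\<Pi>\<^sub>M i\<in>insert i I. P" by (intro prob_space_PiM) unfold_locales
  interpret QJ: prob_space "\<Pi>\<^sub>M i\<in>insert i I. Q" by (intro prob_space_PiM) unfold_locales
  have b: "norm (h w) \<le> 1" for w using insert.prems(2)[of w] by simp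
  have hm[measurable]: "(\<lambda>p. h ((fst p)(i := snd p))) \<in> borel_measurable ((\<Pi>\<^sub>M i\<in>I. P) \<Otimes>\<^sub>M P)"
    by measurable
  have hm1[measurable]: "(\<lambda>z. h (w(i := z))) \<in> borel_measurable P" if "w \<in> space (\<Pi>\<^sub>M i\<in>I. P)" for w
    using that by measurable
  have intP: "integrable P (\<lambda>z. h (w(i := z)))" "integrable Q (\<lambda>z. h (w(i := z)))"
    if "w \<in> space (\<Pi>\<^sub>M i\<in>I. P)" for w
  proof -
    have "(\<lambda>z. h (w(i := z))) \<in> borel_measurable Q"
      using hm1[OF that] by (simp add: measurable_cong_sets[OF PQ refl])
    then show "integrable P (\<lambda>z. h (w(i := z)))" "integrable Q (\<lambda>z. h (w(i := z)))"
      using hm1[OF that] b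
      by (intro P.integrable_const_bound[where B=1] Q.integrable_const_bound[where B=1] AE_I2; blast)+
  qed
  define HP where "HP w = (\<integral>z. h (w(i := z)) \<partial>P)" for w
  define HQ where "HQ w = (\<integral>z. h (w(i := z)) \<partial>Q)" for w
  have [measurable]: "HP \<in> borel_measurable (\<Pi>\<^sub>M i\<in>I. P)" "HQ \<in> borel_measurable (\<Pi>\<^sub>M i\<in>I. P)"
    unfolding HP_def HQ_def by (measurable)
  have HQ01: "0 \<le> HQ w \<and> HQ w \<le> 1" for w
    unfolding HQ_def using insert.prems(2) by (intro Q.integral_unit_interval)
  have HP01: "0 \<le> HP w \<and> HP w \<le> 1" for w
    unfolding HP_def using insert.prems(2) by (intro P.integral_unit_interval)
  have eP: "(\<integral>w. h w \<partial>(\<Pi>\<^sub>M i\<in>insert i I. P)) = (\<integral>w. HP w \<partial>(\<Pi>\<^sub>M i\<in>I. P))"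
    unfolding HP_def using insert b
    by (intro PP.product_integral_insert) (auto intro!: PJ.integrable_const_bound[where B=1])
  have eQ: "(\<integral>w. h w \<partial>(\<Pi>\<^sub>M i\<in>insert i I. Q)) = (\<integral>w. HQ w \<partial>(\<Pi>\<^sub>M i\<in>I. Q))"
    unfolding HQ_def using insert b
    by (intro QQ.product_integral_insert) (auto intro!: QJ.integrable_const_bound[where B=1])
  have c: "\<bar>HP w - HQ w\<bar> \<le> \<Delta>" if "w \<in> space (\<Pi>\<^sub>M i\<in>I. P)" for w
    unfolding HP_def HQ_def using insert.prems(2) hm1[OF that] by (intro close) auto
  have iP: "integrable (\<Pi>\<^sub>M i\<in>I. P) HP" "integrable (\<Pi>\<^sub>M i\<in>I. P) HQ"
    using HQ01 HP01 by (auto intro!: PI.integrable_const_bound[where B=1])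
  have "\<bar>(\<integral>w. HP w \<partial>(\<Pi>\<^sub>M i\<in>I. P)) - (\<integral>w. HQ w \<partial>(\<Pi>\<^sub>M i\<in>I. P))\<bar> = \<bar>\<integral>w. HP w - HQ w \<partial>(\<Pi>\<^sub>M i\<in>I. P)\<bar>"
    using iP by simp
  also have "\<dots> \<le> (\<integral>w. \<bar>HP w - HQ w\<bar> \<partial>(\<Pi>\<^sub>M i\<in>I. P))" by (rule integral_abs_bound)
  also have "\<dots> \<le> \<Delta>"
    using c iP by (intro PI.integral_le_const AE_I2) auto
  finally have 1: "\<bar>(\<integral>w. HP w \<partial>(\<Pi>\<^sub>M i\<in>I. P)) - (\<integral>w. HQ w \<partial>(\<Pi>\<^sub>M i\<in>I. P))\<bar> \<le> \<Delta>" .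
  have 2: "\<bar>(\<integral>w. HQ w \<partial>(\<Pi>\<^sub>M i\<in>I. P)) - (\<integral>w. HQ w \<partial>(\<Pi>\<^sub>M i\<in>I. Q))\<bar> \<le> real (card I) * \<Delta>"
    using HQ01 by (intro insert.IH) auto
  show ?case unfolding eP eQ using 1 2 insert.hyps by (simp add: algebra_simps)
qed

text \<open>Independent marked points can be sampled by drawing all positions and all marks separately.\<close>

lemma PiM_pair_factor:
  fixes J :: "'i set"
  assumes "finite J" "prob_space P" "prob_space Q"
  shows "distr ((\<Pi>\<^sub>M j\<in>J. P) \<Otimes>\<^sub>M (\<Pi>\<^sub>M j\<in>J. Q)) (\<Pi>\<^sub>M j\<in>J. P \<Otimes>\<^sub>M Q) (\<lambda>(x, t). \<lambda>j\<in>J. (x j, t j))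
    = (\<Pi>\<^sub>M j\<in>J. P \<Otimes>\<^sub>M Q)"
proof -
  interpret P: prob_space P by fact
  interpret Q: prob_space Q by fact
  interpret PQ: pair_prob_space P Q ..
  interpret PP: product_prob_space "\<lambda>_::'i. P" by unfold_locales
  interpret QQ: product_prob_space "\<lambda>_::'i. Q" by unfold_locales
  interpret R: product_prob_space "\<lambda>_::'i. P \<Otimes>\<^sub>M Q" by unfold_locales
  interpret PI: prob_space "\<Pi>\<^sub>M i\<in>J. P" by (intro prob_space_PiM) unfold_locales
  interpret QI: prob_space "\<Pi>\<^sub>M i\<in>J. Q" by (intro prob_space_PiM) unfold_locales
  interpret PQI: pair_prob_space "\<Pi>\<^sub>M i\<in>J. P" "\<Pi>\<^sub>M i\<in>J. Q" ..
  show ?thesis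
  proof (rule R.PiM_eqI[OF \<open>finite J\<close>])
    fix A assume A: "\<And>i. i \<in> J \<Longrightarrow> A i \<in> sets (P \<Otimes>\<^sub>M Q)"
    have [measurable]: "(\<lambda>(x, t). \<lambda>j\<in>J. (x j, t j)) \<in>
       ((\<Pi>\<^sub>M j\<in>J. P) \<Otimes>\<^sub>M (\<Pi>\<^sub>M j\<in>J. Q)) \<rightarrow>\<^sub>M (\<Pi>\<^sub>M j\<in>J. P \<Otimes>\<^sub>M Q)"
      by (auto intro!: measurable_restrict simp: split_beta)
    have As: "Pi\<^sub>E J A \<in> sets (\<Pi>\<^sub>M j\<in>J. P \<Otimes>\<^sub>M Q)" using A \<open>finite J\<close> by (intro sets_PiM_I_finite) auto
    have [measurable]: "j \<in> J \<Longrightarrow> A j \<in> sets (P \<Otimes>\<^sub>M Q)" for j by (rule A)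
    have "emeasure (distr ((\<Pi>\<^sub>M j\<in>J. P) \<Otimes>\<^sub>M (\<Pi>\<^sub>M j\<in>J. Q)) (\<Pi>\<^sub>M j\<in>J. P \<Otimes>\<^sub>M Q) (\<lambda>(x, t). \<lambda>j\<in>J. (x j, t j))) (Pi\<^sub>E J A)
      = (\<integral>\<^sup>+ p. indicator (Pi\<^sub>E J A) ((\<lambda>(x, t). \<lambda>j\<in>J. (x j, t j)) p) \<partial>((\<Pi>\<^sub>M j\<in>J. P) \<Otimes>\<^sub>M (\<Pi>\<^sub>M j\<in>J. Q)))"
      using As by (simp add: nn_integral_distr nn_integral_indicator[symmetric] del: nn_integral_indicator)
    also have "\<dots> = (\<integral>\<^sup>+ p. (\<Prod>j\<in>J. indicator (A j) (fst p j, snd p j)) \<partial>((\<Pi>\<^sub>M j\<in>J. P) \<Otimes>\<^sub>M (\<Pi>\<^sub>M j\<in>J. Q)))"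
      using \<open>finite J\<close> by (intro nn_integral_cong) (auto simp: indicator_def PiE_iff prod_zero_iff split: prod.splits)
    also have "\<dots> = (\<integral>\<^sup>+ x. \<integral>\<^sup>+ t. (\<Prod>j\<in>J. indicator (A j) (x j, t j)) \<partial>(\<Pi>\<^sub>M j\<in>J. Q) \<partial>(\<Pi>\<^sub>M j\<in>J. P))"
      by (subst QI.nn_integral_fst[symmetric]) (auto simp: split_beta)
    also have "\<dots> = (\<integral>\<^sup>+ x. (\<Prod>j\<in>J. \<integral>\<^sup>+ t. indicator (A j) (x j, t) \<partial>Q) \<partial>(\<Pi>\<^sub>M j\<in>J. P))"
    proof (intro nn_integral_cong)
      fix x assume x: "x \<in> space (\<Pi>\<^sub>M j\<in>J. P)"
      show "(\<integral>\<^sup>+ t. (\<Prod>j\<in>J. indicator (A j) (x j, t j)) \<partial>(\<Pi>\<^sub>M j\<in>J. Q)) = (\<Prod>j\<in>J. \<integral>\<^sup>+ t. indicator (A j) (x j, t) \<partial>Q)"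
        using \<open>finite J\<close>
      proof (rule QQ.product_nn_integral_prod)
        fix j assume j: "j \<in> J"
        then have "x j \<in> space P" using x by (auto simp: space_PiM)
        then show "(\<lambda>t. indicator (A j) (x j, t)) \<in> borel_measurable Q"
          using measurable_compose[OF measurable_Pair1' borel_measurable_indicator[OF A[OF j]]] by blast
      qed
    qed
    also have "\<dots> = (\<Prod>j\<in>J. \<integral>\<^sup>+ x. \<integral>\<^sup>+ t. indicator (A j) (x, t) \<partial>Q \<partial>P)"
      using \<open>finite J\<close> by (intro PP.product_nn_integral_prod) auto
    also have "\<dots> = (\<Prod>j\<in>J. emeasure (P \<Otimes>\<^sub>M Q) (A j))"
      by (intro prod.cong refl) (auto simp: Q.emeasure_pair_measure A)
    finally show "emeasure (distr ((\<Pi>\<^sub>M j\<in>J. P) \<Otimes>\<^sub>M (\<Pi>\<^sub>M j\<in>J. Q)) (\<Pi>\<^sub>M j\<in>J. P \<Otimes>\<^sub>M Q) (\<lambda>(x, t). \<lambda>j\<in>J. (x j, t j))) (Pi\<^sub>E J A)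
       = (\<Prod>j\<in>J. emeasure (P \<Otimes>\<^sub>M Q) (A j))" .
  qed (use \<open>finite J\<close> in auto)
qed

text \<open>The Efron-Stein inequality in a form suited to counts: \<open>W i\<close> is \<open>V\<close>
  computed without the point \<open>i\<close>, and any function independent of the coordinate
  \<open>i\<close> may stand in for the conditional mean, since the conditional mean is the best
  such approximation in \<open>L\<^sup>2\<close>.\<close>

lemma efron_stein_deletion:
  fixes V :: "('i \<Rightarrow> 'a) \<Rightarrow> real"
  assumes "prob_space P" "finite I"
    and "V \<in> borel_measurable (\<Pi>\<^sub>M i\<in>I. P)" "\<And>w. \<bar>V w\<bar> \<le> B"
    and "\<And>i. i \<in> I \<Longrightarrow> W i \<in> borel_measurable (\<Pi>\<^sub>M i\<in>I. P)" "\<And>i w. i \<in> I \<Longrightarrow> \<bar>W i w\<bar> \<le> B"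
    and "\<And>i w z. i \<in> I \<Longrightarrow> W i (w(i := z)) = W i w"
  shows "(\<integral>w. (V w - (\<integral>w. V w \<partial>(\<Pi>\<^sub>M i\<in>I. P)))\<^sup>2 \<partial>(\<Pi>\<^sub>M i\<in>I. P))
    \<le> (\<Sum>i\<in>I. \<integral>w. (V w - W i w)\<^sup>2 \<partial>(\<Pi>\<^sub>M i\<in>I. P))"
  using \<open>finite I\<close> assms(3-7)
proof (induction I arbitrary: V W rule: finite_induct)
  case empty
  then show ?case by (simp add: PiM_empty lebesgue_integral_count_space_finite)
next
  case (insert i I)
  interpret P: prob_space P by fact
  interpret PP: product_prob_space "\<lambda>_::'i. P" by unfold_locales
  interpret PI: prob_space "\<Pi>\<^sub>M i\<in>I. P" by (intro prob_space_PiM) unfold_locales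
  interpret PJ: prob_space "\<Pi>\<^sub>M i\<in>insert i I. P" by (intro prob_space_PiM) unfold_locales
  interpret PPI: pair_prob_space P "\<Pi>\<^sub>M i\<in>I. P" ..
  let ?PI = "\<Pi>\<^sub>M i\<in>I. P" and ?PJ = "\<Pi>\<^sub>M i\<in>insert i I. P"
  note [measurable] = insert.prems(1)
  have Wm[measurable]: "W j \<in> borel_measurable ?PJ" if "j \<in> insert i I" for j using insert.prems(3)[OF that] .
  have B: "\<bar>V w\<bar> \<le> B" "j \<in> insert i I \<Longrightarrow> \<bar>W j w\<bar> \<le> B" for w j using insert.prems(2,4) by auto
  have B0: "0 \<le> B" using B(1)[of undefined] by linarith
  \<comment> \<open>bounded measurable functions of all the coordinates, and their partial integrals\<close>
  have fub: "(\<integral>w. g w \<partial>?PJ) = (\<integral>w. (\<integral>z. g (w(i := z)) \<partial>P) \<partial>?PI)"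
    "(\<lambda>w. (\<integral>z. g (w(i := z)) \<partial>P)) \<in> borel_measurable ?PI"
    "\<And>w. w \<in> space ?PI \<Longrightarrow> integrable P (\<lambda>z. g (w(i := z)))"
    "integrable ?PI (\<lambda>w. (\<integral>z. g (w(i := z)) \<partial>P))"
    "\<And>w. \<bar>\<integral>z. g (w(i := z)) \<partial>P\<bar> \<le> C"
    if [measurable]: "g \<in> borel_measurable ?PJ" and bd: "\<And>w. \<bar>g w\<bar> \<le> C" for g :: "('i \<Rightarrow> 'a) \<Rightarrow> real" and C
  proof -
    have C0: "0 \<le> C" using bd[of undefined] by linarith
    show "(\<integral>w. g w \<partial>?PJ) = (\<integral>w. (\<integral>z. g (w(i := z)) \<partial>P) \<partial>?PI)"
      using insert bd by (intro PP.product_integral_insert) (auto intro!: PJ.integrable_const_bound[where B=C])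
    have hm[measurable]: "(\<lambda>p. g ((fst p)(i := snd p))) \<in> borel_measurable (?PI \<Otimes>\<^sub>M P)" by measurable
    then show m: "(\<lambda>w. (\<integral>z. g (w(i := z)) \<partial>P)) \<in> borel_measurable ?PI" by measurable
    show int: "integrable P (\<lambda>z. g (w(i := z)))" if "w \<in> space ?PI" for w
    proof -
      have "(\<lambda>z. g (w(i := z))) \<in> borel_measurable P" using that by measurable
      then show ?thesis using bd by (intro P.integrable_const_bound[where B=C]) auto
    qed
    show b: "\<bar>\<integral>z. g (w(i := z)) \<partial>P\<bar> \<le> C" for w
    proof (cases "integrable P (\<lambda>z. g (w(i := z)))")
      case True
      have "\<bar>\<integral>z. g (w(i := z)) \<partial>P\<bar> \<le> (\<integral>z. \<bar>g (w(i := z))\<bar> \<partial>P)" by (rule integral_abs_bound)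
      also have "\<dots> \<le> C" using True bd by (intro P.integral_le_const) auto
      finally show ?thesis .
    qed (simp add: not_integrable_integral_eq C0)
    show "integrable ?PI (\<lambda>w. (\<integral>z. g (w(i := z)) \<partial>P))"
      using b m by (intro PI.integrable_const_bound[where B=C]) auto
  qed
  define h where "h w = (\<integral>z. V (w(i := z)) \<partial>P)" for w
  define hW where "hW j w = (\<integral>z. W j (w(i := z)) \<partial>P)" for j w
  define m where "m = (\<integral>w. V w \<partial>?PJ)"
  note hV = fub[of V B, OF insert.prems(1) B(1), folded h_def m_def]
  note hW = fub[OF insert.prems(3) B(2), folded hW_def]
  have sq: "\<bar>x\<^sup>2\<bar> \<le> C\<^sup>2" if "\<bar>x\<bar> \<le> C" for x C :: real
    using power_mono[OF that, of 2] by simp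
  have mB: "\<bar>m\<bar> \<le> B" 
    unfolding hV(1) using hV(4,5) by (intro order_trans[OF integral_abs_bound] PI.integral_le_const) auto
  have VmW: "\<bar>(V w - W j w)\<^sup>2\<bar> \<le> (2 * B)\<^sup>2" if "j \<in> insert i I" for w j
    using B(1)[of w] B(2)[OF that, of w] by (intro sq) auto
  have fVW: "(\<integral>w. (V w - W j w)\<^sup>2 \<partial>?PJ) = (\<integral>w. (\<integral>z. (V (w(i := z)) - W j (w(i := z)))\<^sup>2 \<partial>P) \<partial>?PI)"
    "integrable ?PI (\<lambda>w. (\<integral>z. (V (w(i := z)) - W j (w(i := z)))\<^sup>2 \<partial>P))"
    "w \<in> space ?PI \<Longrightarrow> integrable P (\<lambda>z. (V (w(i := z)) - W j (w(i := z)))\<^sup>2)"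
    if j: "j \<in> insert i I" for j w
  proof -
    have [measurable]: "W j \<in> borel_measurable ?PJ" using Wm[OF j] .
    have m: "(\<lambda>w. (V w - W j w)\<^sup>2) \<in> borel_measurable ?PJ" by measurable
    show "(\<integral>w. (V w - W j w)\<^sup>2 \<partial>?PJ) = (\<integral>w. (\<integral>z. (V (w(i := z)) - W j (w(i := z)))\<^sup>2 \<partial>P) \<partial>?PI)"
      "integrable ?PI (\<lambda>w. (\<integral>z. (V (w(i := z)) - W j (w(i := z)))\<^sup>2 \<partial>P))"
      "w \<in> space ?PI \<Longrightarrow> integrable P (\<lambda>z. (V (w(i := z)) - W j (w(i := z)))\<^sup>2)"
      using fub(1,4,3)[OF m VmW[OF j]] by auto
  qed
  have Vm: "\<bar>(V w - m)\<^sup>2\<bar> \<le> (2 * B)\<^sup>2" for w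
    using B(1)[of w] mB by (intro sq) auto
  have "(\<lambda>w. (V w - m)\<^sup>2) \<in> borel_measurable ?PJ" by measurable
  note fVm = fub[OF this Vm]
  have hm2: "integrable ?PI (\<lambda>w. (h w - m)\<^sup>2)"
  proof (rule PI.integrable_const_bound[where B="(2 * B)\<^sup>2"])
    have "\<bar>h w - m\<bar> \<le> 2 * B" for w using hV(5)[of w] mB by linarith
    then show "AE w in ?PI. norm ((h w - m)\<^sup>2) \<le> (2 * B)\<^sup>2" using sq[of "h _ - m" "2 * B"] by (intro AE_I2) simp
  qed (use hV(2) in measurable)
  have hW2: "integrable ?PI (\<lambda>w. (h w - hW j w)\<^sup>2)" if "j \<in> insert i I" for j
  proof (rule PI.integrable_const_bound[where B="(2 * B)\<^sup>2"])
    have "\<bar>h w - hW j w\<bar> \<le> 2 * B" for w using hV(5)[of w] hW(5)[OF that that, of w] by linarith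
    then show "AE w in ?PI. norm ((h w - hW j w)\<^sup>2) \<le> (2 * B)\<^sup>2" using sq[of "h _ - hW j _" "2 * B"] by (intro AE_I2) simp
  qed (use hV(2) hW(2)[OF that that] in measurable)
  \<comment> \<open>averaging over coordinate \<open>i\<close> is the orthogonal projection, so it splits the variance\<close>
  have one: "(\<integral>z. (V (w(i := z)) - m)\<^sup>2 \<partial>P) \<le> (\<integral>z. (V (w(i := z)) - W i (w(i := z)))\<^sup>2 \<partial>P) + (h w - m)\<^sup>2"
    if w: "w \<in> space ?PI" for w
  proof -
    have iV: "integrable P (\<lambda>z. V (w(i := z)))" using hV(3)[OF w] .
    have iV2: "integrable P (\<lambda>z. (V (w(i := z)))\<^sup>2)"
    proof (rule P.integrable_const_bound[where B="B\<^sup>2"])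
      show "AE z in P. norm ((V (w(i := z)))\<^sup>2) \<le> B\<^sup>2" using sq[OF B(1)] by auto
    qed (use iV in measurable)
    have var: "(\<integral>z. (V (w(i := z)) - c)\<^sup>2 \<partial>P) = (\<integral>z. (V (w(i := z)))\<^sup>2 \<partial>P) - 2 * c * h w + c\<^sup>2" for c
      using iV iV2 unfolding h_def by (simp add: power2_diff P.prob_space algebra_simps)
    have "(\<integral>z. (V (w(i := z)) - W i (w(i := z)))\<^sup>2 \<partial>P) = (\<integral>z. (V (w(i := z)) - W i w)\<^sup>2 \<partial>P)"
      by (simp only: insert.prems(5)[OF insertI1])
    moreover have "0 \<le> (h w - W i w)\<^sup>2" by simp
    ultimately show ?thesis unfolding var by (simp add: power2_diff algebra_simps)
  qed
  have jen: "(h w - hW j w)\<^sup>2 \<le> (\<integral>z. (V (w(i := z)) - W j (w(i := z)))\<^sup>2 \<partial>P)"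
    if w: "w \<in> space ?PI" and j: "j \<in> insert i I" for w j
  proof -
    let ?g = "\<lambda>z. V (w(i := z)) - W j (w(i := z))"
    have i1: "integrable P ?g" by (rule Bochner_Integration.integrable_diff[OF hV(3)[OF w] hW(3)[OF j j w]])
    have i2: "integrable P (\<lambda>z. (?g z)\<^sup>2)" using fVW(3)[OF j w] .
    have e: "h w - hW j w = P.expectation ?g" unfolding h_def hW_def
      by (rule Bochner_Integration.integral_diff[OF hV(3)[OF w] hW(3)[OF j j w], symmetric])
    have "0 \<le> P.variance ?g" by simp
    also have "\<dots> = P.expectation (\<lambda>z. (?g z)\<^sup>2) - (P.expectation ?g)\<^sup>2" using i1 i2 by (rule P.variance_eq)
    finally show ?thesis unfolding e by simp
  qed
  have mI: "m = (\<integral>w. h w \<partial>?PI)" using hV(1) .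
  have IH: "(\<integral>w. (h w - m)\<^sup>2 \<partial>?PI) \<le> (\<Sum>j\<in>I. \<integral>w. (h w - hW j w)\<^sup>2 \<partial>?PI)"
    unfolding mI
  proof (rule insert.IH[of h hW])
    fix j and w :: "'i \<Rightarrow> 'a" and z assume j: "j \<in> I"
    then have "j \<noteq> i" using insert.hyps by auto
    then have "w(j := z, i := y) = w(i := y, j := z)" for y :: 'a by (simp add: fun_upd_twist)
    then show "hW j (w(j := z)) = hW j w" 
      unfolding hW_def by (simp only: insert.prems(5)[OF insertI2[OF j]])
  qed (use hV hW in auto)
  have "(\<integral>w. (V w - m)\<^sup>2 \<partial>?PJ) = (\<integral>w. (\<integral>z. (V (w(i := z)) - m)\<^sup>2 \<partial>P) \<partial>?PI)"
    by (rule fVm(1))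
  also have "\<dots> \<le> (\<integral>w. (\<integral>z. (V (w(i := z)) - W i (w(i := z)))\<^sup>2 \<partial>P) + (h w - m)\<^sup>2 \<partial>?PI)"
    using one hm2 fVm(4) fVW(2)[OF insertI1] by (intro integral_mono) auto
  also have "\<dots> = (\<integral>w. (V w - W i w)\<^sup>2 \<partial>?PJ) + (\<integral>w. (h w - m)\<^sup>2 \<partial>?PI)"
    using hm2 fVW(1,2)[OF insertI1] by simp
  also have "(\<integral>w. (h w - m)\<^sup>2 \<partial>?PI) \<le> (\<Sum>j\<in>I. \<integral>w. (V w - W j w)\<^sup>2 \<partial>?PJ)"
  proof (rule order_trans[OF IH], rule sum_mono)
    fix j assume j: "j \<in> I"
    then show "(\<integral>w. (h w - hW j w)\<^sup>2 \<partial>?PI) \<le> (\<integral>w. (V w - W j w)\<^sup>2 \<partial>?PJ)"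
      using fVW(1,2)[OF insertI2[OF j]] hW2[of j] jen[of _ j] by (auto intro!: integral_mono)
  qed
  finally show ?case using insert.hyps by (simp add: m_def)
qed

section \<open>Poisson approximation of binomial weights\<close>

lemma binomial_over_power_tendsto:
  "(\<lambda>n. real (n choose m) / real n ^ m) \<longlonglongrightarrow> 1 / fact m"
proof (induction m)
  case (Suc m)
  have "real (n choose Suc m) = real (n choose m) * (real n - real m) / (real m + 1)" for n
  proof (cases "m \<le> n")
    case True
    have "Suc m * (n choose Suc m) = (n - m) * (n choose m)"
      using binomial_absorption[of m n] binomial_absorb_comp[of n m] by simp
    then have "real (Suc m) * real (n choose Suc m) = real (n - m) * real (n choose m)"
      using of_nat_mult by metis
    then show ?thesis using True by (simp add: of_nat_diff field_simps)
  qed (simp add: binomial_eq_0)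
  then have e: "real (n choose Suc m) / real n ^ Suc m
     = real (n choose m) / real n ^ m * ((real n - real m) / real n) / (real m + 1)" for n
    by simp
  have "(\<lambda>n. (real n - real m) / real n) \<longlonglongrightarrow> 1" by real_asymp
  from tendsto_divide[OF tendsto_mult[OF Suc this] tendsto_const[of "real m + 1"]]
  show ?case unfolding e by (simp add: algebra_simps)
qed simp

text \<open>Pointwise convergence of probability weights implies convergence in total variation (Scheffe);
  this is obtained by dominated convergence of the positive parts.\<close>

lemma binomial_poisson_weights_tendsto:
  fixes l :: real assumes "0 \<le> l"
  shows "(\<lambda>n. \<Sum>m. \<bar>real (n choose m) * (l / n) ^ m * (1 - l / n) ^ (n - m) - l ^ m / fact m * exp (- l)\<bar>) \<longlonglongrightarrow> 0"
proof -
  define b where "b n m = real (n choose m) * (l / n) ^ m * (1 - l / n) ^ (n - m)" for n m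
  define p where "p m = l ^ m / fact m * exp (- l)" for m :: nat
  have ev: "eventually (\<lambda>n. l < real n) sequentially"
    using filterlim_real_sequentially by (simp add: filterlim_at_top_dense)
  have lim: "(\<lambda>n. b n m) \<longlonglongrightarrow> p m" for m
  proof -
    have l1: "(\<lambda>n. (1 + (- l) / real n) ^ n) \<longlonglongrightarrow> exp (- l)" by (rule tendsto_exp_limit_sequentially)
    have l2: "(\<lambda>n. (1 - l / real n) ^ m) \<longlonglongrightarrow> 1"
      using tendsto_power[of "\<lambda>n. 1 - l / real n" 1 sequentially m]
      by (auto intro!: tendsto_eq_intros tendsto_divide_0[OF tendsto_const] filterlim_at_top_imp_at_infinity filterlim_real_sequentially)
    have "(\<lambda>n. real (n choose m) / real n ^ m * l ^ m * ((1 + (- l) / real n) ^ n / (1 - l / real n) ^ m)) \<longlonglongrightarrow> 1 / fact m * l ^ m * (exp (- l) / 1)"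
      by (intro tendsto_intros binomial_over_power_tendsto l1 l2) simp
    moreover have "eventually (\<lambda>n. real (n choose m) / real n ^ m * l ^ m * ((1 + (- l) / real n) ^ n / (1 - l / real n) ^ m) = b n m) sequentially"
      using ev eventually_ge_at_top[of m]
    proof eventually_elim
      case (elim n)
      have nz: "(1 - l / real n) ^ m \<noteq> 0" using elim assms by (auto simp: field_simps)
      have "(1 - l / real n) ^ n = (1 - l / real n) ^ (n - m) * (1 - l / real n) ^ m"
        using elim by (simp add: power_add[symmetric])
      then have "(1 + (- l) / real n) ^ n / (1 - l / real n) ^ m = (1 - l / real n) ^ (n - m)" using nz by simp
      then show ?case by (simp add: b_def power_divide)
    qed
    ultimately show ?thesis unfolding p_def by (simp add: tendsto_cong)
  qed
  have bound: "norm \<bar>b n m - p m\<bar> \<le> l ^ m / fact m" if "l < real n" for n m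
  proof -
    have "0 \<le> b n m" using that assms by (auto simp: b_def intro!: mult_nonneg_nonneg)
    have "real ((n choose m) * fact m) \<le> real (n ^ m)" using binomial_fact_pow[of n m] of_nat_le_iff by blast
    then have c: "real (n choose m) / real n ^ m \<le> 1 / fact m"
      using that assms by (simp add: field_simps)
    have "b n m = real (n choose m) / real n ^ m * l ^ m * (1 - l / n) ^ (n - m)" by (simp add: b_def power_divide)
    also have "\<dots> \<le> 1 / fact m * l ^ m * 1"
      using that assms c by (intro mult_mono power_le_one) auto
    finally have "b n m \<le> l ^ m / fact m" by simp
    moreover have "0 \<le> p m" "p m \<le> l ^ m / fact m" unfolding p_def using assms
      using mult_left_le[of "exp (- l)" "l ^ m / fact m"] by auto
    ultimately show ?thesis using \<open>0 \<le> b n m\<close> by (simp add: abs_le_iff)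
  qed
  have "eventually (\<lambda>n. summable (\<lambda>k. norm \<bar>b n k - p k\<bar>)) sequentially \<and>
     summable (\<lambda>k. norm (0::real)) \<and> (\<lambda>n. \<Sum>k. \<bar>b n k - p k\<bar>) \<longlonglongrightarrow> (\<Sum>k. 0)"
  proof (rule tannerys_theorem[where M="\<lambda>m. l ^ m / fact m"])
    show "(\<lambda>n. \<bar>b n k - p k\<bar>) \<longlonglongrightarrow> 0" for k
      using tendsto_rabs[OF tendsto_diff[OF lim[of k] tendsto_const[of "p k"]]] by simp
    have "eventually (\<lambda>(k::nat, n). norm \<bar>b n k - p k\<bar> \<le> l ^ k / fact k) (top \<times>\<^sub>F sequentially)"
      using ev bound unfolding eventually_prod_filter
      by (intro exI[of _ "\<lambda>_. True"] exI[of _ "\<lambda>n. l < real n"]) auto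
    then show "eventually (\<lambda>(k, n). norm \<bar>b n k - p k\<bar> \<le> l ^ k / fact k) (at_top \<times>\<^sub>F sequentially)"
      by (rule filter_leD[OF prod_filter_mono[OF top_greatest order_refl]])
    show "summable (\<lambda>m. l ^ m / fact m)" using summable_exp[of l] by (simp add: divide_inverse mult.commute)
  qed auto
  then show ?thesis unfolding b_def p_def by simp
qed

section \<open>Continuity of translations in the mean\<close>

lemma integrable_translate:
  fixes f :: "'c::euclidean_space \<Rightarrow> real"
  assumes "integrable lborel f"
  shows "integrable lborel (\<lambda>x. f (x + z))" "(\<integral>x. f (x + z) \<partial>lborel) = (\<integral>x. f x \<partial>lborel)"
proof -
  have d: "distr lborel borel (\<lambda>x. x + z) = lborel"
    using lborel_distr_plus[of z] by (simp only: add.commute[of _ z])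
  have i: "integrable (distr lborel borel (\<lambda>x. x + z)) f" unfolding d by fact
  then show "integrable lborel (\<lambda>x. f (x + z))" by (subst (asm) integrable_distr_eq) (use assms in auto)
  have "(\<integral>x. f x \<partial>lborel) = (\<integral>x. f x \<partial>distr lborel borel (\<lambda>x. x + z))" unfolding d ..
  also have "\<dots> = (\<integral>x. f (x + z) \<partial>lborel)" using assms by (subst integral_distr) auto
  finally show "(\<integral>x. f (x + z) \<partial>lborel) = (\<integral>x. f x \<partial>lborel)" ..
qed

text \<open>For integrable \<open>f\<close> this is continuity of translations in \<open>L\<^sup>1\<close>.
  It takes the place of Lebesgue differentiation: it shows that \<open>f\<close> is nearly
  constant on small balls, on average over their centres.\<close>

definition L1_translation_continuous :: "('c::euclidean_space \<Rightarrow> real) \<Rightarrow> bool" where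
  "L1_translation_continuous f \<longleftrightarrow>
     (\<forall>z. z \<longlonglongrightarrow> 0 \<longrightarrow> (\<lambda>k. \<integral>x. \<bar>f (x + z k) - f x\<bar> \<partial>lborel) \<longlonglongrightarrow> 0)"

text \<open>Translation is an isometry of \<open>L\<^sup>1\<close>, so the property passes to
  \<open>L\<^sup>1\<close>-limits. This is the limit step of the approximation by simple
  functions.\<close>

lemma L1_translation_continuous_approx:
  fixes f :: "'c::euclidean_space \<Rightarrow> real"
  assumes f: "integrable lborel f"
    and approx: "\<And>e. e > 0 \<Longrightarrow> \<exists>g. integrable lborel g \<and> L1_translation_continuous g \<and> (\<integral>x. \<bar>f x - g x\<bar> \<partial>lborel) \<le> e"
  shows "L1_translation_continuous f"
  unfolding L1_translation_continuous_def
proof (intro allI impI)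
  fix z :: "nat \<Rightarrow> 'c" assume z: "z \<longlonglongrightarrow> 0"
  show "(\<lambda>k. \<integral>x. \<bar>f (x + z k) - f x\<bar> \<partial>lborel) \<longlonglongrightarrow> 0"
  proof (rule LIMSEQ_I)
    fix e :: real assume e: "0 < e"
    obtain g where g: "integrable lborel g" "L1_translation_continuous g" "(\<integral>x. \<bar>f x - g x\<bar> \<partial>lborel) \<le> e / 4"
      using approx[of "e / 4"] e by auto
    have "(\<lambda>k. \<integral>x. \<bar>g (x + z k) - g x\<bar> \<partial>lborel) \<longlonglongrightarrow> 0"
      using g(2) z by (auto simp: L1_translation_continuous_def)
    from LIMSEQ_D[OF this, of "e / 4"] obtain no where
      no: "\<And>k. k \<ge> no \<Longrightarrow> norm ((\<integral>x. \<bar>g (x + z k) - g x\<bar> \<partial>lborel) - 0) < e / 4" using e by auto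
    show "\<exists>no. \<forall>k\<ge>no. norm ((\<integral>x. \<bar>f (x + z k) - f x\<bar> \<partial>lborel) - 0) < e"
    proof (intro exI allI impI)
      fix k assume k: "no \<le> k"
      note ts = integrable_translate(1)[OF f, of "z k"] integrable_translate(1)[OF g(1), of "z k"]
      have i: "integrable lborel (\<lambda>x. \<bar>f x - g x\<bar>)" using f g by simp
      have "(\<integral>x. \<bar>f (x + z k) - f x\<bar> \<partial>lborel)
        \<le> (\<integral>x. \<bar>f (x + z k) - g (x + z k)\<bar> + \<bar>g (x + z k) - g x\<bar> + \<bar>f x - g x\<bar> \<partial>lborel)"
        using f g(1) ts by (intro integral_mono) auto
      also have "\<dots> = (\<integral>x. \<bar>f x - g x\<bar> \<partial>lborel) + (\<integral>x. \<bar>g (x + z k) - g x\<bar> \<partial>lborel) + (\<integral>x. \<bar>f x - g x\<bar> \<partial>lborel)"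
        using f g(1) ts integrable_translate(2)[OF i, of "z k"] by simp
      also have "\<dots> < e" using no[OF k] g(3) e by simp
      finally show "norm ((\<integral>x. \<bar>f (x + z k) - f x\<bar> \<partial>lborel) - 0) < e" by simp
    qed
  qed
qed

text \<open>The indicator of an open set is lower semicontinuous, and translation preserves the measure.\<close>

lemma L1_translation_continuous_open:
  fixes U :: "'c::euclidean_space set"
  assumes "open U" "emeasure lborel U < \<infinity>"
  shows "L1_translation_continuous (indicator U)"
  unfolding L1_translation_continuous_def
proof (intro allI impI)
  fix z :: "nat \<Rightarrow> 'c" assume z: "z \<longlonglongrightarrow> 0"
  let ?g = "indicator U :: 'c \<Rightarrow> real"
  have [measurable]: "U \<in> sets borel" using assms by simp
  have g: "integrable lborel ?g" using assms by simp
  have eq: "(\<integral>x. \<bar>?g (x + z k) - ?g x\<bar> \<partial>lborel) = 2 * (\<integral>x. max 0 (?g x - ?g (x + z k)) \<partial>lborel)" for k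
  proof -
    have "(\<integral>x. \<bar>?g (x + z k) - ?g x\<bar> \<partial>lborel) = (\<integral>x. 2 * max 0 (?g x - ?g (x + z k)) + (?g (x + z k) - ?g x) \<partial>lborel)"
      by (intro Bochner_Integration.integral_cong) (auto simp: max_def)
    also have "\<dots> = 2 * (\<integral>x. max 0 (?g x - ?g (x + z k)) \<partial>lborel)"
      using g integrable_translate[OF g, of "z k"] by simp
    finally show ?thesis .
  qed
  have "(\<lambda>k. \<integral>x. max 0 (?g x - ?g (x + z k)) \<partial>lborel) \<longlonglongrightarrow> (\<integral>x. 0 \<partial>(lborel :: 'c measure))"
  proof (rule integral_dominated_convergence[where w="?g"])
    show "AE x in lborel. (\<lambda>k. max 0 (?g x - ?g (x + z k))) \<longlonglongrightarrow> 0"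
    proof (rule AE_I2)
      fix x :: 'c
      show "(\<lambda>k. max 0 (?g x - ?g (x + z k))) \<longlonglongrightarrow> 0"
      proof (cases "x \<in> U")
        case True
        have "(\<lambda>k. x + z k) \<longlonglongrightarrow> x" using tendsto_add[OF tendsto_const z, of x] by simp
        then have "eventually (\<lambda>k. x + z k \<in> U) sequentially"
          using topological_tendstoD[OF _ \<open>open U\<close> True] by blast
        then have "eventually (\<lambda>k. max 0 (?g x - ?g (x + z k)) = 0) sequentially"
          by eventually_elim (auto simp: indicator_def)
        then show ?thesis by (rule tendsto_eventually)
      qed (auto simp: indicator_def)
    qed
  qed (use g in \<open>auto simp: indicator_def\<close>)
  then show "(\<lambda>k. \<integral>x. \<bar>?g (x + z k) - ?g x\<bar> \<partial>lborel) \<longlonglongrightarrow> 0"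
    unfolding eq using tendsto_mult_left[of _ "0::real" sequentially 2] by simp
qed

lemma L1_translation_continuous_linear:
  fixes f g :: "'c::euclidean_space \<Rightarrow> real"
  assumes "integrable lborel f" "integrable lborel g" "L1_translation_continuous f" "L1_translation_continuous g"
  shows "L1_translation_continuous (\<lambda>x. c * f x + g x)"
  unfolding L1_translation_continuous_def
proof (intro allI impI)
  fix z :: "nat \<Rightarrow> 'c" assume z: "z \<longlonglongrightarrow> 0"
  have u: "(\<lambda>k. \<bar>c\<bar> * (\<integral>x. \<bar>f (x + z k) - f x\<bar> \<partial>lborel) + (\<integral>x. \<bar>g (x + z k) - g x\<bar> \<partial>lborel)) \<longlonglongrightarrow> \<bar>c\<bar> * 0 + 0"
    using assms z unfolding L1_translation_continuous_def by (intro tendsto_intros) auto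
  show "(\<lambda>k. \<integral>x. \<bar>c * f (x + z k) + g (x + z k) - (c * f x + g x)\<bar> \<partial>lborel) \<longlonglongrightarrow> 0"
  proof (rule tendsto_sandwich[OF _ _ tendsto_const])
    show "eventually (\<lambda>k. (\<integral>x. \<bar>c * f (x + z k) + g (x + z k) - (c * f x + g x)\<bar> \<partial>lborel)
      \<le> \<bar>c\<bar> * (\<integral>x. \<bar>f (x + z k) - f x\<bar> \<partial>lborel) + (\<integral>x. \<bar>g (x + z k) - g x\<bar> \<partial>lborel)) sequentially"
    proof (rule always_eventually, rule allI)
      fix k
      note ts = integrable_translate(1)[OF assms(1), of "z k"] integrable_translate(1)[OF assms(2), of "z k"]
      have "(\<integral>x. \<bar>c * f (x + z k) + g (x + z k) - (c * f x + g x)\<bar> \<partial>lborel) \<le> 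
       (\<integral>x. \<bar>c\<bar> * \<bar>f (x + z k) - f x\<bar> + \<bar>g (x + z k) - g x\<bar> \<partial>lborel)"
      proof (rule integral_mono)
        fix x
        have "c * f (x + z k) + g (x + z k) - (c * f x + g x) = c * (f (x + z k) - f x) + (g (x + z k) - g x)"
          by (simp add: algebra_simps)
        then show "\<bar>c * f (x + z k) + g (x + z k) - (c * f x + g x)\<bar> \<le> \<bar>c\<bar> * \<bar>f (x + z k) - f x\<bar> + \<bar>g (x + z k) - g x\<bar>"
          by (metis abs_mult abs_triangle_ineq)
      qed (use assms ts in auto)
      also have "\<dots> = \<bar>c\<bar> * (\<integral>x. \<bar>f (x + z k) - f x\<bar> \<partial>lborel) + (\<integral>x. \<bar>g (x + z k) - g x\<bar> \<partial>lborel)"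
        using assms ts by simp
      finally show "(\<integral>x. \<bar>c * f (x + z k) + g (x + z k) - (c * f x + g x)\<bar> \<partial>lborel)
        \<le> \<bar>c\<bar> * (\<integral>x. \<bar>f (x + z k) - f x\<bar> \<partial>lborel) + (\<integral>x. \<bar>g (x + z k) - g x\<bar> \<partial>lborel)" .
    qed
  qed (use u in auto)
qed

lemma L1_translation_continuous_integrable:
  fixes f :: "'c::euclidean_space \<Rightarrow> real"
  assumes "integrable lborel f"
  shows "L1_translation_continuous f"
  using assms
proof (induction rule: integrable_induct)
  case (base A c)
  have A[measurable]: "A \<in> sets borel" using base by simp
  have zero: "L1_translation_continuous (\<lambda>x::'c. 0::real)" by (simp add: L1_translation_continuous_def)
  have ind: "L1_translation_continuous (indicator A)"
  proof (rule L1_translation_continuous_approx)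
    show "integrable lborel (indicat_real A)" using base by simp
    fix e :: real assume "e > 0"
    obtain U where U: "open U" "A \<subseteq> U" "emeasure lborel (U - A) \<le> e"
      using outer_regular_lborel_le[OF A \<open>e > 0\<close>] by blast
    have [measurable]: "U \<in> sets borel" using U by simp
    have "emeasure lborel U = emeasure lborel A + emeasure lborel (U - A)"
      using U by (subst plus_emeasure) (auto intro!: arg_cong[where f="emeasure lborel"])
    then have fin: "emeasure lborel U < \<infinity>" using base U(3) by (auto simp: top.not_eq_extremum ennreal_add_eq_top) (metis ennreal_less_top order_le_less_trans)
    have "(\<integral>x. \<bar>indicat_real A x - indicat_real U x\<bar> \<partial>lborel) = (\<integral>x. indicat_real (U - A) x \<partial>lborel)"
      using U by (intro Bochner_Integration.integral_cong) (auto simp: indicator_def)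
    also have "\<dots> = measure lborel (U - A)" by simp
    also have "\<dots> \<le> e" using U(3) \<open>e > 0\<close> by (simp add: measure_def enn2real_leI)
    finally show "\<exists>g. integrable lborel g \<and> L1_translation_continuous g \<and> (\<integral>x. \<bar>indicat_real A x - g x\<bar> \<partial>lborel) \<le> e"
      using L1_translation_continuous_open[OF U(1) fin] fin by (intro exI[of _ "indicator U"]) auto
  qed
  have "L1_translation_continuous (\<lambda>x. c * indicator A x + 0)"
    using base by (intro L1_translation_continuous_linear ind zero) auto
  then show ?case by (simp add: mult.commute)
next
  case (add f g)
  then show ?case using L1_translation_continuous_linear[of f g 1] by simp
next
  case (lim f s)
  show ?case
  proof (rule L1_translation_continuous_approx)
    fix e :: real assume e: "e > 0"
    have "(\<lambda>i. \<integral>x. \<bar>f x - s i x\<bar> \<partial>lborel) \<longlonglongrightarrow> (\<integral>x. 0 \<partial>(lborel :: 'c measure))"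
    proof (rule integral_dominated_convergence[where w="\<lambda>x. 3 * \<bar>f x\<bar>"])
      show "AE x in lborel. (\<lambda>i. \<bar>f x - s i x\<bar>) \<longlonglongrightarrow> 0"
      proof (rule AE_I2)
        fix x :: 'c
        show "(\<lambda>i. \<bar>f x - s i x\<bar>) \<longlonglongrightarrow> 0"
        proof -
          have "(\<lambda>i. s i x) \<longlonglongrightarrow> f x" using lim by auto
          from tendsto_rabs[OF tendsto_diff[OF tendsto_const[of "f x"] this]] show ?thesis by simp
        qed
      qed
      show "AE x in lborel. norm \<bar>f x - s i x\<bar> \<le> 3 * \<bar>f x\<bar>" for i
      proof (rule AE_I2)
        fix x :: 'c
        have "norm (s i x) \<le> 2 * norm (f x)" using lim by auto
        then show "norm \<bar>f x - s i x\<bar> \<le> 3 * \<bar>f x\<bar>" by simp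
      qed
    qed (use lim in auto)
    from LIMSEQ_D[OF this e] obtain i where "norm ((\<integral>x. \<bar>f x - s i x\<bar> \<partial>lborel) - (\<integral>x. 0 \<partial>(lborel :: 'c measure))) < e" by blast
    then show "\<exists>g. integrable lborel g \<and> L1_translation_continuous g \<and> (\<integral>x. \<bar>f x - g x\<bar> \<partial>lborel) \<le> e"
      using lim by (intro exI[of _ "s i"]) auto
  qed fact
qed

section \<open>Random finite sets\<close>

text \<open>The \<open>\<sigma>\<close>-algebra on finite sets generated by the void events \<open>A
  \<inter> B = {}\<close>. All the counts used here are measurable for it, and its generator is
  closed under intersections, because \<open>A \<inter> B = {}\<close> and \<open>A \<inter> C =
  {}\<close> together mean \<open>A \<inter> (B \<union> C) = {}\<close>.\<close>

definition void_algebra :: "'e::topological_space set measure" where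
  "void_algebra = sigma (Collect finite) {{A. finite A \<and> A \<inter> B = {}} | B. B \<in> sets borel}"

lemma space_void_algebra [simp]: "space void_algebra = Collect finite"
  by (auto simp: void_algebra_def space_measure_of_conv)

lemma sets_void_algebra:
  "sets void_algebra = sigma_sets (Collect finite) {{A. finite A \<and> A \<inter> B = {}} | B. B \<in> sets borel}"
  by (auto simp: void_algebra_def intro!: sets_measure_of)

lemma void_event [measurable]:
  assumes "B \<in> sets borel" shows "{A. finite A \<and> A \<inter> B = {}} \<in> sets void_algebra"
  unfolding sets_void_algebra using assms by (intro sigma_sets.Basic) auto

lemma measurable_void_algebra:
  fixes C :: "'w \<Rightarrow> 'e::topological_space set"
  assumes "\<And>\<omega>. \<omega> \<in> space M \<Longrightarrow> finite (C \<omega>)"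
    and "\<And>B. B \<in> sets borel \<Longrightarrow> {\<omega> \<in> space M. C \<omega> \<inter> B = {}} \<in> sets M"
  shows "C \<in> measurable M void_algebra"
  unfolding void_algebra_def
proof (rule measurable_measure_of)
  fix y :: "'e set set" assume "y \<in> {{A. finite A \<and> A \<inter> B = {}} | B. B \<in> sets borel}"
  then obtain B where B: "B \<in> sets borel" "y = {A. finite A \<and> A \<inter> B = {}}" by auto
  have "C -` y \<inter> space M = {\<omega> \<in> space M. C \<omega> \<inter> B = {}}" using B assms(1) by auto
  then show "C -` y \<inter> space M \<in> sets M" using assms(2)[OF B(1)] by simp
qed (use assms(1) in auto)

text \<open>Void events form a generator that is stable under intersection, so a law on finite sets is
  determined by its void probabilities. This is how the Poisson process is identified with a
  sample of Poisson size, without any appeal to joint laws of counts.\<close>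

theorem void_probabilities_determine_law:
  assumes "prob_space P" "prob_space Q"
    and C: "C \<in> measurable P void_algebra" and D: "D \<in> measurable Q void_algebra"
    and eq: "\<And>B. B \<in> sets borel \<Longrightarrow>
      measure P {\<omega> \<in> space P. C \<omega> \<inter> B = {}} = measure Q {\<omega> \<in> space Q. D \<omega> \<inter> B = {}}"
  shows "distr P void_algebra C = distr Q void_algebra D"
proof -
  interpret P: prob_space P by fact
  interpret Q: prob_space Q by fact
  let ?E = "{{A :: 'c set. finite A \<and> A \<inter> B = {}} | B. B \<in> sets borel}"
  show ?thesis
  proof (rule measure_eqI_generator_eq[where E="?E" and \<Omega>="Collect finite" and A="\<lambda>_. Collect finite"])
    show "Int_stable ?E"
    proof (rule Int_stableI)
      fix a b assume "a \<in> ?E" "b \<in> ?E"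
      then obtain A B where AB: "A \<in> sets borel" "B \<in> sets borel" "a = {S. finite S \<and> S \<inter> A = {}}" "b = {S. finite S \<and> S \<inter> B = {}}"
        by auto
      then have "a \<inter> b = {S. finite S \<and> S \<inter> (A \<union> B) = {}}" by auto
      then show "a \<inter> b \<in> ?E" using AB(1,2) by blast
    qed
    fix x assume "x \<in> ?E"
    then obtain B where B: "B \<in> sets borel" "x = {S. finite S \<and> S \<inter> B = {}}" by auto
    have "emeasure (distr P void_algebra C) x = emeasure P {\<omega> \<in> space P. C \<omega> \<inter> B = {}}"
      using C B measurable_space[OF C] by (subst emeasure_distr) (auto intro!: arg_cong[where f="emeasure P"] void_event)
    moreover have "emeasure (distr Q void_algebra D) x = emeasure Q {\<omega> \<in> space Q. D \<omega> \<inter> B = {}}"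
      using D B measurable_space[OF D] by (subst emeasure_distr) (auto intro!: arg_cong[where f="emeasure Q"] void_event)
    ultimately show "emeasure (distr P void_algebra C) x = emeasure (distr Q void_algebra D) x"
      using eq[OF B(1)] by (simp add: P.emeasure_eq_measure Q.emeasure_eq_measure)
  next
    show "range (\<lambda>_. Collect finite) \<subseteq> ?E" by (auto intro!: exI[of _ "{}"])
    show "emeasure (distr P void_algebra C) (Collect finite) \<noteq> \<infinity>"
      using prob_space.emeasure_space_1[OF P.prob_space_distr[OF C]] by simp
  qed (auto simp: sets_void_algebra)
qed

text \<open>A finite set is separated by basic open sets. With a countable basis, statements about
  individual points of a random finite set become countable combinations of void events.\<close>

lemma separated_basic_opens:
  fixes T :: "'e::metric_space set"
  assumes "finite T" "topological_basis BB"
  obtains O' where "\<And>x. x \<in> T \<Longrightarrow> x \<in> O' x \<and> O' x \<in> BB" "\<And>x y. x \<in> T \<Longrightarrow> y \<in> T \<Longrightarrow> x \<noteq> y \<Longrightarrow> O' x \<inter> O' y = {}"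
proof -
  define D where "D = insert 1 ((\<lambda>(x, y). dist x y) ` {(x, y) \<in> T \<times> T. x \<noteq> y})"
  have finD: "finite D" unfolding D_def using assms(1)
    by (auto intro: finite_subset[of _ "T \<times> T"])
  have "\<forall>e\<in>D. 0 < e" unfolding D_def by auto
  then have m1: "Min D > 0" using finD by (subst Min_gr_iff) (auto simp: D_def)
  have m2: "Min D \<le> dist x y" if "x \<in> T" "y \<in> T" "x \<noteq> y" for x y
    using finD that by (intro Min_le) (auto simp: D_def)
  have "\<forall>x. \<exists>U\<in>BB. x \<in> U \<and> U \<subseteq> ball x (Min D / 2)"
    using topological_basisE[OF assms(2) open_ball] m1 by (metis centre_in_ball half_gt_zero)
  then obtain U where U: "\<And>x. U x \<in> BB \<and> x \<in> U x \<and> U x \<subseteq> ball x (Min D / 2)" by metis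
  show ?thesis
  proof (rule that[of U])
    fix x y assume xy: "x \<in> T" "y \<in> T" "x \<noteq> y"
    have "ball x (Min D / 2) \<inter> ball y (Min D / 2) = {}"
      using m2[OF xy] by (intro disjoint_ballI) auto
    then show "U x \<inter> U y = {}" using U[of x] U[of y] by blast
  qed (use U in auto)
qed

lemma measurable_card_void_algebra [measurable]:
  fixes B :: "'e::{metric_space, second_countable_topology} set"
  assumes [measurable]: "B \<in> sets borel"
  shows "(\<lambda>A. card (A \<inter> B)) \<in> measurable void_algebra (count_space UNIV)"
proof -
  obtain BB :: "'e set set" where BB: "countable BB" "topological_basis BB" using ex_countable_basis by blast
  have Bop[measurable]: "U \<in> BB \<Longrightarrow> U \<in> sets borel" for U using topological_basis_open[OF BB(2)] by auto
  have ge: "{A \<in> space void_algebra. k \<le> card (A \<inter> B)} \<in> sets void_algebra" for k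
  proof -
    let ?F = "{F. (finite F \<and> F \<subseteq> BB) \<and> card F = k \<and> disjoint F}"
    have "{A \<in> space void_algebra. k \<le> card (A \<inter> B)} = (\<Union>F\<in>?F. {A. finite A} \<inter> (\<Inter>U\<in>F. {A. finite A} - {A. finite A \<and> A \<inter> (B \<inter> U) = {}}))"
    proof (intro equalityI subsetI)
      fix A assume A: "A \<in> {A \<in> space void_algebra. k \<le> card (A \<inter> B)}"
      then obtain T where T: "T \<subseteq> A \<inter> B" "card T = k" "finite T"
        by (metis (no_types, lifting) card_subset_eq mem_Collect_eq obtain_subset_with_card_n)
      obtain O' where O': "\<And>x. x \<in> T \<Longrightarrow> x \<in> O' x \<and> O' x \<in> BB" "\<And>x y. x \<in> T \<Longrightarrow> y \<in> T \<Longrightarrow> x \<noteq> y \<Longrightarrow> O' x \<inter> O' y = {}"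
        using separated_basic_opens[OF T(3) BB(2)] by metis
      have inj: "inj_on O' T" using O' by (intro inj_onI) (metis disjoint_iff)
      have "O' ` T \<in> ?F" using T O' inj by (auto simp: card_image disjoint_def)
      moreover have "A \<inter> (B \<inter> O' x) \<noteq> {}" if "x \<in> T" for x using T(1) O'(1)[OF that] that by blast
      ultimately show "A \<in> (\<Union>F\<in>?F. {A. finite A} \<inter> (\<Inter>U\<in>F. {A. finite A} - {A. finite A \<and> A \<inter> (B \<inter> U) = {}}))"
        using A by (intro UN_I[of "O' ` T"]) auto
    next
      fix A assume "A \<in> (\<Union>F\<in>?F. {A. finite A} \<inter> (\<Inter>U\<in>F. {A. finite A} - {A. finite A \<and> A \<inter> (B \<inter> U) = {}}))"
      then obtain F where "F \<in> ?F" and FA: "A \<in> {A. finite A} \<inter> (\<Inter>U\<in>F. {A. finite A} - {A. finite A \<and> A \<inter> (B \<inter> U) = {}})"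
        by (rule UN_E)
      then have F: "finite F" "card F = k" "disjoint F" "finite A" by auto
      have FU: "\<exists>x. x \<in> A \<inter> (B \<inter> U)" if "U \<in> F" for U
      proof -
        have "A \<in> {A. finite A} - {A. finite A \<and> A \<inter> (B \<inter> U) = {}}" using FA that by blast
        then show "\<exists>x. x \<in> A \<inter> (B \<inter> U)" by auto
      qed
      obtain g where g: "\<And>U. U \<in> F \<Longrightarrow> g U \<in> A \<inter> (B \<inter> U)" using FU by metis
      have "inj_on g F" using g F(3) by (intro inj_onI) (metis IntD2 disjointD disjoint_iff)
      then have "k = card (g ` F)" using F by (simp add: card_image)
      also have "\<dots> \<le> card (A \<inter> B)" using g F(4) by (intro card_mono) auto
      finally show "A \<in> {A \<in> space void_algebra. k \<le> card (A \<inter> B)}" using F by simp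
    qed
    also have "\<dots> \<in> sets void_algebra"
    proof (rule sets.countable_UN'')
      show "countable ?F" by (rule countable_subset[OF _ countable_Collect_finite_subset[OF BB(1)]]) auto
      have [measurable]: "{A. finite A} \<in> sets (void_algebra :: 'e set measure)" using sets.top[of void_algebra] by simp
      fix F assume F: "F \<in> ?F"
      show "{A. finite A} \<inter> (\<Inter>U\<in>F. {A. finite A} - {A. finite A \<and> A \<inter> (B \<inter> U) = {}}) \<in> sets void_algebra"
      proof (cases "F = {}")
        case False
        then show ?thesis using F
          by (intro sets.Int sets.finite_INT sets.Diff void_event) auto
      next
        case True
        have "{A. finite A} \<in> sets (void_algebra :: 'e set measure)" by measurable
        then show ?thesis using True by simp
      qed
    qed
    finally show ?thesis .
  qed
  show ?thesis
  proof (rule measurable_count_space_eq2_countable[THEN iffD2], safe)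
    fix k :: nat
    have "(\<lambda>A. card (A \<inter> B)) -` {k} \<inter> space void_algebra =
      {A \<in> space void_algebra. k \<le> card (A \<inter> B)} - {A \<in> space void_algebra. Suc k \<le> card (A \<inter> B)}" by auto
    also have "\<dots> \<in> sets void_algebra" using ge by blast
    finally show "(\<lambda>A. card (A \<inter> B)) -` {k} \<inter> space void_algebra \<in> sets void_algebra" .
  qed auto
qed

text \<open>An auxiliary kernel: integrating against it expresses that an event holds at some point of a
  random finite set, which reduces measurability of counts to that of parametrised measures.\<close>

definition uniform_law :: "'e::topological_space set \<Rightarrow> 'e measure" where
  "uniform_law A = (if A = {} then return borel undefined else distr (measure_pmf (pmf_of_set A)) borel id)"

lemma prob_space_uniform_law: "prob_space (uniform_law A)"
  by (auto simp: uniform_law_def intro!: prob_space_return measure_pmf.prob_space_distr)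

lemma sets_uniform_law [simp, measurable_cong]: "sets (uniform_law A) = sets borel"
  by (simp add: uniform_law_def)

lemma measure_uniform_law:
  assumes "finite A" "A \<noteq> {}" "B \<in> sets borel"
  shows "measure (uniform_law A) B = real (card (A \<inter> B)) / real (card A)"
  using assms by (simp add: uniform_law_def measure_distr measure_pmf_of_set)

lemma measurable_uniform_law [measurable]:
  "(uniform_law :: 'e::{metric_space, second_countable_topology} set \<Rightarrow> _) \<in> measurable void_algebra (subprob_algebra borel)"
proof (rule measurable_subprob_algebra)
  fix B :: "'e set" assume B[measurable]: "B \<in> sets borel"
  have "emeasure (uniform_law A) B = ennreal (if card (A \<inter> UNIV) = 0 then indicator B undefined else real (card (A \<inter> B)) / real (card (A \<inter> UNIV)))"
    if "A \<in> space void_algebra" for A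
  proof -
    interpret prob_space "uniform_law A" by (rule prob_space_uniform_law)
    show ?thesis
    proof (cases "A = {}")
      case True
      then show ?thesis by (simp add: uniform_law_def indicator_def)
    next
      case False
      then show ?thesis using that measure_uniform_law[of A B] emeasure_eq_measure[of B] by (simp add: card_eq_0_iff)
    qed
  qed
  note e = this
  have "(\<lambda>A. ennreal (if card (A \<inter> UNIV) = 0 then indicator B undefined else real (card (A \<inter> B)) / real (card (A \<inter> UNIV)))) \<in> borel_measurable (void_algebra :: 'e set measure)"
    by measurable
  then show "(\<lambda>A. emeasure (uniform_law A) B) \<in> borel_measurable void_algebra"
    by (subst measurable_cong[OF e])
qed (auto intro: prob_space_imp_subprob_space prob_space_uniform_law)

text \<open>A random finite set cannot be enumerated measurably without effort, so the points are counted
  through the uniform law on the set: \<open>p\<close> is unrelated to all points of the set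
  exactly if the points related to it form a null set for the uniform law, and such a condition is
  measurable.\<close>

lemma measurable_card_related_points:
  fixes R :: "'s \<Rightarrow> 'e::{metric_space, second_countable_topology} \<Rightarrow> 'e \<Rightarrow> bool" and T :: "'s \<Rightarrow> 'e \<Rightarrow> bool"
  assumes C[measurable]: "C \<in> measurable S void_algebra"
    and R[measurable]: "Measurable.pred (S \<Otimes>\<^sub>M borel \<Otimes>\<^sub>M borel) (\<lambda>(s, p, q). R s p q)"
    and T[measurable]: "Measurable.pred (S \<Otimes>\<^sub>M borel) (\<lambda>(s, p). T s p)"
  shows "(\<lambda>s. card {p \<in> C s. T s p \<and> (\<forall>q\<in>C s. \<not> R s p q)}) \<in> measurable S (count_space UNIV)"
proof -
  have fin: "finite (C s)" if "s \<in> space S" for s using measurable_space[OF C that] by simp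
  let ?K = "\<lambda>s. uniform_law (C s)"
  have zero: "(\<forall>q\<in>C s. \<not> R s p q) \<longleftrightarrow> emeasure (?K s) {q. R s p q} = 0" if "s \<in> space S" "C s \<noteq> {}" for s p
  proof -
    have [measurable]: "{q. R s p q} \<in> sets borel" using that by measurable
    interpret prob_space "?K s" by (rule prob_space_uniform_law)
    show ?thesis using fin[OF that(1)] that
      by (auto simp: emeasure_eq_measure measure_uniform_law card_eq_0_iff)
  qed
  define W where "W s = {p. T s p \<and> emeasure (?K s) {q. R s p q} = 0}" for s
  have K1: "(\<lambda>x. ?K (fst x)) \<in> measurable (S \<Otimes>\<^sub>M borel) (subprob_algebra borel)" by measurable
  have R': "Measurable.pred ((S \<Otimes>\<^sub>M borel) \<Otimes>\<^sub>M borel) (\<lambda>y. case (fst (fst y), snd (fst y), snd y) of (s, p, q) \<Rightarrow> R s p q)"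
    by (rule measurable_compose[OF _ R]) measurable
  have "(SIGMA x:space (S \<Otimes>\<^sub>M borel). {q. R (fst x) (snd x) q}) =
     {y \<in> space ((S \<Otimes>\<^sub>M borel) \<Otimes>\<^sub>M borel). case (fst (fst y), snd (fst y), snd y) of (s, p, q) \<Rightarrow> R s p q}"
    by (auto simp: space_pair_measure)
  also have "\<dots> \<in> sets ((S \<Otimes>\<^sub>M borel) \<Otimes>\<^sub>M borel)" using R' by (simp add: pred_def)
  finally have R2: "(SIGMA x:space (S \<Otimes>\<^sub>M borel). {q. R (fst x) (snd x) q}) \<in> sets ((S \<Otimes>\<^sub>M borel) \<Otimes>\<^sub>M borel)" .
  have "(\<lambda>x. emeasure (?K (fst x)) {q. R (fst x) (snd x) q}) \<in> borel_measurable (S \<Otimes>\<^sub>M (borel :: 'e measure))"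
    by (rule emeasure_measurable_subprob_algebra2[OF R2 K1])
  note [measurable] = this
  have W2: "(SIGMA s:space S. W s) \<in> sets (S \<Otimes>\<^sub>M borel)"
  proof -
    have "(SIGMA s:space S. W s) = {x \<in> space (S \<Otimes>\<^sub>M borel). (case x of (s, p) \<Rightarrow> T s p) \<and> emeasure (?K (fst x)) {q. R (fst x) (snd x) q} = 0}"
      by (auto simp: W_def space_pair_measure)
    also have "\<dots> \<in> sets (S \<Otimes>\<^sub>M borel)" by measurable
    finally show ?thesis .
  qed
  have Wb: "W s \<in> sets borel" if "s \<in> space S" for s
    using sets_Pair1[OF W2, of s] that by (auto simp: vimage_def)
  have mW: "(\<lambda>s. emeasure (?K s) (W s)) \<in> borel_measurable S"
    by (rule emeasure_measurable_subprob_algebra2[OF W2]) (rule measurable_compose[OF C measurable_uniform_law])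
  have "card {p \<in> C s. T s p \<and> (\<forall>q\<in>C s. \<not> R s p q)} =
      nat \<lfloor>real (card (C s \<inter> UNIV)) * enn2real (emeasure (?K s) (W s))\<rfloor>" if s: "s \<in> space S" for s
  proof (cases "C s = {}")
    case False
    have "{p \<in> C s. T s p \<and> (\<forall>q\<in>C s. \<not> R s p q)} = C s \<inter> W s"
      unfolding W_def using zero[OF s False] by auto
    moreover have "enn2real (emeasure (?K s) (W s)) = real (card (C s \<inter> W s)) / real (card (C s))"
      using measure_uniform_law[OF fin[OF s] False Wb[OF s]] by (simp add: measure_def)
    ultimately show ?thesis using False fin[OF s] by simp
  qed simp
  note e = this
  have "(\<lambda>s. nat \<lfloor>real (card (C s \<inter> UNIV)) * enn2real (emeasure (?K s) (W s))\<rfloor>) \<in> measurable S (count_space UNIV)"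
    using mW by measurable
  then show ?thesis by (subst measurable_cong[OF e])
qed

section \<open>Samples of random size\<close>

lemma (in prob_space) measure_pair_eq_integral:
  assumes N: "prob_space N" and X: "X \<in> sets (N \<Otimes>\<^sub>M M)"
  shows "measure (N \<Otimes>\<^sub>M M) X = (\<integral>x. measure M (Pair x -` X) \<partial>N)"
proof -
  interpret N: prob_space N by fact
  have m: "(\<lambda>x. measure M (Pair x -` X)) \<in> borel_measurable N"
    unfolding measure_def using measurable_emeasure_Pair[OF X] by measurable
  have i: "integrable N (\<lambda>x. measure M (Pair x -` X))"
    using m by (intro N.integrable_const_bound[where B=1]) auto
  have "emeasure (N \<Otimes>\<^sub>M M) X = (\<integral>\<^sup>+x. ennreal (measure M (Pair x -` X)) \<partial>N)"
    using emeasure_pair_measure_alt[OF X] by (simp add: emeasure_eq_measure)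
  also have "\<dots> = ennreal (\<integral>x. measure M (Pair x -` X) \<partial>N)"
    using i by (intro nn_integral_eq_integral) auto
  finally show ?thesis by (simp add: measure_def integral_nonneg_AE)
qed

lemma pmf_nat_sums:
  fixes h :: "nat \<Rightarrow> real"
  assumes "\<And>m. \<bar>h m\<bar> \<le> C"
  shows "(\<lambda>m. pmf p m * h m) sums (\<integral>m. h m \<partial>measure_pmf p)"
proof -
  have i: "integrable (measure_pmf p) h"
    using assms by (intro measure_pmf.integrable_const_bound[where B=C]) auto
  then have "integrable (count_space UNIV) (\<lambda>m. pmf p m * h m)"
    unfolding measure_pmf_eq_density[of p] by (subst (asm) integrable_density) auto
  from sums_integral_count_space_nat[OF this]
  show ?thesis unfolding measure_pmf_eq_density[of p] by (subst integral_density) auto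
qed

text \<open>Total variation bounds the difference of expectations of functions with values in
  \<open>[0,1]\<close>.\<close>

lemma pmf_expectation_difference:
  fixes h :: "nat \<Rightarrow> real"
  assumes "\<And>m. 0 \<le> h m \<and> h m \<le> 1"
  shows "\<bar>(\<integral>m. h m \<partial>measure_pmf p) - (\<integral>m. h m \<partial>measure_pmf q)\<bar> \<le> (\<Sum>m. \<bar>pmf p m - pmf q m\<bar>)"
proof -
  have h: "\<bar>h m\<bar> \<le> 1" for m using assms[of m] by auto
  have s1: "summable (pmf r)" for r :: "nat pmf"
    using sums_summable[OF pmf_nat_sums[of "\<lambda>_. 1" 1 r]] by simp
  have sm: "summable (\<lambda>m. \<bar>pmf p m - pmf q m\<bar>)"
    by (rule summable_comparison_test'[OF summable_add[OF s1[of p] s1[of q]], of 0])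
      (use abs_triangle_ineq4[of "pmf p _" "pmf q _"] pmf_nonneg[of p] pmf_nonneg[of q] in simp)
  have d: "(\<lambda>m. (pmf p m - pmf q m) * h m) sums ((\<integral>m. h m \<partial>measure_pmf p) - (\<integral>m. h m \<partial>measure_pmf q))"
    using sums_diff[OF pmf_nat_sums[of h 1 p] pmf_nat_sums[of h 1 q]] h by (simp add: algebra_simps)
  have le: "norm ((pmf p m - pmf q m) * h m) \<le> \<bar>pmf p m - pmf q m\<bar>" for m
    using h[of m] by (simp add: abs_mult mult_left_le)
  have sn: "summable (\<lambda>m. norm ((pmf p m - pmf q m) * h m))"
    by (rule summable_comparison_test'[OF sm, of 0]) (use le in auto)
  have "\<bar>\<Sum>m. (pmf p m - pmf q m) * h m\<bar> \<le> (\<Sum>m. norm ((pmf p m - pmf q m) * h m))"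
    using summable_norm[OF sn] by simp
  also have "\<dots> \<le> (\<Sum>m. \<bar>pmf p m - pmf q m\<bar>)" by (rule suminf_le[OF le sn sm])
  finally show ?thesis using sums_unique[OF d] by simp
qed

text \<open>A random number of points from \<open>\<kappa>\<close>. The binomial and the Poisson choice of
  \<open>p\<close> describe, respectively, the points of a fixed sample in a window and a Poisson
  process in a window.\<close>

definition mixed_sample :: "nat pmf \<Rightarrow> 'e measure \<Rightarrow> (nat \<times> (nat \<Rightarrow> 'e)) measure" where
  "mixed_sample p \<kappa> = measure_pmf p \<Otimes>\<^sub>M (\<Pi>\<^sub>M i\<in>UNIV. \<kappa>)"

definition sample_set :: "nat \<times> (nat \<Rightarrow> 'e) \<Rightarrow> 'e set" where
  "sample_set s = snd s ` {..<fst s}"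

lemma prob_space_mixed_sample:
  assumes "prob_space \<kappa>" shows "prob_space (mixed_sample p \<kappa>)"
proof -
  interpret K: product_prob_space "\<lambda>_::nat. \<kappa>" UNIV
    using assms by (intro product_prob_spaceI) 
  interpret pair_prob_space "measure_pmf p" "\<Pi>\<^sub>M i\<in>(UNIV::nat set). \<kappa>" ..
  show ?thesis unfolding mixed_sample_def by unfold_locales
qed

lemma mixed_sample_void:
  fixes \<kappa> :: "'e::topological_space measure"
  assumes "prob_space \<kappa>" and [measurable_cong]: "sets \<kappa> = sets borel" and B[measurable]: "B \<in> sets borel"
  shows "{s \<in> space (mixed_sample p \<kappa>). sample_set s \<inter> B = {}} \<in> sets (mixed_sample p \<kappa>)" (is ?m)
    and "measure (mixed_sample p \<kappa>) {s \<in> space (mixed_sample p \<kappa>). sample_set s \<inter> B = {}}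
      = (\<integral>m. (1 - measure \<kappa> B) ^ m \<partial>measure_pmf p)" (is ?e)
proof -
  interpret K: product_prob_space "\<lambda>_::nat. \<kappa>" UNIV
    using assms by (intro product_prob_spaceI)
  interpret PK: pair_prob_space "measure_pmf p" "\<Pi>\<^sub>M i\<in>(UNIV::nat set). \<kappa>" ..
  let ?K = "\<Pi>\<^sub>M i\<in>(UNIV::nat set). \<kappa>"
  let ?V = "{s \<in> space (mixed_sample p \<kappa>). sample_set s \<inter> B = {}}"
  have spB: "space \<kappa> = UNIV" using sets_eq_imp_space_eq[OF assms(2)] by simp
  have V: "?V = {s \<in> space (mixed_sample p \<kappa>). \<forall>i<fst s. snd s i \<notin> B}"
    by (auto simp: sample_set_def)
  show m: ?m unfolding V unfolding mixed_sample_def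
  proof -
    have "(\<lambda>s. snd s i) \<in> measurable (measure_pmf p \<Otimes>\<^sub>M ?K) borel" for i
      using measurable_cong_sets[OF refl assms(2)] by (intro measurable_compose[OF measurable_snd]) auto
    note [measurable] = this
    show "{s \<in> space (measure_pmf p \<Otimes>\<^sub>M ?K). \<forall>i<fst s. snd s i \<notin> B} \<in> sets (measure_pmf p \<Otimes>\<^sub>M ?K)"
      by measurable
  qed
  have e: "measure ?K (Pair n -` ?V) = (1 - measure \<kappa> B) ^ n" for n
  proof -
    have eq: "Pair n -` ?V = {x \<in> space ?K. \<forall>i\<in>{..<n}. x i \<in> UNIV - B}"
      unfolding V by (auto simp: mixed_sample_def space_pair_measure spB)
    have "emeasure ?K (Pair n -` ?V) = (\<Prod>i\<in>{..<n}. emeasure \<kappa> (UNIV - B))"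
      unfolding eq by (rule K.emeasure_PiM_Collect) (auto simp: assms(2))
    also have "\<dots> = ennreal ((1 - measure \<kappa> B) ^ n)"
      using K.M.prob_compl[of B] B by (simp add: spB K.M.emeasure_eq_measure ennreal_power assms(2))
    finally show ?thesis using K.M.prob_le_1[of B] by (subst (asm) K.P.emeasure_eq_measure) simp
  qed
  have "measure (mixed_sample p \<kappa>) ?V = (\<integral>n. measure ?K (Pair n -` ?V) \<partial>measure_pmf p)"
    using m unfolding mixed_sample_def by (rule K.P.measure_pair_eq_integral[OF measure_pmf.prob_space_axioms])
  then show ?e unfolding e .
qed

lemma measurable_sample_set [measurable]:
  fixes \<kappa> :: "'e::topological_space measure"
  assumes "prob_space \<kappa>" "sets \<kappa> = sets borel"
  shows "sample_set \<in> measurable (mixed_sample p \<kappa>) void_algebra"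
  using mixed_sample_void(1)[OF assms] by (intro measurable_void_algebra) (auto simp: sample_set_def)

text \<open>Couple the two samples by using the same points: only the law of their number matters.\<close>

lemma mixed_sample_difference:
  fixes \<kappa> :: "'e::topological_space measure"
  assumes "prob_space \<kappa>" "sets \<kappa> = sets borel" and E: "E \<in> sets void_algebra"
  shows "\<bar>measure (distr (mixed_sample p \<kappa>) void_algebra sample_set) E - measure (distr (mixed_sample q \<kappa>) void_algebra sample_set) E\<bar>
    \<le> (\<Sum>m. \<bar>pmf p m - pmf q m\<bar>)"
proof -
  interpret K: product_prob_space "\<lambda>_::nat. \<kappa>" UNIV
    using assms by (intro product_prob_spaceI)
  let ?K = "\<Pi>\<^sub>M i\<in>(UNIV::nat set). \<kappa>"
  have e: "\<exists>h. (\<forall>m. 0 \<le> h m \<and> h m \<le> 1) \<and> (\<forall>r. measure (distr (mixed_sample r \<kappa>) void_algebra sample_set) E = (\<integral>m. h m \<partial>measure_pmf r))"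
  proof (intro exI conjI allI)
    fix r :: "nat pmf"
    interpret PK: pair_prob_space "measure_pmf r" ?K ..
    let ?V = "sample_set -` E \<inter> space (mixed_sample r \<kappa>)"
    have m: "?V \<in> sets (mixed_sample r \<kappa>)" using measurable_sample_set[OF assms(1,2)] E by (rule measurable_sets)
    have "measure (distr (mixed_sample r \<kappa>) void_algebra sample_set) E = measure (mixed_sample r \<kappa>) ?V"
      using measurable_sample_set[OF assms(1,2)] E by (rule measure_distr)
    also have "\<dots> = (\<integral>n. measure ?K (Pair n -` ?V) \<partial>measure_pmf r)"
      using m unfolding mixed_sample_def by (rule K.P.measure_pair_eq_integral[OF measure_pmf.prob_space_axioms])
    also have "\<dots> = (\<integral>n. measure ?K {U \<in> space ?K. U ` {..<n} \<in> E} \<partial>measure_pmf r)"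
      by (intro Bochner_Integration.integral_cong arg_cong[where f="measure ?K"])
        (auto simp: mixed_sample_def space_pair_measure sample_set_def)
    finally show "measure (distr (mixed_sample r \<kappa>) void_algebra sample_set) E
      = (\<integral>n. measure ?K {U \<in> space ?K. U ` {..<n} \<in> E} \<partial>measure_pmf r)" .
  qed (auto intro: K.P.prob_le_1)
  then show ?thesis using pmf_expectation_difference by metis
qed

text \<open>If \<open>b\<close> is the mass of a set under the law of a single point, this is the
  probability that a sample of binomial size misses the set. It agrees with that of
  \<open>n\<close> points which fall into the set with probability \<open>q b\<close> each.\<close>

lemma binomial_void:
  assumes "0 \<le> q" "q \<le> 1"
  shows "(\<integral>m. (1 - b) ^ m \<partial>measure_pmf (binomial_pmf n q)) = (1 - q * b) ^ n"
proof -
  have "(\<integral>m. (1 - b) ^ m \<partial>measure_pmf (binomial_pmf n q))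
    = (\<Sum>k\<le>n. (real (n choose k) * q ^ k * (1 - q) ^ (n - k)) *\<^sub>R (1 - b) ^ k)"
    using assms by (subst expectation_binomial_pmf') auto
  also have "\<dots> = (\<Sum>k\<le>n. real (n choose k) * (q * (1 - b)) ^ k * (1 - q) ^ (n - k))"
    by (intro sum.cong) (auto simp: power_mult_distrib)
  also have "\<dots> = (q * (1 - b) + (1 - q)) ^ n" by (rule binomial_ring[symmetric])
  also have "q * (1 - b) + (1 - q) = 1 - q * b" by (simp add: algebra_simps)
  finally show ?thesis .
qed

lemma poisson_void:
  assumes "0 < l" "0 \<le> b" "b \<le> 1"
  shows "(\<integral>m. (1 - b) ^ m \<partial>measure_pmf (poisson_pmf l)) = exp (- (l * b))"
proof -
  have "(\<lambda>m. pmf (poisson_pmf l) m * (1 - b) ^ m) sums (\<integral>m. (1 - b) ^ m \<partial>measure_pmf (poisson_pmf l))"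
    using assms by (intro pmf_nat_sums[where C=1]) (auto simp: power_le_one)
  moreover have "(\<lambda>m. exp (- l) * ((l * (1 - b)) ^ m /\<^sub>R fact m)) sums (exp (- l) * exp (l * (1 - b)))"
    by (intro sums_mult exp_converges)
  moreover have "pmf (poisson_pmf l) m * (1 - b) ^ m = exp (- l) * ((l * (1 - b)) ^ m /\<^sub>R fact m)" for m
    using assms by (simp add: power_mult_distrib divide_inverse mult_ac)
  ultimately have "(\<integral>m. (1 - b) ^ m \<partial>measure_pmf (poisson_pmf l)) = exp (- l) * exp (l * (1 - b))"
    by (metis (no_types, lifting) sums_cong sums_unique2)
  then show ?thesis by (simp add: exp_add[symmetric] algebra_simps)
qed

section \<open>Captured points and in-degrees\<close>

text \<open>The later point \<open>p\<close> attaches to the point at \<open>x\<close> with time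
  \<open>u\<close>: none of the points that are present by the time of \<open>p\<close> is closer
  to it. Only captures at distance less than \<open>r\<close> are counted, which makes the
  in-degree depend on the points in a window only.\<close>

definition captures :: "real \<Rightarrow> 'c::metric_space \<Rightarrow> real \<Rightarrow> ('c \<times> real) set \<Rightarrow> 'c \<times> real \<Rightarrow> bool" where
  "captures r x u A p \<longleftrightarrow> u < snd p \<and> fst p \<noteq> x \<and> dist (fst p) x < r \<and>
     (\<forall>q\<in>A. snd q \<le> snd p \<and> dist (fst p) (fst q) < dist (fst p) x \<longrightarrow> q = p)"

definition in_degree :: "real \<Rightarrow> 'c::metric_space \<Rightarrow> real \<Rightarrow> ('c \<times> real) set \<Rightarrow> nat" where
  "in_degree r x u A = card {p \<in> A. captures r x u A p}"

lemma measurable_in_degree: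
  fixes x :: "'s \<Rightarrow> 'c::euclidean_space" and g :: "'s \<Rightarrow> real"
  assumes x[measurable]: "x \<in> borel_measurable S" and g[measurable]: "g \<in> borel_measurable S" and C: "C \<in> measurable S void_algebra"
  shows "(\<lambda>s. in_degree r (x s) (g s) (C s)) \<in> measurable S (count_space UNIV)"
proof -
  let ?T = "\<lambda>s (p :: 'c \<times> real). g s < snd p \<and> fst p \<noteq> x s \<and> dist (fst p) (x s) < r"
  let ?R = "\<lambda>(s::'s) (p :: 'c \<times> real) (q :: 'c \<times> real). snd q \<le> snd p \<and> dist (fst p) (fst q) < dist (fst p) (x s) \<and> q \<noteq> p"
  have [measurable]: "(fst :: 'c \<times> real \<Rightarrow> 'c) \<in> measurable borel borel" "(snd :: 'c \<times> real \<Rightarrow> real) \<in> measurable borel borel"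
    by (auto intro!: borel_measurable_continuous_onI continuous_intros)
  have "(\<lambda>s. card {p \<in> C s. ?T s p \<and> (\<forall>q\<in>C s. \<not> ?R s p q)}) \<in> measurable S (count_space UNIV)"
  proof (rule measurable_card_related_points[OF C])
    show "Measurable.pred (S \<Otimes>\<^sub>M borel \<Otimes>\<^sub>M borel) (\<lambda>(s, p, q). ?R s p q)" by measurable
    show "Measurable.pred (S \<Otimes>\<^sub>M borel) (\<lambda>(s, p). ?T s p)" by measurable
  qed
  also have "(\<lambda>s. card {p \<in> C s. ?T s p \<and> (\<forall>q\<in>C s. \<not> ?R s p q)}) = (\<lambda>s. in_degree r (x s) (g s) (C s))"
    unfolding in_degree_def captures_def by (intro ext arg_cong[where f=card]) auto
  finally show ?thesis .
qed

lemma of_nat_le_infsum_of_bool: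
  "of_nat k \<le> (\<Sum>\<^sub>\<infinity>p\<in>T. of_bool (Q p) :: ennreal) \<longleftrightarrow> (\<exists>F. F \<subseteq> {p \<in> T. Q p} \<and> finite F \<and> card F = k)"
proof
  assume k: "of_nat k \<le> (\<Sum>\<^sub>\<infinity>p\<in>T. of_bool (Q p) :: ennreal)"
  show "\<exists>F. F \<subseteq> {p \<in> T. Q p} \<and> finite F \<and> card F = k"
  proof (rule ccontr)
    assume no: "\<not> ?thesis"
    then have "k \<noteq> 0" by (metis card.empty empty_subsetI finite.emptyI)
    have le: "(\<Sum>p\<in>F. of_bool (Q p) :: ennreal) \<le> of_nat (k - 1)" if F: "finite F" "F \<subseteq> T" for F
    proof -
      have "(\<Sum>p\<in>F. of_bool (Q p) :: ennreal) = of_nat (card {p \<in> F. Q p})"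
        using F by (simp add: of_bool_def sum.If_cases Int_def)
      moreover have "\<not> k \<le> card {p \<in> F. Q p}"
      proof
        assume "k \<le> card {p \<in> F. Q p}"
        then obtain G where "G \<subseteq> {p \<in> F. Q p}" "card G = k" "finite G" by (metis obtain_subset_with_card_n)
        then show False using no F by blast
      qed
      ultimately show ?thesis by simp
    qed
    have "(\<Sum>\<^sub>\<infinity>p\<in>T. of_bool (Q p) :: ennreal) = (SUP F\<in>{F. finite F \<and> F \<subseteq> T}. \<Sum>p\<in>F. of_bool (Q p))"
      by (rule nonneg_infsum_complete) auto
    also have "\<dots> \<le> of_nat (k - 1)" by (rule SUP_least) (use le in auto)
    finally have "(of_nat k :: ennreal) \<le> of_nat (k - 1)" by (rule order_trans[OF k])
    then have "k \<le> k - 1" by (simp only: of_nat_le_iff)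
    then show False using \<open>k \<noteq> 0\<close> by simp
  qed
next
  assume "\<exists>F. F \<subseteq> {p \<in> T. Q p} \<and> finite F \<and> card F = k"
  then obtain F where F: "F \<subseteq> {p \<in> T. Q p}" "finite F" "card F = k" by blast
  have "(of_nat k :: ennreal) = (\<Sum>p\<in>F. 1)" using F by simp
  also have "\<dots> = (\<Sum>p\<in>F. of_bool (Q p))" using F(1) by (intro sum.cong) auto
  also have "\<dots> \<le> (SUP F\<in>{F. finite F \<and> F \<subseteq> T}. \<Sum>p\<in>F. of_bool (Q p))"
    using F by (intro SUP_upper) auto
  also have "\<dots> = (\<Sum>\<^sub>\<infinity>p\<in>T. of_bool (Q p) :: ennreal)"
    by (rule nonneg_infsum_complete[symmetric]) auto
  finally show "of_nat k \<le> (\<Sum>\<^sub>\<infinity>p\<in>T. of_bool (Q p) :: ennreal)" .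
qed

text \<open>Radius \<open>2 r\<close> suffices: a point within \<open>r\<close> of \<open>x\<close> whose
  nearest neighbour is in question only looks at points within another \<open>r\<close>.\<close>

definition window :: "'c::metric_space \<Rightarrow> real \<Rightarrow> ('c \<times> real) set" where
  "window x r = ball x (2 * r) \<times> {0..1}"

lemma captures_window:
  assumes A: "A \<subseteq> UNIV \<times> {0..1}" and p: "p \<in> A"
  shows "captures r x u (A \<inter> window x r) p \<longleftrightarrow> captures r x u A p"
proof
  assume c: "captures r x u (A \<inter> window x r) p"
  show "captures r x u A p" unfolding captures_def
  proof (intro conjI ballI impI)
    fix q assume q: "q \<in> A" "snd q \<le> snd p \<and> dist (fst p) (fst q) < dist (fst p) x"
    have "dist x (fst q) \<le> dist (fst p) x + dist (fst p) (fst q)" by (metis dist_commute dist_triangle2)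
    then have "dist x (fst q) < 2 * r" using q c by (auto simp: captures_def)
    moreover have "snd q \<in> {0..1}" using q A by auto
    ultimately have "q \<in> A \<inter> window x r" using q by (cases q) (auto simp: window_def)
    then show "q = p" using c q by (auto simp: captures_def)
  qed (use c in \<open>auto simp: captures_def\<close>)
qed (auto simp: captures_def)

lemma in_degree_window:
  assumes A: "A \<subseteq> UNIV \<times> {0..1}"
  shows "in_degree r x u (A \<inter> window x r) = in_degree r x u A"
proof -
  have w: "p \<in> window x r" if "p \<in> A" "captures r x u A p" for p
  proof -
    have "dist x (fst p) < r" using that(2) unfolding captures_def dist_commute[of x] by blast
    then have "dist x (fst p) < 2 * r" using zero_le_dist[of x "fst p"] by linarith
    moreover have "snd p \<in> {0..1}" using subsetD[OF A that(1)] by (simp add: mem_Times_iff)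
    ultimately show ?thesis unfolding window_def by (cases p) simp
  qed
  have "{p \<in> A \<inter> window x r. captures r x u (A \<inter> window x r) p} = {p \<in> A. captures r x u A p}"
    using captures_window[OF A, of _ r x u] w by blast
  then show ?thesis by (simp add: in_degree_def)
qed

text \<open>The map \<open>y \<mapsto> x + c y\<close> in space, with times unchanged. Captures compare
  distances, so they are invariant under it up to a change of the radius.\<close>

definition rescale :: "'c::real_normed_vector \<Rightarrow> real \<Rightarrow> 'c \<times> real \<Rightarrow> 'c \<times> real" where
  "rescale x c p = (x + c *\<^sub>R fst p, snd p)"

lemma captures_rescale:
  assumes c: "c > 0"
  shows "captures (c * r) x u (rescale x c ` A) (rescale x c p) \<longleftrightarrow> captures r 0 u A p"
proof -
  have d: "dist (x + c *\<^sub>R y) (x + c *\<^sub>R z) = c * dist y z" for y z :: 'a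
    using c by (simp add: dist_norm scaleR_diff_right[symmetric])
  have d0: "dist (x + c *\<^sub>R y) x = c * dist y 0" for y using d[of y 0] by simp
  have d2: "dist (c *\<^sub>R y) (c *\<^sub>R z) = c * dist y z" for y z :: 'a using d[of y z] by simp
  have i: "rescale x c q = rescale x c p \<longleftrightarrow> q = p" for q p using c by (cases q; cases p) (auto simp: rescale_def)
  show ?thesis unfolding captures_def using c by (simp add: d d0 i) (simp add: rescale_def d d0 d2)
qed

lemma in_degree_rescale:
  assumes c: "c > 0"
  shows "in_degree (c * r) x u (rescale x c ` A) = in_degree r 0 u A"
proof -
  have "inj_on (rescale x c) {p \<in> A. captures r 0 u A p}" using c by (intro inj_onI) (auto simp: rescale_def prod_eq_iff)
  moreover have "{p \<in> rescale x c ` A. captures (c * r) x u (rescale x c ` A) p} = rescale x c ` {p \<in> A. captures r 0 u A p}"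
    by (auto simp: captures_rescale[OF c])
  ultimately show ?thesis unfolding in_degree_def by (simp add: card_image)
qed

lemma measurable_rescale [measurable]: "rescale (x :: 'c::euclidean_space) c \<in> borel_measurable borel"
  unfolding rescale_def by (intro borel_measurable_continuous_onI continuous_intros)

lemma nn_integral_lborel_affine:
  fixes x :: "'c::euclidean_space"
  assumes c: "c > 0" and g[measurable]: "g \<in> borel_measurable borel"
  shows "(\<integral>\<^sup>+y. g y \<partial>lborel) = ennreal (c ^ DIM('c)) * (\<integral>\<^sup>+y. g (x + c *\<^sub>R y) \<partial>lborel)"
proof -
  have "c \<noteq> 0" using c by simp
  have "(\<integral>\<^sup>+y. g y \<partial>lborel) = (\<integral>\<^sup>+y. g y \<partial>(density (distr lborel borel (\<lambda>y. x + c *\<^sub>R y)) (\<lambda>_. \<bar>c\<bar> ^ DIM('c))))"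
    using lborel_affine[OF \<open>c \<noteq> 0\<close>, of x] by (rule arg_cong[where f="\<lambda>M. nn_integral M g"])
  also have "\<dots> = (\<integral>\<^sup>+y. ennreal (\<bar>c\<bar> ^ DIM('c)) * g y \<partial>(distr lborel borel (\<lambda>y. x + c *\<^sub>R y)))"
    by (rule nn_integral_density) auto
  also have "\<dots> = (\<integral>\<^sup>+y. ennreal (\<bar>c\<bar> ^ DIM('c)) * g (x + c *\<^sub>R y) \<partial>lborel)"
    by (rule nn_integral_distr) auto
  also have "\<dots> = ennreal (\<bar>c\<bar> ^ DIM('c)) * (\<integral>\<^sup>+y. g (x + c *\<^sub>R y) \<partial>lborel)"
    by (rule nn_integral_cmult) auto
  finally show ?thesis using c by simp
qed

lemma emeasure_lborel_pair_snd:
  assumes "B \<in> sets (borel :: ('c::euclidean_space \<times> real) measure)"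
  shows "emeasure lborel B = (\<integral>\<^sup>+v. \<integral>\<^sup>+y. indicator B (y, v) \<partial>lborel \<partial>lborel)"
    and "(\<lambda>v. \<integral>\<^sup>+y. indicator B (y, v) \<partial>lborel) \<in> borel_measurable borel"
    and "(\<lambda>y. indicator B (y, v) :: ennreal) \<in> borel_measurable borel"
proof -
  have B: "B \<in> sets (lborel \<Otimes>\<^sub>M lborel)" unfolding lborel_prod using assms by simp
  then have i: "(indicator B :: _ \<Rightarrow> ennreal) \<in> borel_measurable (lborel \<Otimes>\<^sub>M lborel)" by simp
  have "emeasure lborel B = (\<integral>\<^sup>+p. indicator B p \<partial>(lborel \<Otimes>\<^sub>M lborel))" unfolding lborel_prod using assms by simp
  also have "\<dots> = (\<integral>\<^sup>+v. \<integral>\<^sup>+y. indicator B (y, v) \<partial>lborel \<partial>lborel)"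
    by (rule lborel_pair.nn_integral_snd[symmetric, OF i])
  finally show "emeasure lborel B = (\<integral>\<^sup>+v. \<integral>\<^sup>+y. indicator B (y, v) \<partial>lborel \<partial>lborel)" .
  show "(\<lambda>y. indicator B (y, v) :: ennreal) \<in> borel_measurable borel"
    using measurable_compose[OF measurable_Pair2'[of v lborel lborel] i] by simp
  have "(\<lambda>v. \<integral>\<^sup>+y. indicator B (y, v) \<partial>lborel) \<in> borel_measurable lborel"
    using lborel.borel_measurable_nn_integral_fst[OF measurable_pair_swap[OF i]] by simp
  then show "(\<lambda>v. \<integral>\<^sup>+y. indicator B (y, v) \<partial>lborel) \<in> borel_measurable borel" by simp
qed

lemma emeasure_rescale_vimage:
  fixes x :: "'c::euclidean_space"
  assumes c: "c > 0" and B: "B \<in> sets borel"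
  shows "emeasure lborel B = ennreal (c ^ DIM('c)) * emeasure lborel (rescale x c -` B)"
proof -
  have B': "rescale x c -` B \<in> sets borel" using measurable_sets[OF measurable_rescale B, of x c] by simp
  have "(\<integral>\<^sup>+y. indicator B (y, v) \<partial>lborel) = ennreal (c ^ DIM('c)) * (\<integral>\<^sup>+y. indicator (rescale x c -` B) (y, v) \<partial>lborel)" for v
    using nn_integral_lborel_affine[OF c emeasure_lborel_pair_snd(3)[OF B], of v x] by (simp add: indicator_def rescale_def)
  then have "emeasure lborel B = (\<integral>\<^sup>+v. ennreal (c ^ DIM('c)) * (\<integral>\<^sup>+y. indicator (rescale x c -` B) (y, v) \<partial>lborel) \<partial>lborel)"
    by (simp only: emeasure_lborel_pair_snd(1)[OF B])
  also have "\<dots> = ennreal (c ^ DIM('c)) * emeasure lborel (rescale x c -` B)"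
    using emeasure_lborel_pair_snd(2)[OF B'] unfolding emeasure_lborel_pair_snd(1)[OF B'] by (intro nn_integral_cmult) simp
  finally show ?thesis .
qed

lemma window_volume_pos: "0 < r \<Longrightarrow> 0 < unit_ball_vol DIM('c::euclidean_space) * (2 * r) ^ DIM('c)"
  by simp

lemma window_props:
  fixes x :: "'c::euclidean_space"
  assumes "0 < r"
  shows "window x r \<in> sets borel" "bounded (window x r)" "window x r \<subseteq> UNIV \<times> {0..1}"
    "emeasure lborel (window x r) = ennreal (unit_ball_vol DIM('c) * (2 * r) ^ DIM('c))"
    "measure lborel (window x r) = unit_ball_vol DIM('c) * (2 * r) ^ DIM('c)"
proof -
  have s: "ball x (2 * r) \<times> {0..1::real} \<in> sets (borel \<Otimes>\<^sub>M borel)" by (rule pair_measureI) auto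
  show "window x r \<in> sets borel" using s unfolding window_def borel_prod .
  show "bounded (window x r)" unfolding window_def by (intro bounded_Times) auto
  show "window x r \<subseteq> UNIV \<times> {0..1}" by (auto simp: window_def)
  have "emeasure lborel (window x r) = emeasure (lborel \<Otimes>\<^sub>M lborel) (ball x (2 * r) \<times> {0..1::real})"
    by (simp add: window_def lborel_prod)
  also have "\<dots> = emeasure lborel (ball x (2 * r)) * emeasure lborel {0..1::real}"
    by (rule lborel.emeasure_pair_measure_Times) auto
  also have "\<dots> = ennreal (unit_ball_vol DIM('c) * (2 * r) ^ DIM('c))"
    using assms by (simp add: emeasure_ball)
  finally show e: "emeasure lborel (window x r) = ennreal (unit_ball_vol DIM('c) * (2 * r) ^ DIM('c))" .
  have p: "0 < unit_ball_vol DIM('c) * (2 * r) ^ DIM('c)" by (rule window_volume_pos[OF assms])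
  show "measure lborel (window x r) = unit_ball_vol DIM('c) * (2 * r) ^ DIM('c)"
    using e p by (simp add: measure_def)
qed

lemma vimage_rescale_window:
  assumes "c > 0" shows "rescale x c -` window x (c * r) = window 0 r"
proof (intro equalityI subsetI)
  fix p :: "'a \<times> real"
  have "dist x (x + c *\<^sub>R fst p) = c * norm (fst p)" using assms by (simp add: dist_norm)
  moreover have "c * norm (fst p) < 2 * (c * r) \<longleftrightarrow> norm (fst p) < 2 * r"
    using mult_less_cancel_left_pos[OF assms, of "norm (fst p)" "2 * r"] by (simp add: mult.left_commute)
  ultimately have "p \<in> rescale x c -` window x (c * r) \<longleftrightarrow> p \<in> window 0 r"
    by (cases p) (simp add: rescale_def window_def)
  then show "p \<in> rescale x c -` window x (c * r) \<Longrightarrow> p \<in> window 0 r" "p \<in> window 0 r \<Longrightarrow> p \<in> rescale x c -` window x (c * r)"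
    by auto
qed

section \<open>The local degree of a Poisson process\<close>

locale poisson_setup =
  fixes N :: "'b measure" and H :: "'b \<Rightarrow> ('c::euclidean_space \<times> real) set" and U :: "'b \<Rightarrow> real"
  assumes marked: "marked_poisson_setup N H U"
begin

sublocale prob_space N using marked by (simp add: marked_poisson_setup_def)

abbreviation "slab \<equiv> (UNIV :: 'c set) \<times> {0..1::real}"

lemma H_slab: "\<omega> \<in> space N \<Longrightarrow> H \<omega> \<subseteq> slab"
  and H_finite: "\<omega> \<in> space N \<Longrightarrow> bounded B \<Longrightarrow> finite (H \<omega> \<inter> B)"
  using marked by (auto simp: marked_poisson_setup_def unit_poisson_process_def)

lemma H_card:
  assumes "B \<in> sets borel" "bounded B" "B \<subseteq> slab"
  shows "(\<lambda>\<omega>. card (H \<omega> \<inter> B)) \<in> measurable N (count_space UNIV)"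
    "measure N {\<omega> \<in> space N. card (H \<omega> \<inter> B) = m} = measure lborel B ^ m / fact m * exp (- measure lborel B)"
  using marked assms unfolding marked_poisson_setup_def unit_poisson_process_def by blast+

lemma void_eq:
  assumes "\<omega> \<in> space N" "bounded W"
  shows "H \<omega> \<inter> W \<inter> B = {} \<longleftrightarrow> card (H \<omega> \<inter> (W \<inter> B)) = 0"
  using H_finite[of \<omega> "W \<inter> B"] assms by (simp add: Int_assoc card_eq_0_iff bounded_Int)

lemma restrict_measurable_process_algebra:
  assumes W: "W \<in> sets borel" "bounded W" "W \<subseteq> slab"
  shows "(\<lambda>\<omega>. H \<omega> \<inter> W) \<in> measurable (point_process_algebra N slab H) void_algebra"
proof (rule measurable_void_algebra)
  have sp: "space (point_process_algebra N slab H) = space N"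
    unfolding point_process_algebra_def by (rule space_measure_of) auto
  fix B :: "('c \<times> real) set" assume B: "B \<in> sets borel"
  have "{\<omega> \<in> space (point_process_algebra N slab H). H \<omega> \<inter> W \<inter> B = {}} = {\<omega> \<in> space N. card (H \<omega> \<inter> (W \<inter> B)) = 0}"
    using void_eq W by (auto simp: sp)
  also have "\<dots> \<in> sets (point_process_algebra N slab H)"
    unfolding point_process_algebra_def using W B
    by (subst sets_measure_of) (auto intro!: sigma_sets.Basic exI[of _ "W \<inter> B"] exI[of _ "0::nat"] bounded_Int)
  finally show "{\<omega> \<in> space (point_process_algebra N slab H). H \<omega> \<inter> W \<inter> B = {}} \<in> sets (point_process_algebra N slab H)" .
qed (use H_finite W in \<open>auto simp: point_process_algebra_def space_measure_of_conv\<close>)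

lemma restrict_measurable:
  assumes W: "W \<in> sets borel" "bounded W" "W \<subseteq> slab"
  shows "(\<lambda>\<omega>. H \<omega> \<inter> W) \<in> measurable N void_algebra"
proof (rule measurable_void_algebra)
  fix B :: "('c \<times> real) set" assume B: "B \<in> sets borel"
  have [measurable]: "(\<lambda>\<omega>. card (H \<omega> \<inter> (W \<inter> B))) \<in> measurable N (count_space UNIV)"
    using W B by (intro H_card) (auto intro: bounded_Int)
  have "{\<omega> \<in> space N. H \<omega> \<inter> W \<inter> B = {}} = {\<omega> \<in> space N. card (H \<omega> \<inter> (W \<inter> B)) = 0}"
    using void_eq W by auto
  also have "\<dots> \<in> sets N" by measurable
  finally show "{\<omega> \<in> space N. H \<omega> \<inter> W \<inter> B = {}} \<in> sets N" .
qed (use H_finite W in auto)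

lemma restrict_void:
  assumes W: "W \<in> sets borel" "bounded W" "W \<subseteq> slab" and B: "B \<in> sets borel"
  shows "measure N {\<omega> \<in> space N. H \<omega> \<inter> W \<inter> B = {}} = exp (- measure lborel (W \<inter> B))"
proof -
  have "{\<omega> \<in> space N. H \<omega> \<inter> W \<inter> B = {}} = {\<omega> \<in> space N. card (H \<omega> \<inter> (W \<inter> B)) = 0}"
    using void_eq W by auto
  then show ?thesis using H_card(2)[of "W \<inter> B" 0] W B by (auto intro: bounded_Int)
qed

text \<open>The scaled Poisson points in a window have the void probabilities of a sample of Poisson size,
  hence the same law.\<close>

theorem scaled_window_law:
  fixes x :: 'c
  assumes r: "0 < r" and s: "0 < s"
  shows "distr N void_algebra (\<lambda>\<omega>. rescale x (r / s) ` (H \<omega> \<inter> window 0 s))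
    = distr (mixed_sample (poisson_pmf (unit_ball_vol DIM('c) * (2 * s) ^ DIM('c))) (uniform_measure lborel (window x r)))
        void_algebra sample_set" (is "_ = distr (mixed_sample (poisson_pmf ?l) ?\<kappa>) _ _")
proof -
  let ?c = "r / s"
  have c: "?c > 0" using r s by simp
  note W = window_props[OF s, of "0::'c"] and V = window_props[OF r, of x]
  note Wp = window_volume_pos[OF s, where 'c='c] and Vp = window_volume_pos[OF r, where 'c='c]
  have V0: "emeasure lborel (window x r) \<noteq> 0" unfolding V(4) using Vp by (simp only: ennreal_eq_0_iff not_le)
  have Vi: "emeasure lborel (window x r) \<noteq> \<infinity>" unfolding V(4) by simp
  have \<kappa>: "prob_space ?\<kappa>" by (rule prob_space_uniform_measure[OF V0 Vi])
  have sk: "sets ?\<kappa> = sets borel" by simp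
  note m = restrict_measurable[OF W(1-3)]
  have eqv: "rescale x ?c ` (H \<omega> \<inter> window 0 s) \<inter> B = {} \<longleftrightarrow> H \<omega> \<inter> window 0 s \<inter> (rescale x ?c -` B) = {}" for \<omega> B
    by auto
  have Bm: "rescale x ?c -` B \<in> sets borel" if "B \<in> sets borel" for B
    using measurable_sets[OF measurable_rescale that] by simp
  have C: "(\<lambda>\<omega>. rescale x ?c ` (H \<omega> \<inter> window 0 s)) \<in> measurable N void_algebra"
  proof (rule measurable_void_algebra)
    fix B :: "('c \<times> real) set" assume B: "B \<in> sets borel"
    have "{\<omega> \<in> space N. rescale x ?c ` (H \<omega> \<inter> window 0 s) \<inter> B = {}} =
      (\<lambda>\<omega>. H \<omega> \<inter> window 0 s) -` {A. finite A \<and> A \<inter> (rescale x ?c -` B) = {}} \<inter> space N"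
      unfolding eqv using H_finite W(2) by auto
    also have "\<dots> \<in> sets N" by (rule measurable_sets[OF m void_event[OF Bm[OF B]]])
    finally show "{\<omega> \<in> space N. rescale x ?c ` (H \<omega> \<inter> window 0 s) \<inter> B = {}} \<in> sets N" .
  qed (use H_finite W in auto)
  show ?thesis
  proof (rule void_probabilities_determine_law[OF prob_space_axioms prob_space_mixed_sample[OF \<kappa>] C measurable_sample_set[OF \<kappa> sk]])
    fix B :: "('c \<times> real) set" assume B: "B \<in> sets borel"
    interpret K: prob_space ?\<kappa> by (rule \<kappa>)
    have "measure N {\<omega> \<in> space N. rescale x ?c ` (H \<omega> \<inter> window 0 s) \<inter> B = {}} = exp (- measure lborel (window 0 s \<inter> rescale x ?c -` B))"
      unfolding eqv by (rule restrict_void[OF W(1-3) Bm[OF B]])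
    also have "window 0 s \<inter> rescale x ?c -` B = rescale x ?c -` (window x r \<inter> B)"
      using vimage_rescale_window[OF c, of x s] s by auto
    also have "measure lborel \<dots> = ?l * measure ?\<kappa> B"
    proof -
      have "emeasure lborel (window x r \<inter> B) = ennreal (?c ^ DIM('c)) * emeasure lborel (rescale x ?c -` (window x r \<inter> B))"
        using V(1) B by (intro emeasure_rescale_vimage c) auto
      then have "measure lborel (window x r \<inter> B) = ?c ^ DIM('c) * measure lborel (rescale x ?c -` (window x r \<inter> B))"
        using c by (simp add: measure_def enn2real_mult)
      moreover have "measure ?\<kappa> B = measure lborel (window x r \<inter> B) / measure lborel (window x r)"
        using B by (intro measure_uniform_measure V0 Vi) auto
      moreover have "unit_ball_vol (real DIM('c)) \<noteq> 0" using unit_ball_vol_pos[of "real DIM('c)"] by linarith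
      ultimately have "r ^ DIM('c) * measure lborel (rescale x ?c -` (window x r \<inter> B)) = r ^ DIM('c) * (?l * measure ?\<kappa> B)"
      proof -
        assume 1: "measure lborel (window x r \<inter> B) = ?c ^ DIM('c) * measure lborel (rescale x ?c -` (window x r \<inter> B))"
          and 2: "measure ?\<kappa> B = measure lborel (window x r \<inter> B) / measure lborel (window x r)"
        have "measure lborel (window x r \<inter> B) = (unit_ball_vol DIM('c) * (2 * r) ^ DIM('c)) * measure ?\<kappa> B"
          using 2 Vp unfolding V(5) by (metis nonzero_mult_div_cancel_left order_less_irrefl times_divide_eq_right)
        moreover have "s ^ DIM('c) * measure lborel (window x r \<inter> B) = r ^ DIM('c) * measure lborel (rescale x ?c -` (window x r \<inter> B))"
          using 1 s by (simp add: power_divide)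
        ultimately show ?thesis by (simp only: power_mult_distrib mult_ac)
      qed
      then show ?thesis using r by simp
    qed
    also have "exp (- (?l * measure ?\<kappa> B)) = (\<integral>m. (1 - measure ?\<kappa> B) ^ m \<partial>measure_pmf (poisson_pmf ?l))"
      by (rule poisson_void[symmetric, OF Wp]) auto
    also have "\<dots> = measure (mixed_sample (poisson_pmf ?l) ?\<kappa>) {s \<in> space (mixed_sample (poisson_pmf ?l) ?\<kappa>). sample_set s \<inter> B = {}}"
      using mixed_sample_void(2)[OF \<kappa> sk B] by simp
    finally show "measure N {\<omega> \<in> space N. rescale x ?c ` (H \<omega> \<inter> window 0 s) \<inter> B = {}} =
       measure (mixed_sample (poisson_pmf ?l) ?\<kappa>) {s \<in> space (mixed_sample (poisson_pmf ?l) ?\<kappa>). sample_set s \<inter> B = {}}" .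
  qed
qed

definition local_prob :: "nat \<Rightarrow> real \<Rightarrow> real \<Rightarrow> real" where
  "local_prob k s u = measure N {\<omega> \<in> space N. k \<le> 1 + in_degree s 0 u (H \<omega> \<inter> window 0 s)}"

text \<open>The analogue of \<open>ong_rho\<close> for captures within distance \<open>s\<close>; it
  increases to \<open>ong_rho\<close> as \<open>s\<close> grows.\<close>

definition local_rho :: "nat \<Rightarrow> real \<Rightarrow> real" where
  "local_rho k s = measure N {\<omega> \<in> space N. k \<le> 1 + in_degree s 0 (U \<omega>) (H \<omega> \<inter> window 0 s)}"

lemma U_measurable: "U \<in> borel_measurable N"
  using marked by (simp add: marked_poisson_setup_def)

lemma degree_event:
  assumes "0 < s" shows "{\<omega> \<in> space N. k \<le> 1 + in_degree s 0 (U \<omega>) (H \<omega> \<inter> window 0 s)} \<in> sets N"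
proof -
  have [measurable]: "(\<lambda>\<omega>. in_degree s 0 (U \<omega>) (H \<omega> \<inter> window 0 s)) \<in> measurable N (count_space UNIV)"
    by (rule measurable_in_degree[OF borel_measurable_const U_measurable restrict_measurable[OF window_props(1-3)[OF assms]]])
  show ?thesis by measurable
qed

theorem mixed_poisson_in_degree:
  fixes x :: 'c
  assumes r: "0 < r" and s: "0 < s"
  shows "measure (distr (mixed_sample (poisson_pmf (unit_ball_vol DIM('c) * (2 * s) ^ DIM('c))) (uniform_measure lborel (window x r)))
        void_algebra sample_set) {A. finite A \<and> k \<le> 1 + in_degree r x u A} = local_prob k s u"
proof -
  have c: "r / s > 0" using r s by simp
  let ?C = "\<lambda>\<omega>. rescale x (r / s) ` (H \<omega> \<inter> window 0 s)"
  have [measurable]: "(\<lambda>A. in_degree r x u A) \<in> measurable void_algebra (count_space UNIV)"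
    using measurable_in_degree[of "\<lambda>_. x" void_algebra "\<lambda>_. u" "\<lambda>A. A" r] by simp
  have "{A \<in> space void_algebra. k \<le> 1 + in_degree r x u A} \<in> sets void_algebra" by measurable
  then have E: "{A. finite A \<and> k \<le> 1 + in_degree r x u A} \<in> sets void_algebra" by simp
  have C: "?C \<in> measurable N void_algebra"
  proof (rule measurable_void_algebra)
    fix B :: "('c \<times> real) set" assume B: "B \<in> sets borel"
    have "rescale x (r / s) -` B \<in> sets borel" using measurable_sets[OF measurable_rescale B] by simp
    from measurable_sets[OF restrict_measurable[OF window_props(1-3)[OF s]] void_event[OF this]]
    show "{\<omega> \<in> space N. ?C \<omega> \<inter> B = {}} \<in> sets N"
      by (rule back_subst[of "\<lambda>X. X \<in> sets N"]) (use H_finite window_props(2)[OF s] in auto)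
  qed (intro finite_imageI H_finite window_props(2)[OF s])
  have fin: "finite (?C \<omega>)" if "\<omega> \<in> space N" for \<omega>
    using that by (intro finite_imageI H_finite window_props(2)[OF s])
  have "measure (distr (mixed_sample (poisson_pmf (unit_ball_vol DIM('c) * (2 * s) ^ DIM('c))) (uniform_measure lborel (window x r)))
        void_algebra sample_set) {A. finite A \<and> k \<le> 1 + in_degree r x u A}
     = measure (distr N void_algebra ?C) {A. finite A \<and> k \<le> 1 + in_degree r x u A}"
    by (simp only: scaled_window_law[OF r s])
  also have "\<dots> = measure N (?C -` {A. finite A \<and> k \<le> 1 + in_degree r x u A} \<inter> space N)"
    using C E by (rule measure_distr)
  also have "?C -` {A. finite A \<and> k \<le> 1 + in_degree r x u A} \<inter> space N = {\<omega> \<in> space N. k \<le> 1 + in_degree s 0 u (H \<omega> \<inter> window 0 s)}"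
    using in_degree_rescale[OF c, of s x u] s fin by auto
  finally show ?thesis unfolding local_prob_def .
qed

theorem local_rho_eq_integral:
  assumes s: "0 < s"
  shows "local_rho k s = (\<integral>u. local_prob k s u \<partial>uniform_measure lborel {0..1})"
    and "local_prob k s \<in> borel_measurable borel"
proof -
  let ?C = "\<lambda>\<omega>. H \<omega> \<inter> window 0 s"
  let ?PP = "point_process_algebra N slab H"
  note W = window_props[OF s, of "0::'c"]
  have C: "?C \<in> measurable N void_algebra" by (rule restrict_measurable[OF W(1-3)])
  have spP: "space ?PP = space N" unfolding point_process_algebra_def by (rule space_measure_of) auto
  have ind: "indep_set (sets (vimage_algebra (space N) U borel)) (sets ?PP)"
    using marked by (simp add: marked_poisson_setup_def)
  interpret DU: prob_space "distr N borel U" by (rule prob_space_distr[OF U_measurable])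
  interpret D: prob_space "distr N void_algebra ?C" by (rule prob_space_distr[OF C])
  have UC: "(\<lambda>\<omega>. (U \<omega>, ?C \<omega>)) \<in> measurable N (borel \<Otimes>\<^sub>M void_algebra)" by (intro measurable_Pair U_measurable C)
  have prod: "distr N borel U \<Otimes>\<^sub>M distr N void_algebra ?C = distr N (borel \<Otimes>\<^sub>M void_algebra) (\<lambda>\<omega>. (U \<omega>, ?C \<omega>))"
  proof (rule pair_measure_eqI)
    fix A B assume A: "A \<in> sets (distr N borel U)" and B: "B \<in> sets (distr N void_algebra ?C)"
    have "U -` A \<inter> space N \<in> sets (vimage_algebra (space N) U borel)" using A by (auto simp: sets_vimage_algebra)
    moreover have "?C -` B \<inter> space N \<in> sets ?PP"
      using measurable_sets[OF restrict_measurable_process_algebra[OF W(1-3)]] B unfolding spP by simp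
    from indep_setD[OF ind calculation this] have "prob ((U -` A \<inter> space N) \<inter> (?C -` B \<inter> space N)) = prob (U -` A \<inter> space N) * prob (?C -` B \<inter> space N)"
      .
    moreover have "(\<lambda>\<omega>. (U \<omega>, ?C \<omega>)) -` (A \<times> B) \<inter> space N = (U -` A \<inter> space N) \<inter> (?C -` B \<inter> space N)" by auto
    moreover have "A \<times> B \<in> sets (borel \<Otimes>\<^sub>M void_algebra)" using A B by simp
    ultimately show "emeasure (distr N borel U) A * emeasure (distr N void_algebra ?C) B =
        emeasure (distr N (borel \<Otimes>\<^sub>M void_algebra) (\<lambda>\<omega>. (U \<omega>, ?C \<omega>))) (A \<times> B)"
      using A B by (simp add: emeasure_distr[OF U_measurable] emeasure_distr[OF C] emeasure_distr[OF UC] emeasure_eq_measure ennreal_mult)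
  qed (auto intro: DU.sigma_finite_measure_axioms D.sigma_finite_measure_axioms)
  define E where "E = {p \<in> space (borel \<Otimes>\<^sub>M void_algebra). k \<le> 1 + in_degree s (0::'c) (fst p) (snd p)}"
  have [measurable]: "(\<lambda>p. in_degree s (0::'c) (fst p) (snd p)) \<in> measurable (borel \<Otimes>\<^sub>M void_algebra) (count_space UNIV)"
    by (rule measurable_in_degree) measurable
  have E[measurable]: "E \<in> sets (borel \<Otimes>\<^sub>M void_algebra)" unfolding E_def by measurable
  have "local_rho k s = measure (distr N (borel \<Otimes>\<^sub>M void_algebra) (\<lambda>\<omega>. (U \<omega>, ?C \<omega>))) E"
    unfolding local_rho_def using H_finite[OF _ W(2)]
    by (subst measure_distr[OF UC E]) (auto simp: E_def space_pair_measure intro!: arg_cong[where f="measure N"])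
  also have "\<dots> = (\<integral>u. measure (distr N void_algebra ?C) (Pair u -` E) \<partial>distr N borel U)"
    unfolding prod[symmetric] using E
    by (intro D.measure_pair_eq_integral prob_space_distr U_measurable) simp
  finally have *: "local_rho k s = (\<integral>u. measure (distr N void_algebra ?C) (Pair u -` E) \<partial>distr N borel U)" .
  have sec: "measure (distr N void_algebra ?C) (Pair u -` E) = local_prob k s u" for u
  proof -
    have "Pair u -` E \<in> sets void_algebra" using E by (rule sets_Pair1)
    then show ?thesis
      unfolding local_prob_def using H_finite[OF _ W(2)]
      by (subst measure_distr[OF C]) (auto simp: E_def space_pair_measure intro!: arg_cong[where f="measure N"])
  qed
  have "distr N borel U = uniform_measure lborel {0..1}" using marked by (simp add: marked_poisson_setup_def)
  then show "local_rho k s = (\<integral>u. local_prob k s u \<partial>uniform_measure lborel {0..1})" using * by (simp only: sec)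
  have "E \<in> sets (borel \<Otimes>\<^sub>M distr N void_algebra ?C)" using E by simp
  from borel_measurable_enn2real[OF D.measurable_emeasure_Pair[OF this]]
  show "local_prob k s \<in> borel_measurable borel" unfolding measure_def[symmetric] sec .
qed

lemma captured_finite:
  assumes "\<omega> \<in> space N"
  shows "finite {p \<in> H \<omega>. captures s 0 u (H \<omega>) p}"
proof (rule finite_subset)
  show "finite (H \<omega> \<inter> (ball 0 s \<times> {0..1}))" using assms by (intro H_finite bounded_Times) auto
  show "{p \<in> H \<omega>. captures s 0 u (H \<omega>) p} \<subseteq> H \<omega> \<inter> (ball 0 s \<times> {0..1})"
    using H_slab[OF assms] by (auto simp: captures_def dist_commute)
qed

lemma local_degree_mono:
  assumes "\<omega> \<in> space N" "s \<le> t"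
  shows "in_degree s 0 u (H \<omega> \<inter> window 0 s) \<le> in_degree t 0 u (H \<omega> \<inter> window 0 t)"
proof -
  have "in_degree s 0 u (H \<omega>) \<le> in_degree t 0 u (H \<omega>)"
    unfolding in_degree_def using assms by (intro card_mono captured_finite) (auto simp: captures_def)
  then show ?thesis using in_degree_window[OF H_slab[OF assms(1)]] by simp
qed

text \<open>The possibly infinite sum is at least \<open>k\<close> as soon as finitely many captures reach
  \<open>k\<close>, and finitely many captures lie in some ball.\<close>

lemma ong_xi_ge_iff:
  assumes \<omega>: "\<omega> \<in> space N" and k: "1 \<le> k"
  shows "of_nat k \<le> ong_xi 0 u (H \<omega>) \<longleftrightarrow> (\<exists>m. k \<le> 1 + in_degree (real (Suc m)) 0 u (H \<omega> \<inter> window 0 (real (Suc m))))"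
proof -
  let ?A = "H \<omega>"
  define Q where "Q = (\<lambda>(y, v). (?A \<inter> (UNIV \<times> {0..v})) \<inter> (ball y (dist y 0) \<times> {0..1}) = {(y, v)})"
  have Qiff: "u < snd p \<and> Q p \<longleftrightarrow> u < snd p \<and> fst p \<noteq> 0 \<and> (\<forall>q\<in>?A. snd q \<le> snd p \<and> dist (fst p) (fst q) < dist (fst p) 0 \<longrightarrow> q = p)"
    if "p \<in> ?A" for p
  proof -
    have s01: "q \<in> ?A \<Longrightarrow> 0 \<le> snd q \<and> snd q \<le> 1" for q using H_slab[OF \<omega>] by auto
    obtain y v where p: "p = (y, v)" by (cases p)
    have "(case p of (y, v) \<Rightarrow> (?A \<inter> (UNIV \<times> {0..v})) \<inter> (ball y (dist y 0) \<times> {0..1}) = {(y, v)}) \<longleftrightarrow> y \<noteq> 0 \<and> (\<forall>q\<in>?A. snd q \<le> v \<and> dist y (fst q) < dist y 0 \<longrightarrow> q = (y, v))"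
      (is "?Qp \<longleftrightarrow> _")
    proof
      assume a: "?Qp"
      have "(y, v) \<in> (?A \<inter> (UNIV \<times> {0..v})) \<inter> (ball y (dist y 0) \<times> {0..1})" using a unfolding p by simp
      then have "y \<noteq> 0" by auto
      moreover have "q = (y, v)" if q: "q \<in> ?A" "snd q \<le> v" "dist y (fst q) < dist y 0" for q
      proof -
        have "q \<in> (?A \<inter> (UNIV \<times> {0..v})) \<inter> (ball y (dist y 0) \<times> {0..1})" using q s01[OF q(1)] by (simp add: mem_Times_iff)
        then have "q \<in> {(y, v)}" using a unfolding p prod.case by (simp only:)
        then show ?thesis by simp
      qed
      ultimately show "y \<noteq> 0 \<and> (\<forall>q\<in>?A. snd q \<le> v \<and> dist y (fst q) < dist y 0 \<longrightarrow> q = (y, v))" by blast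
    next
      assume a: "y \<noteq> 0 \<and> (\<forall>q\<in>?A. snd q \<le> v \<and> dist y (fst q) < dist y 0 \<longrightarrow> q = (y, v))"
      have "q \<in> (?A \<inter> (UNIV \<times> {0..v})) \<inter> (ball y (dist y 0) \<times> {0..1}) \<longleftrightarrow> q = (y, v)" for q
      proof
        assume "q \<in> (?A \<inter> (UNIV \<times> {0..v})) \<inter> (ball y (dist y 0) \<times> {0..1})"
        then have "q \<in> ?A" "snd q \<le> v" "dist y (fst q) < dist y 0" by (simp_all add: mem_Times_iff)
        then show "q = (y, v)" using a by blast
      next
        assume "q = (y, v)"
        moreover have "(y, v) \<in> ?A" using that unfolding p .
        moreover have "0 < dist y 0" using a by simp
        ultimately show "q \<in> (?A \<inter> (UNIV \<times> {0..v})) \<inter> (ball y (dist y 0) \<times> {0..1})"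
          using s01[of "(y, v)"] by (simp add: mem_Times_iff)
      qed
      then show ?Qp unfolding p prod.case by (intro set_eqI) (simp only: singleton_iff)
    qed
    then show ?thesis by (simp only: p Q_def fst_conv snd_conv)
  qed
  have e: "ong_xi 0 u ?A = 1 + (\<Sum>\<^sub>\<infinity>p\<in>{(y, v) \<in> ?A. v > u}. of_bool (Q p))"
    unfolding ong_xi_def
  proof (rule arg_cong2[OF refl, where f="(+)"], rule infsum_cong)
    fix p
    show "(case p of (y, v) \<Rightarrow> of_bool ((?A \<inter> (UNIV \<times> {0..v})) \<inter> (ball y (dist y 0) \<times> {0..1}) = {(y, v)})) = (of_bool (Q p) :: ennreal)"
      by (cases p) (simp only: Q_def prod.case)
  qed
  have "of_nat k \<le> ong_xi 0 u ?A \<longleftrightarrow> (1 + of_nat (k - 1) :: ennreal) \<le> 1 + (\<Sum>\<^sub>\<infinity>p\<in>{(y, v) \<in> ?A. v > u}. of_bool (Q p))"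
  proof -
    have "(of_nat k :: ennreal) = 1 + of_nat (k - 1)" using k by (cases k) (simp_all add: add.commute)
    then show ?thesis by (simp only: e)
  qed
  also have "\<dots> \<longleftrightarrow> (of_nat (k - 1) :: ennreal) \<le> (\<Sum>\<^sub>\<infinity>p\<in>{(y, v) \<in> ?A. v > u}. of_bool (Q p) :: ennreal)"
    by (rule trans[OF ennreal_add_left_cancel_le]) (simp only: infinity_ennreal_def ennreal_one_neq_top simp_thms)
  also have "\<dots> \<longleftrightarrow> (\<exists>F. F \<subseteq> {p \<in> {(y, v) \<in> ?A. v > u}. Q p} \<and> finite F \<and> card F = k - 1)"
    by (rule of_nat_le_infsum_of_bool)
  also have "\<dots> \<longleftrightarrow> (\<exists>m. k - 1 \<le> in_degree (real (Suc m)) 0 u ?A)"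
  proof
    assume "\<exists>F. F \<subseteq> {p \<in> {(y, v) \<in> ?A. v > u}. Q p} \<and> finite F \<and> card F = k - 1"
    then obtain F where F: "F \<subseteq> {p \<in> {(y, v) \<in> ?A. v > u}. Q p}" "finite F" "card F = k - 1" by blast
    obtain m :: nat where m: "\<And>p. p \<in> F \<Longrightarrow> dist (fst p) 0 < real (Suc m)"
    proof -
      obtain m :: nat where "Max (insert 0 ((\<lambda>p. dist (fst p) 0) ` F)) < real m" using reals_Archimedean2 by blast
      then have "\<And>p. p \<in> F \<Longrightarrow> dist (fst p) 0 < real m" using F(2) by (subst (asm) Max_less_iff) auto
      then have "dist (fst p) 0 < real (Suc m)" if "p \<in> F" for p using that by fastforce
      then show thesis by (rule that)
    qed
    have "F \<subseteq> {p \<in> ?A. captures (real (Suc m)) 0 u ?A p}"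
    proof
      fix p assume p: "p \<in> F"
      then have "p \<in> ?A" "u < snd p \<and> Q p" using F(1) by auto
      then show "p \<in> {p \<in> ?A. captures (real (Suc m)) 0 u ?A p}" using Qiff[of p] m[OF p] unfolding captures_def by blast
    qed
    then have "k - 1 \<le> in_degree (real (Suc m)) 0 u ?A"
      unfolding in_degree_def F(3)[symmetric] by (intro card_mono captured_finite \<omega>)
    then show "\<exists>m. k - 1 \<le> in_degree (real (Suc m)) 0 u ?A" by blast
  next
    assume "\<exists>m. k - 1 \<le> in_degree (real (Suc m)) 0 u ?A"
    then obtain m where "k - 1 \<le> card {p \<in> ?A. captures (real (Suc m)) 0 u ?A p}" unfolding in_degree_def by blast
    then obtain F where F: "F \<subseteq> {p \<in> ?A. captures (real (Suc m)) 0 u ?A p}" "card F = k - 1" "finite F"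
      by (rule obtain_subset_with_card_n)
    have "F \<subseteq> {p \<in> {(y, v) \<in> ?A. v > u}. Q p}"
    proof
      fix p assume "p \<in> F"
      then have p: "p \<in> ?A" "captures (real (Suc m)) 0 u ?A p" using F(1) by auto
      then have "u < snd p \<and> Q p" using Qiff[OF p(1)] unfolding captures_def by blast
      then show "p \<in> {p \<in> {(y, v) \<in> ?A. v > u}. Q p}" using p by auto
    qed
    then show "\<exists>F. F \<subseteq> {p \<in> {(y, v) \<in> ?A. v > u}. Q p} \<and> finite F \<and> card F = k - 1" using F by blast
  qed
  finally show ?thesis using in_degree_window[OF H_slab[OF \<omega>]] k by (simp add: le_diff_conv add.commute)
qed

lemma local_rho_mono: "0 < s \<Longrightarrow> s \<le> t \<Longrightarrow> local_rho k s \<le> local_rho k t"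
  unfolding local_rho_def using local_degree_mono
  by (intro finite_measure_mono degree_event) (auto intro: order_trans)

text \<open>Continuity from below: the total degree is at least \<open>k\<close> exactly if some finite
  radius already accounts for \<open>k\<close> captures.\<close>

theorem local_rho_tendsto:
  assumes k: "1 \<le> k"
  shows "(\<lambda>m. local_rho k (real (Suc m))) \<longlonglongrightarrow> ong_rho N H U k"
proof -
  let ?E = "\<lambda>m. {\<omega> \<in> space N. k \<le> 1 + in_degree (real (Suc m)) 0 (U \<omega>) (H \<omega> \<inter> window 0 (real (Suc m)))}"
  have "incseq ?E"
    using local_degree_mono[of _ "real (Suc _)" "real (Suc _)"]
    by (intro monoI) (fastforce intro: order_trans)
  then have "(\<lambda>m. measure N (?E m)) \<longlonglongrightarrow> measure N (\<Union>m. ?E m)"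
    using degree_event by (intro finite_Lim_measure_incseq) auto
  moreover have "(\<Union>m. ?E m) = {\<omega> \<in> space N. of_nat k \<le> ong_xi 0 (U \<omega>) (H \<omega>)}"
    using ong_xi_ge_iff[OF _ k] by auto
  ultimately show ?thesis unfolding local_rho_def ong_rho_def by simp
qed

lemma local_rho_le:
  assumes k: "1 \<le> k" and s: "0 < s" shows "local_rho k s \<le> ong_rho N H U k"
proof -
  obtain n :: nat where n: "s \<le> real n" using real_arch_simple by blast
  show ?thesis
  proof (rule LIMSEQ_le_const[OF local_rho_tendsto[OF k]], intro exI allI impI)
    fix m assume "n \<le> m"
    then have "s \<le> real (Suc m)" using n by simp
    then show "local_rho k s \<le> local_rho k (real (Suc m))" using s by (intro local_rho_mono)
  qed
qed

end

section \<open>Densities bounded above and below on a convex body\<close>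

locale bounded_density =
  fixes f :: "'c::euclidean_space \<Rightarrow> real" and S :: "'c set" and a b :: real
  assumes S_compact: "compact S" and S_convex: "convex S" and S_pos: "emeasure lborel S > 0"
    and f_meas [measurable]: "f \<in> borel_measurable borel" and f_nonneg: "\<And>x. 0 \<le> f x"
    and f_int: "(\<integral>\<^sup>+x. ennreal (f x) \<partial>lborel) = 1"
    and f_out: "\<And>x. x \<notin> S \<Longrightarrow> f x = 0"
    and f_lower: "\<And>x. x \<in> S \<Longrightarrow> a \<le> f x" and f_upper: "\<And>x. f x \<le> b" and a_pos: "0 < a"
begin

definition \<mu> :: "'c measure" where "\<mu> = density lborel (\<lambda>x. ennreal (f x))"

lemma sets_\<mu> [simp, measurable_cong]: "sets \<mu> = sets borel" by (simp add: \<mu>_def)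
lemma space_\<mu> [simp]: "space \<mu> = UNIV" by (simp add: \<mu>_def)

sublocale \<mu>: prob_space \<mu>
  by (rule prob_spaceI) (simp add: \<mu>_def emeasure_density f_int)

lemma prob_space_PiM_\<mu>: "prob_space (\<Pi>\<^sub>M j\<in>J. \<mu>)"
  by (rule prob_space_PiM) unfold_locales

lemma AE_\<mu>_S: "AE x in \<mu>. x \<in> S"
  unfolding \<mu>_def by (subst AE_density) (auto intro!: AE_I2 simp: f_out intro: ccontr[of "_ \<in> S"] dest: f_out)

lemma b_pos: "0 < b"
proof -
  have "S \<noteq> {}" using S_pos by auto
  then show ?thesis using f_lower f_upper a_pos by (meson all_not_in_conv order_less_le_trans order_trans)
qed

lemma f_integrable: "integrable lborel f" "(\<integral>x. f x \<partial>lborel) = 1"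
proof -
  show "integrable lborel f" by (rule integrableI_nonneg) (auto simp: f_nonneg f_int)
  then show "(\<integral>x. f x \<partial>lborel) = 1" using f_int by (subst (asm) nn_integral_eq_integral) (auto simp: f_nonneg)
qed

lemma emeasure_\<mu>_le: "B \<in> sets borel \<Longrightarrow> emeasure \<mu> B \<le> ennreal b * emeasure lborel B"
  unfolding \<mu>_def
  by (subst emeasure_density) (auto simp: f_upper nn_integral_cmult_indicator[symmetric] ennreal_leI
      simp del: nn_integral_cmult_indicator intro!: nn_integral_mono mult_right_mono)

lemma \<mu>_ball_diff_le:
  assumes "0 \<le> r" "r \<le> R"
  shows "measure \<mu> (cball x R - ball x r) \<le> b * unit_ball_vol DIM('c) * (R ^ DIM('c) - r ^ DIM('c))"
proof -
  have "emeasure lborel (cball x R - ball x r) = emeasure lborel (cball x R) - emeasure lborel (ball x r)"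
    using assms by (intro emeasure_Diff) (auto simp: emeasure_ball)
  also have "\<dots> = ennreal (unit_ball_vol DIM('c) * (R ^ DIM('c) - r ^ DIM('c)))"
    using assms by (simp add: emeasure_ball emeasure_cball ennreal_minus algebra_simps)
  finally have "emeasure \<mu> (cball x R - ball x r) \<le> ennreal b * ennreal (unit_ball_vol DIM('c) * (R ^ DIM('c) - r ^ DIM('c)))"
    using emeasure_\<mu>_le[of "cball x R - ball x r"] by simp
  also have "\<dots> = ennreal (b * unit_ball_vol DIM('c) * (R ^ DIM('c) - r ^ DIM('c)))"
    using b_pos by (simp add: ennreal_mult'[symmetric] mult.assoc)
  finally show ?thesis using assms b_pos by (simp add: \<mu>.emeasure_eq_measure power_mono)
qed

lemma \<mu>_cball_le:
  assumes "0 \<le> r" shows "measure \<mu> (cball x r) \<le> b * unit_ball_vol DIM('c) * r ^ DIM('c)"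
  using \<mu>_ball_diff_le[of 0 r x] assms by (simp add: power_0_left)

lemma \<mu>_singleton: "measure \<mu> {x} = 0"
  using \<mu>_cball_le[of 0 x] by (simp add: measure_le_0_iff power_0_left)

text \<open>\<open>S\<close> contains the homothetic image of itself with centre \<open>x\<close> and ratio \<open>r / K\<close>, which lies in the
  ball of radius \<open>r\<close> when \<open>K\<close> exceeds the diameter.\<close>

lemma \<mu>_ball_ge:
  obtains c where "0 < c" "c \<le> 1" "\<And>x r. x \<in> S \<Longrightarrow> 0 < r \<Longrightarrow> r \<le> 1 \<Longrightarrow> c * r ^ DIM('c) \<le> measure \<mu> {y. 0 < dist y x \<and> dist y x < r}"
proof -
  have Sb: "S \<in> sets borel" using S_compact by (simp add: compact_imp_closed)
  obtain K0 where K0: "\<And>x y. x \<in> S \<Longrightarrow> y \<in> S \<Longrightarrow> dist x y \<le> K0"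
    using compact_imp_bounded[OF S_compact] unfolding bounded_two_points by blast
  define K where "K = max 1 (K0 + 1)"
  have K: "1 \<le> K" "\<And>x y. x \<in> S \<Longrightarrow> y \<in> S \<Longrightarrow> dist x y < K" using K0 by (fastforce simp: K_def)+
  have Sfin: "emeasure lborel S < \<infinity>" by (rule emeasure_compact_finite[OF S_compact])
  define c where "c = a * measure lborel S / K ^ DIM('c)"
  have mS: "0 < measure lborel S" using S_pos Sfin by (simp add: measure_def enn2real_positive_iff)
  have c0: "0 < c" unfolding c_def using mS a_pos K(1) by simp
  have main: "c * r ^ DIM('c) \<le> measure \<mu> {y. 0 < dist y x \<and> dist y x < r}" if x: "x \<in> S" and r: "0 < r" "r \<le> 1" for x r
  proof -
    define q where "q = r / K"
    have q: "0 < q" "q \<le> 1" "q * K = r" using r K(1) by (auto simp: q_def)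
    define T where "T = (\<lambda>y. (1 - q) *\<^sub>R x + q *\<^sub>R y) -` (ball x r \<inter> S)"
    have [measurable]: "ball x r \<inter> S \<in> sets borel" using Sb by simp
    have Tm[measurable]: "T \<in> sets borel" unfolding T_def
      by (rule measurable_sets_borel[where M=borel]) (auto intro!: borel_measurable_continuous_onI continuous_intros simp: Sb)
    have "S \<subseteq> T"
    proof
      fix y assume y: "y \<in> S"
      have "(1 - q) *\<^sub>R x + q *\<^sub>R y \<in> S" using S_convex x y q by (simp add: convex_def)
      moreover have "dist x ((1 - q) *\<^sub>R x + q *\<^sub>R y) = q * dist x y"
      proof -
        have "x - ((1 - q) *\<^sub>R x + q *\<^sub>R y) = q *\<^sub>R (x - y)" by (simp add: algebra_simps)
        then show ?thesis using q by (simp add: dist_norm)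
      qed
      moreover have "q * dist x y < r" using mult_strict_left_mono[OF K(2)[OF x y] q(1)] q(3) by simp
      ultimately show "y \<in> T" using q by (simp add: T_def)
    qed
    have nz: "q \<noteq> 0" using q by simp
    have "emeasure lborel (ball x r \<inter> S) = emeasure (density (distr lborel borel (\<lambda>y. (1 - q) *\<^sub>R x + q *\<^sub>R y)) (\<lambda>_. ennreal (\<bar>q\<bar> ^ DIM('c)))) (ball x r \<inter> S)"
      using lborel_affine[OF nz, of "(1 - q) *\<^sub>R x"] by (rule arg_cong[where f="\<lambda>M. emeasure M (ball x r \<inter> S)"])
    also have "\<dots> = ennreal (q ^ DIM('c)) * emeasure lborel T"
      using q by (subst emeasure_density_const) (auto simp: emeasure_distr T_def Sb)
    finally have eq: "emeasure lborel (ball x r \<inter> S) = ennreal (q ^ DIM('c)) * emeasure lborel T" .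
    have "ennreal (c * r ^ DIM('c)) = ennreal a * (ennreal (q ^ DIM('c)) * emeasure lborel S)"
      using Sfin a_pos q r by (simp add: emeasure_eq_ennreal_measure ennreal_mult'[symmetric] c_def q_def power_divide field_simps)
    also have "\<dots> \<le> ennreal a * emeasure lborel (ball x r \<inter> S)"
      unfolding eq using \<open>S \<subseteq> T\<close> by (intro mult_left_mono emeasure_mono) auto
    also have "\<dots> = (\<integral>\<^sup>+y. ennreal a * indicator (ball x r \<inter> S) y \<partial>lborel)"
      by (subst nn_integral_cmult_indicator) auto
    also have "\<dots> \<le> (\<integral>\<^sup>+y. ennreal (f y) * indicator (ball x r) y \<partial>lborel)"
      by (intro nn_integral_mono) (auto simp: indicator_def ennreal_leI f_lower)
    also have "\<dots> = emeasure \<mu> (ball x r)" by (simp add: \<mu>_def emeasure_density)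
    finally have "c * r ^ DIM('c) \<le> measure \<mu> (ball x r)" by (simp add: \<mu>.emeasure_eq_measure)
    also have "\<dots> = measure \<mu> (ball x r - {x})"
      using r \<mu>_singleton[of x] by (subst \<mu>.finite_measure_Diff) auto
    also have "ball x r - {x} = {y. 0 < dist y x \<and> dist y x < r}" by (auto simp: dist_commute)
    finally show ?thesis .
  qed
  obtain x where "x \<in> S" using S_pos by (cases "S = {}") auto
  then have "c * 1 ^ DIM('c) \<le> measure \<mu> {y. 0 < dist y x \<and> dist y x < 1}" by (intro main) auto
  also have "\<dots> \<le> 1" by (rule \<mu>.prob_le_1)
  finally have "c \<le> 1" by simp
  then show thesis using that c0 main by blast
qed

text \<open>Conditionally on the point \<open>i\<close>, functions of the other points relative to it are
  independent.\<close>

lemma nn_integral_PiM_star: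
  fixes g :: "'i \<Rightarrow> 'c \<Rightarrow> 'c \<Rightarrow> ennreal"
  assumes I: "finite I" "i \<notin> I"
    and g: "\<And>j. j \<in> I \<Longrightarrow> (\<lambda>(x, y). g j x y) \<in> borel_measurable (\<mu> \<Otimes>\<^sub>M \<mu>)"
  shows "(\<integral>\<^sup>+w. (\<Prod>j\<in>I. g j (w i) (w j)) \<partial>(\<Pi>\<^sub>M j\<in>insert i I. \<mu>)) = (\<integral>\<^sup>+x. (\<Prod>j\<in>I. \<integral>\<^sup>+y. g j x y \<partial>\<mu>) \<partial>\<mu>)"
proof -
  interpret P: product_prob_space "\<lambda>_::'i. \<mu>" UNIV by unfold_locales
  have [measurable]: "(\<lambda>w. g j (w i) (w j)) \<in> borel_measurable (\<Pi>\<^sub>M j\<in>insert i I. \<mu>)" if "j \<in> I" for j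
    using measurable_compose[OF _ g[OF that], of "\<lambda>w. (w i, w j)"] that by simp
  have "(\<integral>\<^sup>+w. (\<Prod>j\<in>I. g j (w i) (w j)) \<partial>(\<Pi>\<^sub>M j\<in>insert i I. \<mu>))
    = (\<integral>\<^sup>+x. \<integral>\<^sup>+w. (\<Prod>j\<in>I. g j ((w(i := x)) i) ((w(i := x)) j)) \<partial>(\<Pi>\<^sub>M j\<in>I. \<mu>) \<partial>\<mu>)"
    using I by (intro P.product_nn_integral_insert_rev) auto
  also have "\<dots> = (\<integral>\<^sup>+x. \<integral>\<^sup>+w. (\<Prod>j\<in>I. g j x (w j)) \<partial>(\<Pi>\<^sub>M j\<in>I. \<mu>) \<partial>\<mu>)"
    using I by (intro nn_integral_cong prod.cong) auto
  also have "\<dots> = (\<integral>\<^sup>+x. (\<Prod>j\<in>I. \<integral>\<^sup>+y. g j x y \<partial>\<mu>) \<partial>\<mu>)"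
  proof (intro nn_integral_cong P.product_nn_integral_prod I)
    fix x j assume "j \<in> I"
    show "g j x \<in> borel_measurable \<mu>"
      using measurable_compose[OF measurable_Pair1'[of x \<mu> \<mu>] g[OF \<open>j \<in> I\<close>]] by simp
  qed
  finally show ?thesis .
qed

text \<open>Conditionally on the point \<open>i\<close> the count is a sum of independent indicators, so
  \<open>2\<close> to the power of it factorises; \<open>1 + p \<le> exp p\<close> then gives the
  exponential moment.\<close>

lemma expect_two_power_count:
  fixes I :: "'i set"
  assumes I: "finite I" "i \<notin> I" and r: "\<And>j. j \<in> I \<Longrightarrow> 0 \<le> r j"
  shows "(\<integral>\<^sup>+w. ennreal (2 ^ card {j \<in> I. dist (w i) (w j) \<le> r j}) \<partial>(\<Pi>\<^sub>M j\<in>insert i I. \<mu>))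
    \<le> ennreal (exp (\<Sum>j\<in>I. b * unit_ball_vol DIM('c) * r j ^ DIM('c)))"
proof -
  have e: "ennreal (2 ^ card {j \<in> I. dist (w i) (w j) \<le> r j}) = (\<Prod>j\<in>I. 1 + indicator (cball (w i) (r j)) (w j))" for w :: "'i \<Rightarrow> 'c"
  proof -
    have "(\<Prod>j\<in>I. 1 + indicator (cball (w i) (r j)) (w j)) = (\<Prod>j\<in>I. if dist (w i) (w j) \<le> r j then 2 else 1 :: ennreal)"
      by (intro prod.cong refl) (auto simp: indicator_def)
    also have "\<dots> = 2 ^ card {j \<in> I. dist (w i) (w j) \<le> r j}"
      using I by (subst prod.If_cases) (auto simp: Int_def)
    finally show ?thesis by (simp add: ennreal_power[symmetric])
  qed
  have m: "(\<lambda>(x, y). 1 + indicator (cball x (r j)) y :: ennreal) \<in> borel_measurable (\<mu> \<Otimes>\<^sub>M \<mu>)" for j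
  proof -
    have "(\<lambda>(x, y). 1 + indicator (cball x (r j)) y :: ennreal) = (\<lambda>p. 1 + (if dist (fst p) (snd p) \<le> r j then 1 else 0))"
      by (auto simp: indicator_def)
    also have "\<dots> \<in> borel_measurable (\<mu> \<Otimes>\<^sub>M \<mu>)" by measurable
    finally show ?thesis .
  qed
  have "(\<integral>\<^sup>+w. ennreal (2 ^ card {j \<in> I. dist (w i) (w j) \<le> r j}) \<partial>(\<Pi>\<^sub>M j\<in>insert i I. \<mu>))
    = (\<integral>\<^sup>+x. (\<Prod>j\<in>I. \<integral>\<^sup>+y. 1 + indicator (cball x (r j)) y \<partial>\<mu>) \<partial>\<mu>)"
    unfolding e by (rule nn_integral_PiM_star[OF I m])
  also have "\<dots> \<le> (\<integral>\<^sup>+x. ennreal (exp (\<Sum>j\<in>I. b * unit_ball_vol DIM('c) * r j ^ DIM('c))) \<partial>\<mu>)"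
  proof (rule nn_integral_mono)
    fix x
    have "(\<Prod>j\<in>I. \<integral>\<^sup>+y. 1 + indicator (cball x (r j)) y \<partial>\<mu>) = (\<Prod>j\<in>I. ennreal (1 + measure \<mu> (cball x (r j))))"
    proof (intro prod.cong refl)
      fix j
      have "(\<integral>\<^sup>+y. 1 + indicator (cball x (r j)) y \<partial>\<mu>) = (\<integral>\<^sup>+y. 1 \<partial>\<mu>) + (\<integral>\<^sup>+y. indicator (cball x (r j)) y \<partial>\<mu>)"
        by (rule nn_integral_add) (auto intro!: borel_measurable_indicator)
      also have "\<dots> = ennreal (1 + measure \<mu> (cball x (r j)))"
        using \<mu>.emeasure_space_1 by (simp add: \<mu>.emeasure_eq_measure ennreal_plus)
      finally show "(\<integral>\<^sup>+y. 1 + indicator (cball x (r j)) y \<partial>\<mu>) = ennreal (1 + measure \<mu> (cball x (r j)))" .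
    qed
    also have "\<dots> \<le> (\<Prod>j\<in>I. ennreal (exp (b * unit_ball_vol DIM('c) * r j ^ DIM('c))))"
    proof (intro prod_mono_ennreal ennreal_leI)
      fix j assume "j \<in> I"
      have "1 + measure \<mu> (cball x (r j)) \<le> 1 + b * unit_ball_vol DIM('c) * r j ^ DIM('c)" using \<mu>_cball_le[OF r[OF \<open>j \<in> I\<close>]] by simp
      also have "\<dots> \<le> exp (b * unit_ball_vol DIM('c) * r j ^ DIM('c))" by (rule exp_ge_add_one_self)
      finally show "1 + measure \<mu> (cball x (r j)) \<le> exp (b * unit_ball_vol DIM('c) * r j ^ DIM('c))" .
    qed
    also have "\<dots> = ennreal (exp (\<Sum>j\<in>I. b * unit_ball_vol DIM('c) * r j ^ DIM('c)))"
      using I by (simp add: prod_ennreal exp_sum)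
    finally show "(\<Prod>j\<in>I. \<integral>\<^sup>+y. 1 + indicator (cball x (r j)) y \<partial>\<mu>) \<le> ennreal (exp (\<Sum>j\<in>I. b * unit_ball_vol DIM('c) * r j ^ DIM('c)))" .
  qed
  also have "\<dots> = ennreal (exp (\<Sum>j\<in>I. b * unit_ball_vol DIM('c) * r j ^ DIM('c)))" by (simp add: \<mu>.emeasure_space_1[simplified])
  finally show ?thesis .
qed

lemma isolated_prob_le:
  fixes I :: "'i set"
  assumes I: "finite I" "i \<notin> I" and r: "0 < r" "r \<le> 1"
    and c: "0 < c" "c \<le> 1" "\<And>x. x \<in> S \<Longrightarrow> c * r ^ DIM('c) \<le> measure \<mu> {y. 0 < dist y x \<and> dist y x < r}"
  shows "emeasure (\<Pi>\<^sub>M j\<in>insert i I. \<mu>) {w \<in> space (\<Pi>\<^sub>M j\<in>insert i I. \<mu>). \<forall>j\<in>I. \<not> (0 < dist (w j) (w i) \<and> dist (w j) (w i) < r)}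
    \<le> ennreal (exp (- c * r ^ DIM('c) * card I))"
proof -
  let ?g = "\<lambda>x y. if 0 < dist y x \<and> dist y x < r then 0 else 1 :: ennreal"
  let ?E = "{w \<in> space (\<Pi>\<^sub>M j\<in>insert i I. \<mu>). \<forall>j\<in>I. \<not> (0 < dist (w j) (w i) \<and> dist (w j) (w i) < r)}"
  have E: "?E \<in> sets (\<Pi>\<^sub>M j\<in>insert i I. \<mu>)"
  proof (rule sets.sets_Collect_finite_All[OF _ I(1)])
    fix j assume "j \<in> I"
    then have m: "(\<lambda>w. w j) \<in> borel_measurable (\<Pi>\<^sub>M j\<in>insert i I. \<mu>)" "(\<lambda>w. w i) \<in> borel_measurable (\<Pi>\<^sub>M j\<in>insert i I. \<mu>)"
      using measurable_component_singleton[of j "insert i I" "\<lambda>_. \<mu>"] measurable_component_singleton[of i "insert i I" "\<lambda>_. \<mu>"]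
      by (simp_all add: measurable_cong_sets[OF refl sets_\<mu>])
    have "(\<lambda>w. dist (w j) (w i)) \<in> borel_measurable (\<Pi>\<^sub>M j\<in>insert i I. \<mu>)" by (rule borel_measurable_dist[OF m])
    from measurable_sets[OF this, of "- {0<..<r}"]
    show "{w \<in> space (\<Pi>\<^sub>M j\<in>insert i I. \<mu>). \<not> (0 < dist (w j) (w i) \<and> dist (w j) (w i) < r)} \<in> sets (\<Pi>\<^sub>M j\<in>insert i I. \<mu>)"
      by (rule back_subst[of "\<lambda>X. X \<in> sets (\<Pi>\<^sub>M j\<in>insert i I. \<mu>)"]) auto
  qed
  have "emeasure (\<Pi>\<^sub>M j\<in>insert i I. \<mu>) ?E = (\<integral>\<^sup>+w. indicator ?E w \<partial>(\<Pi>\<^sub>M j\<in>insert i I. \<mu>))"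
    using E by simp
  also have "\<dots> = (\<integral>\<^sup>+w. (\<Prod>j\<in>I. ?g (w i) (w j)) \<partial>(\<Pi>\<^sub>M j\<in>insert i I. \<mu>))"
  proof (intro nn_integral_cong)
    fix w assume w: "w \<in> space (\<Pi>\<^sub>M j\<in>insert i I. \<mu>)"
    show "indicator ?E w = (\<Prod>j\<in>I. ?g (w i) (w j))"
    proof (cases "w \<in> ?E")
      case True
      then have "(\<Prod>j\<in>I. ?g (w i) (w j)) = (\<Prod>j\<in>I. 1)" by (intro prod.cong) auto
      then show ?thesis using True by (simp add: indicator_def)
    next
      case False
      then obtain j where "j \<in> I" "?g (w i) (w j) = 0" using w by auto
      then have 0: "(\<Prod>j\<in>I. ?g (w i) (w j)) = 0" by (intro prod_zero[OF I(1)]) blast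
      show ?thesis by (simp only: 0 indicator_simps(2)[OF False])
    qed
  qed
  also have "\<dots> = (\<integral>\<^sup>+x. (\<Prod>j\<in>I. \<integral>\<^sup>+y. ?g x y \<partial>\<mu>) \<partial>\<mu>)"
    by (rule nn_integral_PiM_star[OF I]) simp
  also have "\<dots> \<le> (\<integral>\<^sup>+x. ennreal (exp (- c * r ^ DIM('c) * card I)) \<partial>\<mu>)"
  proof (rule nn_integral_mono_AE)
    show "AE x in \<mu>. (\<Prod>j\<in>I. \<integral>\<^sup>+y. ?g x y \<partial>\<mu>) \<le> ennreal (exp (- c * r ^ DIM('c) * card I))"
      using AE_\<mu>_S
    proof eventually_elim
      case (elim x)
      let ?A = "{y. 0 < dist y x \<and> dist y x < r}"
      have A: "?A \<in> sets borel" by measurable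
      have "(\<integral>\<^sup>+y. ?g x y \<partial>\<mu>) = emeasure \<mu> (UNIV - ?A)"
      proof -
        have "(\<integral>\<^sup>+y. ?g x y \<partial>\<mu>) = (\<integral>\<^sup>+y. indicator (UNIV - ?A) y \<partial>\<mu>)"
          by (intro nn_integral_cong) (auto simp: indicator_def)
        also have "\<dots> = emeasure \<mu> (UNIV - ?A)" by (rule nn_integral_indicator) (use A in simp)
        finally show ?thesis .
      qed
      also have "\<dots> = ennreal (1 - measure \<mu> ?A)"
        using A \<mu>.prob_compl[of ?A] by (simp add: \<mu>.emeasure_eq_measure)
      also have "\<dots> \<le> ennreal (exp (- (c * r ^ DIM('c))))"
        using c(3)[OF elim] exp_ge_add_one_self[of "- (c * r ^ DIM('c))"] by (intro ennreal_leI) linarith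
      finally have "(\<Prod>j\<in>I. \<integral>\<^sup>+y. ?g x y \<partial>\<mu>) \<le> (\<Prod>j\<in>I. ennreal (exp (- (c * r ^ DIM('c)))))"
        by (intro prod_mono_ennreal)
      also have "\<dots> = ennreal (exp (- (c * r ^ DIM('c))) ^ card I)" by (simp add: ennreal_power)
      also have "exp (- (c * r ^ DIM('c))) ^ card I = exp (- c * r ^ DIM('c) * card I)" by (simp add: exp_of_nat_mult[symmetric] mult.commute)
      finally show ?case .
    qed
  qed
  also have "\<dots> = ennreal (exp (- c * r ^ DIM('c) * card I))" by (simp add: \<mu>.emeasure_space_1[simplified])
  finally show ?thesis .
qed

end

section \<open>Counting local degrees in a finite sample\<close>

definition degree_at :: "real \<Rightarrow> 'i set \<Rightarrow> ('i \<Rightarrow> 'c::metric_space \<times> real) \<Rightarrow> 'i \<Rightarrow> nat" where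
  "degree_at r J p j = in_degree r (fst (p j)) (snd (p j)) (p ` (J - {j}))"

definition count_degree :: "nat \<Rightarrow> real \<Rightarrow> 'i set \<Rightarrow> ('i \<Rightarrow> 'c::metric_space \<times> real) \<Rightarrow> nat" where
  "count_degree k r J p = card {j \<in> J. k \<le> 1 + degree_at r J p j}"

lemma count_degree_le: "finite J \<Longrightarrow> count_degree k r J p \<le> card J"
  unfolding count_degree_def by (intro card_mono) auto

lemma count_degree_cong: "(\<And>j. j \<in> J \<Longrightarrow> p j = q j) \<Longrightarrow> count_degree k r J p = count_degree k r J q"
proof -
  assume e: "\<And>j. j \<in> J \<Longrightarrow> p j = q j"
  have "degree_at r J p j = degree_at r J q j" if "j \<in> J" for j
  proof -
    have "p ` (J - {j}) = q ` (J - {j})" using e by auto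
    then show ?thesis using e[OF that] by (simp add: degree_at_def)
  qed
  then show ?thesis by (auto simp: count_degree_def intro!: arg_cong[where f=card])
qed

lemma measurable_finite_image:
  fixes P :: "'i \<Rightarrow> 's \<Rightarrow> 'e::topological_space"
  assumes "finite I" "\<And>l. l \<in> I \<Longrightarrow> P l \<in> borel_measurable S"
  shows "(\<lambda>s. (\<lambda>l. P l s) ` I) \<in> measurable S void_algebra"
proof (rule measurable_void_algebra)
  fix B :: "'e set" assume B: "B \<in> sets borel"
  have "{s \<in> space S. (\<lambda>l. P l s) ` I \<inter> B = {}} = {s \<in> space S. \<forall>l\<in>I. P l s \<notin> B}" by auto
  also have "\<dots> \<in> sets S"
  proof (rule sets.sets_Collect_finite_All[OF _ assms(1)])
    fix l assume "l \<in> I"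
    from measurable_sets[OF assms(2)[OF this], of "- B"] B
    show "{s \<in> space S. P l s \<notin> B} \<in> sets S" by (auto simp: vimage_def Int_def conj_commute)
  qed
  finally show "{s \<in> space S. (\<lambda>l. P l s) ` I \<inter> B = {}} \<in> sets S" .
qed (use assms in auto)

lemma measurable_degree_at:
  fixes P :: "'i \<Rightarrow> 's \<Rightarrow> 'c::euclidean_space \<times> real"
  assumes "finite J" "j \<in> J" and P: "\<And>l. l \<in> J \<Longrightarrow> P l \<in> borel_measurable S"
  shows "(\<lambda>s. degree_at r J (\<lambda>l. P l s) j) \<in> measurable S (count_space UNIV)"
proof -
  have fs: "(fst :: 'c \<times> real \<Rightarrow> 'c) \<in> borel_measurable borel" "(snd :: 'c \<times> real \<Rightarrow> real) \<in> borel_measurable borel"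
    by (auto intro!: borel_measurable_continuous_onI continuous_intros)
  show ?thesis unfolding degree_at_def
    using assms by (intro measurable_in_degree measurable_compose[OF P fs(1)] measurable_compose[OF P fs(2)] measurable_finite_image) auto
qed

lemma count_degree_sum:
  assumes "finite J"
  shows "real (count_degree k r J p) = (\<Sum>j\<in>J. of_bool (k \<le> 1 + degree_at r J p j))"
  using assms by (simp add: count_degree_def of_bool_def sum.If_cases Int_def)

lemma measurable_count_degree:
  fixes P :: "'i \<Rightarrow> 's \<Rightarrow> 'c::euclidean_space \<times> real"
  assumes "finite J" "\<And>l. l \<in> J \<Longrightarrow> P l \<in> borel_measurable S"
  shows "(\<lambda>s. real (count_degree k r J (\<lambda>l. P l s))) \<in> borel_measurable S"
  unfolding count_degree_sum[OF assms(1)]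
proof (rule borel_measurable_sum)
  fix j assume "j \<in> J"
  note [measurable] = measurable_degree_at[OF assms(1) this assms(2)]
  show "(\<lambda>s. of_bool (k \<le> 1 + degree_at r J (\<lambda>l. P l s) j) :: real) \<in> borel_measurable S"
    by measurable
qed

lemma in_degree_insert_far:
  assumes "2 * r \<le> dist (fst q) x" "0 < r"
  shows "in_degree r x u (insert q A) = in_degree r x u A"
proof -
  have "captures r x u (insert q A) p \<longleftrightarrow> captures r x u A p" for p
  proof
    assume c: "captures r x u A p"
    have "\<not> dist (fst p) (fst q) < dist (fst p) x"
    proof
      assume "dist (fst p) (fst q) < dist (fst p) x"
      moreover have "dist (fst p) x < r" using c by (simp add: captures_def)
      moreover have "dist (fst q) x \<le> dist (fst p) (fst q) + dist (fst p) x" by (metis dist_commute dist_triangle2)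
      ultimately show False using assms by linarith
    qed
    then show "captures r x u (insert q A) p" using c by (auto simp: captures_def)
  qed (auto simp: captures_def)
  moreover have "\<not> captures r x u A q" using assms by (auto simp: captures_def)
  ultimately have "{p \<in> insert q A. captures r x u (insert q A) p} = {p \<in> A. captures r x u A p}" by auto
  then show ?thesis by (simp add: in_degree_def)
qed

text \<open>Removing a point only affects degrees of points within \<open>2 r\<close> of it.\<close>

lemma count_degree_deletion:
  assumes J: "finite J" "i \<in> J" and r: "0 < r"
  shows "\<bar>real (count_degree k r J p) - real (count_degree k r (J - {i}) p)\<bar>
    \<le> 1 + real (card {j \<in> J - {i}. dist (fst (p i)) (fst (p j)) \<le> 2 * r})"
proof -
  let ?A = "{j \<in> J. k \<le> 1 + degree_at r J p j}" and ?B = "{j \<in> J - {i}. k \<le> 1 + degree_at r (J - {i}) p j}"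
    and ?N = "insert i {j \<in> J - {i}. dist (fst (p i)) (fst (p j)) \<le> 2 * r}"
  have same: "degree_at r J p j = degree_at r (J - {i}) p j" if "j \<in> J" "j \<notin> ?N" for j
  proof -
    have "p ` (J - {j}) = insert (p i) (p ` (J - {i} - {j}))" using that J by auto
    then show ?thesis unfolding degree_at_def using that r by (auto intro: in_degree_insert_far)
  qed
  have "j \<in> ?A \<longleftrightarrow> j \<in> ?B" if "j \<in> J" "j \<notin> ?N" for j using same[OF that] that by auto
  then have "?A \<subseteq> ?B \<union> ?N" "?B \<subseteq> ?A \<union> ?N" by blast+
  moreover have "finite (?B \<union> ?N)" "finite (?A \<union> ?N)" using J by auto
  ultimately have "card ?A \<le> card (?B \<union> ?N)" "card ?B \<le> card (?A \<union> ?N)" by (blast intro: card_mono)+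
  moreover have "card (?B \<union> ?N) \<le> card ?B + card ?N" "card (?A \<union> ?N) \<le> card ?A + card ?N" by (rule card_Un_le)+
  moreover have "card ?N = Suc (card {j \<in> J - {i}. dist (fst (p i)) (fst (p j)) \<le> 2 * r})" using J by (subst card_insert_disjoint) auto
  ultimately show ?thesis unfolding count_degree_def by linarith
qed

lemma degree_at_index:
  assumes inj: "inj_on p J" and j: "j \<in> J"
  shows "degree_at r J p j = card {l \<in> J - {j}. snd (p j) < snd (p l) \<and> fst (p l) \<noteq> fst (p j) \<and> dist (fst (p l)) (fst (p j)) < r \<and>
    (\<forall>m\<in>J - {j}. snd (p m) \<le> snd (p l) \<and> dist (fst (p l)) (fst (p m)) < dist (fst (p l)) (fst (p j)) \<longrightarrow> m = l)}"
    (is "_ = card ?K")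
proof -
  have "{q \<in> p ` (J - {j}). captures r (fst (p j)) (snd (p j)) (p ` (J - {j})) q} = p ` ?K"
    using inj by (auto simp: captures_def inj_on_eq_iff)
  moreover have "inj_on p ?K" using inj by (rule inj_on_subset) auto
  ultimately show ?thesis by (simp add: degree_at_def in_degree_def card_image)
qed

lemma count_degree_order_invariant:
  assumes "inj_on t J" "inj_on t' J" and ord: "\<And>i j. i \<in> J \<Longrightarrow> j \<in> J \<Longrightarrow> t i \<le> t j \<longleftrightarrow> t' i \<le> t' j"
  shows "count_degree k r J (\<lambda>l. (x l, t l)) = count_degree k r J (\<lambda>l. (x l, t' l))"
proof -
  have i: "inj_on (\<lambda>l. (x l, t l)) J" "inj_on (\<lambda>l. (x l, t' l)) J" using assms(1,2) by (auto simp: inj_on_def)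
  have "degree_at r J (\<lambda>l. (x l, t l)) j = degree_at r J (\<lambda>l. (x l, t' l)) j" if j: "j \<in> J" for j
    unfolding degree_at_index[OF i(1) j] degree_at_index[OF i(2) j]
    using ord j by (intro arg_cong[where f=card]) (auto simp: not_le[symmetric])
  then show ?thesis by (auto simp: count_degree_def intro!: arg_cong[where f=card])
qed

lemma count_degree_reindex:
  assumes \<sigma>: "bij_betw \<sigma> J J"
  shows "count_degree k r J (\<lambda>l. p (\<sigma> l)) = count_degree k r J p"
proof -
  have inj: "inj_on \<sigma> J" and im: "\<sigma> ` J = J" using \<sigma> by (auto simp: bij_betw_def)
  have d: "degree_at r J (\<lambda>l. p (\<sigma> l)) j = degree_at r J p (\<sigma> j)" if j: "j \<in> J" for j
  proof -
    have "\<sigma> ` (J - {j}) = J - {\<sigma> j}" using inj im j by (simp add: inj_on_image_set_diff[of _ J])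
    then have "(\<lambda>l. p (\<sigma> l)) ` (J - {j}) = p ` (J - {\<sigma> j})" by (metis image_image)
    then show ?thesis by (simp add: degree_at_def)
  qed
  have "{j \<in> J. k \<le> 1 + degree_at r J p j} = \<sigma> ` {j \<in> J. k \<le> 1 + degree_at r J (\<lambda>l. p (\<sigma> l)) j}"
    using d im by (auto simp: image_iff) (metis imageE)
  then show ?thesis unfolding count_degree_def using inj by (simp add: card_image inj_on_subset[OF inj])
qed

text \<open>The permutation is the inverse of the rank function of \<open>t\<close>.\<close>

lemma sorting_permutation:
  fixes t :: "nat \<Rightarrow> real"
  assumes "inj_on t {0..n}"
  obtains \<sigma> where "bij_betw \<sigma> {0..n} {0..n}" "\<And>i j. i \<in> {0..n} \<Longrightarrow> j \<in> {0..n} \<Longrightarrow> t (\<sigma> i) \<le> t (\<sigma> j) \<longleftrightarrow> i \<le> j"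
proof -
  let ?J = "{0..n}"
  define rank where "rank j = card {l \<in> ?J. t l < t j}" for j
  have mono: "rank i < rank j" if "i \<in> ?J" "j \<in> ?J" "t i < t j" for i j
    unfolding rank_def using that by (intro psubset_card_mono) auto
  have rle: "rank i \<le> rank j \<longleftrightarrow> t i \<le> t j" if "i \<in> ?J" "j \<in> ?J" for i j
  proof (cases "t i = t j")
    case True
    then have "i = j" using assms that by (simp add: inj_on_eq_iff)
    then show ?thesis by simp
  next
    case False
    then show ?thesis using mono[OF that] mono[OF that(2,1)] by linarith
  qed
  have inj: "inj_on rank ?J"
  proof (rule inj_onI)
    fix i j assume "i \<in> ?J" "j \<in> ?J" "rank i = rank j"
    then have "t i = t j" using rle[of i j] rle[of j i] by simp
    then show "i = j" using assms \<open>i \<in> ?J\<close> \<open>j \<in> ?J\<close> by (simp add: inj_on_eq_iff)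
  qed
  have "rank ` ?J \<subseteq> ?J"
  proof
    fix y assume "y \<in> rank ` ?J"
    then obtain j where j: "j \<in> ?J" "y = rank j" by auto
    have "rank j \<le> card (?J - {j})" unfolding rank_def by (intro card_mono) auto
    then show "y \<in> ?J" using j by (simp add: card_Diff_singleton)
  qed
  then have bij: "bij_betw rank ?J ?J" using inj by (simp add: bij_betw_def endo_inj_surj)
  show thesis
  proof (rule that[of "the_inv_into ?J rank"])
    show b: "bij_betw (the_inv_into ?J rank) ?J ?J" by (rule bij_betw_the_inv_into[OF bij])
    fix i j assume ij: "i \<in> ?J" "j \<in> ?J"
    have "the_inv_into ?J rank i \<in> ?J" "the_inv_into ?J rank j \<in> ?J" using b ij by (auto dest: bij_betwE)
    moreover have "rank (the_inv_into ?J rank i) = i" "rank (the_inv_into ?J rank j) = j"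
      using bij ij by (simp_all add: f_the_inv_into_f_bij_betw)
    ultimately show "t (the_inv_into ?J rank i) \<le> t (the_inv_into ?J rank j) \<longleftrightarrow> i \<le> j" using rle by metis
  qed
qed

lemma square_le_two_power: "(1 + real N)\<^sup>2 \<le> 4 * 2 ^ N"
proof -
  have "(1 + real N)\<^sup>2 + 2 \<le> 4 * 2 ^ N"
  proof (induction N)
    case (Suc N)
    have "(1 + real (Suc N))\<^sup>2 + 2 \<le> 2 * ((1 + real N)\<^sup>2 + 2)" by (simp add: power2_eq_square algebra_simps)
    then show ?case using Suc by simp
  qed simp
  then show ?thesis by simp
qed

context bounded_density begin

definition times_law :: "real measure" where "times_law = uniform_measure lborel {0..1}"

lemma prob_space_times_law: "prob_space times_law"
  unfolding times_law_def by (rule prob_space_uniform_measure) auto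

lemma sets_times_law [simp, measurable_cong]: "sets times_law = sets borel" by (simp add: times_law_def)

lemma index_points_measurable:
  "l \<in> J \<Longrightarrow> (\<lambda>w. (w l, real l)) \<in> borel_measurable (\<Pi>\<^sub>M j\<in>J. \<mu>)"
proof -
  assume "l \<in> J"
  then have "(\<lambda>w. w l) \<in> borel_measurable (\<Pi>\<^sub>M j\<in>J. \<mu>)"
    using measurable_component_singleton[of l J "\<lambda>_. \<mu>"] by (simp add: measurable_cong_sets[OF refl sets_\<mu>])
  then show ?thesis by (intro borel_measurable_Pair) auto
qed

text \<open>Deleting one point changes the count by at most one plus the number of points within \<open>2
  r\<close>, whose second moment is bounded through \<open>(1 + N)\<^sup>2 \<le> 4 \<sqdot>
  2\<^bsup>N\<^esup>\<close> and the exponential moment.\<close>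

theorem count_degree_variance:
  fixes J :: "nat set" and k n :: nat and r :: real
  assumes r: "0 < r" "J = {0..n}"
  defines "V \<equiv> \<lambda>w. real (count_degree k r J (\<lambda>l. (w l, real l)))"
  shows "(\<integral>w. (V w - (\<integral>w. V w \<partial>(\<Pi>\<^sub>M j\<in>J. \<mu>)))\<^sup>2 \<partial>(\<Pi>\<^sub>M j\<in>J. \<mu>))
    \<le> (real n + 1) * (4 * exp (real n * (b * unit_ball_vol DIM('c) * (2 * r) ^ DIM('c))))"
proof -
  have J: "finite J" using r by simp
  interpret PJ: prob_space "\<Pi>\<^sub>M j\<in>J. \<mu>" by (rule prob_space_PiM_\<mu>)
  define W where "W i w = real (count_degree k r (J - {i}) (\<lambda>l. (w l, real l)))" for i and w :: "nat \<Rightarrow> 'c"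
  have Wm: "W i \<in> borel_measurable (\<Pi>\<^sub>M j\<in>J. \<mu>)" for i
    unfolding W_def using J index_points_measurable by (intro measurable_count_degree) auto
  have Vm: "V \<in> borel_measurable (\<Pi>\<^sub>M j\<in>J. \<mu>)"
    unfolding V_def using J index_points_measurable by (intro measurable_count_degree) auto
  have Vb: "\<bar>V w\<bar> \<le> real (card J)" for w
    using count_degree_le[OF J] by (simp add: V_def)
  have Wb: "\<bar>W i w\<bar> \<le> real (card J)" for i w
    using order_trans[OF count_degree_le[of "J - {i}"] card_mono[of J "J - {i}"]] J by (simp add: W_def)
  have each: "(\<integral>w. (V w - W i w)\<^sup>2 \<partial>(\<Pi>\<^sub>M j\<in>J. \<mu>)) \<le> 4 * exp (real n * (b * unit_ball_vol DIM('c) * (2 * r) ^ DIM('c)))" if i: "i \<in> J" for i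
  proof -
    let ?N = "\<lambda>w. card {j \<in> J - {i}. dist (w i) (w j) \<le> 2 * r}"
    have Ji: "insert i (J - {i}) = J" using i by auto
    have le: "(V w - W i w)\<^sup>2 \<le> 4 * 2 ^ ?N w" for w
    proof -
      have "\<bar>V w - W i w\<bar> \<le> 1 + real (?N w)"
        using count_degree_deletion[OF J i r(1), of k "\<lambda>l. (w l, real l)"] by (simp add: V_def W_def)
      then have "(V w - W i w)\<^sup>2 \<le> (1 + real (?N w))\<^sup>2" using power_mono[of "\<bar>V w - W i w\<bar>" _ 2] by simp
      then show ?thesis using square_le_two_power[of "?N w"] by linarith
    qed
    have "(\<integral>\<^sup>+w. ennreal ((V w - W i w)\<^sup>2) \<partial>(\<Pi>\<^sub>M j\<in>J. \<mu>)) \<le> (\<integral>\<^sup>+w. ennreal 4 * ennreal (2 ^ ?N w) \<partial>(\<Pi>\<^sub>M j\<in>J. \<mu>))"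
    proof (rule nn_integral_mono)
      fix w :: "nat \<Rightarrow> 'c"
      have "ennreal 4 * ennreal (2 ^ ?N w) = ennreal (4 * 2 ^ ?N w)" by (rule ennreal_mult[symmetric]) auto
      then show "ennreal ((V w - W i w)\<^sup>2) \<le> ennreal 4 * ennreal (2 ^ ?N w)" using ennreal_leI[OF le] by (simp only:)
    qed
    also have "\<dots> = ennreal 4 * (\<integral>\<^sup>+w. ennreal (2 ^ ?N w) \<partial>(\<Pi>\<^sub>M j\<in>J. \<mu>))"
    proof (rule nn_integral_cmult)
      have m: "(\<lambda>w. w j) \<in> borel_measurable (\<Pi>\<^sub>M j\<in>J. \<mu>)" if "j \<in> J" for j
        using measurable_component_singleton[of j J "\<lambda>_. \<mu>"] that by (simp add: measurable_cong_sets[OF refl sets_\<mu>])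
      have "(\<lambda>w. ennreal (2 ^ ?N w)) = (\<lambda>w. \<Prod>j\<in>J - {i}. if dist (w i) (w j) \<le> 2 * r then 2 else 1)"
        using J by (simp add: prod.If_cases Int_def ennreal_power[symmetric])
      also have "\<dots> \<in> borel_measurable (\<Pi>\<^sub>M j\<in>J. \<mu>)"
      proof (rule borel_measurable_prod_ennreal)
        fix j assume "j \<in> J - {i}"
        then have [measurable]: "(\<lambda>w. dist (w i) (w j)) \<in> borel_measurable (\<Pi>\<^sub>M j\<in>J. \<mu>)" using i by (intro borel_measurable_dist m) auto
        show "(\<lambda>w. if dist (w i) (w j) \<le> 2 * r then 2 else 1 :: ennreal) \<in> borel_measurable (\<Pi>\<^sub>M j\<in>J. \<mu>)" by measurable
      qed
      finally show "(\<lambda>w. ennreal (2 ^ ?N w)) \<in> borel_measurable (\<Pi>\<^sub>M j\<in>J. \<mu>)" .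
    qed
    also have "\<dots> \<le> ennreal 4 * ennreal (exp (\<Sum>j\<in>J - {i}. b * unit_ball_vol DIM('c) * (2 * r) ^ DIM('c)))"
      using expect_two_power_count[of "J - {i}" i "\<lambda>_. 2 * r"] r J unfolding Ji by (intro mult_left_mono) auto
    also have "\<dots> = ennreal (4 * exp (real n * (b * unit_ball_vol DIM('c) * (2 * r) ^ DIM('c))))"
      using i r by (simp add: ennreal_mult')
    finally have "(\<integral>\<^sup>+w. ennreal ((V w - W i w)\<^sup>2) \<partial>(\<Pi>\<^sub>M j\<in>J. \<mu>)) \<le> ennreal (4 * exp (real n * (b * unit_ball_vol DIM('c) * (2 * r) ^ DIM('c))))" .
    then show ?thesis
      using Vm Wm[of i] by (subst integral_eq_nn_integral) (auto intro!: enn2real_leI)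
  qed
  have "(\<integral>w. (V w - (\<integral>w. V w \<partial>(\<Pi>\<^sub>M j\<in>J. \<mu>)))\<^sup>2 \<partial>(\<Pi>\<^sub>M j\<in>J. \<mu>)) \<le> (\<Sum>i\<in>J. \<integral>w. (V w - W i w)\<^sup>2 \<partial>(\<Pi>\<^sub>M j\<in>J. \<mu>))"
  proof (rule efron_stein_deletion[OF \<mu>.prob_space_axioms J Vm Vb Wm Wb])
    fix i w z
    show "W i (w(i := z)) = W i w" unfolding W_def by (intro arg_cong[where f=real] count_degree_cong) auto
  qed
  also have "\<dots> \<le> (\<Sum>i\<in>J. 4 * exp (real n * (b * unit_ball_vol DIM('c) * (2 * r) ^ DIM('c))))"
    by (rule sum_mono) (rule each)
  also have "\<dots> = (real n + 1) * (4 * exp (real n * (b * unit_ball_vol DIM('c) * (2 * r) ^ DIM('c))))" using r by simp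
  finally show ?thesis .
qed

lemma times_law_AE_inj: "AE t in (\<Pi>\<^sub>M j\<in>{0..n::nat}. times_law). inj_on t {0..n}"
proof -
  let ?J = "{0..n::nat}"
  interpret T: prob_space times_law by (rule prob_space_times_law)
  interpret PT: product_prob_space "\<lambda>_::nat. times_law" UNIV by unfold_locales
  have "AE t in (\<Pi>\<^sub>M j\<in>?J. times_law). t i \<noteq> t j" if ij: "i \<in> ?J" "j \<in> ?J" "i \<noteq> j" for i j
  proof -
    let ?E = "{t \<in> space (\<Pi>\<^sub>M j\<in>?J. times_law). t i = t j}"
    have m: "(\<lambda>w. w l) \<in> borel_measurable (\<Pi>\<^sub>M j\<in>?J. times_law)" if "l \<in> ?J" for l
      using measurable_component_singleton[of l ?J "\<lambda>_. times_law"] that by (simp add: measurable_cong_sets[OF refl sets_times_law])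
    have E: "?E \<in> sets (\<Pi>\<^sub>M j\<in>?J. times_law)" using m[OF ij(1)] m[OF ij(2)] by measurable
    have Ji: "insert i (?J - {i}) = ?J" using ij by auto
    have "emeasure (\<Pi>\<^sub>M j\<in>?J. times_law) ?E = (\<integral>\<^sup>+t. indicator ?E t \<partial>(\<Pi>\<^sub>M j\<in>insert i (?J - {i}). times_law))"
      using E unfolding Ji by simp
    also have "\<dots> = (\<integral>\<^sup>+t. \<integral>\<^sup>+s. indicator ?E (t(i := s)) \<partial>times_law \<partial>(\<Pi>\<^sub>M j\<in>?J - {i}. times_law))"
      using E Ji by (intro PT.product_nn_integral_insert) auto
    also have "\<dots> \<le> (\<integral>\<^sup>+t. \<integral>\<^sup>+s. indicator {t j} s \<partial>times_law \<partial>(\<Pi>\<^sub>M j\<in>?J - {i}. times_law))"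
      using ij by (intro nn_integral_mono) (auto simp: indicator_def)
    also have "\<dots> = 0"
    proof -
      have "emeasure lborel ({0..1} \<inter> {s}) = 0" for s :: real by (cases "s \<in> {0..1}") auto
      then have "emeasure times_law {s} = 0" for s by (simp add: times_law_def emeasure_uniform_measure)
      then show ?thesis by simp
    qed
    finally have "emeasure (\<Pi>\<^sub>M j\<in>?J. times_law) ?E = 0" by simp
    then show ?thesis using E by (intro AE_I[of _ _ ?E]) auto
  qed
  then have "AE t in (\<Pi>\<^sub>M j\<in>?J. times_law). \<forall>i\<in>?J. \<forall>j\<in>?J. i \<noteq> j \<longrightarrow> t i \<noteq> t j"
    by (intro AE_finite_allI) auto
  then show ?thesis by eventually_elim (auto simp: inj_on_def)
qed

text \<open>Only the order of the times matters for captures. Distinct times induce a permutation of the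
  indices, and the law of independent positions is invariant under permutations, so the index
  order and uniform random times give the same mean.\<close>

theorem random_times_exchange:
  fixes J :: "nat set"
  assumes "J = {0..n}"
  shows "(\<integral>w. real (count_degree k r J (\<lambda>l. (w l, real l))) \<partial>(\<Pi>\<^sub>M j\<in>J. \<mu>))
    = (\<integral>z. real (count_degree k r J z) \<partial>(\<Pi>\<^sub>M j\<in>J. \<mu> \<Otimes>\<^sub>M times_law))"
proof -
  have J: "finite J" using assms by simp
  interpret T: prob_space times_law by (rule prob_space_times_law)
  interpret PX: prob_space "\<Pi>\<^sub>M j\<in>J. \<mu>" by (rule prob_space_PiM_\<mu>)
  interpret PT: prob_space "\<Pi>\<^sub>M j\<in>J. times_law" by (rule prob_space_PiM) unfold_locales
  interpret XT: pair_prob_space "\<Pi>\<^sub>M j\<in>J. \<mu>" "\<Pi>\<^sub>M j\<in>J. times_law" ..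
  let ?V = "\<lambda>t w. real (count_degree k r J (\<lambda>l. (w l, t l)))"
  let ?E = "\<integral>w. ?V real w \<partial>(\<Pi>\<^sub>M j\<in>J. \<mu>)"
  have Vm: "?V t \<in> borel_measurable (\<Pi>\<^sub>M j\<in>J. \<mu>)" for t :: "nat \<Rightarrow> real"
  proof -
    have "(\<lambda>w. w l) \<in> borel_measurable (\<Pi>\<^sub>M j\<in>J. \<mu>)" if "l \<in> J" for l
      using measurable_component_singleton[of l J "\<lambda>_. \<mu>"] that by (simp add: measurable_cong_sets[OF refl sets_\<mu>])
    then show ?thesis using J by (intro measurable_count_degree borel_measurable_Pair) auto
  qed
  have inv: "(\<integral>w. ?V t w \<partial>(\<Pi>\<^sub>M j\<in>J. \<mu>)) = ?E" if t: "inj_on t J" for t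
  proof -
    obtain \<sigma> where \<sigma>: "bij_betw \<sigma> J J" "\<And>i j. i \<in> J \<Longrightarrow> j \<in> J \<Longrightarrow> t (\<sigma> i) \<le> t (\<sigma> j) \<longleftrightarrow> i \<le> j"
      using sorting_permutation t unfolding assms by blast
    have \<sigma>J: "\<And>l. l \<in> J \<Longrightarrow> \<sigma> l \<in> J" "inj_on \<sigma> J" using \<sigma>(1) by (auto simp: bij_betw_def)
    have t\<sigma>: "inj_on (\<lambda>l. t (\<sigma> l)) J"
    proof (rule inj_onI)
      fix i j assume "i \<in> J" "j \<in> J" "t (\<sigma> i) = t (\<sigma> j)"
      then show "i = j" using \<sigma>(2)[of i j] \<sigma>(2)[of j i] by simp
    qed
    have Vt: "?V t w = ?V real (\<lambda>l\<in>J. w (\<sigma> l))" for w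
    proof -
      have "count_degree k r J (\<lambda>l. (w l, t l)) = count_degree k r J (\<lambda>l. (w (\<sigma> l), t (\<sigma> l)))"
        using count_degree_reindex[OF \<sigma>(1), of k r "\<lambda>l. (w l, t l)"] by simp
      also have "\<dots> = count_degree k r J (\<lambda>l. (w (\<sigma> l), real l))"
        using \<sigma>(2) by (intro count_degree_order_invariant t\<sigma>) (auto simp: inj_on_def)
      also have "\<dots> = count_degree k r J (\<lambda>l. ((\<lambda>l\<in>J. w (\<sigma> l)) l, real l))" by (rule count_degree_cong) auto
      finally show ?thesis by simp
    qed
    have d: "distr (\<Pi>\<^sub>M j\<in>J. \<mu>) (\<Pi>\<^sub>M j\<in>J. \<mu>) (\<lambda>w. \<lambda>l\<in>J. w (\<sigma> l)) = (\<Pi>\<^sub>M j\<in>J. \<mu>)"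
      using distr_PiM_reindex[of J "\<lambda>_. \<mu>" \<sigma> J] \<sigma>J \<mu>.prob_space_axioms by auto
    have "?E = (\<integral>w. ?V real w \<partial>distr (\<Pi>\<^sub>M j\<in>J. \<mu>) (\<Pi>\<^sub>M j\<in>J. \<mu>) (\<lambda>w. \<lambda>l\<in>J. w (\<sigma> l)))" unfolding d ..
    also have "\<dots> = (\<integral>w. ?V real (\<lambda>l\<in>J. w (\<sigma> l)) \<partial>(\<Pi>\<^sub>M j\<in>J. \<mu>))"
      using \<sigma>J Vm by (intro integral_distr measurable_restrict measurable_component_singleton) auto
    finally show ?thesis unfolding Vt ..
  qed
  let ?D = "\<lambda>(x, t). \<lambda>j\<in>J. (x j :: 'c, t j :: real)"
  have D: "?D \<in> measurable ((\<Pi>\<^sub>M j\<in>J. \<mu>) \<Otimes>\<^sub>M (\<Pi>\<^sub>M j\<in>J. times_law)) (\<Pi>\<^sub>M j\<in>J. \<mu> \<Otimes>\<^sub>M times_law)"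
    by (auto intro!: measurable_restrict simp: split_beta)
  have sb: "sets (\<mu> \<Otimes>\<^sub>M times_law) = sets borel"
    by (simp add: borel_prod[symmetric] cong: sets_pair_measure_cong)
  have Zm: "(\<lambda>z. real (count_degree k r J z)) \<in> borel_measurable (\<Pi>\<^sub>M j\<in>J. \<mu> \<Otimes>\<^sub>M times_law)"
  proof -
    have "(\<lambda>z. z l) \<in> borel_measurable (\<Pi>\<^sub>M j\<in>J. \<mu> \<Otimes>\<^sub>M times_law)" if "l \<in> J" for l
      using measurable_component_singleton[of l J "\<lambda>_. \<mu> \<Otimes>\<^sub>M times_law"] that by (simp add: measurable_cong_sets[OF refl sb])
    from measurable_count_degree[OF J this] show ?thesis by simp
  qed
  have VD: "real (count_degree k r J (?D p)) = ?V (snd p) (fst p)" for p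
    by (intro arg_cong[where f=real] count_degree_cong) (auto simp: split_beta)
  have "(\<integral>z. real (count_degree k r J z) \<partial>(\<Pi>\<^sub>M j\<in>J. \<mu> \<Otimes>\<^sub>M times_law))
     = (\<integral>z. real (count_degree k r J z) \<partial>distr ((\<Pi>\<^sub>M j\<in>J. \<mu>) \<Otimes>\<^sub>M (\<Pi>\<^sub>M j\<in>J. times_law)) (\<Pi>\<^sub>M j\<in>J. \<mu> \<Otimes>\<^sub>M times_law) ?D)"
    by (simp only: PiM_pair_factor[OF J \<mu>.prob_space_axioms prob_space_times_law])
  also have "\<dots> = (\<integral>p. ?V (snd p) (fst p) \<partial>((\<Pi>\<^sub>M j\<in>J. \<mu>) \<Otimes>\<^sub>M (\<Pi>\<^sub>M j\<in>J. times_law)))"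
    unfolding integral_distr[OF D Zm] VD ..
  also have "\<dots> = (\<integral>t. \<integral>w. ?V t w \<partial>(\<Pi>\<^sub>M j\<in>J. \<mu>) \<partial>(\<Pi>\<^sub>M j\<in>J. times_law))"
  proof -
    have "(\<lambda>p. ?V (snd p) (fst p)) \<in> borel_measurable ((\<Pi>\<^sub>M j\<in>J. \<mu>) \<Otimes>\<^sub>M (\<Pi>\<^sub>M j\<in>J. times_law))"
      using measurable_compose[OF D Zm] unfolding VD .
    then have "integrable ((\<Pi>\<^sub>M j\<in>J. \<mu>) \<Otimes>\<^sub>M (\<Pi>\<^sub>M j\<in>J. times_law)) (\<lambda>(w, t). ?V t w)"
      using count_degree_le[OF J] by (intro XT.integrable_const_bound[where B="real (card J)"]) (auto simp: split_beta)
    from XT.integral_snd[OF this] show ?thesis by (simp add: case_prod_unfold)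
  qed
  also have "\<dots> = (\<integral>t. ?E \<partial>(\<Pi>\<^sub>M j\<in>J. times_law))"
  proof (rule integral_cong_AE)
    show "AE t in (\<Pi>\<^sub>M j\<in>J. times_law). (\<integral>w. ?V t w \<partial>(\<Pi>\<^sub>M j\<in>J. \<mu>)) = ?E"
      using times_law_AE_inj[of n] unfolding assms[symmetric] by eventually_elim (rule inv)
    have "(\<lambda>p. ?V (snd p) (fst p)) \<in> borel_measurable ((\<Pi>\<^sub>M j\<in>J. \<mu>) \<Otimes>\<^sub>M (\<Pi>\<^sub>M j\<in>J. times_law))"
      using measurable_compose[OF D Zm] unfolding VD .
    then have "(\<lambda>(t, w). ?V t w) \<in> borel_measurable ((\<Pi>\<^sub>M j\<in>J. times_law) \<Otimes>\<^sub>M (\<Pi>\<^sub>M j\<in>J. \<mu>))"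
      using measurable_pair_swap[of "\<lambda>p. ?V (snd p) (fst p)"] by simp
    then show "(\<lambda>t. \<integral>w. ?V t w \<partial>(\<Pi>\<^sub>M j\<in>J. \<mu>)) \<in> borel_measurable (\<Pi>\<^sub>M j\<in>J. times_law)"
      by (rule PX.borel_measurable_lebesgue_integral)
  qed simp
  also have "\<dots> = ?E" by (simp add: PT.prob_space)
  finally show ?thesis ..
qed

end

section \<open>The window around a sample point\<close>

context bounded_density begin

definition \<nu> :: "('c \<times> real) measure" where "\<nu> = \<mu> \<Otimes>\<^sub>M times_law"

lemma sets_\<nu> [simp, measurable_cong]: "sets \<nu> = sets borel"
proof -
  have "sets (\<mu> \<Otimes>\<^sub>M times_law) = sets (borel \<Otimes>\<^sub>M borel)" by (intro sets_pair_measure_cong) simp_all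
  then show ?thesis by (simp only: \<nu>_def borel_prod)
qed

lemma space_\<nu> [simp]: "space \<nu> = UNIV"
  using sets_eq_imp_space_eq[OF sets_\<nu>] by simp

lemma prob_space_\<nu>: "prob_space \<nu>"
proof -
  interpret T: prob_space times_law by (rule prob_space_times_law)
  interpret P: pair_prob_space \<mu> times_law ..
  show ?thesis unfolding \<nu>_def by unfold_locales
qed

definition g :: "'c \<times> real \<Rightarrow> real" where "g z = f (fst z) * indicator {0..1} (snd z)"

lemma fst_snd_measurable [measurable]:
  "(fst :: 'c \<times> real \<Rightarrow> 'c) \<in> borel_measurable borel" "(snd :: 'c \<times> real \<Rightarrow> real) \<in> borel_measurable borel"
  by (auto intro!: borel_measurable_continuous_onI continuous_intros)

lemma g_measurable [measurable]: "g \<in> borel_measurable borel"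
  unfolding g_def by measurable

lemma g_nonneg: "0 \<le> g z" by (simp add: g_def f_nonneg)

lemma \<nu>_density: "\<nu> = density lborel (\<lambda>z. ennreal (g z))"
proof -
  have t: "times_law = density lborel (indicator {0..1})"
    by (auto simp: times_law_def uniform_measure_def divide_ennreal_def intro!: density_cong)
  have "\<nu> = density (lborel \<Otimes>\<^sub>M lborel) (\<lambda>(x, y). ennreal (f x) * indicator {0..1} y)"
    unfolding \<nu>_def \<mu>_def t
  proof (rule pair_measure_density)
    show "sigma_finite_measure (density lborel (indicator {0..1 :: real}))"
      unfolding t[symmetric] using prob_space_times_law by (rule prob_space_imp_sigma_finite)
  qed (auto intro: lborel.sigma_finite_measure_axioms)
  also have "\<dots> = density lborel (\<lambda>z. ennreal (g z))"
    unfolding lborel_prod by (intro density_cong) (auto simp: g_def f_nonneg indicator_def split: prod.splits)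
  finally show ?thesis .
qed

lemma g_integrable: "integrable lborel g" "(\<integral>z. g z \<partial>lborel) = 1"
proof -
  interpret prob_space \<nu> by (rule prob_space_\<nu>)
  have i: "(\<integral>\<^sup>+z. ennreal (g z) \<partial>lborel) = 1"
    using emeasure_space_1 by (simp add: \<nu>_density emeasure_density)
  show "integrable lborel g" by (rule integrableI_nonneg) (auto simp: g_nonneg i)
  then show "(\<integral>z. g z \<partial>lborel) = 1" using i by (subst (asm) nn_integral_eq_integral) (auto simp: g_nonneg)
qed

lemma window_subset_slab: "z \<in> window x r \<Longrightarrow> g z = f (fst z)"
  by (auto simp: window_def g_def)

text \<open>The density of \<open>\<nu>\<close> is flattened to the constant \<open>f x\<close> in the
  window and rescaled outside, which keeps the total mass \<open>1\<close> and does not affect the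
  captures. The error is controlled by the oscillation of \<open>f\<close> around
  \<open>x\<close>.\<close>

theorem flattened_law:
  fixes x :: 'c and r :: real
  assumes r: "0 < r" and small: "b * (unit_ball_vol DIM('c) * (2 * r) ^ DIM('c)) < 1"
  defines "D \<equiv> \<integral>z. indicator (window x r) z * \<bar>f (fst z) - f x\<bar> \<partial>lborel"
  obtains \<nu>' where "prob_space \<nu>'" "sets \<nu>' = sets borel"
    "\<And>B. B \<in> sets borel \<Longrightarrow> B \<subseteq> window x r \<Longrightarrow> measure \<nu>' B = f x * measure lborel B"
    "\<And>h. h \<in> borel_measurable borel \<Longrightarrow> (\<And>z. 0 \<le> h z \<and> h z \<le> 1) \<Longrightarrow> \<bar>(\<integral>z. h z \<partial>\<nu>) - (\<integral>z. h z \<partial>\<nu>')\<bar> \<le> 2 * D"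
proof -
  let ?W = "window x r"
  note W = window_props(1-4)[OF r, of x] and Wm = window_props(5)[OF r, of x]
  have [measurable]: "?W \<in> sets borel" by (rule W(1))
  let ?i = "indicator ?W :: _ \<Rightarrow> real"
  define w where "w = measure lborel ?W"
  have w: "w = unit_ball_vol DIM('c) * (2 * r) ^ DIM('c)" "0 \<le> w" unfolding w_def by (rule Wm, rule measure_nonneg)
  have Wfin: "emeasure lborel ?W < \<infinity>" using W(4) by simp
  have iW: "integrable lborel ?i" "(\<integral>z. ?i z \<partial>lborel) = w" using Wfin by (simp_all add: w_def)
  define p where "p = (\<integral>z. ?i z * g z \<partial>lborel)"
  define q where "q = f x * w"
  have ig: "integrable lborel (\<lambda>z. ?i z * g z)"
    using g_integrable(1) by (rule integrable_mult_indicator[of ?W lborel g, simplified])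
  have "p \<le> (\<integral>z. ?i z * b \<partial>lborel)"
    unfolding p_def
  proof (rule integral_mono[OF ig])
    show "integrable lborel (\<lambda>z. ?i z * b)" by (rule integrable_mult_left[OF iW(1)])
    show "?i z * g z \<le> ?i z * b" for z
      using f_upper[of "fst z"] b_pos by (intro mult_left_mono) (auto simp: g_def indicator_def)
  qed
  then have p: "p < 1" using iW small w by (simp add: mult.commute)
  have "q \<le> b * w" unfolding q_def using f_upper[of x] w(2) by (intro mult_right_mono)
  then have q: "q < 1" using small w by simp
  have p0: "0 \<le> p" "0 \<le> q" using f_nonneg g_nonneg w by (auto simp: p_def q_def intro!: integral_nonneg_AE)
  define \<theta> where "\<theta> = (1 - q) / (1 - p)"
  have \<theta>: "0 \<le> \<theta>" "\<theta> * (1 - p) = 1 - q" using p q by (auto simp: \<theta>_def)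
  define g' where "g' z = ?i z * f x + \<theta> * (g z - ?i z * g z)" for z
  have g'W: "z \<in> ?W \<Longrightarrow> g' z = f x" and g'O: "z \<notin> ?W \<Longrightarrow> g' z = \<theta> * g z" for z by (auto simp: g'_def)
  have [measurable]: "g' \<in> borel_measurable borel" unfolding g'_def by measurable
  have g'0: "0 \<le> g' z" for z using \<theta>(1) g_nonneg f_nonneg by (cases "z \<in> ?W") (auto simp: g'W g'O)
  have g'i: "integrable lborel g'" unfolding g'_def using g_integrable ig iW by auto
  have g'1: "(\<integral>z. g' z \<partial>lborel) = 1"
  proof -
    have "(\<integral>z. g' z \<partial>lborel) = w * f x + \<theta> * (1 - p)"
      unfolding g'_def using g_integrable ig iW by (simp add: p_def)
    then show ?thesis using \<theta> by (simp add: q_def mult.commute)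
  qed
  define \<nu>' where "\<nu>' = density lborel (\<lambda>z. ennreal (g' z))"
  have pr: "prob_space \<nu>'"
    by (rule prob_spaceI) (simp add: \<nu>'_def emeasure_density nn_integral_eq_integral g'i g'0 g'1)
  have D: "integrable lborel (\<lambda>z. ?i z * \<bar>f (fst z) - f x\<bar>)"
  proof -
    have "integrable lborel (\<lambda>z. \<bar>?i z * g z - ?i z * f x\<bar>)" using ig iW by auto
    then show ?thesis
      by (rule back_subst[of "integrable lborel"]) (auto simp: indicator_def g_def window_def)
  qed
  have D0: "0 \<le> D" unfolding D_def by (intro integral_nonneg_AE) auto
  have qp: "\<bar>q - p\<bar> \<le> D"
  proof -
    have "p - q = (\<integral>z. ?i z * g z - ?i z * f x \<partial>lborel)" using ig iW by (simp add: p_def q_def mult.commute)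
    also have "\<bar>\<dots>\<bar> \<le> (\<integral>z. \<bar>?i z * g z - ?i z * f x\<bar> \<partial>lborel)" by (rule integral_abs_bound)
    also have "\<dots> = D" unfolding D_def
      by (intro Bochner_Integration.integral_cong) (auto simp: indicator_def g_def window_def)
    finally show ?thesis by linarith
  qed
  have tot: "(\<integral>z. \<bar>g z - g' z\<bar> \<partial>lborel) \<le> 2 * D"
  proof -
    have "(\<integral>z. \<bar>g z - g' z\<bar> \<partial>lborel) = (\<integral>z. ?i z * \<bar>f (fst z) - f x\<bar> + \<bar>1 - \<theta>\<bar> * (g z - ?i z * g z) \<partial>lborel)"
    proof (rule Bochner_Integration.integral_cong[OF refl])
      fix z
      show "\<bar>g z - g' z\<bar> = ?i z * \<bar>f (fst z) - f x\<bar> + \<bar>1 - \<theta>\<bar> * (g z - ?i z * g z)"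
      proof (cases "z \<in> ?W")
        case False
        have "\<bar>g z - \<theta> * g z\<bar> = \<bar>(1 - \<theta>) * g z\<bar>" by (simp add: algebra_simps)
        then show ?thesis using False g_nonneg[of z] by (simp add: g'O abs_mult)
      qed (simp add: g'W window_subset_slab)
    qed
    also have "\<dots> = D + \<bar>1 - \<theta>\<bar> * (1 - p)"
      using D ig g_integrable by (simp add: D_def p_def)
    also have "\<bar>1 - \<theta>\<bar> * (1 - p) = \<bar>(1 - \<theta>) * (1 - p)\<bar>" using p by (simp add: abs_mult)
    also have "(1 - \<theta>) * (1 - p) = q - p" using \<theta>(2) by (simp add: algebra_simps)
    finally show ?thesis using qp by simp
  qed
  show thesis
  proof (rule that[OF pr])
    show "sets \<nu>' = sets borel" by (simp add: \<nu>'_def)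
    fix B :: "('c \<times> real) set" assume B[measurable]: "B \<in> sets borel" and BW: "B \<subseteq> ?W"
    have Bf: "emeasure lborel B < \<infinity>" using emeasure_mono[OF BW, of lborel] Wfin by (simp add: order_le_less_trans)
    have "emeasure \<nu>' B = (\<integral>\<^sup>+z. ennreal (f x) * indicator B z \<partial>lborel)"
      unfolding \<nu>'_def using BW by (subst emeasure_density) (auto intro!: nn_integral_cong simp: indicator_def g'W subset_iff)
    also have "\<dots> = ennreal (f x) * emeasure lborel B" by (simp add: nn_integral_cmult_indicator)
    finally show "measure \<nu>' B = f x * measure lborel B" using f_nonneg by (simp add: measure_def enn2real_mult)
  next
    fix h :: "'c \<times> real \<Rightarrow> real" assume h[measurable]: "h \<in> borel_measurable borel" and h01: "\<And>z. 0 \<le> h z \<and> h z \<le> 1"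
    have e1: "(\<integral>z. h z \<partial>\<nu>) = (\<integral>z. g z * h z \<partial>lborel)"
      unfolding \<nu>_density by (subst integral_density) (auto simp: g_nonneg)
    have e2: "(\<integral>z. h z \<partial>\<nu>') = (\<integral>z. g' z * h z \<partial>lborel)"
      unfolding \<nu>'_def by (subst integral_density) (auto simp: g'0)
    have i1: "integrable lborel (\<lambda>z. g z * h z)" using h01 g_nonneg
      by (intro Bochner_Integration.integrable_bound[OF g_integrable(1)]) (auto simp: abs_mult mult_left_le)
    have i2: "integrable lborel (\<lambda>z. g' z * h z)" using h01 g'0
      by (intro Bochner_Integration.integrable_bound[OF g'i]) (auto simp: abs_mult mult_left_le)
    have "\<bar>(\<integral>z. h z \<partial>\<nu>) - (\<integral>z. h z \<partial>\<nu>')\<bar> = \<bar>\<integral>z. g z * h z - g' z * h z \<partial>lborel\<bar>"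
      unfolding e1 e2 using i1 i2 by simp
    also have "\<dots> \<le> (\<integral>z. \<bar>g z * h z - g' z * h z\<bar> \<partial>lborel)" by (rule integral_abs_bound)
    also have "\<dots> \<le> (\<integral>z. \<bar>g z - g' z\<bar> \<partial>lborel)"
    proof (rule integral_mono)
      show "\<bar>g z * h z - g' z * h z\<bar> \<le> \<bar>g z - g' z\<bar>" for z
        using h01[of z] by (simp add: left_diff_distrib[symmetric] abs_mult mult_left_le)
    qed (use i1 i2 g_integrable g'i in auto)
    also note tot
    finally show "\<bar>(\<integral>z. h z \<partial>\<nu>) - (\<integral>z. h z \<partial>\<nu>')\<bar> \<le> 2 * D" .
  qed
qed

theorem flat_window_law:
  fixes I :: "nat set"
  assumes r: "0 < r" and I: "finite I" and \<nu>': "prob_space \<nu>'" "sets \<nu>' = sets borel"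
    and flat: "\<And>B. B \<in> sets borel \<Longrightarrow> B \<subseteq> window x r \<Longrightarrow> measure \<nu>' B = c * measure lborel B"
    and q: "q = c * (unit_ball_vol DIM('c) * (2 * r) ^ DIM('c))" "0 \<le> q" "q \<le> 1"
  shows "(\<lambda>w. w ` I \<inter> window (x::'c) r) \<in> measurable (\<Pi>\<^sub>M j\<in>I. \<nu>') void_algebra"
    "distr (\<Pi>\<^sub>M j\<in>I. \<nu>') void_algebra (\<lambda>w. w ` I \<inter> window x r)
     = distr (mixed_sample (binomial_pmf (card I) q) (uniform_measure lborel (window x r))) void_algebra sample_set"
proof -
  let ?W = "window x r" and ?\<kappa> = "uniform_measure lborel (window x r)"
  note W = window_props[OF r, of x]
  have vp: "0 < unit_ball_vol DIM('c) * (2 * r) ^ DIM('c)" by (rule window_volume_pos[OF r])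
  have V0: "emeasure lborel ?W \<noteq> 0" unfolding W(4) using vp by (simp only: ennreal_eq_0_iff not_le)
  have Vi: "emeasure lborel ?W \<noteq> \<infinity>" unfolding W(4) by simp
  have \<kappa>: "prob_space ?\<kappa>" by (rule prob_space_uniform_measure[OF V0 Vi])
  have sk: "sets ?\<kappa> = sets borel" by simp
  interpret P: prob_space \<nu>' by fact
  interpret PP: product_prob_space "\<lambda>_::nat. \<nu>'" I by unfold_locales
  have sp: "space \<nu>' = UNIV" using sets_eq_imp_space_eq[OF \<nu>'(2)] by simp
  have voidset: "{w \<in> space (\<Pi>\<^sub>M j\<in>I. \<nu>'). w ` I \<inter> ?W \<inter> B = {}} = {w \<in> space (\<Pi>\<^sub>M j\<in>I. \<nu>'). \<forall>j\<in>I. w j \<in> UNIV - ?W \<inter> B}" for B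
    by auto
  have cm: "UNIV - ?W \<inter> B \<in> sets \<nu>'" if "B \<in> sets borel" for B
    using that W(1) \<nu>'(2) by auto
  show C: "(\<lambda>w. w ` I \<inter> ?W) \<in> measurable (\<Pi>\<^sub>M j\<in>I. \<nu>') void_algebra"
  proof (rule measurable_void_algebra)
    fix B :: "('c \<times> real) set" assume "B \<in> sets borel"
    note m = cm[OF this]
    show "{w \<in> space (\<Pi>\<^sub>M j\<in>I. \<nu>'). w ` I \<inter> ?W \<inter> B = {}} \<in> sets (\<Pi>\<^sub>M j\<in>I. \<nu>')"
      unfolding voidset
    proof (rule sets.sets_Collect_finite_All[OF _ I])
      fix j assume "j \<in> I"
      from measurable_sets[OF measurable_component_singleton[OF this, of "\<lambda>_. \<nu>'"] m]
      show "{w \<in> space (\<Pi>\<^sub>M j\<in>I. \<nu>'). w j \<in> UNIV - ?W \<inter> B} \<in> sets (\<Pi>\<^sub>M j\<in>I. \<nu>')"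
        by (simp add: vimage_def Int_def conj_commute)
    qed
  qed (use I in auto)
  show "distr (\<Pi>\<^sub>M j\<in>I. \<nu>') void_algebra (\<lambda>w. w ` I \<inter> ?W) = distr (mixed_sample (binomial_pmf (card I) q) ?\<kappa>) void_algebra sample_set"
  proof (rule void_probabilities_determine_law[OF PP.prob_space_axioms prob_space_mixed_sample[OF \<kappa>] C measurable_sample_set[OF \<kappa> sk]])
    fix B :: "('c \<times> real) set" assume B: "B \<in> sets borel"
    have WB: "?W \<inter> B \<in> sets borel" using B W(1) by auto
    have "emeasure (\<Pi>\<^sub>M j\<in>I. \<nu>') {w \<in> space (\<Pi>\<^sub>M j\<in>I. \<nu>'). w ` I \<inter> ?W \<inter> B = {}} = (\<Prod>j\<in>I. emeasure \<nu>' (UNIV - ?W \<inter> B))"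
      unfolding voidset by (rule PP.emeasure_PiM_Collect[OF order_refl I]) (rule cm[OF B])
    also have "\<dots> = ennreal ((1 - measure \<nu>' (?W \<inter> B)) ^ card I)"
      using P.prob_compl[of "?W \<inter> B"] WB \<nu>'(2) by (simp add: sp P.emeasure_eq_measure ennreal_power)
    finally have 1: "measure (\<Pi>\<^sub>M j\<in>I. \<nu>') {w \<in> space (\<Pi>\<^sub>M j\<in>I. \<nu>'). w ` I \<inter> ?W \<inter> B = {}} = (1 - measure \<nu>' (?W \<inter> B)) ^ card I"
      using P.prob_le_1[of "?W \<inter> B"] by (subst (asm) PP.emeasure_eq_measure) simp
    have "measure ?\<kappa> B = measure lborel (?W \<inter> B) / measure lborel ?W"
      using B by (intro measure_uniform_measure V0 Vi) auto
    then have 2: "measure \<nu>' (?W \<inter> B) = q * measure ?\<kappa> B"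
    proof -
      define v where "v = unit_ball_vol DIM('c) * (2 * r) ^ DIM('c)"
      have "v \<noteq> 0" using vp by (simp only: v_def)
      then show ?thesis using flat[OF WB] \<open>measure ?\<kappa> B = _\<close> unfolding q(1) W(5) v_def[symmetric] by simp
    qed
    have "measure (mixed_sample (binomial_pmf (card I) q) ?\<kappa>) {s \<in> space (mixed_sample (binomial_pmf (card I) q) ?\<kappa>). sample_set s \<inter> B = {}}
       = (1 - q * measure ?\<kappa> B) ^ card I"
      using mixed_sample_void(2)[OF \<kappa> sk B] binomial_void[OF q(2,3)] by simp
    then show "measure (\<Pi>\<^sub>M j\<in>I. \<nu>') {w \<in> space (\<Pi>\<^sub>M j\<in>I. \<nu>'). w ` I \<inter> ?W \<inter> B = {}}
       = measure (mixed_sample (binomial_pmf (card I) q) ?\<kappa>) {s \<in> space (mixed_sample (binomial_pmf (card I) q) ?\<kappa>). sample_set s \<inter> B = {}}"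
      using 1 2 by simp
  qed
qed

text \<open>The conditional probability that a point at \<open>x\<close> with time \<open>u\<close> has
  degree at least \<open>k\<close>, when the points with indices in \<open>I\<close> are
  independent with law \<open>\<nu>\<close>.\<close>

definition hit :: "nat \<Rightarrow> real \<Rightarrow> nat set \<Rightarrow> 'c \<Rightarrow> real \<Rightarrow> real" where
  "hit k r I x u = (\<integral>w. of_bool (k \<le> 1 + in_degree r x u (w ` I)) \<partial>(\<Pi>\<^sub>M j\<in>I. \<nu>))"

lemma component_\<nu>_measurable: "j \<in> I \<Longrightarrow> (\<lambda>w. w j) \<in> borel_measurable (\<Pi>\<^sub>M j\<in>I. \<nu>)"
  using measurable_component_singleton[of j I "\<lambda>_. \<nu>"] by (simp add: measurable_cong_sets[OF refl sets_\<nu>])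

lemma hit_integrand_measurable:
  assumes "finite I"
  shows "(\<lambda>p. of_bool (k \<le> 1 + in_degree r (fst (fst p)) (snd (fst p)) (snd p ` I)) :: real) \<in> borel_measurable (\<nu> \<Otimes>\<^sub>M (\<Pi>\<^sub>M j\<in>I. \<nu>))"
proof -
  have "(\<lambda>p. in_degree r (fst (fst p)) (snd (fst p)) ((\<lambda>j. snd p j) ` I)) \<in> measurable (\<nu> \<Otimes>\<^sub>M (\<Pi>\<^sub>M j\<in>I. \<nu>)) (count_space UNIV)"
    using assms by (intro measurable_in_degree measurable_finite_image measurable_compose[OF measurable_snd component_\<nu>_measurable]) measurable
  note [measurable] = this
  show ?thesis by measurable
qed

lemma hit_measurable: "finite I \<Longrightarrow> (\<lambda>z. hit k r I (fst z) (snd z)) \<in> borel_measurable \<nu>"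
proof -
  assume I: "finite I"
  interpret P: prob_space "\<Pi>\<^sub>M j\<in>I. \<nu>" by (rule prob_space_PiM) (rule prob_space_\<nu>)
  show ?thesis unfolding hit_def
    using P.borel_measurable_lebesgue_integral[of "\<lambda>z w. of_bool (k \<le> 1 + in_degree r (fst z) (snd z) (w ` I)) :: real" \<nu>]
      hit_integrand_measurable[OF I] by (simp add: split_beta)
qed

lemma hit_bounds: "0 \<le> hit k r I x u \<and> hit k r I x u \<le> 1"
proof -
  interpret P: prob_space "\<Pi>\<^sub>M j\<in>I. \<nu>" by (rule prob_space_PiM) (rule prob_space_\<nu>)
  show ?thesis unfolding hit_def by (rule P.integral_unit_interval) auto
qed

text \<open>Linearity of expectation, followed by integrating out all points other than \<open>j\<close>.\<close>

theorem expected_count_degree: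
  assumes J: "finite J"
  shows "(\<integral>z. real (count_degree k r J z) \<partial>(\<Pi>\<^sub>M j\<in>J. \<nu>)) = (\<Sum>j\<in>J. \<integral>z. hit k r (J - {j}) (fst z) (snd z) \<partial>\<nu>)"
proof -
  interpret N: prob_space \<nu> by (rule prob_space_\<nu>)
  interpret PP: product_prob_space "\<lambda>_::nat. \<nu>" UNIV by unfold_locales
  interpret PJ: prob_space "\<Pi>\<^sub>M j\<in>J. \<nu>" by (rule prob_space_PiM) (rule prob_space_\<nu>)
  have m: "(\<lambda>z. of_bool (k \<le> 1 + degree_at r J z j) :: real) \<in> borel_measurable (\<Pi>\<^sub>M j\<in>J. \<nu>)" if "j \<in> J" for j
  proof -
    note [measurable] = measurable_degree_at[OF J that component_\<nu>_measurable]
    show ?thesis by measurable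
  qed
  have i: "integrable (\<Pi>\<^sub>M j\<in>J. \<nu>) (\<lambda>z. of_bool (k \<le> 1 + degree_at r J z j) :: real)" if "j \<in> J" for j
    using m[OF that] by (intro PJ.integrable_const_bound[where B=1]) auto
  have "(\<integral>z. real (count_degree k r J z) \<partial>(\<Pi>\<^sub>M j\<in>J. \<nu>)) = (\<Sum>j\<in>J. \<integral>z. of_bool (k \<le> 1 + degree_at r J z j) \<partial>(\<Pi>\<^sub>M j\<in>J. \<nu>))"
    unfolding count_degree_sum[OF J] by (rule Bochner_Integration.integral_sum) (rule i)
  also have "\<dots> = (\<Sum>j\<in>J. \<integral>z. hit k r (J - {j}) (fst z) (snd z) \<partial>\<nu>)"
  proof (rule sum.cong[OF refl])
    fix j assume j: "j \<in> J"
    let ?I = "J - {j}"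
    interpret PI: prob_space "\<Pi>\<^sub>M j\<in>?I. \<nu>" by (rule prob_space_PiM) (rule prob_space_\<nu>)
    interpret NP: pair_prob_space \<nu> "\<Pi>\<^sub>M j\<in>?I. \<nu>" ..
    have Ji: "insert j ?I = J" using j by auto
    have "(\<integral>z. of_bool (k \<le> 1 + degree_at r J z j) \<partial>(\<Pi>\<^sub>M j\<in>J. \<nu>)) = (\<integral>z. of_bool (k \<le> 1 + degree_at r J z j) \<partial>(\<Pi>\<^sub>M j\<in>insert j ?I. \<nu>) :: real)"
      unfolding Ji ..
    also have "\<dots> = (\<integral>w. \<integral>y. of_bool (k \<le> 1 + degree_at r J (w(j := y)) j) \<partial>\<nu> \<partial>(\<Pi>\<^sub>M j\<in>?I. \<nu>))"
    proof (rule PP.product_integral_insert)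
      show "integrable (\<Pi>\<^sub>M j\<in>insert j ?I. \<nu>) (\<lambda>z. of_bool (k \<le> 1 + degree_at r J z j) :: real)"
        unfolding Ji by (rule i[OF j])
    qed (use J in auto)
    also have "\<dots> = (\<integral>w. \<integral>y. of_bool (k \<le> 1 + in_degree r (fst y) (snd y) (w ` ?I)) \<partial>\<nu> \<partial>(\<Pi>\<^sub>M j\<in>?I. \<nu>))"
    proof -
      have "(w(j := y)) ` ?I = w ` ?I" for w :: "nat \<Rightarrow> 'c \<times> real" and y by auto
      then show ?thesis by (simp add: degree_at_def)
    qed
    also have "\<dots> = (\<integral>y. \<integral>w. of_bool (k \<le> 1 + in_degree r (fst y) (snd y) (w ` ?I)) \<partial>(\<Pi>\<^sub>M j\<in>?I. \<nu>) \<partial>\<nu>)"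
    proof (rule NP.Fubini_integral)
      show "integrable (\<nu> \<Otimes>\<^sub>M (\<Pi>\<^sub>M j\<in>?I. \<nu>)) (\<lambda>(y, w). of_bool (k \<le> 1 + in_degree r (fst y) (snd y) (w ` ?I)) :: real)"
        using hit_integrand_measurable[of ?I k r] J by (intro NP.integrable_const_bound[where B=1]) (auto simp: split_beta)
    qed
    finally show "(\<integral>z. of_bool (k \<le> 1 + degree_at r J z j) \<partial>(\<Pi>\<^sub>M j\<in>J. \<nu>)) = (\<integral>z. hit k r (J - {j}) (fst z) (snd z) \<partial>\<nu>)"
      by (simp add: hit_def)
  qed
  finally show ?thesis .
qed

lemma AE_\<nu>_slab: "AE z in \<nu>. snd z \<in> {0..1}"
  unfolding \<nu>_density by (subst AE_density) (auto simp: g_def indicator_def intro!: AE_I2 split: if_splits)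

lemma hit_window:
  assumes I: "finite I"
  shows "hit k r I x u = (\<integral>w. of_bool (k \<le> 1 + in_degree r x u (w ` I \<inter> window x r)) \<partial>(\<Pi>\<^sub>M j\<in>I. \<nu>))"
  unfolding hit_def
proof (rule integral_cong_AE)
  have m: "(\<lambda>w. w ` I) \<in> measurable (\<Pi>\<^sub>M j\<in>I. \<nu>) void_algebra"
    using measurable_finite_image[OF I component_\<nu>_measurable, of "\<lambda>l. l"] by simp
  note [measurable] = measurable_in_degree[OF borel_measurable_const borel_measurable_const m, of r x u]
  show "(\<lambda>w. of_bool (k \<le> 1 + in_degree r x u (w ` I)) :: real) \<in> borel_measurable (\<Pi>\<^sub>M j\<in>I. \<nu>)" by measurable
  have w: "window x r \<in> sets borel"
    unfolding window_def borel_prod[symmetric] by (rule pair_measureI) auto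
  have m2: "(\<lambda>w. w ` I \<inter> window x r) \<in> measurable (\<Pi>\<^sub>M j\<in>I. \<nu>) void_algebra"
  proof (rule measurable_void_algebra)
    fix B :: "('c \<times> real) set" assume B: "B \<in> sets borel"
    have "{\<omega> \<in> space (\<Pi>\<^sub>M j\<in>I. \<nu>). \<omega> ` I \<inter> window x r \<inter> B = {}} = (\<lambda>w. w ` I) -` {A. finite A \<and> A \<inter> (window x r \<inter> B) = {}} \<inter> space (\<Pi>\<^sub>M j\<in>I. \<nu>)"
      using I by auto
    also have "\<dots> \<in> sets (\<Pi>\<^sub>M j\<in>I. \<nu>)" using B w by (intro measurable_sets[OF m] void_event) auto
    finally show "{\<omega> \<in> space (\<Pi>\<^sub>M j\<in>I. \<nu>). \<omega> ` I \<inter> window x r \<inter> B = {}} \<in> sets (\<Pi>\<^sub>M j\<in>I. \<nu>)" .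
  qed (use I in auto)
  note [measurable] = measurable_in_degree[OF borel_measurable_const borel_measurable_const m2, of r x u]
  show "(\<lambda>w. of_bool (k \<le> 1 + in_degree r x u (w ` I \<inter> window x r)) :: real) \<in> borel_measurable (\<Pi>\<^sub>M j\<in>I. \<nu>)" by measurable
  have "AE w in (\<Pi>\<^sub>M j\<in>I. \<nu>). \<forall>j\<in>I. snd (w j) \<in> {0..1}"
  proof (intro AE_finite_allI I)
    fix j assume "j \<in> I"
    then show "AE w in (\<Pi>\<^sub>M j\<in>I. \<nu>). snd (w j) \<in> {0..1}"
      using AE_\<nu>_slab prob_space_\<nu> by (intro AE_PiM_component) auto
  qed
  then show "AE w in (\<Pi>\<^sub>M j\<in>I. \<nu>). (of_bool (k \<le> 1 + in_degree r x u (w ` I)) :: real) = of_bool (k \<le> 1 + in_degree r x u (w ` I \<inter> window x r))"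
  proof eventually_elim
    case (elim w)
    then have "w ` I \<subseteq> UNIV \<times> {0..1}" unfolding image_subset_iff by (simp add: mem_Times_iff)
    then show ?case by (simp add: in_degree_window)
  qed
qed

end

section \<open>From the sample to the Poisson process\<close>

text \<open>Twice the distance in total variation between the binomial law with \<open>n\<close> trials and
  mean \<open>l\<close> and the Poisson law with mean \<open>l\<close>.\<close>

definition binomial_poisson_gap :: "nat \<Rightarrow> real \<Rightarrow> real" where
  "binomial_poisson_gap n l = (\<Sum>m. \<bar>real (n choose m) * (l / n) ^ m * (1 - l / n) ^ (n - m) - l ^ m / fact m * exp (- l)\<bar>)"

locale ong_limit = poisson_setup N H U + bounded_density f S a b
  for N :: "'b measure" and H :: "'b \<Rightarrow> ('c::euclidean_space \<times> real) set" and U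
    and f :: "'c \<Rightarrow> real" and S a b
begin

text \<open>Integrated over \<open>x\<close>, this is the integral, over displacements shorter than \<open>2
  r\<close>, of the \<open>L\<^sup>1\<close>-distance between \<open>f\<close> and its translate.\<close>

definition osc :: "real \<Rightarrow> 'c \<Rightarrow> real" where
  "osc r x = (\<integral>z. indicator (window x r) z * \<bar>f (fst z) - f x\<bar> \<partial>lborel)"

lemma osc_nonneg: "0 \<le> osc r x" unfolding osc_def by (intro integral_nonneg_AE) auto

text \<open>Three replacements: the density is flattened in the window, at a cost proportional to the
  oscillation for each of the \<open>n\<close> points; the number of points in the window is then
  binomial and is replaced by a Poisson number; the result is a Poisson process rescaled by
  \<open>r / s\<close>.\<close>

lemma hit_local_prob_close:
  assumes r: "0 < r" and small: "b * (unit_ball_vol DIM('c) * (2 * r) ^ DIM('c)) < 1"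
    and I: "finite I" "card I = n" "0 < n" and x: "x \<in> S" and s: "0 < s" "s ^ DIM('c) = r ^ DIM('c) * (f x * n)"
  shows "\<bar>hit k r I x u - local_prob k s u\<bar>
    \<le> n * (2 * osc r x) + binomial_poisson_gap n (f x * (n * (unit_ball_vol DIM('c) * (2 * r) ^ DIM('c))))"
proof -
  define v where "v = unit_ball_vol DIM('c) * (2 * r) ^ DIM('c)"
  define q where "q = f x * v"
  define l where "l = unit_ball_vol DIM('c) * (2 * s) ^ DIM('c)"
  have v: "0 < v" unfolding v_def by (rule window_volume_pos[OF r])
  have l0: "0 < l" unfolding l_def by (rule window_volume_pos[OF s(1)])
  have lq: "l = n * q" unfolding l_def q_def v_def by (simp add: power_mult_distrib s(2))
  have "f x * v \<le> b * v" using f_upper[of x] v by (intro mult_right_mono) auto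
  then have q: "0 \<le> q" "q \<le> 1" using f_nonneg[of x] v small[folded v_def] unfolding q_def
    by (simp, linarith)
  obtain \<nu>' where \<nu>': "prob_space \<nu>'" "sets \<nu>' = sets borel"
    "\<And>B. B \<in> sets borel \<Longrightarrow> B \<subseteq> window x r \<Longrightarrow> measure \<nu>' B = f x * measure lborel B"
    "\<And>h. h \<in> borel_measurable borel \<Longrightarrow> (\<And>z. 0 \<le> h z \<and> h z \<le> 1) \<Longrightarrow> \<bar>(\<integral>z. h z \<partial>\<nu>) - (\<integral>z. h z \<partial>\<nu>')\<bar> \<le> 2 * osc r x"
    using flattened_law[OF r small, of x] unfolding osc_def by blast
  let ?h = "\<lambda>w. of_bool (k \<le> 1 + in_degree r x u (w ` I \<inter> window x r)) :: real"
  let ?C = "\<lambda>w. w ` I \<inter> window x r" and ?\<kappa> = "uniform_measure lborel (window x r)"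
  let ?E = "{A. finite A \<and> k \<le> 1 + in_degree r x u A}"
  have law: "?C \<in> measurable (\<Pi>\<^sub>M j\<in>I. \<nu>') void_algebra"
    "distr (\<Pi>\<^sub>M j\<in>I. \<nu>') void_algebra ?C = distr (mixed_sample (binomial_pmf n q) ?\<kappa>) void_algebra sample_set"
    using flat_window_law[OF r I(1) \<nu>'(1,2,3), of x q] q I(2) by (simp_all add: q_def v_def)
  have [measurable]: "(\<lambda>A. in_degree r x u A) \<in> measurable void_algebra (count_space UNIV)"
    using measurable_in_degree[of "\<lambda>_. x" void_algebra "\<lambda>_. u" "\<lambda>A. A" r] by simp
  have "{A \<in> space void_algebra. k \<le> 1 + in_degree r x u A} \<in> sets void_algebra" by measurable
  then have E: "?E \<in> sets void_algebra" by simp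
  have hm: "?h \<in> borel_measurable (\<Pi>\<^sub>M j\<in>I. \<nu>')"
    by (rule measurable_compose[OF law(1), of "\<lambda>A. of_bool (k \<le> 1 + in_degree r x u A)"]) measurable
  have cong: "sets (\<Pi>\<^sub>M j\<in>I. \<nu>') = sets (\<Pi>\<^sub>M j\<in>I. \<nu>)" by (intro sets_PiM_cong) (auto simp: \<nu>'(2))
  have "\<bar>(\<integral>w. ?h w \<partial>(\<Pi>\<^sub>M j\<in>I. \<nu>)) - (\<integral>w. ?h w \<partial>(\<Pi>\<^sub>M j\<in>I. \<nu>'))\<bar> \<le> real (card I) * (2 * osc r x)"
  proof (rule product_prob_close[OF prob_space_\<nu> \<nu>'(1) _ I(1)])
    show "?h \<in> borel_measurable (\<Pi>\<^sub>M j\<in>I. \<nu>)" using hm by (simp only: measurable_cong_sets[OF cong refl])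
    fix g :: "'c \<times> real \<Rightarrow> real" assume "g \<in> borel_measurable \<nu>" "\<And>z. 0 \<le> g z \<and> g z \<le> 1"
    then show "\<bar>(\<integral>z. g z \<partial>\<nu>) - (\<integral>z. g z \<partial>\<nu>')\<bar> \<le> 2 * osc r x" by (intro \<nu>'(4)) (simp_all add: measurable_cong_sets[OF sets_\<nu> refl])
  qed (auto simp: \<nu>'(2))
  then have 1: "\<bar>hit k r I x u - (\<integral>w. ?h w \<partial>(\<Pi>\<^sub>M j\<in>I. \<nu>'))\<bar> \<le> n * (2 * osc r x)"
    unfolding hit_window[OF I(1)] I(2) .
  have "(\<integral>w. ?h w \<partial>(\<Pi>\<^sub>M j\<in>I. \<nu>')) = (\<integral>w. indicator (?C -` ?E \<inter> space (\<Pi>\<^sub>M j\<in>I. \<nu>')) w \<partial>(\<Pi>\<^sub>M j\<in>I. \<nu>'))"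
    using I(1) by (intro Bochner_Integration.integral_cong) (auto simp: indicator_def)
  also have "\<dots> = measure (distr (\<Pi>\<^sub>M j\<in>I. \<nu>') void_algebra ?C) ?E"
    using measurable_sets[OF law(1) E] by (subst measure_distr[OF law(1) E]) simp
  also have "\<dots> = measure (distr (mixed_sample (binomial_pmf n q) ?\<kappa>) void_algebra sample_set) ?E" unfolding law(2) ..
  finally have 2: "(\<integral>w. ?h w \<partial>(\<Pi>\<^sub>M j\<in>I. \<nu>')) = measure (distr (mixed_sample (binomial_pmf n q) ?\<kappa>) void_algebra sample_set) ?E" .
  have 3: "measure (distr (mixed_sample (poisson_pmf l) ?\<kappa>) void_algebra sample_set) ?E = local_prob k s u"
    unfolding l_def by (rule mixed_poisson_in_degree[OF r s(1)])
  have \<kappa>: "prob_space ?\<kappa>"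
  proof (rule prob_space_uniform_measure)
    show "emeasure lborel (window x r) \<noteq> 0" unfolding window_props(4)[OF r] using v unfolding v_def by (simp only: ennreal_eq_0_iff not_le)
    show "emeasure lborel (window x r) \<noteq> \<infinity>" unfolding window_props(4)[OF r] by simp
  qed
  have "\<bar>measure (distr (mixed_sample (binomial_pmf n q) ?\<kappa>) void_algebra sample_set) ?E - measure (distr (mixed_sample (poisson_pmf l) ?\<kappa>) void_algebra sample_set) ?E\<bar>
    \<le> (\<Sum>m. \<bar>pmf (binomial_pmf n q) m - pmf (poisson_pmf l) m\<bar>)"
    by (rule mixed_sample_difference[OF \<kappa> _ E]) simp
  also have "\<dots> = binomial_poisson_gap n l"
    unfolding binomial_poisson_gap_def using q l0 I(3) by (simp add: lq)
  finally have "\<bar>(\<integral>w. ?h w \<partial>(\<Pi>\<^sub>M j\<in>I. \<nu>')) - local_prob k s u\<bar> \<le> binomial_poisson_gap n l" unfolding 2 3 .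
  moreover have leq: "f x * (n * (unit_ball_vol DIM('c) * (2 * r) ^ DIM('c))) = l" unfolding lq q_def v_def by simp
  ultimately show ?thesis using 1 unfolding leq by linarith
qed

lemma local_prob_bounds: "0 \<le> local_prob k s u \<and> local_prob k s u \<le> 1"
  by (simp add: local_prob_def)

lemma hit_time_average_close:
  assumes r: "0 < r" and small: "b * (unit_ball_vol DIM('c) * (2 * r) ^ DIM('c)) < 1"
    and I: "finite I" "card I = n" "0 < n" and x: "x \<in> S" and k: "1 \<le> k"
    and s0: "0 < s0" "s0 ^ DIM('c) \<le> r ^ DIM('c) * (a * n)"
  shows "\<bar>(\<integral>u. hit k r I x u \<partial>times_law) - ong_rho N H U k\<bar>
    \<le> n * (2 * osc r x) + max 0 (min 1 (binomial_poisson_gap n (f x * (n * (unit_ball_vol DIM('c) * (2 * r) ^ DIM('c))))))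
      + (ong_rho N H U k - local_rho k s0)" (is "_ \<le> ?o + max 0 (min 1 ?g) + _")
proof -
  interpret T: prob_space times_law by (rule prob_space_times_law)
  have fx: "0 < f x" using f_lower[OF x] a_pos by simp
  define s where "s = root DIM('c) (r ^ DIM('c) * (f x * n))"
  have pos: "0 < r ^ DIM('c) * (f x * n)" using r fx I(3) by simp
  have s: "0 < s" "s ^ DIM('c) = r ^ DIM('c) * (f x * n)"
    unfolding s_def using pos by (simp_all add: real_root_pow_pos)
  have "s0 ^ DIM('c) \<le> s ^ DIM('c)"
    unfolding s(2) using s0(2) f_lower[OF x] r by (intro order_trans[OF s0(2)] mult_left_mono mult_right_mono) auto
  then have "s0 \<le> s" using s(1) s0(1) by (simp add: power_mono_iff)
  then have rho: "local_rho k s0 \<le> local_rho k s" "local_rho k s \<le> ong_rho N H U k"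
    using local_rho_mono[OF s0(1)] local_rho_le[OF k s(1)] by auto
  have hm: "(\<lambda>u. hit k r I x u) \<in> borel_measurable times_law"
  proof -
    have "Pair x \<in> measurable times_law (\<mu> \<Otimes>\<^sub>M times_law)" by (rule measurable_Pair1') simp
    from measurable_compose[OF this hit_measurable[OF I(1), unfolded \<nu>_def]] show ?thesis by simp
  qed
  have i1: "integrable times_law (\<lambda>u. hit k r I x u)"
    using hm hit_bounds by (intro T.integrable_const_bound[where B=1]) auto
  have i2: "integrable times_law (\<lambda>u. local_prob k s u)"
    using local_rho_eq_integral(2)[OF s(1), of k] local_prob_bounds
    by (intro T.integrable_const_bound[where B=1]) (auto simp: measurable_cong_sets[OF sets_times_law refl])
  have o: "0 \<le> ?o" using osc_nonneg by simp
  have pt: "\<bar>hit k r I x u - local_prob k s u\<bar> \<le> ?o + max 0 (min 1 ?g)" for u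
    using hit_local_prob_close[OF r small I x s, of k u] hit_bounds[of k r I x u] local_prob_bounds[of k s u] o by linarith
  have "\<bar>(\<integral>u. hit k r I x u \<partial>times_law) - local_rho k s\<bar> = \<bar>\<integral>u. hit k r I x u - local_prob k s u \<partial>times_law\<bar>"
    using i1 i2 local_rho_eq_integral(1)[OF s(1), of k] by (simp add: times_law_def)
  also have "\<dots> \<le> (\<integral>u. \<bar>hit k r I x u - local_prob k s u\<bar> \<partial>times_law)" by (rule integral_abs_bound)
  also have "\<dots> \<le> ?o + max 0 (min 1 ?g)" using i1 i2 pt by (intro T.integral_le_const) auto
  finally show ?thesis using rho by linarith
qed

lemma osc_nn_integral:
  assumes r: "0 < r" and \<tau>: "0 \<le> \<tau>" "\<And>z. norm z < 2 * r \<Longrightarrow> (\<integral>x. \<bar>f (x + z) - f x\<bar> \<partial>lborel) \<le> \<tau>"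
  shows "(\<integral>\<^sup>+x. ennreal (osc r x) \<partial>\<mu>) \<le> ennreal (b * (\<tau> * (unit_ball_vol DIM('c) * (2 * r) ^ DIM('c))))"
proof -
  let ?B = "ball (0::'c) (2 * r)"
  have o: "ennreal (osc r x) \<le> (\<integral>\<^sup>+z. indicator ?B z * ennreal \<bar>f (x + z) - f x\<bar> \<partial>lborel)" for x
  proof -
    have "ennreal (osc r x) \<le> (\<integral>\<^sup>+z. ennreal (indicator (window x r) z * \<bar>f (fst z) - f x\<bar>) \<partial>lborel)"
    proof -
      have [measurable]: "window x r \<in> sets borel" by (rule window_props(1)[OF r])
      have "osc r x = enn2real (\<integral>\<^sup>+z. ennreal (indicator (window x r) z * \<bar>f (fst z) - f x\<bar>) \<partial>lborel)" (is "_ = enn2real ?y")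
        unfolding osc_def by (rule integral_eq_nn_integral) auto
      moreover have "ennreal (enn2real ?y) \<le> ?y" by (cases ?y rule: ennreal_cases) auto
      ultimately show ?thesis by simp
    qed
    also have "\<dots> = (\<integral>\<^sup>+z. indicator (ball x (2 * r)) (fst z) * ennreal \<bar>f (fst z) - f x\<bar> * indicator {0..1::real} (snd z) \<partial>(lborel \<Otimes>\<^sub>M lborel))"
      unfolding lborel_prod by (intro nn_integral_cong) (auto simp: window_def indicator_def)
    also have "\<dots> = (\<integral>\<^sup>+y. \<integral>\<^sup>+t. indicator (ball x (2 * r)) y * ennreal \<bar>f y - f x\<bar> * indicator {0..1::real} t \<partial>lborel \<partial>lborel)"
    proof (subst lborel.nn_integral_fst[symmetric])
      have [measurable]: "(\<lambda>z. indicator (ball x (2 * r)) (fst z) :: ennreal) \<in> borel_measurable ((lborel :: 'c measure) \<Otimes>\<^sub>M (lborel :: real measure))"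
        "(\<lambda>z. indicator {0..1::real} (snd z) :: ennreal) \<in> borel_measurable ((lborel :: 'c measure) \<Otimes>\<^sub>M lborel)"
        "(\<lambda>z. f (fst z)) \<in> borel_measurable ((lborel :: 'c measure) \<Otimes>\<^sub>M (lborel :: real measure))"
        by (rule measurable_compose[OF measurable_fst borel_measurable_indicator], simp,
            rule measurable_compose[OF measurable_snd borel_measurable_indicator], simp,
            rule measurable_compose[OF measurable_fst], simp)
      show "(\<lambda>z. indicator (ball x (2 * r)) (fst z) * ennreal \<bar>f (fst z) - f x\<bar> * indicator {0..1::real} (snd z)) \<in> borel_measurable (lborel \<Otimes>\<^sub>M lborel)"
        by measurable
    qed simp
    also have "\<dots> = (\<integral>\<^sup>+y. indicator (ball x (2 * r)) y * ennreal \<bar>f y - f x\<bar> \<partial>lborel)"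
      by (intro nn_integral_cong) (simp add: nn_integral_cmult)
    also have "\<dots> = (\<integral>\<^sup>+z. indicator (ball x (2 * r)) (x + z) * ennreal \<bar>f (x + z) - f x\<bar> \<partial>lborel)"
    proof -
      have "(\<lambda>y. indicator (ball x (2 * r)) y * ennreal \<bar>f y - f x\<bar>) \<in> borel_measurable borel"
        by (intro borel_measurable_times_ennreal borel_measurable_indicator) auto
      from nn_integral_lborel_affine[OF zero_less_one this, of x] show ?thesis by simp
    qed
    also have "\<dots> = (\<integral>\<^sup>+z. indicator ?B z * ennreal \<bar>f (x + z) - f x\<bar> \<partial>lborel)"
      by (intro nn_integral_cong) (auto simp: indicator_def dist_norm)
    finally show ?thesis .
  qed
  have jm: "(\<lambda>p. indicator ?B (snd p) * ennreal \<bar>f (fst p + snd p) - f (fst p)\<bar>) \<in> borel_measurable (borel \<Otimes>\<^sub>M borel)"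
  proof -
    have i: "(\<lambda>p. indicator ?B (snd p) :: ennreal) \<in> borel_measurable ((borel :: 'c measure) \<Otimes>\<^sub>M borel)"
      by (rule measurable_compose[OF measurable_snd borel_measurable_indicator]) simp
    show ?thesis by (rule borel_measurable_times_ennreal[OF i]) measurable
  qed
  then have jm': "(\<lambda>p. indicator ?B (snd p) * ennreal \<bar>f (fst p + snd p) - f (fst p)\<bar>) \<in> borel_measurable ((lborel :: 'c measure) \<Otimes>\<^sub>M lborel)"
    by (simp cong: measurable_cong_sets sets_pair_measure_cong)
  have zm: "(\<lambda>x. \<integral>\<^sup>+z. indicator ?B z * ennreal \<bar>f (x + z) - f x\<bar> \<partial>lborel) \<in> borel_measurable lborel"
    using lborel.borel_measurable_nn_integral_fst[OF jm'] by simp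
  have "(\<integral>\<^sup>+x. ennreal (osc r x) \<partial>\<mu>) \<le> (\<integral>\<^sup>+x. (\<integral>\<^sup>+z. indicator ?B z * ennreal \<bar>f (x + z) - f x\<bar> \<partial>lborel) \<partial>\<mu>)"
    by (intro nn_integral_mono o)
  also have "\<dots> = (\<integral>\<^sup>+x. ennreal (f x) * (\<integral>\<^sup>+z. indicator ?B z * ennreal \<bar>f (x + z) - f x\<bar> \<partial>lborel) \<partial>lborel)"
    unfolding \<mu>_def by (rule nn_integral_density) (use zm in auto)
  also have "\<dots> \<le> (\<integral>\<^sup>+x. ennreal b * (\<integral>\<^sup>+z. indicator ?B z * ennreal \<bar>f (x + z) - f x\<bar> \<partial>lborel) \<partial>lborel)"
    by (intro nn_integral_mono mult_right_mono ennreal_leI f_upper) auto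
  also have "\<dots> = ennreal b * (\<integral>\<^sup>+x. \<integral>\<^sup>+z. indicator ?B z * ennreal \<bar>f (x + z) - f x\<bar> \<partial>lborel \<partial>lborel)"
    by (rule nn_integral_cmult[OF zm])
  also have "(\<integral>\<^sup>+x. \<integral>\<^sup>+z. indicator ?B z * ennreal \<bar>f (x + z) - f x\<bar> \<partial>lborel \<partial>lborel)
     = (\<integral>\<^sup>+z. \<integral>\<^sup>+x. indicator ?B z * ennreal \<bar>f (x + z) - f x\<bar> \<partial>lborel \<partial>lborel)"
    using lborel_pair.nn_integral_snd[OF jm'] lborel.nn_integral_fst[OF jm'] by simp
  also have "\<dots> \<le> (\<integral>\<^sup>+z. ennreal \<tau> * indicator ?B z \<partial>lborel)"
  proof (rule nn_integral_mono)
    fix z :: 'c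
    have i: "integrable lborel (\<lambda>x. \<bar>f (x + z) - f x\<bar>)"
      using integrable_translate(1)[OF f_integrable(1), of z] f_integrable(1) by auto
    have "(\<integral>\<^sup>+x. indicator ?B z * ennreal \<bar>f (x + z) - f x\<bar> \<partial>lborel) = indicator ?B z * ennreal (\<integral>x. \<bar>f (x + z) - f x\<bar> \<partial>lborel)"
      using i by (subst nn_integral_cmult) (auto simp: nn_integral_eq_integral)
    also have "\<dots> \<le> ennreal \<tau> * indicator ?B z" using \<tau>(2)[of z] by (auto simp: indicator_def intro: ennreal_leI)
    finally show "(\<integral>\<^sup>+x. indicator ?B z * ennreal \<bar>f (x + z) - f x\<bar> \<partial>lborel) \<le> ennreal \<tau> * indicator ?B z" .
  qed
  also have "\<dots> = ennreal \<tau> * ennreal (unit_ball_vol DIM('c) * (2 * r) ^ DIM('c))"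
    using r by (simp add: nn_integral_cmult_indicator emeasure_ball)
  finally have "(\<integral>\<^sup>+x. ennreal (osc r x) \<partial>\<mu>) \<le> ennreal b * (ennreal \<tau> * ennreal (unit_ball_vol DIM('c) * (2 * r) ^ DIM('c)))"
    by (simp add: mult_left_mono)
  then show ?thesis using b_pos \<tau>(1) by (simp only: ennreal_mult'[symmetric] less_imp_le)
qed

lemma translation_modulus:
  assumes "0 < \<tau>"
  obtains \<delta> where "0 < \<delta>" "\<And>z. norm z < \<delta> \<Longrightarrow> (\<integral>x. \<bar>f (x + z) - f x\<bar> \<partial>lborel) \<le> \<tau>"
proof -
  have "\<forall>u. (\<forall>n. u n \<noteq> 0) \<and> u \<longlonglongrightarrow> 0 \<longrightarrow> (\<lambda>k. \<integral>x. \<bar>f (x + u k) - f x\<bar> \<partial>lborel) \<longlonglongrightarrow> 0"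
    using L1_translation_continuous_integrable[OF f_integrable(1)] unfolding L1_translation_continuous_def by blast
  then have "(\<lambda>z. \<integral>x. \<bar>f (x + z) - f x\<bar> \<partial>lborel) \<midarrow>0\<rightarrow> 0"
    by (rule LIMSEQ_SEQ_conv[THEN iffD1])
  from LIM_D[OF this assms] obtain \<delta> where \<delta>: "0 < \<delta>" "\<And>z. z \<noteq> 0 \<Longrightarrow> norm z < \<delta> \<Longrightarrow> norm (\<integral>x. \<bar>f (x + z) - f x\<bar> \<partial>lborel) < \<tau>"
    by auto
  show thesis
  proof (rule that[OF \<delta>(1)])
    fix z :: 'c assume "norm z < \<delta>"
    then show "(\<integral>x. \<bar>f (x + z) - f x\<bar> \<partial>lborel) \<le> \<tau>" using \<delta>(2)[of z] assms by (cases "z = 0") auto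
  qed
qed

end

context ong_limit begin

lemma osc_measurable: "0 < r \<Longrightarrow> osc r \<in> borel_measurable borel"
proof -
  assume r: "0 < r"
  have i: "(\<lambda>p. indicator (window (fst p) r) (snd p) :: real) \<in> borel_measurable ((borel :: 'c measure) \<Otimes>\<^sub>M (borel :: ('c \<times> real) measure))"
  proof -
    have "(\<lambda>p. indicator (window (fst p) r) (snd p) :: real) = (\<lambda>p. if dist (fst p) (fst (snd p)) < 2 * r \<and> snd (snd p) \<in> {0..1} then 1 else 0)"
      by (auto simp: indicator_def window_def mem_Times_iff)
    also have "\<dots> \<in> borel_measurable ((borel :: 'c measure) \<Otimes>\<^sub>M (borel :: ('c \<times> real) measure))" by measurable
    finally show ?thesis .
  qed
  have "(\<lambda>p. indicator (window (fst p) r) (snd p) * \<bar>f (fst (snd p)) - f (fst p)\<bar>) \<in> borel_measurable ((borel :: 'c measure) \<Otimes>\<^sub>M (borel :: ('c \<times> real) measure))"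
    by (rule borel_measurable_times[OF i]) measurable
  then have "(\<lambda>(x, z). indicator (window x r) z * \<bar>f (fst z) - f x\<bar>) \<in> borel_measurable ((borel :: 'c measure) \<Otimes>\<^sub>M (lborel :: ('c \<times> real) measure))"
    by (simp add: case_prod_unfold cong: measurable_cong_sets sets_pair_measure_cong)
  from lborel.borel_measurable_lebesgue_integral[OF this] show ?thesis by (simp add: osc_def[abs_def])
qed

lemma gap_measurable: "(\<lambda>x. max 0 (min 1 (binomial_poisson_gap n (f x * C)))) \<in> borel_measurable borel"
  unfolding binomial_poisson_gap_def by measurable

lemma gap_integral_tendsto:
  assumes C: "0 \<le> C"
  shows "(\<lambda>n. \<integral>x. max 0 (min 1 (binomial_poisson_gap n (f x * C))) \<partial>\<mu>) \<longlonglongrightarrow> 0"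
proof -
  have "(\<lambda>n. \<integral>x. max 0 (min 1 (binomial_poisson_gap n (f x * C))) \<partial>\<mu>) \<longlonglongrightarrow> (\<integral>x. 0 \<partial>\<mu>)"
  proof (rule integral_dominated_convergence[where w="\<lambda>_. 1"])
    show "AE x in \<mu>. (\<lambda>n. max 0 (min 1 (binomial_poisson_gap n (f x * C)))) \<longlonglongrightarrow> 0"
    proof (rule AE_I2)
      fix x
      have "0 \<le> f x * C" using C f_nonneg[of x] by simp
      from binomial_poisson_weights_tendsto[OF this]
      have "(\<lambda>n. binomial_poisson_gap n (f x * C)) \<longlonglongrightarrow> 0" unfolding binomial_poisson_gap_def .
      from tendsto_max[OF tendsto_const[of 0] tendsto_min[OF tendsto_const[of 1] this]]
      show "(\<lambda>n. max 0 (min 1 (binomial_poisson_gap n (f x * C)))) \<longlonglongrightarrow> 0" by simp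
    qed
    show "(\<lambda>x. max 0 (min 1 (binomial_poisson_gap n (f x * C)))) \<in> borel_measurable \<mu>" for n
      using gap_measurable[of n C] by (simp only: measurable_cong_sets[OF sets_\<mu> refl])
  qed auto
  then show ?thesis by simp
qed

lemma hit_mean_close:
  assumes r: "0 < r" and small: "b * (unit_ball_vol DIM('c) * (2 * r) ^ DIM('c)) < 1"
    and I: "finite I" "card I = n" "0 < n" and k: "1 \<le> k"
    and s0: "0 < s0" "s0 ^ DIM('c) \<le> r ^ DIM('c) * (a * n)"
    and \<tau>: "0 \<le> \<tau>" "\<And>z. norm z < 2 * r \<Longrightarrow> (\<integral>x. \<bar>f (x + z) - f x\<bar> \<partial>lborel) \<le> \<tau>"
    and C: "C = n * (unit_ball_vol DIM('c) * (2 * r) ^ DIM('c))"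
  shows "\<bar>(\<integral>z. hit k r I (fst z) (snd z) \<partial>\<nu>) - ong_rho N H U k\<bar>
    \<le> 2 * b * \<tau> * C + (\<integral>x. max 0 (min 1 (binomial_poisson_gap n (f x * C))) \<partial>\<mu>) + (ong_rho N H U k - local_rho k s0)"
proof -
  interpret T: prob_space times_law by (rule prob_space_times_law)
  interpret MT: pair_prob_space \<mu> times_law ..
  define h where "h x = (\<integral>u. hit k r I x u \<partial>times_law)" for x
  define G where "G x = max 0 (min 1 (binomial_poisson_gap n (f x * C)))" for x
  let ?\<rho> = "ong_rho N H U k"
  have hm: "(\<lambda>(x, u). hit k r I x u) \<in> borel_measurable (\<mu> \<Otimes>\<^sub>M times_law)"
    using hit_measurable[OF I(1), of k r] unfolding \<nu>_def by (simp add: case_prod_unfold)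
  have hi: "integrable (\<mu> \<Otimes>\<^sub>M times_law) (\<lambda>(x, u). hit k r I x u)"
    using hm hit_bounds by (intro MT.integrable_const_bound[where B=1]) (auto simp: case_prod_unfold)
  have e: "(\<integral>z. hit k r I (fst z) (snd z) \<partial>\<nu>) = (\<integral>x. h x \<partial>\<mu>)"
    using MT.integral_fst[OF hi] unfolding h_def \<nu>_def by (simp add: case_prod_unfold)
  have h_m: "h \<in> borel_measurable \<mu>" unfolding h_def using hm by (rule T.borel_measurable_lebesgue_integral)
  have h01: "0 \<le> h x \<and> h x \<le> 1" for x unfolding h_def using hit_bounds by (intro T.integral_unit_interval)
  have hint: "integrable \<mu> h" using h_m h01 by (intro \<mu>.integrable_const_bound[where B=1]) auto
  have Gm: "G \<in> borel_measurable \<mu>"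
    unfolding G_def using gap_measurable[of n C] by (simp only: measurable_cong_sets[OF sets_\<mu> refl])
  have Gi: "integrable \<mu> G" using Gm by (intro \<mu>.integrable_const_bound[where B=1]) (auto simp: G_def)
  have eps: "0 \<le> ?\<rho> - local_rho k s0" using local_rho_le[OF k s0(1)] by simp
  have om: "(\<lambda>x. ennreal (osc r x)) \<in> borel_measurable \<mu>"
    using osc_measurable[OF r] by (simp add: measurable_cong_sets[OF sets_\<mu> refl])
  have "\<bar>(\<integral>x. h x \<partial>\<mu>) - ?\<rho>\<bar> = \<bar>\<integral>x. h x - ?\<rho> \<partial>\<mu>\<bar>" using hint by (simp add: \<mu>.prob_space[simplified])
  also have "\<dots> \<le> (\<integral>x. \<bar>h x - ?\<rho>\<bar> \<partial>\<mu>)" by (rule integral_abs_bound)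
  finally have 1: "\<bar>(\<integral>x. h x \<partial>\<mu>) - ?\<rho>\<bar> \<le> (\<integral>x. \<bar>h x - ?\<rho>\<bar> \<partial>\<mu>)" .
  have "ennreal (\<integral>x. \<bar>h x - ?\<rho>\<bar> \<partial>\<mu>) = (\<integral>\<^sup>+x. ennreal \<bar>h x - ?\<rho>\<bar> \<partial>\<mu>)"
    using hint by (intro nn_integral_eq_integral[symmetric]) auto
  also have "\<dots> \<le> (\<integral>\<^sup>+x. ennreal (2 * real n) * ennreal (osc r x) + (ennreal (G x) + ennreal (?\<rho> - local_rho k s0)) \<partial>\<mu>)"
  proof (rule nn_integral_mono_AE)
    show "AE x in \<mu>. ennreal \<bar>h x - ?\<rho>\<bar> \<le> ennreal (2 * real n) * ennreal (osc r x) + (ennreal (G x) + ennreal (?\<rho> - local_rho k s0))"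
      using AE_\<mu>_S
    proof eventually_elim
      case (elim x)
      have "\<bar>h x - ?\<rho>\<bar> \<le> 2 * real n * osc r x + (G x + (?\<rho> - local_rho k s0))"
        using hit_time_average_close[OF r small I elim k s0] unfolding h_def G_def C by (simp add: algebra_simps)
      then have "ennreal \<bar>h x - ?\<rho>\<bar> \<le> ennreal (2 * real n * osc r x + (G x + (?\<rho> - local_rho k s0)))" by (rule ennreal_leI)
      also have "\<dots> = ennreal (2 * real n) * ennreal (osc r x) + (ennreal (G x) + ennreal (?\<rho> - local_rho k s0))"
        using osc_nonneg[of r x] eps by (simp add: ennreal_plus ennreal_mult' G_def)
      finally show ?case .
    qed
  qed
  also have "\<dots> = ennreal (2 * real n) * (\<integral>\<^sup>+x. ennreal (osc r x) \<partial>\<mu>) + ((\<integral>\<^sup>+x. ennreal (G x) \<partial>\<mu>) + ennreal (?\<rho> - local_rho k s0))"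
    using om Gm \<mu>.emeasure_space_1 by (simp add: nn_integral_add nn_integral_cmult)
  also have "(\<integral>\<^sup>+x. ennreal (G x) \<partial>\<mu>) = ennreal (\<integral>x. G x \<partial>\<mu>)"
    by (rule nn_integral_eq_integral[OF Gi]) (auto simp: G_def)
  also have "ennreal (2 * real n) * (\<integral>\<^sup>+x. ennreal (osc r x) \<partial>\<mu>) \<le> ennreal (2 * real n) * ennreal (b * (\<tau> * (unit_ball_vol DIM('c) * (2 * r) ^ DIM('c))))"
    by (intro mult_left_mono osc_nn_integral[OF r \<tau>]) auto
  also have "\<dots> = ennreal (2 * b * \<tau> * C)" unfolding C
    by (subst ennreal_mult'[symmetric]) (auto simp: algebra_simps)
  finally have "ennreal (\<integral>x. \<bar>h x - ?\<rho>\<bar> \<partial>\<mu>) \<le> ennreal (2 * b * \<tau> * C) + (ennreal (\<integral>x. G x \<partial>\<mu>) + ennreal (?\<rho> - local_rho k s0))"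
    by (simp add: add_right_mono)
  also have "\<dots> = ennreal (2 * b * \<tau> * C + ((\<integral>x. G x \<partial>\<mu>) + (?\<rho> - local_rho k s0)))"
  proof -
    have "0 \<le> 2 * b * \<tau> * C" using b_pos \<tau>(1) r unfolding C by (intro mult_nonneg_nonneg) auto
    moreover have "0 \<le> (\<integral>x. G x \<partial>\<mu>)" by (intro integral_nonneg_AE) (auto simp: G_def)
    ultimately show ?thesis using eps by (simp add: ennreal_plus)
  qed
  finally have "(\<integral>x. \<bar>h x - ?\<rho>\<bar> \<partial>\<mu>) \<le> 2 * b * \<tau> * C + ((\<integral>x. G x \<partial>\<mu>) + (?\<rho> - local_rho k s0))"
  proof (subst (asm) ennreal_le_iff)
    have "0 \<le> 2 * b * \<tau> * C" using b_pos \<tau>(1) r unfolding C by (intro mult_nonneg_nonneg) auto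
    moreover have "0 \<le> (\<integral>x. G x \<partial>\<mu>)" by (intro integral_nonneg_AE) (auto simp: G_def)
    ultimately show "0 \<le> 2 * b * \<tau> * C + ((\<integral>x. G x \<partial>\<mu>) + (?\<rho> - local_rho k s0))" using eps by simp
  qed
  then show ?thesis using 1 unfolding e G_def by linarith
qed

definition local_radius :: "real \<Rightarrow> nat \<Rightarrow> real" where "local_radius L n = root DIM('c) (L / n)"

definition sample_count :: "nat \<Rightarrow> real \<Rightarrow> nat \<Rightarrow> (nat \<Rightarrow> 'c) \<Rightarrow> real" where
  "sample_count k L n w = real (count_degree k (local_radius L n) {0..n} (\<lambda>l. (w l, real l)))"

lemma local_radius: "0 < L \<Longrightarrow> 0 < n \<Longrightarrow> 0 < local_radius L n" "0 < L \<Longrightarrow> 0 < n \<Longrightarrow> local_radius L n ^ DIM('c) = L / n"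
  unfolding local_radius_def by (simp_all add: real_root_pow_pos)

lemma local_radius_tendsto: "(\<lambda>n. local_radius L n) \<longlonglongrightarrow> 0"
proof -
  have "(\<lambda>n. L / real n) \<longlonglongrightarrow> 0" by real_asymp
  from tendsto_real_root[OF this, of "DIM('c)"] show ?thesis unfolding local_radius_def by simp
qed

text \<open>The relevant Poisson radius at \<open>x\<close> is \<open>root d (L f(x))\<close>, which depends
  on \<open>x\<close>. As \<open>local_rho\<close> is monotone and \<open>f \<ge> a\<close> on
  \<open>S\<close>, it lies between the value at \<open>root d (L a)\<close> and
  \<open>ong_rho\<close>; the gap between these is the error that remains for fixed
  \<open>L\<close>.\<close>

theorem sample_count_mean:
  assumes L: "0 < L" and k: "1 \<le> k" and e: "0 < e"
  defines "s0 \<equiv> root DIM('c) (L * a)"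
  shows "eventually (\<lambda>n. \<bar>(\<integral>w. sample_count k L n w \<partial>(\<Pi>\<^sub>M j\<in>{0..n}. \<mu>)) / (real n + 1) - ong_rho N H U k\<bar>
    \<le> (ong_rho N H U k - local_rho k s0) + e) sequentially"
proof -
  define v where "v = unit_ball_vol DIM('c) * 2 ^ DIM('c) * L"
  have vp: "0 < v" using L unfolding v_def by simp
  have s0: "0 < s0" "s0 ^ DIM('c) = L * a" using L a_pos unfolding s0_def by (simp_all add: real_root_pow_pos)
  define \<tau> where "\<tau> = e / (4 * b * v)"
  have \<tau>: "0 < \<tau>" "2 * b * \<tau> * v = e / 2" using e b_pos vp by (auto simp: \<tau>_def)
  obtain \<delta> where \<delta>: "0 < \<delta>" "\<And>z. norm z < \<delta> \<Longrightarrow> (\<integral>x. \<bar>f (x + z) - f x\<bar> \<partial>lborel) \<le> \<tau>"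
    using translation_modulus[OF \<tau>(1)] by blast
  have "(\<lambda>n. 2 * local_radius L n) \<longlonglongrightarrow> 2 * 0" by (intro tendsto_mult tendsto_const local_radius_tendsto)
  then have ev1: "eventually (\<lambda>n. 2 * local_radius L n < \<delta>) sequentially" using \<delta>(1) by (intro order_tendstoD(2)) auto
  have "(\<lambda>n. b * (v / real n)) \<longlonglongrightarrow> 0" by real_asymp
  then have ev2: "eventually (\<lambda>n. b * (v / real n) < 1) sequentially" by (rule order_tendstoD(2)) simp
  have ev3: "eventually (\<lambda>n. (\<integral>x. max 0 (min 1 (binomial_poisson_gap n (f x * v))) \<partial>\<mu>) < e / 2) sequentially"
    using gap_integral_tendsto[of v] vp e by (intro order_tendstoD(2)) auto
  show ?thesis using ev1 ev2 ev3 eventually_gt_at_top[of 0]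
  proof eventually_elim
    case (elim n)
    let ?r = "local_radius L n" and ?J = "{0..n}" and ?\<rho> = "ong_rho N H U k"
    have r: "0 < ?r" "?r ^ DIM('c) = L / n" using local_radius L elim(4) by auto
    have vol: "unit_ball_vol DIM('c) * (2 * ?r) ^ DIM('c) = v / n" by (simp add: power_mult_distrib r(2) v_def)
    have each: "\<bar>(\<integral>z. hit k ?r (?J - {j}) (fst z) (snd z) \<partial>\<nu>) - ?\<rho>\<bar> \<le> (?\<rho> - local_rho k s0) + e" if "j \<in> ?J" for j
    proof -
      have "\<bar>(\<integral>z. hit k ?r (?J - {j}) (fst z) (snd z) \<partial>\<nu>) - ?\<rho>\<bar>
        \<le> 2 * b * \<tau> * v + (\<integral>x. max 0 (min 1 (binomial_poisson_gap n (f x * v))) \<partial>\<mu>) + (?\<rho> - local_rho k s0)"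
      proof (rule hit_mean_close[OF r(1) _ _ _ elim(4) k s0(1)])
        show "b * (unit_ball_vol DIM('c) * (2 * ?r) ^ DIM('c)) < 1" unfolding vol by (rule elim(2))
        show "card (?J - {j}) = n" using that by simp
        show "s0 ^ DIM('c) \<le> ?r ^ DIM('c) * (a * n)" unfolding s0(2) r(2) using elim(4) by simp
        show "v = n * (unit_ball_vol DIM('c) * (2 * ?r) ^ DIM('c))" unfolding vol using elim(4) by simp
        show "(\<integral>x. \<bar>f (x + z) - f x\<bar> \<partial>lborel) \<le> \<tau>" if "norm z < 2 * ?r" for z
          using \<delta>(2)[of z] that elim(1) by simp
      qed (use \<tau> in auto)
      then show ?thesis using elim(3) \<tau>(2) by linarith
    qed
    have "(\<integral>w. sample_count k L n w \<partial>(\<Pi>\<^sub>M j\<in>?J. \<mu>)) = (\<Sum>j\<in>?J. \<integral>z. hit k ?r (?J - {j}) (fst z) (snd z) \<partial>\<nu>)"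
      unfolding sample_count_def random_times_exchange[OF refl] \<nu>_def[symmetric] by (rule expected_count_degree) simp
    then have "(\<integral>w. sample_count k L n w \<partial>(\<Pi>\<^sub>M j\<in>?J. \<mu>)) - (real n + 1) * ?\<rho> = (\<Sum>j\<in>?J. (\<integral>z. hit k ?r (?J - {j}) (fst z) (snd z) \<partial>\<nu>) - ?\<rho>)"
      by (simp add: sum_subtractf algebra_simps)
    also have "\<bar>\<dots>\<bar> \<le> (\<Sum>j\<in>?J. (?\<rho> - local_rho k s0) + e)"
      by (rule order_trans[OF sum_abs]) (rule sum_mono, rule each)
    finally have "\<bar>(\<integral>w. sample_count k L n w \<partial>(\<Pi>\<^sub>M j\<in>?J. \<mu>)) - (real n + 1) * ?\<rho>\<bar> \<le> (real n + 1) * ((?\<rho> - local_rho k s0) + e)"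
      by (simp add: algebra_simps)
    moreover have "(\<integral>w. sample_count k L n w \<partial>(\<Pi>\<^sub>M j\<in>?J. \<mu>)) - (real n + 1) * ?\<rho>
       = (real n + 1) * ((\<integral>w. sample_count k L n w \<partial>(\<Pi>\<^sub>M j\<in>?J. \<mu>)) / (real n + 1) - ?\<rho>)"
      by (simp add: right_diff_distrib)
    ultimately have "(real n + 1) * \<bar>(\<integral>w. sample_count k L n w \<partial>(\<Pi>\<^sub>M j\<in>?J. \<mu>)) / (real n + 1) - ?\<rho>\<bar>
       \<le> (real n + 1) * ((?\<rho> - local_rho k s0) + e)" by (simp add: abs_mult)
    then show ?case by (rule mult_left_le_imp_le) simp
  qed
qed

text \<open>The variance is of order \<open>n\<close>, so after division by \<open>n\<close> the count is
  concentrated at its mean.\<close>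

theorem sample_count_L1:
  assumes L: "0 < L" and k: "1 \<le> k" and e: "0 < e"
  defines "s0 \<equiv> root DIM('c) (L * a)"
  shows "eventually (\<lambda>n. (\<integral>w. \<bar>sample_count k L n w / (real n + 1) - ong_rho N H U k\<bar> \<partial>(\<Pi>\<^sub>M j\<in>{0..n}. \<mu>))
    \<le> (ong_rho N H U k - local_rho k s0) + e) sequentially"
proof -
  define K where "K = 4 * exp (b * (unit_ball_vol DIM('c) * 2 ^ DIM('c) * L))"
  have "(\<lambda>n. (K + 1) / sqrt (real n + 1)) \<longlonglongrightarrow> 0" by real_asymp
  then have ev: "eventually (\<lambda>n. (K + 1) / sqrt (real n + 1) < e / 2) sequentially" using e by (intro order_tendstoD(2)) auto
  show ?thesis
    using ev sample_count_mean[OF L k half_gt_zero[OF e]] eventually_gt_at_top[of 0]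
  proof eventually_elim
    case (elim n)
    let ?P = "\<Pi>\<^sub>M j\<in>{0..n}. \<mu>" and ?r = "local_radius L n" and ?\<rho> = "ong_rho N H U k"
    interpret P: prob_space ?P by (rule prob_space_PiM_\<mu>)
    define V where "V = sample_count k L n"
    define m where "m = (\<integral>w. V w \<partial>?P)"
    define q where "q = sqrt (real n + 1)"
    have q: "0 < q" "q\<^sup>2 = real n + 1" by (auto simp: q_def)
    have r: "0 < ?r" "?r ^ DIM('c) = L / n" using local_radius L elim(3) by auto
    have Vm: "V \<in> borel_measurable ?P"
      unfolding V_def sample_count_def using index_points_measurable by (intro measurable_count_degree) auto
    have Vb: "\<bar>V w\<bar> \<le> real n + 1" for w
      using count_degree_le[of "{0..n}" k ?r "\<lambda>l. (w l, real l)"] by (simp add: V_def sample_count_def)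
    have Vi: "integrable ?P V" using Vm Vb by (intro P.integrable_const_bound[where B="real n + 1"]) auto
    have V2: "integrable ?P (\<lambda>w. (V w - m)\<^sup>2)"
    proof (rule P.integrable_const_bound[where B="(real n + 1 + \<bar>m\<bar>)\<^sup>2"])
      have "\<bar>V w - m\<bar> \<le> real n + 1 + \<bar>m\<bar>" for w using Vb[of w] by linarith
      then show "AE w in ?P. norm ((V w - m)\<^sup>2) \<le> (real n + 1 + \<bar>m\<bar>)\<^sup>2"
        using power_mono[of "\<bar>V _ - m\<bar>" "real n + 1 + \<bar>m\<bar>" 2] by (intro AE_I2) simp
    qed (use Vm in measurable)
    have var: "(\<integral>w. (V w - m)\<^sup>2 \<partial>?P) \<le> (real n + 1) * K"
    proof -
      have eq: "real n * (b * unit_ball_vol DIM('c) * (2 * ?r) ^ DIM('c)) = b * (unit_ball_vol DIM('c) * 2 ^ DIM('c) * L)"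
        using elim(3) by (simp add: power_mult_distrib r(2))
      then show ?thesis
        using count_degree_variance[OF r(1) refl, of n k] unfolding m_def V_def sample_count_def K_def eq by blast
    qed
    have "\<bar>V w - m\<bar> \<le> (V w - m)\<^sup>2 / (2 * q) + q / 2" for w
    proof -
      have "0 \<le> (\<bar>V w - m\<bar> - q)\<^sup>2" by simp
      then have "2 * q * \<bar>V w - m\<bar> \<le> (V w - m)\<^sup>2 + q\<^sup>2" by (simp add: power2_diff mult_ac)
      then show ?thesis using q(1) by (simp add: field_simps power2_eq_square)
    qed
    then have "(\<integral>w. \<bar>V w - m\<bar> \<partial>?P) \<le> (\<integral>w. (V w - m)\<^sup>2 / (2 * q) + q / 2 \<partial>?P)"
      using Vi V2 by (intro integral_mono) auto
    also have "\<dots> = (\<integral>w. (V w - m)\<^sup>2 \<partial>?P) / (2 * q) + q / 2" using V2 by (simp add: P.prob_space)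
    also have "\<dots> \<le> (real n + 1) * K / (2 * q) + q / 2" using var q(1) by (intro add_right_mono divide_right_mono) auto
    also have "\<dots> \<le> (real n + 1) * ((K + 1) / q)"
    proof -
      define Z where "Z = (real n + 1) * ((K + 1) / q)"
      have eq: "(real n + 1) * K / (2 * q) + q / 2 = Z / 2" using q by (simp add: Z_def field_simps power2_eq_square)
      have "0 \<le> Z" using q(1) by (simp add: Z_def K_def)
      then have "Z / 2 \<le> Z" by simp
      then show ?thesis unfolding eq Z_def .
    qed
    finally have dev: "(\<integral>w. \<bar>V w - m\<bar> \<partial>?P) \<le> (real n + 1) * (e / 2)"
      using elim(1) by (smt (verit) mult_left_mono of_nat_0_le_iff q_def)
    have mean: "\<bar>m / (real n + 1) - ?\<rho>\<bar> \<le> (?\<rho> - local_rho k s0) + e / 2"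
      using elim(2) unfolding m_def V_def s0_def .
    have "(\<integral>w. \<bar>V w / (real n + 1) - ?\<rho>\<bar> \<partial>?P) \<le> (\<integral>w. \<bar>V w - m\<bar> / (real n + 1) + \<bar>m / (real n + 1) - ?\<rho>\<bar> \<partial>?P)"
    proof (rule integral_mono)
      fix w
      have "V w / (real n + 1) - ?\<rho> = (V w - m) / (real n + 1) + (m / (real n + 1) - ?\<rho>)" by (simp add: diff_divide_distrib)
      also have "\<bar>\<dots>\<bar> \<le> \<bar>(V w - m) / (real n + 1)\<bar> + \<bar>m / (real n + 1) - ?\<rho>\<bar>" by (rule abs_triangle_ineq)
      finally show "\<bar>V w / (real n + 1) - ?\<rho>\<bar> \<le> \<bar>V w - m\<bar> / (real n + 1) + \<bar>m / (real n + 1) - ?\<rho>\<bar>" by simp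
    qed (use Vi in auto)
    also have "\<dots> = (\<integral>w. \<bar>V w - m\<bar> \<partial>?P) / (real n + 1) + \<bar>m / (real n + 1) - ?\<rho>\<bar>" using Vi by (simp add: P.prob_space)
    also have "\<dots> \<le> e / 2 + ((?\<rho> - local_rho k s0) + e / 2)"
      using dev mean by (intro add_mono) (simp_all add: field_simps)
    finally show ?case unfolding V_def by simp
  qed
qed

end

locale iid_sample = bounded_density f S a b + prob_space M
  for f :: "'c::euclidean_space \<Rightarrow> real" and S a b and M :: "'a measure" +
  fixes X :: "nat \<Rightarrow> 'a \<Rightarrow> 'c"
  assumes X_indep: "indep_vars (\<lambda>_. borel) X UNIV" and X_law: "\<And>n. distr M borel (X n) = \<mu>"
begin

lemma X_meas [measurable]: "X n \<in> borel_measurable M"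
  using X_indep by (auto simp: indep_vars_def2)

lemma restrict_X_meas: "(\<lambda>\<omega>. \<lambda>i\<in>J. X i \<omega>) \<in> measurable M (\<Pi>\<^sub>M j\<in>J. \<mu>)"
  by (intro measurable_restrict) (simp add: measurable_cong_sets[OF refl sets_\<mu>])

lemma joint_law:
  assumes "J \<noteq> {}"
  shows "distr M (\<Pi>\<^sub>M j\<in>J. \<mu>) (\<lambda>\<omega>. \<lambda>i\<in>J. X i \<omega>) = (\<Pi>\<^sub>M j\<in>J. \<mu>)"
proof -
  have "indep_vars (\<lambda>_. borel) X J" by (rule indep_vars_subset[OF X_indep]) auto
  then have "distr M (\<Pi>\<^sub>M j\<in>J. borel) (\<lambda>\<omega>. \<lambda>i\<in>J. X i \<omega>) = (\<Pi>\<^sub>M j\<in>J. \<mu>)"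
    using indep_vars_iff_distr_eq_PiM[OF assms, where M'="\<lambda>_. borel" and X=X] by (simp add: X_law)
  moreover have "distr M (\<Pi>\<^sub>M j\<in>J. \<mu>) (\<lambda>\<omega>. \<lambda>i\<in>J. X i \<omega>) = distr M (\<Pi>\<^sub>M j\<in>J. borel) (\<lambda>\<omega>. \<lambda>i\<in>J. X i \<omega>)"
    by (intro distr_cong refl sets_PiM_cong) auto
  ultimately show ?thesis by simp
qed

lemma nn_integral_sample:
  assumes "J \<noteq> {}" "h \<in> borel_measurable (\<Pi>\<^sub>M j\<in>J. \<mu>)"
  shows "(\<integral>\<^sup>+\<omega>. h (\<lambda>i\<in>J. X i \<omega>) \<partial>M) = (\<integral>\<^sup>+w. h w \<partial>(\<Pi>\<^sub>M j\<in>J. \<mu>))"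
proof -
  have "(\<integral>\<^sup>+w. h w \<partial>(\<Pi>\<^sub>M j\<in>J. \<mu>)) = (\<integral>\<^sup>+w. h w \<partial>distr M (\<Pi>\<^sub>M j\<in>J. \<mu>) (\<lambda>\<omega>. \<lambda>i\<in>J. X i \<omega>))"
    unfolding joint_law[OF assms(1)] ..
  also have "\<dots> = (\<integral>\<^sup>+\<omega>. h (\<lambda>i\<in>J. X i \<omega>) \<partial>M)"
    by (rule nn_integral_distr[OF restrict_X_meas]) (use assms(2) in simp)
  finally show ?thesis ..
qed

lemma component_\<mu>_measurable: "j \<in> J \<Longrightarrow> (\<lambda>w. w j) \<in> borel_measurable (\<Pi>\<^sub>M j\<in>J. \<mu>)"
  using measurable_component_singleton[of j J "\<lambda>_. \<mu>"] by (simp add: measurable_cong_sets[OF refl sets_\<mu>])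

text \<open>Given the last point, the others fall independently into the ball around it.\<close>

lemma isolated_prob:
  assumes r: "0 < r" "r \<le> 1"
    and c: "0 < c" "c \<le> 1" "\<And>x. x \<in> S \<Longrightarrow> c * r ^ DIM('c) \<le> measure \<mu> {y. 0 < dist y x \<and> dist y x < r}"
  shows "measure M {\<omega> \<in> space M. \<forall>j<n. \<not> (0 < dist (X j \<omega>) (X n \<omega>) \<and> dist (X j \<omega>) (X n \<omega>) < r)} \<le> exp (- c * r ^ DIM('c) * n)"
proof -
  let ?J = "insert n {..<n}"
  let ?E = "{w \<in> space (\<Pi>\<^sub>M j\<in>?J. \<mu>). \<forall>j\<in>{..<n}. \<not> (0 < dist (w j) (w n) \<and> dist (w j) (w n) < r)}"
  have E: "?E \<in> sets (\<Pi>\<^sub>M j\<in>?J. \<mu>)"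
  proof (rule sets.sets_Collect_finite_All)
    fix j assume "j \<in> {..<n}"
    then have dm: "(\<lambda>w. dist (w j) (w n)) \<in> borel_measurable (\<Pi>\<^sub>M j\<in>?J. \<mu>)" by (intro borel_measurable_dist component_\<mu>_measurable) auto
    show "{w \<in> space (\<Pi>\<^sub>M j\<in>?J. \<mu>). \<not> (0 < dist (w j) (w n) \<and> dist (w j) (w n) < r)} \<in> sets (\<Pi>\<^sub>M j\<in>?J. \<mu>)"
      using measurable_sets[OF dm, of "- {0<..<r}"]
      by (rule back_subst[of "\<lambda>X. X \<in> sets (\<Pi>\<^sub>M j\<in>?J. \<mu>)"]) auto
  qed simp
  have "emeasure (\<Pi>\<^sub>M j\<in>?J. \<mu>) ?E \<le> ennreal (exp (- c * r ^ DIM('c) * card {..<n}))"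
    by (rule isolated_prob_le[OF _ _ r c]) auto
  also have "emeasure (\<Pi>\<^sub>M j\<in>?J. \<mu>) ?E = emeasure (distr M (\<Pi>\<^sub>M j\<in>?J. \<mu>) (\<lambda>\<omega>. \<lambda>i\<in>?J. X i \<omega>)) ?E"
    by (subst joint_law) auto
  also have "\<dots> = emeasure M ((\<lambda>\<omega>. \<lambda>i\<in>?J. X i \<omega>) -` ?E \<inter> space M)" by (rule emeasure_distr[OF restrict_X_meas E])
  also have "(\<lambda>\<omega>. \<lambda>i\<in>?J. X i \<omega>) -` ?E \<inter> space M = {\<omega> \<in> space M. \<forall>j<n. \<not> (0 < dist (X j \<omega>) (X n \<omega>) \<and> dist (X j \<omega>) (X n \<omega>) < r)}"
    by (auto simp: space_PiM)
  finally show ?thesis by (simp add: emeasure_eq_measure)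
qed

text \<open>Markov inequality for \<open>2\<close> to the power of the count.\<close>

lemma many_close_prob:
  assumes r: "\<And>i. 0 \<le> r i"
  shows "measure M {\<omega> \<in> space M. k \<le> card {i \<in> {j<..n}. dist (X j \<omega>) (X i \<omega>) \<le> r i}}
    \<le> exp (\<Sum>i\<in>{j<..n}. b * unit_ball_vol DIM('c) * r i ^ DIM('c)) / 2 ^ k"
proof -
  let ?I = "{j<..n}" and ?J = "insert j {j<..n}"
  let ?N = "\<lambda>w. card {i \<in> ?I. dist (w j) (w i) \<le> r i}"
  have N: "(\<lambda>w. ennreal (2 ^ ?N w)) \<in> borel_measurable (\<Pi>\<^sub>M j\<in>?J. \<mu>)"
  proof -
    have "(\<lambda>w. ennreal (2 ^ ?N w)) = (\<lambda>w. \<Prod>i\<in>?I. if dist (w j) (w i) \<le> r i then 2 else 1)"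
      by (simp add: prod.If_cases Int_def ennreal_power[symmetric])
    also have "\<dots> \<in> borel_measurable (\<Pi>\<^sub>M j\<in>?J. \<mu>)"
    proof (rule borel_measurable_prod_ennreal)
      fix i assume "i \<in> ?I"
      then have [measurable]: "(\<lambda>w. dist (w j) (w i)) \<in> borel_measurable (\<Pi>\<^sub>M j\<in>?J. \<mu>)" by (intro borel_measurable_dist component_\<mu>_measurable) auto
      show "(\<lambda>w. if dist (w j) (w i) \<le> r i then 2 else 1 :: ennreal) \<in> borel_measurable (\<Pi>\<^sub>M j\<in>?J. \<mu>)" by measurable
    qed
    finally show ?thesis .
  qed
  define h where "h w = ennreal (2 ^ ?N w)" for w :: "nat \<Rightarrow> 'c"
  have hN: "h \<in> borel_measurable (\<Pi>\<^sub>M j\<in>?J. \<mu>)" using N unfolding h_def .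
  define g where "g \<omega> = h (\<lambda>i\<in>?J. X i \<omega>)" for \<omega>
  have gm: "g \<in> borel_measurable M" unfolding g_def by (rule measurable_compose[OF restrict_X_meas hN])
  have g: "g \<omega> = ennreal (2 ^ card {i \<in> ?I. dist (X j \<omega>) (X i \<omega>) \<le> r i})" for \<omega>
  proof -
    have "{i \<in> ?I. dist ((\<lambda>i\<in>?J. X i \<omega>) j) ((\<lambda>i\<in>?J. X i \<omega>) i) \<le> r i} = {i \<in> ?I. dist (X j \<omega>) (X i \<omega>) \<le> r i}" by auto
    then show ?thesis unfolding g_def h_def by (simp only:)
  qed
  let ?A = "{\<omega> \<in> space M. k \<le> card {i \<in> ?I. dist (X j \<omega>) (X i \<omega>) \<le> r i}}"
  have "?A = {\<omega> \<in> space M. ennreal (2 ^ k) \<le> g \<omega>}"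
    unfolding g by (simp add: power_increasing_iff)
  moreover have "{\<omega> \<in> space M. ennreal (2 ^ k) \<le> g \<omega>} \<in> sets M" using gm by measurable
  ultimately have "emeasure M ?A = (\<integral>\<^sup>+\<omega>. indicator ?A \<omega> \<partial>M)" by (simp only: nn_integral_indicator)
  also have "\<dots> \<le> (\<integral>\<^sup>+\<omega>. g \<omega> * ennreal (1 / 2 ^ k) \<partial>M)"
  proof (rule nn_integral_mono)
    fix \<omega>
    let ?n = "card {i \<in> ?I. dist (X j \<omega>) (X i \<omega>) \<le> r i}"
    have eq: "g \<omega> * ennreal (1 / 2 ^ k) = ennreal (2 ^ ?n / 2 ^ k)" unfolding g by (simp add: ennreal_mult'[symmetric])
    show "indicator ?A \<omega> \<le> g \<omega> * ennreal (1 / 2 ^ k)"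
    proof (cases "\<omega> \<in> ?A")
      case True
      then have "k \<le> ?n" by simp
      then have "(2::real) ^ k \<le> 2 ^ ?n" by (simp add: power_increasing)
      then have "ennreal 1 \<le> ennreal (2 ^ ?n / 2 ^ k)" by (intro ennreal_leI) simp
      then show ?thesis unfolding eq indicator_simps(1)[OF True] by (simp only: ennreal_1)
    next
      case False
      show ?thesis unfolding indicator_simps(2)[OF False] by (rule zero_le)
    qed
  qed
  also have "\<dots> = (\<integral>\<^sup>+\<omega>. g \<omega> \<partial>M) * ennreal (1 / 2 ^ k)" by (rule nn_integral_multc[OF gm])
  also have "(\<integral>\<^sup>+\<omega>. g \<omega> \<partial>M) = (\<integral>\<^sup>+w. h w \<partial>(\<Pi>\<^sub>M j\<in>?J. \<mu>))"
    unfolding g_def by (rule nn_integral_sample[OF _ hN]) simp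
  also have "\<dots> \<le> ennreal (exp (\<Sum>i\<in>?I. b * unit_ball_vol DIM('c) * r i ^ DIM('c)))"
    unfolding h_def by (rule expect_two_power_count) (use r in auto)
  finally have "emeasure M ?A \<le> ennreal (exp (\<Sum>i\<in>?I. b * unit_ball_vol DIM('c) * r i ^ DIM('c))) * ennreal (1 / 2 ^ k)"
    by (simp add: mult_right_mono)
  also have "\<dots> = ennreal (exp (\<Sum>i\<in>?I. b * unit_ball_vol DIM('c) * r i ^ DIM('c)) / 2 ^ k)" by (simp add: ennreal_mult'[symmetric])
  finally show ?thesis by (simp add: emeasure_eq_measure)
qed

lemma close_prob:
  assumes "i \<noteq> j" "0 \<le> r"
  shows "measure M {\<omega> \<in> space M. dist (X i \<omega>) (X j \<omega>) \<le> r} \<le> b * unit_ball_vol DIM('c) * r ^ DIM('c)"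
proof -
  let ?J = "insert i {j}"
  let ?h = "\<lambda>w. \<Prod>l\<in>{j}. if dist (w i) (w l) \<le> r then 1 else 0 :: ennreal"
  have [measurable]: "(\<lambda>w. dist (w i) (w j)) \<in> borel_measurable (\<Pi>\<^sub>M j\<in>?J. \<mu>)"
    by (intro borel_measurable_dist component_\<mu>_measurable) auto
  have h: "?h \<in> borel_measurable (\<Pi>\<^sub>M j\<in>?J. \<mu>)" by simp measurable
  have "emeasure M {\<omega> \<in> space M. dist (X i \<omega>) (X j \<omega>) \<le> r} = (\<integral>\<^sup>+\<omega>. indicator {\<omega> \<in> space M. dist (X i \<omega>) (X j \<omega>) \<le> r} \<omega> \<partial>M)"
    by simp
  also have "\<dots> = (\<integral>\<^sup>+\<omega>. ?h (\<lambda>i\<in>?J. X i \<omega>) \<partial>M)" by (intro nn_integral_cong) (auto simp: indicator_def)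
  also have "\<dots> = (\<integral>\<^sup>+w. ?h w \<partial>(\<Pi>\<^sub>M j\<in>?J. \<mu>))" by (rule nn_integral_sample[OF _ h]) simp
  also have "\<dots> = (\<integral>\<^sup>+x. (\<Prod>l\<in>{j}. \<integral>\<^sup>+y. (if dist x y \<le> r then 1 else 0) \<partial>\<mu>) \<partial>\<mu>)"
    by (rule nn_integral_PiM_star) (use assms in auto)
  also have "\<dots> \<le> (\<integral>\<^sup>+x. ennreal (b * unit_ball_vol DIM('c) * r ^ DIM('c)) \<partial>\<mu>)"
  proof (rule nn_integral_mono)
    fix x
    have "(\<integral>\<^sup>+y. (if dist x y \<le> r then 1 else 0) \<partial>\<mu>) = (\<integral>\<^sup>+y. indicator (cball x r) y \<partial>\<mu>)" by (intro nn_integral_cong) (auto simp: indicator_def)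
    also have "\<dots> = ennreal (measure \<mu> (cball x r))" by (simp add: \<mu>.emeasure_eq_measure)
    also have "\<dots> \<le> ennreal (b * unit_ball_vol DIM('c) * r ^ DIM('c))" by (intro ennreal_leI \<mu>_cball_le assms)
    finally show "(\<Prod>l\<in>{j}. \<integral>\<^sup>+y. (if dist x y \<le> r then 1 else 0) \<partial>\<mu>) \<le> ennreal (b * unit_ball_vol DIM('c) * r ^ DIM('c))" by simp
  qed
  also have "\<dots> = ennreal (b * unit_ball_vol DIM('c) * r ^ DIM('c))" using \<mu>.emeasure_space_1 by simp
  finally show ?thesis using b_pos assms by (simp add: emeasure_eq_measure)
qed

lemma nearly_measurable:
  "(\<lambda>p :: real \<times> real. if fst p \<le> R \<and> fst p \<le> snd p \<and> snd p \<le> (1 + e) * fst p then 1 else 0 :: ennreal) \<in> borel_measurable (borel \<Otimes>\<^sub>M borel)"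
  by measurable

text \<open>Given the points \<open>n\<close> and \<open>i\<close>, the point \<open>j\<close> must fall
  into a thin shell around the point \<open>n\<close>.\<close>

lemma near_tie_prob:
  assumes d: "i \<noteq> n" "j \<noteq> n" "i \<noteq> j" and R: "0 \<le> R" "0 \<le> e"
  shows "measure M {\<omega> \<in> space M. dist (X n \<omega>) (X i \<omega>) \<le> R \<and> dist (X n \<omega>) (X i \<omega>) \<le> dist (X n \<omega>) (X j \<omega>)
       \<and> dist (X n \<omega>) (X j \<omega>) \<le> (1 + e) * dist (X n \<omega>) (X i \<omega>)}
    \<le> (b * unit_ball_vol DIM('c) * R ^ DIM('c)) * (b * unit_ball_vol DIM('c) * ((1 + e) ^ DIM('c) - 1) * R ^ DIM('c))"
    (is "measure M ?A \<le> ?p * ?q")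
proof -
  let ?I = "{n, i}"
  let ?J = "insert j ?I"
  let ?P = "\<lambda>x y z. dist x y \<le> R \<and> dist x y \<le> dist x z \<and> dist x z \<le> (1 + e) * dist x y"
  let ?h = "\<lambda>w. if ?P (w n) (w i) (w j) then 1 else 0 :: ennreal"
  interpret PP: product_prob_space "\<lambda>_::nat. \<mu>" UNIV by unfold_locales
  have pm: "(\<lambda>w. (dist (w n) (w i), dist (w n) (w j))) \<in> measurable (\<Pi>\<^sub>M j\<in>?J. \<mu>) (borel \<Otimes>\<^sub>M borel)"
    by (intro measurable_Pair borel_measurable_dist component_\<mu>_measurable; simp)
  have h: "?h \<in> borel_measurable (\<Pi>\<^sub>M j\<in>?J. \<mu>)"
    using measurable_compose[OF pm nearly_measurable[of R e]] unfolding fst_conv snd_conv .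
  have gm: "(\<lambda>w. if dist (w n) (w i) \<le> R then 1 else 0 :: ennreal) \<in> borel_measurable (\<Pi>\<^sub>M j\<in>?I. \<mu>)"
  proof -
    have [measurable]: "(\<lambda>w. dist (w n) (w i)) \<in> borel_measurable (\<Pi>\<^sub>M j\<in>?I. \<mu>)" by (intro borel_measurable_dist component_\<mu>_measurable; simp)
    show ?thesis by measurable
  qed
  have "1 \<le> (1 + e) ^ DIM('c)" using R by (intro one_le_power) simp
  then have c0: "0 \<le> b * unit_ball_vol DIM('c) * ((1 + e) ^ DIM('c) - 1)" using b_pos by (intro mult_nonneg_nonneg) auto
  have q0: "0 \<le> ?q" by (rule mult_nonneg_nonneg[OF c0 zero_le_power[OF R(1)]])
  have p0: "0 \<le> ?p" using b_pos R(1) by simp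
  have "emeasure M ?A = (\<integral>\<^sup>+\<omega>. indicator ?A \<omega> \<partial>M)" by simp
  also have "\<dots> = (\<integral>\<^sup>+\<omega>. ?h (\<lambda>i\<in>?J. X i \<omega>) \<partial>M)" by (intro nn_integral_cong) (auto simp: indicator_def)
  also have "\<dots> = (\<integral>\<^sup>+w. ?h w \<partial>(\<Pi>\<^sub>M j\<in>?J. \<mu>))" by (rule nn_integral_sample[OF _ h]) simp
  also have "\<dots> = (\<integral>\<^sup>+w. \<integral>\<^sup>+z. ?h (w(j := z)) \<partial>\<mu> \<partial>(\<Pi>\<^sub>M j\<in>?I. \<mu>))"
    by (rule PP.product_nn_integral_insert[OF _ _ h]) (use d in auto)
  also have "\<dots> \<le> (\<integral>\<^sup>+w. ennreal ?q * (if dist (w n) (w i) \<le> R then 1 else 0) \<partial>(\<Pi>\<^sub>M j\<in>?I. \<mu>))"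
  proof (rule nn_integral_mono)
    fix w :: "nat \<Rightarrow> 'c"
    let ?d = "dist (w n) (w i)"
    have "(\<integral>\<^sup>+z. ?h (w(j := z)) \<partial>\<mu>) = (\<integral>\<^sup>+z. (if ?d \<le> R then indicator (cball (w n) ((1 + e) * ?d) - ball (w n) ?d) z else 0) \<partial>\<mu>)"
      using d by (intro nn_integral_cong) (auto simp: indicator_def)
    also have "\<dots> \<le> ennreal ?q * (if ?d \<le> R then 1 else 0)"
    proof (cases "?d \<le> R")
      case True
      have "measure \<mu> (cball (w n) ((1 + e) * ?d) - ball (w n) ?d) \<le> b * unit_ball_vol DIM('c) * (((1 + e) * ?d) ^ DIM('c) - ?d ^ DIM('c))"
        using R by (intro \<mu>_ball_diff_le) (auto simp: algebra_simps)
      also have "\<dots> = b * unit_ball_vol DIM('c) * ((1 + e) ^ DIM('c) - 1) * ?d ^ DIM('c)" by (simp only: power_mult_distrib) (simp add: left_diff_distrib right_diff_distrib)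
      also have "\<dots> \<le> ?q"
        by (rule mult_left_mono[OF power_mono[OF True zero_le_dist] c0])
      finally show ?thesis using True by (simp add: \<mu>.emeasure_eq_measure ennreal_leI)
    qed simp
    finally show "(\<integral>\<^sup>+z. ?h (w(j := z)) \<partial>\<mu>) \<le> ennreal ?q * (if ?d \<le> R then 1 else 0)" .
  qed
  also have "\<dots> = ennreal ?q * (\<integral>\<^sup>+w. (if dist (w n) (w i) \<le> R then 1 else 0) \<partial>(\<Pi>\<^sub>M j\<in>?I. \<mu>))"
    by (rule nn_integral_cmult[OF gm])
  also have "(\<integral>\<^sup>+w. (if dist (w n) (w i) \<le> R then 1 else 0) \<partial>(\<Pi>\<^sub>M j\<in>?I. \<mu>)) = (\<integral>\<^sup>+\<omega>. (\<lambda>w. if dist (w n) (w i) \<le> R then 1 else 0) (\<lambda>i\<in>?I. X i \<omega>) \<partial>M)"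
    by (rule nn_integral_sample[OF _ gm, symmetric]) simp
  also have "\<dots> = (\<integral>\<^sup>+\<omega>. indicator {\<omega> \<in> space M. dist (X n \<omega>) (X i \<omega>) \<le> R} \<omega> \<partial>M)" by (intro nn_integral_cong) (auto simp: indicator_def)
  also have "\<dots> = ennreal (measure M {\<omega> \<in> space M. dist (X n \<omega>) (X i \<omega>) \<le> R})" by (simp add: emeasure_eq_measure)
  also have "\<dots> \<le> ennreal ?p" using close_prob[of n i R] d R by (intro ennreal_leI) auto
  finally have "emeasure M ?A \<le> ennreal ?q * ennreal ?p" by (simp add: mult_left_mono)
  also have "\<dots> = ennreal (?q * ?p)" by (rule ennreal_mult[OF q0 p0, symmetric])
  also have "?q * ?p = ?p * ?q" by (rule mult.commute)
  finally show ?thesis unfolding emeasure_eq_measure ennreal_le_iff[OF mult_nonneg_nonneg[OF p0 q0]] .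
qed

text \<open>Near ties with tolerance \<open>0\<close> have probability \<open>0\<close>.\<close>

lemma AE_no_ties:
  "AE \<omega> in M. \<forall>n i j. i < n \<and> j < n \<and> i \<noteq> j \<longrightarrow> X i \<omega> \<noteq> X n \<omega> \<and> dist (X n \<omega>) (X i \<omega>) \<noteq> dist (X n \<omega>) (X j \<omega>)"
proof -
  have 1: "AE \<omega> in M. X i \<omega> \<noteq> X n \<omega>" if "i \<noteq> n" for i n
  proof -
    have "measure M {\<omega> \<in> space M. dist (X i \<omega>) (X n \<omega>) \<le> 0} \<le> 0"
      using close_prob[OF that, of 0] by (simp add: power_0_left)
    then have "emeasure M {\<omega> \<in> space M. X i \<omega> = X n \<omega>} = 0" by (simp add: emeasure_eq_measure measure_le_0_iff)
    then show ?thesis by (intro AE_I[of _ _ "{\<omega> \<in> space M. X i \<omega> = X n \<omega>}"]) auto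
  qed
  have 2: "AE \<omega> in M. dist (X n \<omega>) (X i \<omega>) \<noteq> dist (X n \<omega>) (X j \<omega>)" if "i \<noteq> n" "j \<noteq> n" "i \<noteq> j" for n i j
  proof -
    have "AE \<omega> in M. \<not> (dist (X n \<omega>) (X i \<omega>) \<le> real R \<and> dist (X n \<omega>) (X i \<omega>) = dist (X n \<omega>) (X j \<omega>))" for R :: nat
    proof -
      let ?A = "{\<omega> \<in> space M. dist (X n \<omega>) (X i \<omega>) \<le> real R \<and> dist (X n \<omega>) (X i \<omega>) \<le> dist (X n \<omega>) (X j \<omega>)
       \<and> dist (X n \<omega>) (X j \<omega>) \<le> (1 + 0) * dist (X n \<omega>) (X i \<omega>)}"
      have "measure M ?A \<le> 0" using near_tie_prob[OF that, of "real R" 0] by simp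
      then have "emeasure M ?A = 0" by (simp add: emeasure_eq_measure measure_le_0_iff)
      moreover have "?A \<in> sets M" by measurable
      ultimately show ?thesis by (intro AE_I[of _ _ ?A]) auto
    qed
    then have "AE \<omega> in M. \<forall>R::nat. \<not> (dist (X n \<omega>) (X i \<omega>) \<le> real R \<and> dist (X n \<omega>) (X i \<omega>) = dist (X n \<omega>) (X j \<omega>))"
      unfolding AE_all_countable by blast
    then show ?thesis by eventually_elim (meson real_arch_simple)
  qed
  have "AE \<omega> in M. i < n \<and> j < n \<and> i \<noteq> j \<longrightarrow> X i \<omega> \<noteq> X n \<omega> \<and> dist (X n \<omega>) (X i \<omega>) \<noteq> dist (X n \<omega>) (X j \<omega>)" for n i j
  proof (cases "i < n \<and> j < n \<and> i \<noteq> j")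
    case True
    then show ?thesis using 1[of i n] 2[of i n j] by (auto elim!: AE_mp)
  qed auto
  then show ?thesis unfolding AE_all_countable by blast
qed

end

section \<open>Degrees in attachment trees\<close>

lemma attachment_degree_eq:
  assumes p: "\<And>i. 1 \<le> i \<Longrightarrow> i \<le> n \<Longrightarrow> p i < i" and j: "j \<le> n"
  shows "attachment_degree p n j = (if 1 \<le> j then 1 else 0) + card {i \<in> {1..n}. p i = j}"
proof -
  have inj: "inj_on (\<lambda>i. {i, p i}) {1..n}"
  proof (rule inj_onI)
    fix i i' assume "i \<in> {1..n}" "i' \<in> {1..n}" "{i, p i} = {i', p i'}"
    then show "i = i'" using p[of i] p[of i'] by (auto simp: doubleton_eq_iff)
  qed
  have "{e \<in> attachment_edges p n. j \<in> e} = (\<lambda>i. {i, p i}) ` ({i \<in> {1..n}. i = j} \<union> {i \<in> {1..n}. p i = j})"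
    by (auto simp: attachment_edges_def)
  moreover have "inj_on (\<lambda>i. {i, p i}) ({i \<in> {1..n}. i = j} \<union> {i \<in> {1..n}. p i = j})"
    using inj by (rule inj_on_subset) auto
  ultimately have "attachment_degree p n j = card ({i \<in> {1..n}. i = j} \<union> {i \<in> {1..n}. p i = j})"
    by (simp add: attachment_degree_def card_image)
  also have "\<dots> = card {i \<in> {1..n}. i = j} + card {i \<in> {1..n}. p i = j}"
  proof (rule card_Un_disjoint)
    show "{i \<in> {1..n}. i = j} \<inter> {i \<in> {1..n}. p i = j} = {}" using p[of j] by fastforce
  qed auto
  also have "{i \<in> {1..n}. i = j} = (if 1 \<le> j then {j} else {})" using j by auto
  finally show ?thesis by simp
qed

lemma attachment_degree_le: "attachment_degree p n j \<le> n"
proof -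
  have "attachment_degree p n j \<le> card (attachment_edges p n)"
    unfolding attachment_degree_def by (intro card_mono) (auto simp: attachment_edges_def)
  also have "\<dots> \<le> card {1..n}" unfolding attachment_edges_def by (intro card_image_le) auto
  finally show ?thesis by simp
qed

lemma attachment_degree_pos:
  assumes p: "\<And>i. 1 \<le> i \<Longrightarrow> i \<le> n \<Longrightarrow> p i < i" and n: "1 \<le> n" and j: "j \<le> n"
  shows "1 \<le> attachment_degree p n j"
proof (cases "1 \<le> j")
  case False
  then have "1 \<in> {i \<in> {1..n}. p i = j}" using p[of 1] n by auto
  then have "0 < card {i \<in> {1..n}. p i = j}" by (subst card_gt_0_iff) auto
  then show ?thesis using attachment_degree_eq[OF p j] by simp
qed (use attachment_degree_eq[OF p j] in simp)

section \<open>The attractiveness function\<close>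

lemma F_attract_ge_1: "1 \<le> F_attract g r"
  by (simp add: F_attract_def)

lemma F_attract_antimono:
  assumes "0 < x" "x \<le> y" "0 \<le> g" shows "F_attract g y \<le> F_attract g x"
proof -
  have "ln x \<le> ln y" using assms by simp
  then have "max 0 (ln (1 / y)) \<le> max 0 (ln (1 / x))" using assms by (simp add: ln_div max_def)
  then show ?thesis unfolding F_attract_def using assms by (simp add: powr_mono2)
qed

text \<open>Convexity of the power: \<open>A\<^bsup>g\<^esup> - B\<^bsup>g\<^esup> \<ge> (A - B)
  A\<^bsup>g-1\<^esup>\<close> for \<open>0 \<le> B \<le> A\<close>.\<close>

lemma F_attract_ratio:
  assumes g: "1 \<le> g" and r: "0 < r" "r \<le> l" "l \<le> 1"
  shows "F_attract g l / F_attract g r \<le> exp (- (ln (l / r) * ln (1 / r) powr (g - 1)))"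
proof -
  define A where "A = ln (1 / r)"
  define B where "B = ln (1 / l)"
  have AB: "0 \<le> B" "B \<le> A" "ln (l / r) = A - B" using r by (auto simp: A_def B_def ln_div)
  have p: "x powr g = x * x powr (g - 1)" if "0 \<le> x" for x :: real
    using powr_mult_base[OF that, of "g - 1"] by simp
  have "B powr g \<le> B * A powr (g - 1)" using AB g by (subst p) (auto intro!: mult_left_mono powr_mono2)
  then have "B powr g - A powr g \<le> - ((A - B) * A powr (g - 1))" using AB by (subst (2) p) (auto simp: algebra_simps)
  moreover have "F_attract g l / F_attract g r = exp (B powr g - A powr g)"
    using AB unfolding F_attract_def A_def[symmetric] B_def[symmetric] by (simp add: exp_diff)
  ultimately show ?thesis using AB(3) unfolding A_def[symmetric] by simp
qed

lemma sum_inverse_le_ln: "0 < n \<Longrightarrow> (\<Sum>i\<in>{1..n}. 1 / real i) \<le> 1 + ln (real n)"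
proof (induction n)
  case (Suc n)
  show ?case
  proof (cases "n = 0")
    case False
    have "ln (real n / real (Suc n)) \<le> real n / real (Suc n) - 1" using False by (intro ln_le_minus_one) auto
    also have "\<dots> = - 1 / real (Suc n)" by (simp add: field_simps)
    finally have "1 / real (Suc n) \<le> ln (real (Suc n)) - ln (real n)" using False by (simp add: ln_div)
    then show ?thesis using Suc.IH False by (simp add: atLeastAtMostSuc_conv)
  qed simp
qed simp

lemma (in prob_space) eventually_prob_tendsto_0:
  assumes B: "\<And>n. B n \<in> events" and ev: "AE \<omega> in M. eventually (\<lambda>n. \<omega> \<notin> B n) sequentially"
  shows "(\<lambda>n. prob (B n)) \<longlonglongrightarrow> 0"
proof -
  have "(\<lambda>n. \<integral>\<omega>. indicator (B n) \<omega> \<partial>M) \<longlonglongrightarrow> (\<integral>\<omega>. 0 \<partial>M :: real)"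
  proof (rule integral_dominated_convergence[where w="\<lambda>_. 1"])
    show "AE \<omega> in M. (\<lambda>n. indicator (B n) \<omega> :: real) \<longlonglongrightarrow> 0"
      using ev
    proof eventually_elim
      case (elim \<omega>)
      have "eventually (\<lambda>n. indicator (B n) \<omega> = (0::real)) sequentially" using elim by eventually_elim simp
      then show ?case by (rule tendsto_eventually)
    qed
  qed (use B in \<open>auto simp: indicator_def\<close>)
  then show ?thesis using B by simp
qed

lemma (in prob_space) AE_eventually_of_inverse_square:
  assumes B: "\<And>m. 1 \<le> m \<Longrightarrow> B m \<in> events" and ev: "eventually (\<lambda>m. prob (B m) \<le> C / real m ^ 2) sequentially"
  shows "AE \<omega> in M. eventually (\<lambda>m. \<omega> \<notin> B m) sequentially"
proof -
  have sm: "summable (\<lambda>m. prob (B (Suc m)))"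
  proof (rule summable_comparison_test_ev)
    have "eventually (\<lambda>m. prob (B (Suc m)) \<le> C / real (Suc m) ^ 2) sequentially"
      using ev by (rule eventually_sequentially_Suc[where P="\<lambda>m. prob (B m) \<le> C / real m ^ 2", THEN iffD2])
    then show "eventually (\<lambda>m. norm (prob (B (Suc m))) \<le> C * inverse (real (Suc m) ^ 2)) sequentially"
      by (simp add: divide_inverse)
    have "summable (\<lambda>m. inverse (real m ^ 2))" by (rule inverse_power_summable) simp
    then have "summable (\<lambda>m. inverse (real (Suc m) ^ 2))" by (rule summable_Suc_iff[THEN iffD2])
    then show "summable (\<lambda>m. C * inverse (real (Suc m) ^ 2))" by (rule summable_mult)
  qed
  have "AE \<omega> in M. eventually (\<lambda>m. \<omega> \<in> space M - B (Suc m)) sequentially"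
    using sm B by (intro borel_cantelli_AE1) (auto simp: emeasure_eq_measure)
  then show ?thesis
  proof eventually_elim
    case (elim \<omega>)
    then have "eventually (\<lambda>m. \<omega> \<notin> B (Suc m)) sequentially" by eventually_elim simp
    then show ?case by (rule eventually_sequentially_Suc[where P="\<lambda>m. \<omega> \<notin> B m", THEN iffD1])
  qed
qed

section \<open>Edge lengths and degrees in geometric preferential attachment\<close>

locale gpa_graph = iid_sample f S a b M X
  for f :: "'c::euclidean_space \<Rightarrow> real" and S a b and M :: "'a measure" and X +
  fixes v :: "nat \<Rightarrow> 'a \<Rightarrow> nat" and \<gamma> :: real
  assumes \<gamma>: "1 < \<gamma>" and gpa: "gpa_process M (F_attract \<gamma>) X v"
begin

abbreviation "hist \<equiv> history M X v"
abbreviation "deg n \<omega> j \<equiv> attachment_degree (\<lambda>i. v i \<omega>) n j"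

lemma v_meas [measurable]: "1 \<le> n \<Longrightarrow> v n \<in> measurable M (count_space UNIV)"
proof -
  have "\<forall>n\<ge>1. v n \<in> measurable M (count_space UNIV)" using gpa unfolding gpa_process_def by (elim conjE)
  then show "1 \<le> n \<Longrightarrow> v n \<in> measurable M (count_space UNIV)" by blast
qed

lemma v_less: "\<omega> \<in> space M \<Longrightarrow> 1 \<le> i \<Longrightarrow> v i \<omega> < i"
proof -
  assume w: "\<omega> \<in> space M" and i: "1 \<le> i"
  have 1: "\<forall>\<omega>\<in>space M. v 1 \<omega> = 0" using gpa unfolding gpa_process_def by (elim conjE)
  have 2: "\<forall>n\<ge>1. \<forall>\<omega>\<in>space M. v (Suc n) \<omega> \<in> {0..n}" using gpa unfolding gpa_process_def by (elim conjE)
  show ?thesis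
  proof (cases "i = 1")
    case True then show ?thesis using bspec[OF 1 w] by simp
  next
    case False
    then obtain n where n: "i = Suc n" "1 \<le> n" using i by (cases i) auto
    then have "v (Suc n) \<omega> \<in> {0..n}" using 2 w by blast
    then show ?thesis using n by simp
  qed
qed

lemma hist_generators: "{X i -` A \<inter> space M | i A. i \<le> m \<and> A \<in> sets borel} \<union> {v i -` B \<inter> space M | i B. 1 \<le> i \<and> i \<le> n} \<subseteq> Pow (space M)"
  by auto

lemma space_hist [simp]: "space (hist m n) = space M"
  unfolding history_def by (rule space_measure_of[OF hist_generators])

lemma sets_hist: "sets (hist m n) = sigma_sets (space M) ({X i -` A \<inter> space M | i A. i \<le> m \<and> A \<in> sets borel} \<union> {v i -` B \<inter> space M | i B. 1 \<le> i \<and> i \<le> n})"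
  unfolding history_def by (rule sets_measure_of[OF hist_generators])

lemma hist_subalgebra: "subalgebra M (hist m n)"
  unfolding subalgebra_def
proof (intro conjI)
  have "{X i -` A \<inter> space M | i A. i \<le> m \<and> A \<in> sets borel} \<union> {v i -` B \<inter> space M | i B. 1 \<le> i \<and> i \<le> n} \<subseteq> events"
    using measurable_sets[OF X_meas] measurable_sets[OF v_meas] by auto
  then show "sets (hist m n) \<subseteq> events" unfolding sets_hist by (rule sets.sigma_sets_subset)
qed simp

lemma X_hist: "i \<le> m \<Longrightarrow> X i \<in> borel_measurable (hist m n)"
  by (rule measurableI) (auto simp: sets_hist intro!: sigma_sets.Basic)

lemma v_hist: "1 \<le> i \<Longrightarrow> i \<le> n \<Longrightarrow> v i \<in> measurable (hist m n) (count_space UNIV)"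
proof (rule measurableI)
  fix B :: "nat set" assume "1 \<le> i" "i \<le> n"
  then have "v i -` B \<inter> space M \<in> {v i -` B \<inter> space M | i B. 1 \<le> i \<and> i \<le> n}" by blast
  then show "v i -` B \<inter> space (hist m n) \<in> sets (hist m n)"
    unfolding sets_hist space_hist by (intro sigma_sets.Basic UnI2)
qed simp

lemma degree_hist:
  assumes "j \<le> n" shows "(\<lambda>\<omega>. real (deg n \<omega> j)) \<in> borel_measurable (hist m n)"
proof -
  have "(\<lambda>\<omega>. (if 1 \<le> j then 1 else 0) + (\<Sum>i\<in>{1..n}. of_bool (v i \<omega> = j)) :: real) \<in> borel_measurable (hist m n)"
  proof (intro borel_measurable_add borel_measurable_sum)
    fix i assume "i \<in> {1..n}"
    then have [measurable]: "v i \<in> measurable (hist m n) (count_space UNIV)" by (intro v_hist) auto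
    show "(\<lambda>\<omega>. of_bool (v i \<omega> = j) :: real) \<in> borel_measurable (hist m n)" by measurable
  qed simp
  moreover have "real (deg n \<omega> j) = (if 1 \<le> j then 1 else 0) + (\<Sum>i\<in>{1..n}. of_bool (v i \<omega> = j))" if "\<omega> \<in> space (hist m n)" for \<omega>
  proof -
    have "deg n \<omega> j = (if 1 \<le> j then 1 else 0) + card {i \<in> {1..n}. v i \<omega> = j}"
      using that by (intro attachment_degree_eq assms v_less) auto
    then show ?thesis by (simp add: of_bool_def sum.If_cases Int_def)
  qed
  ultimately show ?thesis by (rule measurable_cong[THEN iffD2, rotated])
qed

lemma degree_meas: "j \<le> n \<Longrightarrow> (\<lambda>\<omega>. real (deg n \<omega> j)) \<in> borel_measurable M"
  by (rule measurable_from_subalg[OF hist_subalgebra degree_hist])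

lemma dist_hist: "i \<le> m \<Longrightarrow> j \<le> m \<Longrightarrow> (\<lambda>\<omega>. dist (X i \<omega>) (X j \<omega>)) \<in> borel_measurable (hist m n)"
  by (intro borel_measurable_dist X_hist)

definition attach_prob :: "nat \<Rightarrow> 'a \<Rightarrow> nat \<Rightarrow> real" where
  "attach_prob n \<omega> j = gpa_weight (F_attract \<gamma>) (\<lambda>i. X i \<omega>) (\<lambda>i. v i \<omega>) n (X (Suc n) \<omega>) j /
          (\<Sum>i=0..n. gpa_weight (F_attract \<gamma>) (\<lambda>i. X i \<omega>) (\<lambda>i. v i \<omega>) n (X (Suc n) \<omega>) i)"

text \<open>The conditional law of the new edge is only used through this bound: on an event of the past on
  which the conditional probability of \<open>j\<close> is at most \<open>q\<close>, the edge goes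
  to \<open>j\<close> with probability at most \<open>q\<close>.\<close>

lemma attachment_event_le:
  assumes n: "1 \<le> n" "j \<le> n" and A: "A \<in> sets (hist (Suc n) n)" and q: "0 \<le> q" "\<And>\<omega>. \<omega> \<in> A \<Longrightarrow> attach_prob n \<omega> j \<le> q"
  shows "prob (A \<inter> {\<omega> \<in> space M. v (Suc n) \<omega> = j}) \<le> q * prob A"
proof -
  have "finite_measure_subalgebra M (hist (Suc n) n)"
    by (intro finite_measure_subalgebra.intro finite_measure_subalgebra_axioms.intro hist_subalgebra finite_measure_axioms)
  then have sfs: "sigma_finite_subalgebra M (hist (Suc n) n)" by (rule finite_measure_subalgebra_is_sigma_finite)
  let ?V = "{\<omega> \<in> space M. v (Suc n) \<omega> = j}"
  have V: "?V \<in> events" by measurable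
  have AM: "A \<in> events" using A hist_subalgebra[of "Suc n" n] by (auto simp: subalgebra_def)
  have iV: "integrable M (indicator ?V :: 'a \<Rightarrow> real)" 
    using V by (intro integrable_real_indicator) (auto simp: emeasure_eq_measure)
  have AE: "AE \<omega> in M. real_cond_exp M (hist (Suc n) n) (indicator ?V) \<omega> = attach_prob n \<omega> j"
    unfolding attach_prob_def
  proof -
    have "\<forall>n\<ge>1. \<forall>j\<in>{0..n}. AE \<omega> in M.
        real_cond_exp M (hist (Suc n) n) (indicator {\<omega> \<in> space M. v (Suc n) \<omega> = j}) \<omega> =
          gpa_weight (F_attract \<gamma>) (\<lambda>i. X i \<omega>) (\<lambda>i. v i \<omega>) n (X (Suc n) \<omega>) j /
          (\<Sum>i=0..n. gpa_weight (F_attract \<gamma>) (\<lambda>i. X i \<omega>) (\<lambda>i. v i \<omega>) n (X (Suc n) \<omega>) i)"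
      using gpa unfolding gpa_process_def by (elim conjE)
    moreover have "j \<in> {0..n}" using n by simp
    ultimately show "AE \<omega> in M. real_cond_exp M (hist (Suc n) n) (indicator {\<omega> \<in> space M. v (Suc n) \<omega> = j}) \<omega> =
          gpa_weight (F_attract \<gamma>) (\<lambda>i. X i \<omega>) (\<lambda>i. v i \<omega>) n (X (Suc n) \<omega>) j /
          (\<Sum>i=0..n. gpa_weight (F_attract \<gamma>) (\<lambda>i. X i \<omega>) (\<lambda>i. v i \<omega>) n (X (Suc n) \<omega>) i)"
      using n(1) by blast
  qed
  have "prob (A \<inter> ?V) = (\<integral>\<omega>\<in>A. indicator ?V \<omega> \<partial>M)"
  proof -
    have "prob (A \<inter> ?V) = (\<integral>\<omega>. indicator (A \<inter> ?V) \<omega> \<partial>M)" using AM V by simp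
    then show ?thesis unfolding set_lebesgue_integral_def indicator_inter_arith real_scaleR_def .
  qed
  also have "\<dots> = (\<integral>\<omega>\<in>A. real_cond_exp M (hist (Suc n) n) (indicator ?V) \<omega> \<partial>M)"
    by (rule sigma_finite_subalgebra.real_cond_exp_intA[OF sfs iV A])
  also have "\<dots> \<le> (\<integral>\<omega>. q * indicator A \<omega> \<partial>M)"
    unfolding set_lebesgue_integral_def
  proof (rule integral_mono_AE)
    show "integrable M (\<lambda>\<omega>. indicator A \<omega> *\<^sub>R real_cond_exp M (hist (Suc n) n) (indicator ?V) \<omega>)"
      using AM sigma_finite_subalgebra.real_cond_exp_int(1)[OF sfs iV] by (rule integrable_mult_indicator)
    show "AE \<omega> in M. indicator A \<omega> *\<^sub>R real_cond_exp M (hist (Suc n) n) (indicator ?V) \<omega> \<le> q * indicator A \<omega>"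
      using AE
    proof eventually_elim
      case (elim \<omega>)
      then show ?case using q(2)[of \<omega>] by (cases "\<omega> \<in> A") auto
    qed
  next
    show "integrable M (\<lambda>\<omega>. q * indicator A \<omega>)"
      using AM by (intro integrable_mult_right integrable_real_indicator) (auto simp: emeasure_eq_measure)
  qed
  also have "\<dots> = q * prob A" using AM by simp
  finally show ?thesis .
qed

text \<open>Every degree is at least \<open>1\<close>, so a single vertex \<open>i\<close> already bounds
  the denominator from below.\<close>

lemma attach_prob_le:
  assumes \<omega>: "\<omega> \<in> space M" and n: "1 \<le> n" and i: "i \<le> n"
  shows "attach_prob n \<omega> j \<le> real (deg n \<omega> j) * (F_attract \<gamma> (dist (X j \<omega>) (X (Suc n) \<omega>)) / F_attract \<gamma> (dist (X i \<omega>) (X (Suc n) \<omega>)))"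
proof -
  let ?w = "gpa_weight (F_attract \<gamma>) (\<lambda>i. X i \<omega>) (\<lambda>i. v i \<omega>) n (X (Suc n) \<omega>)"
  have Fp: "0 < F_attract \<gamma> r" for r using F_attract_ge_1[of \<gamma> r] by linarith
  have w0: "0 \<le> ?w l" for l unfolding gpa_weight_def by (intro mult_nonneg_nonneg less_imp_le[OF Fp]) simp
  have "1 \<le> deg n \<omega> i" using v_less[OF \<omega>] by (intro attachment_degree_pos n i) auto
  then have "1 * F_attract \<gamma> (dist (X i \<omega>) (X (Suc n) \<omega>)) \<le> ?w i" 
    unfolding gpa_weight_def by (intro mult_right_mono less_imp_le[OF Fp]) simp
  also have "\<dots> \<le> (\<Sum>l=0..n. ?w l)" using i w0 by (intro member_le_sum) auto
  finally have le: "F_attract \<gamma> (dist (X i \<omega>) (X (Suc n) \<omega>)) \<le> (\<Sum>l=0..n. ?w l)" by simp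
  have "attach_prob n \<omega> j \<le> ?w j / F_attract \<gamma> (dist (X i \<omega>) (X (Suc n) \<omega>))"
    unfolding attach_prob_def
    by (rule divide_left_mono[OF le w0 mult_pos_pos[OF less_le_trans[OF Fp le] Fp]])
  then show ?thesis by (simp add: gpa_weight_def)
qed

definition isolated :: "nat \<Rightarrow> real \<Rightarrow> 'a set" where
  "isolated m r = {\<omega> \<in> space M. \<forall>j<m. \<not> (0 < dist (X j \<omega>) (X m \<omega>) \<and> dist (X j \<omega>) (X m \<omega>) < r)}"

lemma isolated_meas [measurable]: "isolated m r \<in> events"
  unfolding isolated_def by measurable

definition long_edge :: "nat \<Rightarrow> real \<Rightarrow> 'a set" where
  "long_edge m l = {\<omega> \<in> space M. l < dist (X (v m \<omega>) \<omega>) (X m \<omega>)}"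

lemma long_edge_eq: "1 \<le> m \<Longrightarrow> long_edge m l = (\<Union>j<m. {\<omega> \<in> space M. l < dist (X j \<omega>) (X m \<omega>)} \<inter> {\<omega> \<in> space M. v m \<omega> = j})"
proof (intro set_eqI iffI)
  fix \<omega> assume "1 \<le> m" and w: "\<omega> \<in> long_edge m l"
  then have "v m \<omega> < m" by (intro v_less) (simp_all add: long_edge_def)
  then show "\<omega> \<in> (\<Union>j<m. {\<omega> \<in> space M. l < dist (X j \<omega>) (X m \<omega>)} \<inter> {\<omega> \<in> space M. v m \<omega> = j})"
    using w by (simp add: long_edge_def)
qed (auto simp: long_edge_def)

lemma long_edge_meas: "1 \<le> m \<Longrightarrow> long_edge m l \<in> events"
  by (subst long_edge_eq) auto

text \<open>Unless vertex \<open>n + 1\<close> is isolated at scale \<open>r\<close>, each of the at most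
  \<open>n + 1\<close> vertices beyond \<open>l\<close>, of degree at most \<open>n\<close>,
  competes with one within \<open>r\<close>.\<close>

lemma long_edge_prob:
  assumes n: "1 \<le> n" and r: "0 < r" "r \<le> l"
  shows "prob (long_edge (Suc n) l) \<le> prob (isolated (Suc n) r) + real (Suc n) ^ 2 * (F_attract \<gamma> l / F_attract \<gamma> r)"
proof -
  let ?q = "real n * (F_attract \<gamma> l / F_attract \<gamma> r)"
  define A where "A j = {\<omega> \<in> space M. l < dist (X j \<omega>) (X (Suc n) \<omega>) \<and> (\<exists>i\<in>{..n}. 0 < dist (X i \<omega>) (X (Suc n) \<omega>) \<and> dist (X i \<omega>) (X (Suc n) \<omega>) < r)}" for j
  have Fp: "0 < F_attract \<gamma> x" for x using F_attract_ge_1[of \<gamma> x] by linarith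
  have A: "A j \<in> sets (hist (Suc n) n)" if "j \<le> n" for j
  proof -
    have [measurable]: "(\<lambda>\<omega>. dist (X i \<omega>) (X (Suc n) \<omega>)) \<in> borel_measurable (hist (Suc n) n)" if "i \<in> {..n}" for i
      using that by (intro dist_hist) auto
    have [measurable]: "(\<lambda>\<omega>. dist (X j \<omega>) (X (Suc n) \<omega>)) \<in> borel_measurable (hist (Suc n) n)" using that by (intro dist_hist) auto
    have "{\<omega> \<in> space (hist (Suc n) n). l < dist (X j \<omega>) (X (Suc n) \<omega>) \<and> (\<exists>i\<in>{..n}. 0 < dist (X i \<omega>) (X (Suc n) \<omega>) \<and> dist (X i \<omega>) (X (Suc n) \<omega>) < r)} \<in> sets (hist (Suc n) n)"
      by measurable
    then show ?thesis by (simp add: A_def)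
  qed
  have AM: "A j \<in> events" if "j \<le> n" for j using A[OF that] hist_subalgebra by (auto simp: subalgebra_def)
  have each: "prob (A j \<inter> {\<omega> \<in> space M. v (Suc n) \<omega> = j}) \<le> ?q" if j: "j \<le> n" for j
  proof -
    have "prob (A j \<inter> {\<omega> \<in> space M. v (Suc n) \<omega> = j}) \<le> ?q * prob (A j)"
    proof (rule attachment_event_le[OF n j A[OF j]])
      show "0 \<le> ?q" using Fp by (simp add: less_imp_le)
      fix \<omega> assume "\<omega> \<in> A j"
      then obtain i where i: "i \<le> n" "0 < dist (X i \<omega>) (X (Suc n) \<omega>)" "dist (X i \<omega>) (X (Suc n) \<omega>) < r" "l < dist (X j \<omega>) (X (Suc n) \<omega>)" "\<omega> \<in> space M"
        by (auto simp: A_def)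
      have "attach_prob n \<omega> j \<le> real (deg n \<omega> j) * (F_attract \<gamma> (dist (X j \<omega>) (X (Suc n) \<omega>)) / F_attract \<gamma> (dist (X i \<omega>) (X (Suc n) \<omega>)))"
        by (rule attach_prob_le[OF i(5) n i(1)])
      also have "\<dots> \<le> ?q"
        using i r \<gamma> Fp F_attract_ge_1 attachment_degree_le[of "\<lambda>i. v i \<omega>" n j]
        by (intro mult_mono frac_le F_attract_antimono) (auto simp: less_imp_le)
      finally show "attach_prob n \<omega> j \<le> ?q" .
    qed
    also have "\<dots> \<le> ?q * 1" using Fp by (intro mult_left_mono) (auto simp: less_imp_le)
    finally show ?thesis by simp
  qed
  have "long_edge (Suc n) l \<subseteq> isolated (Suc n) r \<union> (\<Union>j\<in>{..n}. A j \<inter> {\<omega> \<in> space M. v (Suc n) \<omega> = j})"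
  proof
    fix \<omega> assume w: "\<omega> \<in> long_edge (Suc n) l"
    then have "\<omega> \<in> space M" "v (Suc n) \<omega> \<le> n" using v_less[of \<omega> "Suc n"] by (auto simp: long_edge_def)
    then show "\<omega> \<in> isolated (Suc n) r \<union> (\<Union>j\<in>{..n}. A j \<inter> {\<omega> \<in> space M. v (Suc n) \<omega> = j})"
    proof (cases "\<omega> \<in> isolated (Suc n) r")
      case False
      with \<open>\<omega> \<in> space M\<close> obtain i where "i < Suc n" "0 < dist (X i \<omega>) (X (Suc n) \<omega>)" "dist (X i \<omega>) (X (Suc n) \<omega>) < r"
        unfolding isolated_def by blast
      then have "i \<in> {..n}" "0 < dist (X i \<omega>) (X (Suc n) \<omega>)" "dist (X i \<omega>) (X (Suc n) \<omega>) < r" by auto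
      then have "\<omega> \<in> A (v (Suc n) \<omega>)" using w unfolding A_def long_edge_def by blast
      then show ?thesis using \<open>\<omega> \<in> space M\<close> \<open>v (Suc n) \<omega> \<le> n\<close> by (intro UnI2 UN_I[of "v (Suc n) \<omega>"]) auto
    qed simp
  qed
  then have "prob (long_edge (Suc n) l) \<le> prob (isolated (Suc n) r \<union> (\<Union>j\<in>{..n}. A j \<inter> {\<omega> \<in> space M. v (Suc n) \<omega> = j}))"
    using AM by (intro finite_measure_mono) auto
  also have "\<dots> \<le> prob (isolated (Suc n) r) + prob (\<Union>j\<in>{..n}. A j \<inter> {\<omega> \<in> space M. v (Suc n) \<omega> = j})"
    using AM by (intro measure_Un_le) auto
  also have "prob (\<Union>j\<in>{..n}. A j \<inter> {\<omega> \<in> space M. v (Suc n) \<omega> = j}) \<le> (\<Sum>j\<in>{..n}. prob (A j \<inter> {\<omega> \<in> space M. v (Suc n) \<omega> = j}))"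
    using AM by (intro measure_UNION_le) auto
  also have "\<dots> \<le> (\<Sum>j\<in>{..n}. ?q)" by (intro sum_mono each) auto
  also have "\<dots> = real (Suc n) * real n * (F_attract \<gamma> l / F_attract \<gamma> r)" by simp
  also have "\<dots> \<le> real (Suc n) ^ 2 * (F_attract \<gamma> l / F_attract \<gamma> r)"
    using Fp by (intro mult_right_mono) (auto simp: power2_eq_square less_imp_le intro!: mult_left_mono)
  finally show ?thesis by simp
qed

text \<open>The factor \<open>2\<close> leaves room for a second scale \<open>m\<^bsup>-1/d\<^esup> exp ((ln
  m)\<^bsup>\<theta>\<^esup>)\<close> at which vertices are rarely isolated.\<close>

definition edge_scale :: "real \<Rightarrow> nat \<Rightarrow> real" where
  "edge_scale \<theta> m = exp (- ln (real m) / DIM('c) + 2 * ln (real m) powr \<theta>)"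

lemma edge_scale_power:
  assumes "1 \<le> m" shows "edge_scale \<theta> m ^ DIM('c) = exp (2 * real DIM('c) * ln (real m) powr \<theta>) / real m"
proof -
  have "edge_scale \<theta> m ^ DIM('c) = exp (real DIM('c) * (- ln (real m) / DIM('c) + 2 * ln (real m) powr \<theta>))"
    unfolding edge_scale_def by (rule exp_of_nat_mult[symmetric])
  also have "real DIM('c) * (- ln (real m) / DIM('c) + 2 * ln (real m) powr \<theta>) = 2 * real DIM('c) * ln (real m) powr \<theta> - ln (real m)"
    by (simp add: field_simps)
  finally show ?thesis using assms by (simp add: exp_diff)
qed

lemma eventually_ln: "eventually P at_top \<Longrightarrow> eventually (\<lambda>m. P (ln (real m))) sequentially"
  for P :: "real \<Rightarrow> bool"
proof -
  have "filterlim (\<lambda>m. ln (real m)) at_top sequentially" by real_asymp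
  then show "eventually P at_top \<Longrightarrow> eventually (\<lambda>m. P (ln (real m))) sequentially" by (auto simp: filterlim_iff)
qed

text \<open>With \<open>t = ln m\<close> the two scales are \<open>exp (- t / d +
  t\<^bsup>\<theta>\<^esup>)\<close> and \<open>exp (- t / d + 2
  t\<^bsup>\<theta>\<^esup>)\<close>. Isolation costs \<open>exp (- c exp (d
  t\<^bsup>\<theta>\<^esup>))\<close> and the handicap is of order \<open>exp (-
  t\<^bsup>\<theta>+\<gamma>-1\<^esup>)\<close>; both are eventually smaller than
  \<open>m\<^bsup>-2\<^esup>\<close> with the polynomial factor included, since \<open>\<theta> +
  \<gamma> - 1 > 1\<close>.\<close>

theorem long_edge_prob_le:
  assumes \<theta>: "0 < \<theta>" "\<theta> < 1" "2 - \<gamma> < \<theta>"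
  shows "eventually (\<lambda>m. prob (long_edge m (edge_scale \<theta> m)) \<le> 2 / real m ^ 2) sequentially"
proof -
  obtain c where c: "0 < c" "c \<le> 1" "\<And>x r. x \<in> S \<Longrightarrow> 0 < r \<Longrightarrow> r \<le> 1 \<Longrightarrow> c * r ^ DIM('c) \<le> measure \<mu> {y. 0 < dist y x \<and> dist y x < r}"
    using \<mu>_ball_ge by blast
  define D where "D = real DIM('c)"
  have D: "0 < D" by (simp add: D_def)
  define \<delta> where "\<delta> = \<gamma> - 2 + \<theta>"
  have \<delta>: "0 < \<delta>" "\<gamma> - 1 = 1 - \<theta> + \<delta>" using \<theta> by (auto simp: \<delta>_def)
  have 1: "eventually (\<lambda>t. 2 * t \<le> c * exp (D * t powr \<theta>)) at_top" using \<theta> c D by real_asymp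
  have 2: "eventually (\<lambda>t. 4 * t \<le> t powr \<theta> * (t / D - t powr \<theta>) powr (1 - \<theta> + \<delta>)) at_top" using \<theta>(1,2) \<delta>(1) D by real_asymp
  have 3: "eventually (\<lambda>t. - t / D + 2 * t powr \<theta> \<le> 0) at_top" using \<theta> D by real_asymp
  show ?thesis
    using eventually_ln[OF 1] eventually_ln[OF 2] eventually_ln[OF 3] eventually_ge_at_top[of 2]
  proof eventually_elim
    case (elim m)
    define t where "t = ln (real m)"
    obtain n where mn: "m = Suc n" "1 \<le> n" using elim(4) by (cases m) auto
    have m: "real m = exp t" "0 \<le> t" using elim(4) by (auto simp: t_def)
    define r where "r = exp (- t / D + t powr \<theta>)"
    let ?l = "edge_scale \<theta> m"
    have l: "?l = exp (- t / D + 2 * t powr \<theta>)" by (simp add: edge_scale_def t_def D_def)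
    have e3: "- t / D + 2 * t powr \<theta> \<le> 0" using elim(3) unfolding t_def .
    have p0: "0 \<le> t powr \<theta>" by simp
    have rl: "0 < r" "r \<le> ?l" "?l \<le> 1" "r \<le> 1"
      unfolding l r_def using e3 p0 by (auto simp del: powr_ge_zero)
    have "c * r ^ DIM('c) * m = c * exp (D * t powr \<theta>)"
    proof -
      have "r ^ DIM('c) = exp (D * (- t / D + t powr \<theta>))" unfolding r_def D_def by (rule exp_of_nat_mult[symmetric])
      then show ?thesis using D by (simp add: m exp_add[symmetric] algebra_simps)
    qed
    then have "prob (isolated m r) \<le> exp (- (c * exp (D * t powr \<theta>)))"
      using isolated_prob[OF rl(1,4) c(1,2) c(3)[OF _ rl(1,4)], of m] unfolding isolated_def minus_mult_left[symmetric] by metis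
    also have "\<dots> \<le> exp (- (2 * t))" using elim(1) unfolding t_def by simp
    finally have iso: "prob (isolated m r) \<le> exp (- (2 * t))" .
    have "F_attract \<gamma> ?l / F_attract \<gamma> r \<le> exp (- (ln (?l / r) * ln (1 / r) powr (\<gamma> - 1)))"
      using \<gamma> rl by (intro F_attract_ratio) auto
    also have "ln (?l / r) = t powr \<theta>" unfolding l r_def by (simp add: ln_div)
    also have "ln (1 / r) = t / D - t powr \<theta>" unfolding r_def by (simp add: ln_div)
    also have "exp (- (t powr \<theta> * (t / D - t powr \<theta>) powr (\<gamma> - 1))) \<le> exp (- (4 * t))"
      using elim(2) unfolding \<delta>(2) t_def by simp
    finally have F: "F_attract \<gamma> ?l / F_attract \<gamma> r \<le> exp (- (4 * t))" .
    have "prob (long_edge m ?l) \<le> prob (isolated m r) + real m ^ 2 * (F_attract \<gamma> ?l / F_attract \<gamma> r)"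
      using long_edge_prob[OF mn(2) rl(1,2)] unfolding mn(1) .
    also have "\<dots> \<le> exp (- (2 * t)) + real m ^ 2 * exp (- (4 * t))"
      using iso F by (intro add_mono mult_left_mono) auto
    also have "real m ^ 2 * exp (- (4 * t)) = exp (- (2 * t))"
      by (simp add: m exp_of_nat_mult[symmetric] exp_add[symmetric])
    also have "exp (- (2 * t)) + exp (- (2 * t)) = 2 / real m ^ 2"
      by (simp add: m exp_of_nat_mult[symmetric] exp_minus field_simps)
    finally show ?case .
  qed
qed

lemma long_edge_tendsto:
  assumes \<theta>: "0 < \<theta>" "\<theta> < 1" "2 - \<gamma> < \<theta>"
  shows "(\<lambda>m. prob (long_edge m (edge_scale \<theta> m))) \<longlonglongrightarrow> 0"
proof (rule tendsto_sandwich[OF _ long_edge_prob_le[OF \<theta>] tendsto_const])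
  show "(\<lambda>m. 2 / real m ^ 2) \<longlonglongrightarrow> 0" by real_asymp
qed auto

lemma AE_short_edges:
  assumes \<theta>: "0 < \<theta>" "\<theta> < 1" "2 - \<gamma> < \<theta>"
  shows "AE \<omega> in M. eventually (\<lambda>m. dist (X (v m \<omega>) \<omega>) (X m \<omega>) \<le> edge_scale \<theta> m) sequentially"
proof -
  have "AE \<omega> in M. eventually (\<lambda>m. \<omega> \<notin> long_edge m (edge_scale \<theta> m)) sequentially"
    using long_edge_meas long_edge_prob_le[OF \<theta>] by (rule AE_eventually_of_inverse_square)
  then show ?thesis using AE_space
  proof eventually_elim
    case (elim \<omega>)
    show ?case using elim(1) by eventually_elim (use elim(2) in \<open>auto simp: long_edge_def not_less\<close>)
  qed
qed

lemma close_count_meas: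
  assumes "\<And>i. i \<in> I \<Longrightarrow> 1 \<le> i" and I: "finite I"
  shows "(\<lambda>\<omega>. real (card {i \<in> I. dist (X j \<omega>) (X i \<omega>) \<le> r i})) \<in> borel_measurable M"
proof -
  have "(\<lambda>\<omega>. (\<Sum>i\<in>I. indicator {\<omega> \<in> space M. dist (X j \<omega>) (X i \<omega>) \<le> r i} \<omega>) :: real) \<in> borel_measurable M"
    by (intro borel_measurable_sum borel_measurable_indicator) measurable
  moreover have "real (card {i \<in> I. dist (X j \<omega>) (X i \<omega>) \<le> r i}) = (\<Sum>i\<in>I. indicator {\<omega> \<in> space M. dist (X j \<omega>) (X i \<omega>) \<le> r i} \<omega>)"
    if "\<omega> \<in> space M" for \<omega>
    using that I by (simp add: indicator_def of_bool_def sum.If_cases Int_def)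
  ultimately show ?thesis by (rule measurable_cong[THEN iffD2, rotated])
qed

text \<open>Some vertex has so many later points within edge length that its degree might exceed half of the
  bound to be proved.\<close>

definition crowded :: "real \<Rightarrow> real \<Rightarrow> nat \<Rightarrow> 'a set" where
  "crowded \<theta> \<beta> n = {\<omega> \<in> space M. \<exists>j\<in>{..n}. exp (ln (real n) powr \<beta>) / 2 \<le> real (card {i \<in> {j<..n}. dist (X j \<omega>) (X i \<omega>) \<le> edge_scale \<theta> i})}"

lemma crowded_meas: "crowded \<theta> \<beta> n \<in> events"
proof -
  have [measurable]: "(\<lambda>\<omega>. real (card {i \<in> {j<..n}. dist (X j \<omega>) (X i \<omega>) \<le> edge_scale \<theta> i})) \<in> borel_measurable M" for j
    by (intro close_count_meas) auto
  show ?thesis unfolding crowded_def by measurable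
qed

text \<open>The volumes of the balls of radius \<open>edge_scale \<theta> i\<close> add up to \<open>exp
  (O((ln n)\<^bsup>\<theta>\<^esup>))\<close>, whereas the threshold for the count is \<open>exp
  ((ln n)\<^bsup>\<beta>\<^esup>) / 2\<close> with \<open>\<beta> > \<theta>\<close>; the
  exponential moment then beats the union over \<open>n + 1\<close> vertices.\<close>

lemma crowded_prob_le:
  assumes \<theta>: "0 < \<theta>" "\<theta> < \<beta>" "\<beta> < 1"
  shows "eventually (\<lambda>n. prob (crowded \<theta> \<beta> n) \<le> 1 / real n ^ 2) sequentially"
proof -
  define D where "D = real DIM('c)"
  have D: "0 < D" by (simp add: D_def)
  define C where "C = b * unit_ball_vol D"
  have C: "0 < C" using b_pos D unfolding C_def by (intro mult_pos_pos) auto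
  have 3: "eventually (\<lambda>t. 2 * t + (t + 1) + C * exp (2 * D * t powr \<theta>) * (1 + t) \<le> ln 2 * exp (t powr \<beta>) / 2) at_top"
    using \<theta> C D by real_asymp
  show ?thesis
    using eventually_ln[OF 3] eventually_ge_at_top[of 2]
  proof eventually_elim
    case (elim n)
    define t where "t = ln (real n)"
    have m: "real n = exp t" "0 \<le> t" using elim(2) by (auto simp: t_def)
    define k where "k = nat \<lceil>exp (t powr \<beta>) / 2\<rceil>"
    let ?E = "\<lambda>j. {\<omega> \<in> space M. k \<le> card {i \<in> {j<..n}. dist (X j \<omega>) (X i \<omega>) \<le> edge_scale \<theta> i}}"
    have eq: "crowded \<theta> \<beta> n = (\<Union>j\<in>{..n}. ?E j)"
      unfolding crowded_def k_def t_def[symmetric] by (auto simp: nat_le_iff ceiling_le_iff)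
    have Em: "?E j \<in> events" for j
    proof -
      have [measurable]: "(\<lambda>\<omega>. real (card {i \<in> {j<..n}. dist (X j \<omega>) (X i \<omega>) \<le> edge_scale \<theta> i})) \<in> borel_measurable M"
        by (intro close_count_meas) auto
      have "?E j = {\<omega> \<in> space M. real k \<le> real (card {i \<in> {j<..n}. dist (X j \<omega>) (X i \<omega>) \<le> edge_scale \<theta> i})}" by simp
      also have "\<dots> \<in> events" by measurable
      finally show ?thesis .
    qed
    define s where "s = C * exp (2 * D * t powr \<theta>) * (1 + t)"
    have sum: "(\<Sum>i\<in>{j<..n}. b * unit_ball_vol D * edge_scale \<theta> i ^ DIM('c)) \<le> s" for j
    proof -
      have "(\<Sum>i\<in>{j<..n}. b * unit_ball_vol D * edge_scale \<theta> i ^ DIM('c)) \<le> (\<Sum>i\<in>{j<..n}. C * exp (2 * D * t powr \<theta>) * (1 / real i))"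
      proof (rule sum_mono)
        fix i assume i: "i \<in> {j<..n}"
        then have "ln (real i) \<le> t" "0 \<le> ln (real i)" unfolding t_def by auto
        then have "ln (real i) powr \<theta> \<le> t powr \<theta>" using \<theta> by (intro powr_mono2) auto
        then have "exp (2 * D * ln (real i) powr \<theta>) \<le> exp (2 * D * t powr \<theta>)" using D by simp
        then have "exp (2 * D * ln (real i) powr \<theta>) / real i \<le> exp (2 * D * t powr \<theta>) * (1 / real i)" using i by (simp add: divide_right_mono)
        moreover have "edge_scale \<theta> i ^ DIM('c) = exp (2 * D * ln (real i) powr \<theta>) / real i"
          using i unfolding D_def by (intro edge_scale_power) auto
        ultimately show "b * unit_ball_vol D * edge_scale \<theta> i ^ DIM('c) \<le> C * exp (2 * D * t powr \<theta>) * (1 / real i)"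
          unfolding C_def[symmetric] mult.assoc using C by (intro mult_left_mono) auto
      qed
      also have "\<dots> = C * exp (2 * D * t powr \<theta>) * (\<Sum>i\<in>{j<..n}. 1 / real i)" by (rule sum_distrib_left[symmetric])
      also have "(\<Sum>i\<in>{j<..n}. 1 / real i) \<le> (\<Sum>i\<in>{1..n}. 1 / real i)" by (intro sum_mono2) auto
      also have "\<dots> \<le> 1 + t" unfolding t_def using elim(2) by (intro sum_inverse_le_ln) auto
      finally show ?thesis unfolding s_def using C by (simp add: mult_left_mono)
    qed
    have k: "exp (t powr \<beta>) / 2 \<le> real k" unfolding k_def by linarith
    have each: "prob (?E j) \<le> exp (- (2 * t) - (t + 1))" for j
    proof -
      have "prob (?E j) \<le> exp (\<Sum>i\<in>{j<..n}. b * unit_ball_vol D * edge_scale \<theta> i ^ DIM('c)) / 2 ^ k"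
        unfolding D_def by (rule many_close_prob) (auto simp: edge_scale_def)
      also have "\<dots> \<le> exp s / 2 ^ k" using sum by (intro divide_right_mono) auto
      also have "2 ^ k = exp (ln 2 * real k)" by (simp add: exp_of_nat2_mult)
      also have "exp s / exp (ln 2 * real k) = exp (s - ln 2 * real k)" by (simp add: exp_diff)
      also have "\<dots> \<le> exp (- (2 * t) - (t + 1))"
      proof -
        have "ln 2 * (exp (t powr \<beta>) / 2) \<le> ln 2 * real k" using k by (intro mult_left_mono) auto
        moreover have "2 * t + (t + 1) + s \<le> ln 2 * exp (t powr \<beta>) / 2" using elim(1) unfolding s_def t_def .
        ultimately show ?thesis unfolding exp_le_cancel_iff by linarith
      qed
      finally show ?thesis .
    qed
    have "prob (crowded \<theta> \<beta> n) \<le> (\<Sum>j\<in>{..n}. prob (?E j))"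
      unfolding eq using Em by (intro measure_UNION_le) auto
    also have "\<dots> \<le> (\<Sum>j\<in>{..n}. exp (- (2 * t) - (t + 1)))" by (intro sum_mono each)
    also have "\<dots> = real (Suc n) * exp (- (2 * t) - (t + 1))" by simp
    also have "\<dots> \<le> exp (t + 1) * exp (- (2 * t) - (t + 1))"
    proof (rule mult_right_mono)
      have "1 \<le> exp t" "2 \<le> exp (1::real)" using m exp_ge_add_one_self[of 1] by auto
      then have "exp t * 2 \<le> exp t * exp 1" by (intro mult_left_mono) auto
      then show "real (Suc n) \<le> exp (t + 1)" 
        unfolding exp_add using m(1) \<open>1 \<le> exp t\<close> by linarith
    qed simp
    also have "\<dots> = exp (- (2 * t))" by (simp add: exp_add[symmetric])
    also have "\<dots> = 1 / real n ^ 2" by (simp add: m exp_of_nat_mult[symmetric] exp_minus field_simps)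
    finally show ?case .
  qed
qed

text \<open>Finitely many edges are long; all others come from points within edge length. Half of the bound
  is left for the finitely many exceptions.\<close>

theorem AE_max_degree_le:
  assumes \<beta>: "0 < \<beta>" "\<beta> < 1" "2 - \<gamma> < \<beta>"
  shows "AE \<omega> in M. eventually (\<lambda>n. real (MAX i\<in>{0..n}. deg n \<omega> i) \<le> exp (ln (real n) powr \<beta>)) sequentially"
proof -
  define \<theta> where "\<theta> = (max 0 (2 - \<gamma>) + \<beta>) / 2"
  have \<theta>: "0 < \<theta>" "\<theta> < \<beta>" "\<theta> < 1" "2 - \<gamma> < \<theta>" using \<beta> unfolding \<theta>_def by (auto simp: max_def)
  have "AE \<omega> in M. eventually (\<lambda>n. \<omega> \<notin> crowded \<theta> \<beta> n) sequentially"
    by (rule AE_eventually_of_inverse_square[OF crowded_meas crowded_prob_le[OF \<theta>(1,2) \<beta>(2)]])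
  then show ?thesis using AE_short_edges[OF \<theta>(1,3,4)] AE_space
  proof eventually_elim
    case (elim \<omega>)
    obtain n0 where n0: "\<And>m. n0 \<le> m \<Longrightarrow> dist (X (v m \<omega>) \<omega>) (X m \<omega>) \<le> edge_scale \<theta> m"
      using elim(2) unfolding eventually_sequentially by blast
    have "eventually (\<lambda>t. 3 + real n0 + exp (t powr \<beta>) / 2 \<le> exp (t powr \<beta>)) at_top" using \<beta> by real_asymp
    from eventually_ln[OF this] elim(1) show ?case
    proof eventually_elim
      case (elim n)
      have "real (deg n \<omega> j) \<le> exp (ln (real n) powr \<beta>)" if j: "j \<in> {0..n}" for j
      proof -
        let ?K = "{i \<in> {j<..n}. dist (X j \<omega>) (X i \<omega>) \<le> edge_scale \<theta> i}"
        have "{i \<in> {1..n}. v i \<omega> = j} \<subseteq> {..<n0} \<union> ?K"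
        proof
          fix i assume i: "i \<in> {i \<in> {1..n}. v i \<omega> = j}"
          then have "j < i" using v_less[OF \<open>\<omega> \<in> space M\<close>, of i] by simp
          then show "i \<in> {..<n0} \<union> ?K" using i n0[of i] by (cases "i < n0") auto
        qed
        then have "card {i \<in> {1..n}. v i \<omega> = j} \<le> card ({..<n0} \<union> ?K)" by (intro card_mono) auto
        also have "\<dots> \<le> n0 + card ?K" using card_Un_le[of "{..<n0}" ?K] by simp
        finally have "real (card {i \<in> {1..n}. v i \<omega> = j}) \<le> real n0 + real (card ?K)" by linarith
        moreover have "real (card ?K) < exp (ln (real n) powr \<beta>) / 2"
        proof (rule ccontr)
          assume "\<not> ?thesis"
          then have "exp (ln (real n) powr \<beta>) / 2 \<le> real (card ?K)" by simp
          moreover have "j \<in> {..n}" using j by simp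
          ultimately have "\<omega> \<in> crowded \<theta> \<beta> n" using \<open>\<omega> \<in> space M\<close> unfolding crowded_def by blast
          then show False using elim(2) by blast
        qed
        moreover have "real (deg n \<omega> j) \<le> 1 + real (card {i \<in> {1..n}. v i \<omega> = j})"
        proof -
          have "deg n \<omega> j = (if 1 \<le> j then 1 else 0) + card {i \<in> {1..n}. v i \<omega> = j}"
            using j \<open>\<omega> \<in> space M\<close> by (intro attachment_degree_eq v_less) auto
          then show ?thesis by simp
        qed
        ultimately show ?thesis using elim(1) by linarith
      qed
      moreover have "(MAX i\<in>{0..n}. deg n \<omega> i) \<in> (\<lambda>i. deg n \<omega> i) ` {0..n}" by (intro Max_in) auto
      ultimately show ?case by (metis (mono_tags, lifting) imageE)
    qed
  qed
qed

end

section \<open>Attachment to the nearest neighbour\<close>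

lemma online_nn_eq_choice:
  "online_nn x n = (SOME i. i \<in> {i \<in> {..<n}. \<forall>l\<in>{..<n}. dist (x n) (x i) \<le> dist (x n) (x l)})"
  unfolding online_nn_def arg_min_on_def arg_min_def is_arg_min_def
  by (rule arg_cong[where f=Eps]) (auto simp: not_less fun_eq_iff, meson not_le)

lemma online_nn_nearest:
  assumes "1 \<le> n" shows "online_nn x n < n" "l < n \<Longrightarrow> dist (x n) (x (online_nn x n)) \<le> dist (x n) (x l)"
proof -
  have ne: "{0..<n} \<noteq> {}" using assms by auto
  show "online_nn x n < n"
    using arg_min_if_finite(1)[OF _ ne, of "\<lambda>i. dist (x n) (x i)"] unfolding online_nn_def by simp
  show "dist (x n) (x (online_nn x n)) \<le> dist (x n) (x l)" if "l < n"
  proof (rule ccontr)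
    assume "\<not> ?thesis"
    then show False
      using arg_min_if_finite(2)[OF _ ne, of "\<lambda>i. dist (x n) (x i)"] that unfolding online_nn_def by (auto simp: not_le)
  qed
qed

context gpa_graph begin

text \<open>The nearest neighbour is a choice from the set of minimisers, so the event is a finite union
  over the possible sets of minimisers.\<close>

lemma online_nn_event: "{\<omega> \<in> space M. online_nn (\<lambda>i. X i \<omega>) n = j} \<in> events"
proof -
  let ?E = "\<lambda>T. {\<omega> \<in> space M. \<forall>i\<in>{..<n}. i \<in> T \<longleftrightarrow> (\<forall>l\<in>{..<n}. dist (X n \<omega>) (X i \<omega>) \<le> dist (X n \<omega>) (X l \<omega>))}"
  let ?T = "\<lambda>\<omega>. {i \<in> {..<n}. \<forall>l\<in>{..<n}. dist (X n \<omega>) (X i \<omega>) \<le> dist (X n \<omega>) (X l \<omega>)}"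
  let ?C = "{T \<in> Pow {..<n}. (SOME i. i \<in> T) = j}"
  have E: "?E T \<in> events" for T
  proof (rule sets.sets_Collect_finite_All)
    fix i
    have "{\<omega> \<in> space M. dist (X n \<omega>) (X i \<omega>) \<le> dist (X n \<omega>) (X l \<omega>)} \<in> events" for l by measurable
    then have Q: "{\<omega> \<in> space M. \<forall>l\<in>{..<n}. dist (X n \<omega>) (X i \<omega>) \<le> dist (X n \<omega>) (X l \<omega>)} \<in> events"
      by (rule sets.sets_Collect_finite_All) simp
    show "{\<omega> \<in> space M. i \<in> T \<longleftrightarrow> (\<forall>l\<in>{..<n}. dist (X n \<omega>) (X i \<omega>) \<le> dist (X n \<omega>) (X l \<omega>))} \<in> events"
    proof (cases "i \<in> T")
      case True then show ?thesis using Q by (simp only: simp_thms)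
    next
      case False then show ?thesis using sets.sets_Collect_neg[OF Q] by (simp only: simp_thms)
    qed
  qed simp
  have "{\<omega> \<in> space M. online_nn (\<lambda>i. X i \<omega>) n = j} = (\<Union>T\<in>?C. ?E T)"
  proof (intro set_eqI iffI)
    fix \<omega> assume "\<omega> \<in> {\<omega> \<in> space M. online_nn (\<lambda>i. X i \<omega>) n = j}"
    then have w: "\<omega> \<in> space M" "(SOME i. i \<in> ?T \<omega>) = j" by (simp_all only: online_nn_eq_choice mem_Collect_eq)
    have "?T \<omega> \<in> ?C" using w(2) by (simp only: mem_Collect_eq Pow_iff simp_thms) (rule Collect_subset)
    moreover have "\<omega> \<in> ?E (?T \<omega>)" using w(1) by (simp only: mem_Collect_eq) simp
    ultimately show "\<omega> \<in> (\<Union>T\<in>?C. ?E T)" by (rule UN_I)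
  next
    fix \<omega> assume "\<omega> \<in> (\<Union>T\<in>?C. ?E T)"
    then obtain T where TC: "T \<in> ?C" and TE: "\<omega> \<in> ?E T" by (rule UN_E)
    have T: "T \<subseteq> {..<n}" "(SOME i. i \<in> T) = j" using CollectD[OF TC] by (simp_all only: Pow_iff)
    have w: "\<omega> \<in> space M"
      and E: "\<forall>i\<in>{..<n}. i \<in> T \<longleftrightarrow> (\<forall>l\<in>{..<n}. dist (X n \<omega>) (X i \<omega>) \<le> dist (X n \<omega>) (X l \<omega>))"
      using CollectD[OF TE] by (rule conjunct1, rule conjunct2)
    have "T = ?T \<omega>"
    proof (intro set_eqI iffI)
      fix i assume "i \<in> T"
      then have "i \<in> {..<n}" using T(1) by (rule subsetD[rotated])
      then show "i \<in> ?T \<omega>" using bspec[OF E] \<open>i \<in> T\<close> by simp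
    next
      fix i assume "i \<in> ?T \<omega>"
      then show "i \<in> T" using bspec[OF E, of i] by simp
    qed
    then have "(SOME i. i \<in> ?T \<omega>) = j" using T(2) by simp
    then show "\<omega> \<in> {\<omega> \<in> space M. online_nn (\<lambda>i. X i \<omega>) n = j}" using w by (simp only: online_nn_eq_choice mem_Collect_eq simp_thms)
  qed
  also have "\<dots> \<in> events"
  proof (rule sets.finite_UN[OF _ E])
    show "finite ?C" by (rule finite_subset[of _ "Pow {..<n}"]) auto
  qed
  finally show ?thesis .
qed

definition misattached :: "nat \<Rightarrow> 'a set" where
  "misattached m = {\<omega> \<in> space M. v m \<omega> \<noteq> online_nn (\<lambda>i. X i \<omega>) m}"

lemma misattached_meas: assumes "1 \<le> m" shows "misattached m \<in> events"
proof -
  have "misattached m = space M - (\<Union>j\<in>{..<m}. {\<omega> \<in> space M. v m \<omega> = j} \<inter> {\<omega> \<in> space M. online_nn (\<lambda>i. X i \<omega>) m = j})"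
    using online_nn_nearest(1)[OF assms] by (auto simp: misattached_def)
  also have "\<dots> \<in> events"
  proof (intro sets.compl_sets sets.finite_UN sets.Int online_nn_event)
    have [measurable]: "v m \<in> measurable M (count_space UNIV)" by (rule v_meas[OF assms])
    show "{\<omega> \<in> space M. v m \<omega> = j} \<in> events" for j by measurable
  qed simp
  finally show ?thesis .
qed

lemma deg_large_meas: "{\<omega> \<in> space M. \<exists>j\<in>{..n}. E < real (deg n \<omega> j)} \<in> events"
proof -
  have "{\<omega> \<in> space M. \<exists>j\<in>{..n}. E < real (deg n \<omega> j)} = (\<Union>j\<in>{..n}. {\<omega> \<in> space M. E < real (deg n \<omega> j)})" by auto
  also have "\<dots> \<in> events"
  proof (intro sets.finite_UN)
    fix j assume "j \<in> {..n}"
    then have [measurable]: "(\<lambda>\<omega>. real (deg n \<omega> j)) \<in> borel_measurable M" by (intro degree_meas) auto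
    show "{\<omega> \<in> space M. E < real (deg n \<omega> j)} \<in> events" by measurable
  qed simp
  finally show ?thesis .
qed

text \<open>On \<open>A\<close> the vertex \<open>j\<close> has moderate degree and is within edge length,
  but some vertex is closer to the new one by a factor \<open>1 + e\<close>. The bound is the
  handicap times the probability that \<open>j\<close> is within edge length at all; the latter
  compensates the sum over all \<open>j\<close>.\<close>

lemma clear_winner_prob:
  assumes n: "1 \<le> n" "j \<le> n" and R: "0 < R" "R \<le> 1" and e: "0 \<le> e" and l: "0 < l" "l \<le> 1" and E: "0 \<le> E"
  defines "A \<equiv> {\<omega> \<in> space M. dist (X j \<omega>) (X (Suc n) \<omega>) \<le> l \<and> real (deg n \<omega> j) \<le> E \<and>
      (\<exists>i\<in>{..n}. 0 < dist (X i \<omega>) (X (Suc n) \<omega>) \<and> dist (X i \<omega>) (X (Suc n) \<omega>) < R \<and> (1 + e) * dist (X i \<omega>) (X (Suc n) \<omega>) < dist (X j \<omega>) (X (Suc n) \<omega>))}"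
  shows "A \<in> events" "prob (A \<inter> {\<omega> \<in> space M. v (Suc n) \<omega> = j})
    \<le> E * exp (- (ln (1 + e) * ln (1 / R) powr (\<gamma> - 1))) * (b * unit_ball_vol DIM('c) * l ^ DIM('c))"
proof -
  let ?q = "E * exp (- (ln (1 + e) * ln (1 / R) powr (\<gamma> - 1)))"
  have Ah: "A \<in> sets (hist (Suc n) n)"
  proof -
    have [measurable]: "(\<lambda>\<omega>. dist (X i \<omega>) (X (Suc n) \<omega>)) \<in> borel_measurable (hist (Suc n) n)" if "i \<in> {..n}" for i
      using that by (intro dist_hist) auto
    have [measurable]: "(\<lambda>\<omega>. dist (X j \<omega>) (X (Suc n) \<omega>)) \<in> borel_measurable (hist (Suc n) n)" using n(2) by (intro dist_hist) auto
    have [measurable]: "(\<lambda>\<omega>. real (deg n \<omega> j)) \<in> borel_measurable (hist (Suc n) n)" by (rule degree_hist[OF n(2)])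
    have "{\<omega> \<in> space (hist (Suc n) n). dist (X j \<omega>) (X (Suc n) \<omega>) \<le> l \<and> real (deg n \<omega> j) \<le> E \<and>
      (\<exists>i\<in>{..n}. 0 < dist (X i \<omega>) (X (Suc n) \<omega>) \<and> dist (X i \<omega>) (X (Suc n) \<omega>) < R \<and> (1 + e) * dist (X i \<omega>) (X (Suc n) \<omega>) < dist (X j \<omega>) (X (Suc n) \<omega>))} \<in> sets (hist (Suc n) n)"
      by measurable
    then show ?thesis by (simp only: A_def space_hist)
  qed
  then show AM: "A \<in> events" using hist_subalgebra by (auto simp: subalgebra_def)
  have q0: "0 \<le> ?q" using E by simp
  have "prob (A \<inter> {\<omega> \<in> space M. v (Suc n) \<omega> = j}) \<le> ?q * prob A"
  proof (rule attachment_event_le[OF n Ah q0])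
    fix \<omega> assume "\<omega> \<in> A"
    then obtain i where i: "i \<le> n" "0 < dist (X i \<omega>) (X (Suc n) \<omega>)" "dist (X i \<omega>) (X (Suc n) \<omega>) < R"
        "(1 + e) * dist (X i \<omega>) (X (Suc n) \<omega>) < dist (X j \<omega>) (X (Suc n) \<omega>)"
      and w: "\<omega> \<in> space M" "dist (X j \<omega>) (X (Suc n) \<omega>) \<le> l" "real (deg n \<omega> j) \<le> E"
      unfolding A_def by auto
    define d where "d = dist (X i \<omega>) (X (Suc n) \<omega>)"
    define d' where "d' = dist (X j \<omega>) (X (Suc n) \<omega>)"
    have d: "0 < d" "d < R" "(1 + e) * d < d'" "d' \<le> l" using i w by (simp_all add: d_def d'_def)
    have d1: "d \<le> (1 + e) * d" using d(1) e by (simp add: algebra_simps)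
    have Fp: "0 < F_attract \<gamma> x" for x using F_attract_ge_1[of \<gamma> x] by linarith
    have "F_attract \<gamma> d' / F_attract \<gamma> d \<le> F_attract \<gamma> ((1 + e) * d) / F_attract \<gamma> d"
      using d d1 \<gamma> by (intro divide_right_mono F_attract_antimono less_imp_le[OF Fp]) auto
    also have "\<dots> \<le> exp (- (ln ((1 + e) * d / d) * ln (1 / d) powr (\<gamma> - 1)))"
      using d d1 \<gamma> l by (intro F_attract_ratio) auto
    also have "(1 + e) * d / d = 1 + e" using d by simp
    also have "exp (- (ln (1 + e) * ln (1 / d) powr (\<gamma> - 1))) \<le> exp (- (ln (1 + e) * ln (1 / R) powr (\<gamma> - 1)))"
    proof -
      have "0 \<le> ln (1 / R)" using R by (simp add: ln_div)
      moreover have "ln (1 / R) \<le> ln (1 / d)" using R d by (simp add: ln_div)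
      ultimately have "ln (1 / R) powr (\<gamma> - 1) \<le> ln (1 / d) powr (\<gamma> - 1)" using \<gamma> by (intro powr_mono2) auto
      then show ?thesis using e by (simp add: mult_left_mono)
    qed
    finally have ratio: "F_attract \<gamma> d' / F_attract \<gamma> d \<le> exp (- (ln (1 + e) * ln (1 / R) powr (\<gamma> - 1)))" .
    have "attach_prob n \<omega> j \<le> real (deg n \<omega> j) * (F_attract \<gamma> d' / F_attract \<gamma> d)"
      unfolding d_def d'_def by (rule attach_prob_le[OF w(1) n(1) i(1)])
    also have "\<dots> \<le> ?q"
      using w(3) ratio E Fp by (intro mult_mono) (simp_all add: less_imp_le)
    finally show "attach_prob n \<omega> j \<le> ?q" .
  qed
  also have "prob A \<le> prob {\<omega> \<in> space M. dist (X j \<omega>) (X (Suc n) \<omega>) \<le> l}"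
    unfolding A_def by (rule finite_measure_mono) (auto, measurable)
  also have "\<dots> \<le> b * unit_ball_vol DIM('c) * l ^ DIM('c)"
    using n l by (intro close_prob) auto
  finally show "prob (A \<inter> {\<omega> \<in> space M. v (Suc n) \<omega> = j}) \<le> ?q * (b * unit_ball_vol DIM('c) * l ^ DIM('c))"
    using q0 by (simp add: mult_left_mono)
qed

lemma near_ties_prob:
  fixes n :: nat
  assumes "0 \<le> R" "0 \<le> e"
  defines "T \<equiv> {\<omega> \<in> space M. \<exists>i\<in>{..n}. \<exists>j\<in>{..n} - {i}. dist (X (Suc n) \<omega>) (X i \<omega>) \<le> R \<and> dist (X (Suc n) \<omega>) (X i \<omega>) \<le> dist (X (Suc n) \<omega>) (X j \<omega>)
       \<and> dist (X (Suc n) \<omega>) (X j \<omega>) \<le> (1 + e) * dist (X (Suc n) \<omega>) (X i \<omega>)}"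
  shows "T \<in> events" "prob T \<le> (b * unit_ball_vol DIM('c)) ^ 2 * (real (Suc n) * R ^ DIM('c)) ^ 2 * ((1 + e) ^ DIM('c) - 1)"
proof -
  define C where "C = b * unit_ball_vol DIM('c)"
  let ?c = "C * R ^ DIM('c) * (C * ((1 + e) ^ DIM('c) - 1) * R ^ DIM('c))"
  let ?A = "\<lambda>i j. {\<omega> \<in> space M. dist (X (Suc n) \<omega>) (X i \<omega>) \<le> R \<and> dist (X (Suc n) \<omega>) (X i \<omega>) \<le> dist (X (Suc n) \<omega>) (X j \<omega>)
       \<and> dist (X (Suc n) \<omega>) (X j \<omega>) \<le> (1 + e) * dist (X (Suc n) \<omega>) (X i \<omega>)}"
  have A: "?A i j \<in> events" for i j by measurable
  have C0: "0 \<le> C" unfolding C_def using b_pos by simp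
  have "1 \<le> (1 + e) ^ DIM('c)" using assms by (intro one_le_power) simp
  then have c0: "0 \<le> ?c" using C0 assms by simp
  have T: "T = (\<Union>i\<in>{..n}. \<Union>j\<in>{..n} - {i}. ?A i j)" unfolding T_def by blast
  then show "T \<in> events" using A by (simp add: sets.finite_UN)
  have "prob T \<le> (\<Sum>i\<in>{..n}. prob (\<Union>j\<in>{..n} - {i}. ?A i j))"
    unfolding T using A by (intro measure_UNION_le sets.finite_UN) auto
  also have "\<dots> \<le> (\<Sum>i\<in>{..n}. \<Sum>j\<in>{..n}. ?c)"
  proof (rule sum_mono)
    fix i assume i: "i \<in> {..n}"
    have "prob (\<Union>j\<in>{..n} - {i}. ?A i j) \<le> (\<Sum>j\<in>{..n} - {i}. prob (?A i j))"
      using A by (intro measure_UNION_le) auto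
    also have "\<dots> \<le> (\<Sum>j\<in>{..n} - {i}. ?c)"
      using i assms unfolding C_def by (intro sum_mono near_tie_prob) auto
    also have "\<dots> \<le> (\<Sum>j\<in>{..n}. ?c)" using c0 by (intro sum_mono2) auto
    finally show "prob (\<Union>j\<in>{..n} - {i}. ?A i j) \<le> (\<Sum>j\<in>{..n}. ?c)" .
  qed
  also have "\<dots> = C ^ 2 * (real (Suc n) * R ^ DIM('c)) ^ 2 * ((1 + e) ^ DIM('c) - 1)"
    by (simp add: power2_eq_square)
  finally show "prob T \<le> (b * unit_ball_vol DIM('c)) ^ 2 * (real (Suc n) * R ^ DIM('c)) ^ 2 * ((1 + e) ^ DIM('c) - 1)"
    unfolding C_def .
qed

text \<open>If the new vertex does not join its nearest neighbour, then it is isolated, or there is a near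
  tie, or some degree is large, or the edge is long, or it joins a vertex that is clearly beaten.\<close>

lemma misattached_prob_le:
  assumes n: "1 \<le> n" and R: "0 < R" "R \<le> 1" and e: "0 \<le> e" and l: "0 < l" "l \<le> 1" and E: "0 \<le> E"
  defines "C \<equiv> b * unit_ball_vol DIM('c)"
  shows "prob (misattached (Suc n)) \<le> prob (isolated (Suc n) R) + C ^ 2 * (real (Suc n) * R ^ DIM('c)) ^ 2 * ((1 + e) ^ DIM('c) - 1)
    + prob {\<omega> \<in> space M. \<exists>j\<in>{..n}. E < real (deg n \<omega> j)} + prob (long_edge (Suc n) l)
    + real (Suc n) * (E * exp (- (ln (1 + e) * ln (1 / R) powr (\<gamma> - 1))) * (C * l ^ DIM('c)))"
proof -
  let ?m = "Suc n"
  define T where "T = {\<omega> \<in> space M. \<exists>i\<in>{..n}. \<exists>j\<in>{..n} - {i}. dist (X ?m \<omega>) (X i \<omega>) \<le> R \<and> dist (X ?m \<omega>) (X i \<omega>) \<le> dist (X ?m \<omega>) (X j \<omega>)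
       \<and> dist (X ?m \<omega>) (X j \<omega>) \<le> (1 + e) * dist (X ?m \<omega>) (X i \<omega>)}"
  define G where "G = {\<omega> \<in> space M. \<exists>j\<in>{..n}. E < real (deg n \<omega> j)}"
  define A where "A j = {\<omega> \<in> space M. dist (X j \<omega>) (X ?m \<omega>) \<le> l \<and> real (deg n \<omega> j) \<le> E \<and>
      (\<exists>i\<in>{..n}. 0 < dist (X i \<omega>) (X ?m \<omega>) \<and> dist (X i \<omega>) (X ?m \<omega>) < R \<and> (1 + e) * dist (X i \<omega>) (X ?m \<omega>) < dist (X j \<omega>) (X ?m \<omega>))}" for j
  let ?B = "\<lambda>j. A j \<inter> {\<omega> \<in> space M. v ?m \<omega> = j}"
  let ?c = "E * exp (- (ln (1 + e) * ln (1 / R) powr (\<gamma> - 1))) * (C * l ^ DIM('c))"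
  have Im: "isolated ?m R \<in> events" by simp
  have Tm: "T \<in> events" and Tp: "prob T \<le> C ^ 2 * (real (Suc n) * R ^ DIM('c)) ^ 2 * ((1 + e) ^ DIM('c) - 1)"
    unfolding T_def C_def using near_ties_prob R e by (blast intro: less_imp_le)+
  have Gm: "G \<in> events" unfolding G_def by (rule deg_large_meas)
  have Lm: "long_edge ?m l \<in> events" by (rule long_edge_meas) simp
  have Bm: "?B j \<in> events" if "j \<in> {..n}" for j
  proof -
    have "A j \<in> events" unfolding A_def using that by (intro clear_winner_prob(1) n R e l E) auto
    moreover have "{\<omega> \<in> space M. v ?m \<omega> = j} \<in> events" by measurable
    ultimately show ?thesis by (rule sets.Int)
  qed
  have Bu: "(\<Union>j\<in>{..n}. ?B j) \<in> events" using Bm by (intro sets.finite_UN) auto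
  have "AE \<omega> in M. \<omega> \<in> misattached ?m \<longrightarrow> \<omega> \<in> isolated ?m R \<union> T \<union> G \<union> long_edge ?m l \<union> (\<Union>j\<in>{..n}. ?B j)"
    using AE_no_ties AE_space
  proof eventually_elim
    case (elim \<omega>)
    show ?case
    proof (intro impI, rule ccontr)
      assume mis: "\<omega> \<in> misattached ?m" and no: "\<omega> \<notin> isolated ?m R \<union> T \<union> G \<union> long_edge ?m l \<union> (\<Union>j\<in>{..n}. ?B j)"
      define i where "i = online_nn (\<lambda>i. X i \<omega>) ?m"
      define j where "j = v ?m \<omega>"
      have ij: "i < ?m" "j < ?m" "j \<noteq> i" using mis v_less[OF elim(2), of ?m] online_nn_nearest(1)[of ?m "\<lambda>i. X i \<omega>"]
        by (simp_all add: i_def j_def misattached_def)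
      have near: "dist (X ?m \<omega>) (X i \<omega>) \<le> dist (X ?m \<omega>) (X l \<omega>)" if "l < ?m" for l
        unfolding i_def by (rule online_nn_nearest(2)) (use that in simp_all)
      obtain i0 where i0: "i0 < ?m" "dist (X i0 \<omega>) (X ?m \<omega>) < R" using no elim(2) unfolding isolated_def by blast
      have dR: "dist (X ?m \<omega>) (X i \<omega>) < R" using near[OF i0(1)] i0(2) by (simp add: dist_commute)
      have "X i \<omega> \<noteq> X ?m \<omega>" using elim(1) ij by metis
      then have d0: "0 < dist (X i \<omega>) (X ?m \<omega>)" by simp
      have in': "i \<in> {..n}" "j \<in> {..n}" "j \<in> {..n} - {i}" using ij by auto
      have gap: "(1 + e) * dist (X ?m \<omega>) (X i \<omega>) < dist (X ?m \<omega>) (X j \<omega>)"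
      proof (rule ccontr)
        assume "\<not> ?thesis"
        then have "dist (X ?m \<omega>) (X j \<omega>) \<le> (1 + e) * dist (X ?m \<omega>) (X i \<omega>)" by simp
        then have "\<omega> \<in> T" unfolding T_def using in' near[OF ij(2)] less_imp_le[OF dR] elim(2) by blast
        then show False using no by blast
      qed
      have small: "real (deg n \<omega> j) \<le> E"
      proof (rule ccontr)
        assume "\<not> ?thesis"
        then have "E < real (deg n \<omega> j)" by simp
        then have "\<omega> \<in> G" unfolding G_def using in' elim(2) by blast
        then show False using no by blast
      qed
      have short: "dist (X j \<omega>) (X ?m \<omega>) \<le> l"
        using no elim(2) unfolding long_edge_def j_def by (simp add: not_less)
      have "\<omega> \<in> A j" unfolding A_def using elim(2) short small in'(1) d0 dR gap
        unfolding dist_commute[of "X ?m \<omega>"] by blast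
      then have "\<omega> \<in> ?B j" using elim(2) by (simp add: j_def)
      then show False using no in'(2) by blast
    qed
  qed
  then have "prob (misattached ?m) \<le> prob (isolated ?m R \<union> T \<union> G \<union> long_edge ?m l \<union> (\<Union>j\<in>{..n}. ?B j))"
    using Im Tm Gm Lm Bu by (intro finite_measure_mono_AE sets.Un)
  also have "\<dots> \<le> prob (isolated ?m R \<union> T \<union> G \<union> long_edge ?m l) + prob (\<Union>j\<in>{..n}. ?B j)"
    using Im Tm Gm Lm Bu by (intro measure_Un_le sets.Un)
  also have "prob (isolated ?m R \<union> T \<union> G \<union> long_edge ?m l) \<le> prob (isolated ?m R \<union> T \<union> G) + prob (long_edge ?m l)"
    using Im Tm Gm Lm by (intro measure_Un_le sets.Un)
  also have "prob (isolated ?m R \<union> T \<union> G) \<le> prob (isolated ?m R \<union> T) + prob G"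
    using Im Tm Gm by (intro measure_Un_le sets.Un)
  also have "prob (isolated ?m R \<union> T) \<le> prob (isolated ?m R) + prob T"
    using Im Tm by (intro measure_Un_le)
  also have "prob (\<Union>j\<in>{..n}. ?B j) \<le> (\<Sum>j\<in>{..n}. prob (?B j))"
    using Bm by (intro measure_UNION_le) auto
  also have "\<dots> \<le> (\<Sum>j\<in>{..n}. ?c)"
    unfolding A_def C_def by (intro sum_mono clear_winner_prob(2) n R e l E) auto
  also have "\<dots> = real ?m * ?c" by simp
  finally show ?thesis using Tp unfolding G_def by linarith
qed

lemma max_degree_prob_tendsto:
  assumes \<beta>: "0 < \<beta>" "\<beta> < 1" "2 - \<gamma> < \<beta>"
  shows "(\<lambda>n. prob {\<omega> \<in> space M. \<exists>j\<in>{..n}. exp (ln (real n) powr \<beta>) < real (deg n \<omega> j)}) \<longlonglongrightarrow> 0"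
proof (rule eventually_prob_tendsto_0[OF deg_large_meas])
  show "AE \<omega> in M. eventually (\<lambda>n. \<omega> \<notin> {\<omega> \<in> space M. \<exists>j\<in>{..n}. exp (ln (real n) powr \<beta>) < real (deg n \<omega> j)}) sequentially"
    using AE_max_degree_le[OF \<beta>]
  proof eventually_elim
    case (elim \<omega>)
    then show ?case
    proof eventually_elim
      case (elim n)
      have "real (deg n \<omega> j) \<le> exp (ln (real n) powr \<beta>)" if "j \<in> {..n}" for j
      proof -
        have "deg n \<omega> j \<le> (MAX i\<in>{0..n}. deg n \<omega> i)" using that by (intro Max_ge) auto
        then show ?thesis using elim by linarith
      qed
      then show ?case by (auto simp: not_less)
    qed
  qed
qed

text \<open>With \<open>t = ln m\<close>, take \<open>R\<close> such that \<open>m R\<^bsup>d\<^esup> =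
  t\<^bsup>k\<^esup>\<close> and tolerance \<open>e = t\<^bsup>-3k\<^esup>\<close>: isolation
  within \<open>R\<close> costs \<open>exp (- c t\<^bsup>k\<^esup>)\<close>, near ties cost
  \<open>O(t\<^bsup>2k\<^esup> t\<^bsup>-3k\<^esup>)\<close>, and the handicap exponent
  \<open>t\<^bsup>\<gamma>-1-3k\<^esup>\<close> dominates \<open>t\<^bsup>\<beta>\<^esup>\<close>
  and \<open>t\<^bsup>\<theta>\<^esup>\<close>, because \<open>k = (\<gamma> - 1 - \<beta>) /
  6\<close>.\<close>

theorem misattached_prob_tendsto:
  assumes g: "3 / 2 < \<gamma>"
  shows "(\<lambda>m. prob (misattached m)) \<longlonglongrightarrow> 0"
proof -
  define D where "D = real DIM('c)"
  have D: "0 < D" by (simp add: D_def)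
  define C where "C = b * unit_ball_vol D"
  have C: "0 < C" using b_pos D unfolding C_def by (intro mult_pos_pos) auto
  obtain c where c: "0 < c" "c \<le> 1" "\<And>x r. x \<in> S \<Longrightarrow> 0 < r \<Longrightarrow> r \<le> 1 \<Longrightarrow> c * r ^ DIM('c) \<le> measure \<mu> {y. 0 < dist y x \<and> dist y x < r}"
    using \<mu>_ball_ge by blast
  define \<beta> where "\<beta> = (max 0 (2 - \<gamma>) + min 1 (\<gamma> - 1)) / 2"
  have \<beta>: "0 < \<beta>" "\<beta> < 1" "2 - \<gamma> < \<beta>" "max 0 (2 - \<gamma>) < \<beta>" "\<beta> < \<gamma> - 1" using g unfolding \<beta>_def by (auto simp: max_def min_def)
  define \<theta> where "\<theta> = (max 0 (2 - \<gamma>) + \<beta>) / 2"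
  have \<theta>: "0 < \<theta>" "\<theta> < \<beta>" "\<theta> < 1" "2 - \<gamma> < \<theta>" using \<beta> unfolding \<theta>_def by (auto simp: max_def)
  \<comment> \<open>a sixth leaves half of the gap between \<open>\<beta>\<close> and \<open>\<gamma> - 1\<close> after the tolerance has taken \<open>3 k\<close>\<close>
  define k where "k = (\<gamma> - 1 - \<beta>) / 6"
  define g1 where "g1 = \<gamma> - 1"
  have k: "0 < k" "\<beta> + 3 * k < g1" using \<beta> by (simp_all add: k_def g1_def field_simps)
  \<comment> \<open>the competitors within edge length, their degrees and their handicap\<close>
  have a4: "((\<lambda>t. C * exp (2 * D * t powr \<theta> + t powr \<beta> - (t powr (- (3 * k)) / 2) * (t / (2 * D)) powr g1)) \<longlongrightarrow> 0) at_top"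
    using C D \<theta>(1,2) \<beta>(1,2) k by real_asymp
  have a5: "((\<lambda>t. C ^ 2 * (t powr k) ^ 2 * ((1 + t powr (- (3 * k))) ^ DIM('c) - 1)) \<longlongrightarrow> 0) at_top"
    using C k(1) by real_asymp
  have a6: "((\<lambda>t. exp (- (c * t powr k))) \<longlongrightarrow> 0) at_top" using c k(1) by real_asymp
  have e1: "eventually (\<lambda>t. t / (2 * D) \<le> (t - k * ln t) / D) at_top" using D k(1) by real_asymp
  have e2: "eventually (\<lambda>t. t powr (- (3 * k)) \<le> 1 / 2) at_top" using k(1) by real_asymp
  have e3: "eventually (\<lambda>t. - t / D + 2 * t powr \<theta> \<le> 0) at_top" using \<theta> D by real_asymp
  have lt: "filterlim (\<lambda>m. ln (real m)) at_top sequentially" by real_asymp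
  define U where "U m = exp (- (c * ln (real m) powr k))
     + C ^ 2 * (ln (real m) powr k) ^ 2 * ((1 + ln (real m) powr (- (3 * k))) ^ DIM('c) - 1)
     + prob {\<omega> \<in> space M. \<exists>j\<in>{..m - 1}. exp (ln (real (m - 1)) powr \<beta>) < real (deg (m - 1) \<omega> j)}
     + prob (long_edge m (edge_scale \<theta> m))
     + C * exp (2 * D * ln (real m) powr \<theta> + ln (real m) powr \<beta> - (ln (real m) powr (- (3 * k)) / 2) * (ln (real m) / (2 * D)) powr g1)" for m
  have "U \<longlonglongrightarrow> 0 + 0 + 0 + 0 + 0"
    unfolding U_def
  proof (intro tendsto_add)
    show "(\<lambda>m. prob {\<omega> \<in> space M. \<exists>j\<in>{..m - 1}. exp (ln (real (m - 1)) powr \<beta>) < real (deg (m - 1) \<omega> j)}) \<longlonglongrightarrow> 0"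
      using max_degree_prob_tendsto[OF \<beta>(1-3)] by (subst filterlim_sequentially_Suc[symmetric]) simp
    show "(\<lambda>m. prob (long_edge m (edge_scale \<theta> m))) \<longlonglongrightarrow> 0" by (rule long_edge_tendsto[OF \<theta>(1,3,4)])
  qed (rule filterlim_compose[OF a6 lt] filterlim_compose[OF a5 lt] filterlim_compose[OF a4 lt])+
  then have U0: "U \<longlonglongrightarrow> 0" by simp
  have bound: "eventually (\<lambda>m. prob (misattached m) \<le> U m) sequentially"
    using eventually_ln[OF e1] eventually_ln[OF e2] eventually_ln[OF e3] eventually_ge_at_top[of 3]
  proof eventually_elim
    case (elim m)
    define t where "t = ln (real m)"
    obtain n where mn: "m = Suc n" "1 \<le> n" using elim(4) by (cases m) auto
    have "exp 1 \<le> real m" using elim(4) exp_le by (auto intro: order_trans)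
    then have "ln (exp 1) \<le> t" unfolding t_def using elim(4) by (subst ln_le_cancel_iff) auto
    then have t: "1 \<le> t" by simp
    have m: "real m = exp t" using elim(4) by (simp add: t_def)
    define R where "R = exp (- ((t - k * ln t) / D))"
    define e where "e = t powr (- (3 * k))"
    let ?l = "edge_scale \<theta> m"
    let ?E = "exp (ln (real n) powr \<beta>)"
    have el: "t / (2 * D) \<le> (t - k * ln t) / D" "e \<le> 1 / 2" "- t / D + 2 * t powr \<theta> \<le> 0"
      using elim unfolding t_def e_def by auto
    have "0 \<le> t / (2 * D)" using t D by simp
    then have R: "0 < R" "R \<le> 1" "ln (1 / R) = (t - k * ln t) / D" using el(1) by (auto simp: R_def ln_div)
    have e0: "0 \<le> e" by (simp add: e_def)
    have l: "0 < ?l" "?l \<le> 1" using el(3) by (simp_all add: edge_scale_def t_def D_def)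
    have mR: "real m * R ^ DIM('c) = t powr k"
    proof -
      have "R ^ DIM('c) = exp (D * (- ((t - k * ln t) / D)))" unfolding R_def D_def by (rule exp_of_nat_mult[symmetric])
      also have "D * (- ((t - k * ln t) / D)) = k * ln t - t" using D by simp
      finally show ?thesis using t by (simp add: m exp_diff powr_def)
    qed
    have ml: "real m * ?l ^ DIM('c) = exp (2 * D * t powr \<theta>)"
      using edge_scale_power[of m \<theta>] elim(4) by (simp add: D_def t_def)
    have "prob (isolated m R) \<le> exp (- c * R ^ DIM('c) * real m)"
      unfolding isolated_def by (rule isolated_prob[OF R(1,2) c(1,2) c(3)[OF _ R(1,2)]])
    also have "- c * R ^ DIM('c) * real m = - (c * t powr k)" unfolding mR[symmetric] by simp
    finally have iso: "prob (isolated m R) \<le> exp (- (c * t powr k))" .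
    have "real m * (?E * exp (- (ln (1 + e) * ln (1 / R) powr (\<gamma> - 1))) * (C * ?l ^ DIM('c)))
       = C * (real m * ?l ^ DIM('c)) * (?E * exp (- (ln (1 + e) * ln (1 / R) powr (\<gamma> - 1))))" by (simp only: mult_ac)
    also have "\<dots> \<le> C * exp (2 * D * t powr \<theta>) * (exp (t powr \<beta>) * exp (- (e / 2 * (t / (2 * D)) powr g1)))"
      unfolding ml
    proof (intro mult_left_mono mult_mono)
      have "ln (real n) \<le> t" "0 \<le> ln (real n)" using mn by (auto simp: t_def)
      then show "?E \<le> exp (t powr \<beta>)" using \<beta> by (auto intro: powr_mono2)
      have "e * e \<le> e * (1 / 2)" using el(2) e0 by (intro mult_left_mono) auto
      moreover have "e - e\<^sup>2 \<le> ln (1 + e)" using e0 el(2) by (intro ln_one_plus_pos_lower_bound) auto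
      ultimately have "e / 2 \<le> ln (1 + e)" by (simp add: power2_eq_square)
      moreover have "(t / (2 * D)) powr g1 \<le> ln (1 / R) powr g1"
        unfolding R(3) using el(1) g \<open>0 \<le> t / (2 * D)\<close> by (intro powr_mono2) (auto simp: g1_def)
      ultimately have "e / 2 * (t / (2 * D)) powr g1 \<le> ln (1 + e) * ln (1 / R) powr g1"
        using e0 by (intro mult_mono) auto
      then show "exp (- (ln (1 + e) * ln (1 / R) powr (\<gamma> - 1))) \<le> exp (- (e / 2 * (t / (2 * D)) powr g1))"
        by (simp add: g1_def)
    qed (use C in auto)
    also have "\<dots> = C * exp (2 * D * t powr \<theta> + t powr \<beta> - (e / 2) * (t / (2 * D)) powr g1)"
      by (simp only: diff_conv_add_uminus exp_add mult.assoc)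
    finally have main: "real m * (?E * exp (- (ln (1 + e) * ln (1 / R) powr (\<gamma> - 1))) * (C * ?l ^ DIM('c)))
      \<le> C * exp (2 * D * t powr \<theta> + t powr \<beta> - (e / 2) * (t / (2 * D)) powr g1)" .
    have "prob (misattached m) \<le> prob (isolated m R) + C ^ 2 * (real m * R ^ DIM('c)) ^ 2 * ((1 + e) ^ DIM('c) - 1)
      + prob {\<omega> \<in> space M. \<exists>j\<in>{..n}. ?E < real (deg n \<omega> j)} + prob (long_edge m ?l)
      + real m * (?E * exp (- (ln (1 + e) * ln (1 / R) powr (\<gamma> - 1))) * (C * ?l ^ DIM('c)))"
      unfolding mn(1) C_def D_def using R l e0 mn by (intro misattached_prob_le) auto
    also have "\<dots> \<le> U m"
    proof -
      have "U m = exp (- (c * t powr k)) + C ^ 2 * (t powr k) ^ 2 * ((1 + e) ^ DIM('c) - 1)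
        + prob {\<omega> \<in> space M. \<exists>j\<in>{..n}. ?E < real (deg n \<omega> j)} + prob (long_edge m ?l)
        + C * exp (2 * D * t powr \<theta> + t powr \<beta> - (e / 2) * (t / (2 * D)) powr g1)"
        unfolding U_def t_def e_def by (simp only: mn(1) diff_Suc_1)
      then show ?thesis unfolding mR using iso main by linarith
    qed
    finally show ?case .
  qed
  show ?thesis
    by (rule tendsto_sandwich[OF _ bound tendsto_const U0]) simp
qed

end

section \<open>Comparison of degree sequences\<close>

lemma card_filter_diff_le:
  assumes J: "finite J" and K: "finite K" "\<And>j. j \<in> J \<Longrightarrow> P j \<noteq> Q j \<Longrightarrow> j \<in> K"
  shows "\<bar>real (card {j \<in> J. P j}) - real (card {j \<in> J. Q j})\<bar> \<le> real (card K)"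
proof -
  have le: "card {j \<in> J. P j} \<le> card {j \<in> J. Q j} + card K" if "\<And>j. j \<in> J \<Longrightarrow> P j \<noteq> Q j \<Longrightarrow> j \<in> K" for P Q
  proof -
    have "{j \<in> J. P j} \<subseteq> {j \<in> J. Q j} \<union> K" using that by blast
    then have "card {j \<in> J. P j} \<le> card ({j \<in> J. Q j} \<union> K)" using J K(1) by (intro card_mono) auto
    then show ?thesis using card_Un_le[of "{j \<in> J. Q j}" K] by linarith
  qed
  have 1: "card {j \<in> J. P j} \<le> card {j \<in> J. Q j} + card K" by (rule le[OF K(2)])
  have 2: "card {j \<in> J. Q j} \<le> card {j \<in> J. P j} + card K" by (rule le[OF K(2)]) simp_all
  show ?thesis using 1 2 by linarith
qed

text \<open>A vertex has different degrees only if it is an endpoint, in one of the two trees, of an edge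
  that they do not share.\<close>

lemma num_degree_ge_diff_le:
  assumes p: "\<And>i. 1 \<le> i \<Longrightarrow> i \<le> n \<Longrightarrow> p i < i" and q: "\<And>i. 1 \<le> i \<Longrightarrow> i \<le> n \<Longrightarrow> q i < i"
  shows "\<bar>real (num_degree_ge p n k) - real (num_degree_ge q n k)\<bar> \<le> 2 * (\<Sum>i=1..n. of_bool (p i \<noteq> q i))"
proof -
  let ?B = "{i \<in> {1..n}. p i \<noteq> q i}"
  define K where "K = p ` ?B \<union> q ` ?B"
  have "\<bar>real (num_degree_ge p n k) - real (num_degree_ge q n k)\<bar> \<le> real (card K)"
    unfolding num_degree_ge_def
  proof (rule card_filter_diff_le)
    fix j assume j: "j \<in> {0..n}" and ne: "(k \<le> attachment_degree p n j) \<noteq> (k \<le> attachment_degree q n j)"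
    show "j \<in> K"
    proof (rule ccontr)
      assume "j \<notin> K"
      have "p i = j \<longleftrightarrow> q i = j" if i: "i \<in> {1..n}" for i
      proof (cases "p i = q i")
        case False
        then have "i \<in> ?B" using i by simp
        then have "p i \<in> K" "q i \<in> K" unfolding K_def by (rule imageI[THEN UnI1], rule imageI[THEN UnI2])
        then show ?thesis using \<open>j \<notin> K\<close> by metis
      qed simp
      then have "{i \<in> {1..n}. p i = j} = {i \<in> {1..n}. q i = j}" by (intro Collect_cong conj_cong refl)
      then have "attachment_degree p n j = attachment_degree q n j"
      proof -
        have "attachment_degree p n j = (if 1 \<le> j then 1 else 0) + card {i \<in> {1..n}. p i = j}" using j by (intro attachment_degree_eq p) auto
        also have "\<dots> = (if 1 \<le> j then 1 else 0) + card {i \<in> {1..n}. q i = j}" by (simp only: \<open>{i \<in> {1..n}. p i = j} = {i \<in> {1..n}. q i = j}\<close>)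
        also have "\<dots> = attachment_degree q n j" using j by (intro attachment_degree_eq[symmetric] q) auto
        finally show ?thesis .
      qed
      then show False using ne by simp
    qed
  qed (simp_all add: K_def)
  moreover have "card K \<le> card ?B + card ?B"
    unfolding K_def by (rule order_trans[OF card_Un_le add_mono[OF card_image_le card_image_le]]) auto
  moreover have "(\<Sum>i=1..n. of_bool (p i \<noteq> q i)) = real (card ?B)"
    by (simp add: of_bool_def sum.If_cases Int_def)
  ultimately show ?thesis by linarith
qed

lemma num_degree_ge_le: "num_degree_ge p n k \<le> n + 1"
proof -
  have "num_degree_ge p n k \<le> card {0..n}" unfolding num_degree_ge_def by (intro card_mono) auto
  then show ?thesis by simp
qed

text \<open>Without ties, capturing within distance \<open>r\<close> is being the on-line nearest neighbour
  at distance less than \<open>r\<close>.\<close>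

lemma online_nn_degree_at:
  fixes x :: "nat \<Rightarrow> 'c::metric_space"
  assumes ties: "\<And>m i j. i < m \<Longrightarrow> j < m \<Longrightarrow> i \<noteq> j \<Longrightarrow> dist (x m) (x i) \<noteq> dist (x m) (x j)"
    and distinct: "\<And>m i. i < m \<Longrightarrow> x i \<noteq> x m" and j: "j \<le> n"
  shows "degree_at r {0..n} (\<lambda>l. (x l, real l)) j = card {l \<in> {1..n}. online_nn x l = j \<and> dist (x l) (x j) < r}"
proof -
  have inj: "inj_on (\<lambda>l. (x l, real l)) {0..n}" by (rule inj_onI) simp
  have "{l \<in> {0..n} - {j}. j < l \<and> x l \<noteq> x j \<and> dist (x l) (x j) < r \<and>
      (\<forall>m\<in>{0..n} - {j}. m \<le> l \<and> dist (x l) (x m) < dist (x l) (x j) \<longrightarrow> m = l)}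
    = {l \<in> {1..n}. online_nn x l = j \<and> dist (x l) (x j) < r}" (is "?L = ?R")
  proof (intro set_eqI iffI)
    fix l assume l: "l \<in> ?L"
    then have jl: "j < l" "l \<le> n" "1 \<le> l" by auto
    have "online_nn x l = j"
    proof (rule ccontr)
      assume ne: "online_nn x l \<noteq> j"
      have m: "online_nn x l < l" "dist (x l) (x (online_nn x l)) \<le> dist (x l) (x j)"
        using online_nn_nearest[OF jl(3)] jl(1) by auto
      then have "dist (x l) (x (online_nn x l)) < dist (x l) (x j)" using ties[OF m(1) jl(1) ne] by simp
      then have "online_nn x l = l" using l m(1) jl ne by auto
      then show False using m(1) by simp
    qed
    then show "l \<in> ?R" using l jl by auto
  next
    fix l assume l: "l \<in> ?R"
    then have jl: "j < l" "l \<le> n" "1 \<le> l" "online_nn x l = j" "dist (x l) (x j) < r" using online_nn_nearest(1)[of l x] by auto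
    have "m = l" if "m \<le> l" "dist (x l) (x m) < dist (x l) (x j)" for m
    proof (rule ccontr)
      assume "m \<noteq> l"
      then have "dist (x l) (x j) \<le> dist (x l) (x m)" using online_nn_nearest(2)[OF jl(3), of m x] that(1) jl(4) by simp
      then show False using that(2) by simp
    qed
    moreover have "x l \<noteq> x j" using distinct[OF jl(1)] by metis
    ultimately show "l \<in> ?L" using jl by auto
  qed
  then show ?thesis using degree_at_index[OF inj, of j r] j by simp
qed

text \<open>The two degrees of a vertex differ only if it is the root, which has no edge to an older vertex,
  or if it receives an edge from a vertex that is isolated at radius \<open>r\<close>.\<close>

lemma num_degree_ge_online_nn_local:
  fixes x :: "nat \<Rightarrow> 'c::metric_space"
  assumes ties: "\<And>m i j. i < m \<Longrightarrow> j < m \<Longrightarrow> i \<noteq> j \<Longrightarrow> dist (x m) (x i) \<noteq> dist (x m) (x j)"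
    and distinct: "\<And>m i. i < m \<Longrightarrow> x i \<noteq> x m"
  shows "\<bar>real (num_degree_ge (online_nn x) n k) - real (count_degree k r {0..n} (\<lambda>l. (x l, real l)))\<bar>
    \<le> 1 + (\<Sum>i=1..n. of_bool (\<forall>j<i. \<not> (0 < dist (x j) (x i) \<and> dist (x j) (x i) < r)))"
proof -
  let ?B = "{i \<in> {1..n}. \<forall>j<i. \<not> (0 < dist (x j) (x i) \<and> dist (x j) (x i) < r)}"
  let ?K = "insert 0 (online_nn x ` ?B)"
  have "\<bar>real (num_degree_ge (online_nn x) n k) - real (count_degree k r {0..n} (\<lambda>l. (x l, real l)))\<bar> \<le> real (card ?K)"
    unfolding num_degree_ge_def count_degree_def
  proof (rule card_filter_diff_le)
    fix j assume j: "j \<in> {0..n}"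
      and ne: "(k \<le> attachment_degree (online_nn x) n j) \<noteq> (k \<le> 1 + degree_at r {0..n} (\<lambda>l. (x l, real l)) j)"
    show "j \<in> ?K"
    proof (rule ccontr)
      assume no: "j \<notin> ?K"
      have d: "degree_at r {0..n} (\<lambda>l. (x l, real l)) j = card {l \<in> {1..n}. online_nn x l = j \<and> dist (x l) (x j) < r}"
        using ties distinct j by (intro online_nn_degree_at) auto
      have "dist (x l) (x j) < r" if l: "l \<in> {1..n}" "online_nn x l = j" for l
      proof -
        have "l \<notin> ?B" using no l by blast
        then obtain i where i: "i < l" "dist (x i) (x l) < r" using l(1) by blast
        have "dist (x l) (x j) \<le> dist (x l) (x i)" using online_nn_nearest(2)[of l i x] l i(1) by simp
        then show ?thesis using i(2) by (simp add: dist_commute)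
      qed
      then have "{l \<in> {1..n}. online_nn x l = j \<and> dist (x l) (x j) < r} = {l \<in> {1..n}. online_nn x l = j}" by blast
      moreover have "attachment_degree (online_nn x) n j = (if 1 \<le> j then 1 else 0) + card {l \<in> {1..n}. online_nn x l = j}"
        using j by (intro attachment_degree_eq online_nn_nearest) auto
      ultimately show False using ne d no by simp
    qed
  qed auto
  also have "real (card ?K) \<le> 1 + real (card ?B)"
  proof -
    have "card ?K \<le> Suc (card (online_nn x ` ?B))" by (subst card_insert_if) auto
    then show ?thesis using card_image_le[of ?B "online_nn x"] by simp
  qed
  also have "real (card ?B) = (\<Sum>i=1..n. of_bool (\<forall>j<i. \<not> (0 < dist (x j) (x i) \<and> dist (x j) (x i) < r)))"
    by (simp add: of_bool_def sum.If_cases Int_def)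
  finally show ?thesis .
qed

text \<open>A geometric sum, with \<open>exp s - 1 \<ge> s\<close>.\<close>

lemma sum_exp_le:
  fixes s :: real assumes s: "0 < s" shows "(\<Sum>i=1..n. exp (- s * real i)) \<le> 1 / s"
proof -
  have "(\<Sum>i=1..n. exp (- s * real i)) * (exp s - 1) = 1 - exp (- s * real n)"
  proof (induction n)
    case (Suc n)
    have "exp (- s * real (Suc n)) * exp s = exp (- s * real n)" by (simp add: exp_add[symmetric] algebra_simps)
    then show ?case using Suc by (simp add: algebra_simps)
  qed simp
  then have "(\<Sum>i=1..n. exp (- s * real i)) * (exp s - 1) \<le> 1" by simp
  moreover have "s \<le> exp s - 1" using exp_ge_add_one_self[of s] by linarith
  then have "(\<Sum>i=1..n. exp (- s * real i)) * s \<le> (\<Sum>i=1..n. exp (- s * real i)) * (exp s - 1)"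
    by (intro mult_left_mono sum_nonneg) auto
  ultimately show ?thesis using s by (simp add: field_simps)
qed

lemma tendsto_zero_nonneg:
  fixes u :: "nat \<Rightarrow> real"
  assumes nonneg: "\<And>n. 0 \<le> u n" and small: "\<And>e. 0 < e \<Longrightarrow> eventually (\<lambda>n. u n < e) sequentially"
  shows "u \<longlonglongrightarrow> 0"
proof (rule order_tendstoI)
  fix a :: real assume "a < 0"
  then have "a < u n" for n using nonneg[of n] by linarith
  then show "eventually (\<lambda>n. a < u n) sequentially" by simp
qed (rule small)

section \<open>Convergence of the degree sequence\<close>

context gpa_graph begin

definition misattached_fraction :: "nat \<Rightarrow> real" where
  "misattached_fraction n = (1 / real n) * (\<integral>\<omega>. (\<Sum>i=1..n. of_bool (v i \<omega> \<noteq> online_nn (\<lambda>j. X j \<omega>) i)) \<partial>M)"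

lemma misattached_integrable:
  assumes "1 \<le> i" shows "integrable M (\<lambda>\<omega>. of_bool (v i \<omega> \<noteq> online_nn (\<lambda>j. X j \<omega>) i) :: real)"
    "(\<integral>\<omega>. of_bool (v i \<omega> \<noteq> online_nn (\<lambda>j. X j \<omega>) i) \<partial>M) = prob (misattached i)"
proof -
  have eq: "indicator (misattached i) \<omega> = (of_bool (v i \<omega> \<noteq> online_nn (\<lambda>j. X j \<omega>) i) :: real)" if "\<omega> \<in> space M" for \<omega>
    using that by (simp add: misattached_def indicator_def)
  have "integrable M (indicator (misattached i) :: 'a \<Rightarrow> real)"
    using misattached_meas[OF assms] by (intro integrable_real_indicator) (auto simp: emeasure_eq_measure)
  then show "integrable M (\<lambda>\<omega>. of_bool (v i \<omega> \<noteq> online_nn (\<lambda>j. X j \<omega>) i) :: real)"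
    by (rule Bochner_Integration.integrable_cong[THEN iffD1, rotated 2]) (simp_all add: eq)
  have "(\<integral>\<omega>. of_bool (v i \<omega> \<noteq> online_nn (\<lambda>j. X j \<omega>) i) \<partial>M) = (\<integral>\<omega>. indicator (misattached i) \<omega> \<partial>M :: real)"
    by (intro Bochner_Integration.integral_cong) (simp_all add: eq)
  also have "\<dots> = prob (misattached i)" using misattached_meas[OF assms] by simp
  finally show "(\<integral>\<omega>. of_bool (v i \<omega> \<noteq> online_nn (\<lambda>j. X j \<omega>) i) \<partial>M) = prob (misattached i)" .
qed

lemma misattached_fraction_eq: "misattached_fraction n = (\<Sum>i=1..n. prob (misattached i)) / real n"
proof -
  have "(\<integral>\<omega>. (\<Sum>i=1..n. of_bool (v i \<omega> \<noteq> online_nn (\<lambda>j. X j \<omega>) i)) \<partial>M) = (\<Sum>i=1..n. (\<integral>\<omega>. of_bool (v i \<omega> \<noteq> online_nn (\<lambda>j. X j \<omega>) i) \<partial>M) :: real)"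
    by (rule Bochner_Integration.integral_sum) (simp add: misattached_integrable)
  also have "\<dots> = (\<Sum>i=1..n. prob (misattached i))" by (intro sum.cong refl misattached_integrable(2)) auto
  finally show ?thesis by (simp add: misattached_fraction_def)
qed

theorem misattached_fraction_tendsto:
  assumes g: "3 / 2 < \<gamma>" shows "misattached_fraction \<longlonglongrightarrow> 0"
proof -
  let ?p = "\<lambda>m. prob (misattached m)"
  have "eventually (\<lambda>n. misattached_fraction n < e) sequentially" if e: "0 < e" for e
  proof -
    obtain m where m: "\<And>i. m \<le> i \<Longrightarrow> ?p i < e / 2"
      using order_tendstoD(2)[OF misattached_prob_tendsto[OF g], of "e / 2"] e unfolding eventually_sequentially by auto
    have "(\<lambda>n. real m / real n) \<longlonglongrightarrow> 0" by real_asymp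
    from order_tendstoD(2)[OF this, of "e / 2"] e have "eventually (\<lambda>n. real m / real n < e / 2) sequentially" by simp
    then show ?thesis using eventually_gt_at_top[of 0]
    proof eventually_elim
      case (elim n)
      have "(\<Sum>i=1..n. ?p i) \<le> (\<Sum>i=1..n. of_bool (i < m) + e / 2)"
        using m e by (intro sum_mono) (auto simp: of_bool_def not_less intro: less_imp_le order_trans[OF prob_le_1])
      also have "\<dots> = real (card {i \<in> {1..n}. i < m}) + real n * (e / 2)"
        by (simp add: sum.distrib of_bool_def sum.If_cases Int_def)
      also have "card {i \<in> {1..n}. i < m} \<le> card {..<m}" by (intro card_mono) auto
      finally have "(\<Sum>i=1..n. ?p i) / real n \<le> (real m + real n * (e / 2)) / real n" by (intro divide_right_mono) auto
      also have "\<dots> = real m / real n + e / 2" using elim(2) by (simp add: add_divide_distrib)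
      finally show ?case unfolding misattached_fraction_eq using elim(1) by linarith
    qed
  qed
  moreover have "0 \<le> misattached_fraction n" for n unfolding misattached_fraction_eq by (intro divide_nonneg_nonneg sum_nonneg) auto
  ultimately show ?thesis by (intro tendsto_zero_nonneg)
qed

theorem online_nn_prob_tendsto:
  assumes g: "3 / 2 < \<gamma>"
  shows "(\<lambda>n. measure M {\<omega> \<in> space M. v n \<omega> = online_nn (\<lambda>i. X i \<omega>) n}) \<longlonglongrightarrow> 1"
proof -
  have eq: "measure M {\<omega> \<in> space M. v n \<omega> = online_nn (\<lambda>i. X i \<omega>) n} = 1 - prob (misattached n)" if "1 \<le> n" for n
  proof -
    have "{\<omega> \<in> space M. v n \<omega> = online_nn (\<lambda>i. X i \<omega>) n} = space M - misattached n" by (auto simp: misattached_def)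
    then show ?thesis using prob_compl[OF misattached_meas[OF that]] by simp
  qed
  have "(\<lambda>n. 1 - prob (misattached n)) \<longlonglongrightarrow> 1 - 0"
    by (intro tendsto_diff tendsto_const misattached_prob_tendsto[OF g])
  then show ?thesis
    by (rule Lim_transform_eventually[THEN tendsto_eq_rhs]) (auto intro!: eventually_sequentiallyI[of 1] simp: eq)
qed

lemma num_degree_ge_meas: "(\<lambda>\<omega>. real (num_degree_ge (\<lambda>i. v i \<omega>) n k)) \<in> borel_measurable M"
proof -
  have "(\<lambda>\<omega>. (\<Sum>j\<in>{0..n}. indicator {\<omega> \<in> space M. real k \<le> real (deg n \<omega> j)} \<omega>) :: real) \<in> borel_measurable M"
  proof (intro borel_measurable_sum borel_measurable_indicator)
    fix j assume "j \<in> {0..n}"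
    then have [measurable]: "(\<lambda>\<omega>. real (deg n \<omega> j)) \<in> borel_measurable M" by (intro degree_meas) auto
    show "{\<omega> \<in> space M. real k \<le> real (deg n \<omega> j)} \<in> events" by measurable
  qed
  moreover have "real (num_degree_ge (\<lambda>i. v i \<omega>) n k) = (\<Sum>j\<in>{0..n}. indicator {\<omega> \<in> space M. real k \<le> real (deg n \<omega> j)} \<omega>)"
    if "\<omega> \<in> space M" for \<omega>
    using that by (simp add: num_degree_ge_def indicator_def of_bool_def sum.If_cases Int_def)
  ultimately show ?thesis by (rule measurable_cong[THEN iffD2, rotated])
qed

lemma num_degree_ge_local:
  assumes "\<omega> \<in> space M"
    and "\<forall>n i j. i < n \<and> j < n \<and> i \<noteq> j \<longrightarrow> X i \<omega> \<noteq> X n \<omega> \<and> dist (X n \<omega>) (X i \<omega>) \<noteq> dist (X n \<omega>) (X j \<omega>)"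
    and "X 0 \<omega> \<noteq> X 1 \<omega>"
  shows "\<bar>real (num_degree_ge (\<lambda>i. v i \<omega>) n k) - real (count_degree k r {0..n} (\<lambda>l. (X l \<omega>, real l)))\<bar>
    \<le> 2 * (\<Sum>i=1..n. of_bool (v i \<omega> \<noteq> online_nn (\<lambda>j. X j \<omega>) i)) + (1 + (\<Sum>i=1..n. indicator (isolated i r) \<omega>))"
proof -
  let ?x = "\<lambda>i. X i \<omega>"
  have "\<bar>real (num_degree_ge (\<lambda>i. v i \<omega>) n k) - real (num_degree_ge (online_nn ?x) n k)\<bar>
      \<le> 2 * (\<Sum>i=1..n. of_bool (v i \<omega> \<noteq> online_nn ?x i))"
    using assms(1) by (intro num_degree_ge_diff_le v_less online_nn_nearest(1))
  moreover have "\<bar>real (num_degree_ge (online_nn ?x) n k) - real (count_degree k r {0..n} (\<lambda>l. (?x l, real l)))\<bar>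
      \<le> 1 + (\<Sum>i=1..n. of_bool (\<forall>j<i. \<not> (0 < dist (?x j) (?x i) \<and> dist (?x j) (?x i) < r)))"
  proof (rule num_degree_ge_online_nn_local)
    show "dist (?x m) (?x i) \<noteq> dist (?x m) (?x j)" if "i < m" "j < m" "i \<noteq> j" for m i j using assms(2) that by blast
    show "?x i \<noteq> ?x m" if "i < m" for m i
    proof (cases "m = 1")
      case True then show ?thesis using that assms(3) by simp
    next
      case False
      then have "(if i = 0 then 1 else 0) < m" "i \<noteq> (if i = 0 then 1 else 0)" using that by auto
      then show ?thesis using assms(2) that by blast
    qed
  qed
  moreover have "(\<Sum>i=1..n. of_bool (\<forall>j<i. \<not> (0 < dist (?x j) (?x i) \<and> dist (?x j) (?x i) < r)))
      = (\<Sum>i=1..n. indicator (isolated i r) \<omega> :: real)"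
    using assms(1) by (intro sum.cong refl) (simp add: isolated_def indicator_def of_bool_def)
  ultimately show ?thesis by linarith
qed

text \<open>Two coinciding points would be at equal distances from a third one.\<close>

lemma AE_first_two_distinct: "AE \<omega> in M. X 0 \<omega> \<noteq> X 1 \<omega>"
  using AE_no_ties
proof eventually_elim
  case (elim \<omega>)
  have "dist (X 2 \<omega>) (X 0 \<omega>) \<noteq> dist (X 2 \<omega>) (X 1 \<omega>)" using elim[rule_format, of 0 2 1] by simp
  then show ?case by metis
qed

text \<open>For fixed \<open>L\<close> the error is at most twice the fraction of misattached edges, the
  fraction of isolated vertices, which is at most \<open>1 / (c L)\<close>, and the error of the
  local count. The first vanishes as \<open>n\<close> grows, the others as \<open>L\<close> grows.\<close>

theorem num_degree_ge_L1:
  fixes N :: "'n measure" and H :: "'n \<Rightarrow> ('c \<times> real) set"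
  assumes g: "3 / 2 < \<gamma>" and marked: "marked_poisson_setup N H U" and k: "1 \<le> k"
  shows "(\<lambda>n. \<integral>\<omega>. \<bar>real (num_degree_ge (\<lambda>j. v j \<omega>) n k) / real n - ong_rho N H U k\<bar> \<partial>M) \<longlonglongrightarrow> 0"
proof -
  interpret O: ong_limit N H U f S a b by (unfold_locales) (rule marked)
  let ?\<rho> = "ong_rho N H U k"
  let ?Z = "\<lambda>n \<omega>. real (num_degree_ge (\<lambda>j. v j \<omega>) n k)"
  obtain c where c: "0 < c" "c \<le> 1" "\<And>x r. x \<in> S \<Longrightarrow> 0 < r \<Longrightarrow> r \<le> 1 \<Longrightarrow> c * r ^ DIM('c) \<le> measure \<mu> {y. 0 < dist y x \<and> dist y x < r}"
    using \<mu>_ball_ge by blast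
  have bound: "eventually (\<lambda>n. (\<integral>\<omega>. \<bar>?Z n \<omega> / real n - ?\<rho>\<bar> \<partial>M) \<le>
      2 * misattached_fraction n + 2 / real n + 1 / (c * L) + (?\<rho> - O.local_rho k (root DIM('c) (L * a))) + e) sequentially"
    if L: "0 < L" and e: "0 < e" for L e
  proof -
    have "eventually (\<lambda>n. O.local_radius L n < 1) sequentially"
      by (rule order_tendstoD(2)[OF O.local_radius_tendsto]) simp
    then show ?thesis using O.sample_count_L1[OF L k e] eventually_gt_at_top[of 0]
    proof eventually_elim
      case (elim n)
      let ?r = "O.local_radius L n"
      let ?J = "{0..n}"
      let ?V = "\<lambda>\<omega>. O.sample_count k L n (\<lambda>l\<in>?J. X l \<omega>)"
      let ?W = "\<lambda>\<omega>. (\<Sum>i=1..n. of_bool (v i \<omega> \<noteq> online_nn (\<lambda>j. X j \<omega>) i)) :: real"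
      let ?I = "\<lambda>\<omega>. (\<Sum>i=1..n. indicator (isolated i ?r) \<omega>) :: real"
      have n: "0 < real n" using elim(3) by simp
      have r: "0 < ?r" "?r \<le> 1" "?r ^ DIM('c) = L / n" using O.local_radius[OF L elim(3)] elim(1) by auto
      have VX: "?V \<omega> = real (count_degree k ?r ?J (\<lambda>l. (X l \<omega>, real l)))" for \<omega>
        unfolding O.sample_count_def by (intro arg_cong[where f=real] count_degree_cong) simp
      have Vb: "0 \<le> O.sample_count k L n w" "O.sample_count k L n w \<le> real n + 1" for w
        using count_degree_le[of ?J k ?r "\<lambda>l. (w l, real l)"] by (simp_all add: O.sample_count_def)
      have Vm: "O.sample_count k L n \<in> borel_measurable (\<Pi>\<^sub>M j\<in>?J. \<mu>)"
        unfolding O.sample_count_def using index_points_measurable by (intro measurable_count_degree) auto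
      have VmM: "?V \<in> borel_measurable M" by (rule measurable_compose[OF restrict_X_meas Vm])
      have iW: "integrable M ?W" by (intro Bochner_Integration.integrable_sum misattached_integrable(1)) auto
      have iI: "integrable M ?I"
        by (intro Bochner_Integration.integrable_sum integrable_real_indicator) (auto simp: emeasure_eq_measure)
      have iV: "integrable M (\<lambda>\<omega>. \<bar>?V \<omega> / (real n + 1) - ?\<rho>\<bar>)"
      proof (rule integrable_const_bound[where B="1 + \<bar>?\<rho>\<bar>"])
        show "AE \<omega> in M. norm \<bar>?V \<omega> / (real n + 1) - ?\<rho>\<bar> \<le> 1 + \<bar>?\<rho>\<bar>"
        proof (rule AE_I2)
          fix \<omega>
          have "\<bar>?V \<omega> / (real n + 1)\<bar> \<le> 1" using Vb[of "\<lambda>l\<in>?J. X l \<omega>"] by simp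
          then show "norm \<bar>?V \<omega> / (real n + 1) - ?\<rho>\<bar> \<le> 1 + \<bar>?\<rho>\<bar>"
            using abs_triangle_ineq4[of "?V \<omega> / (real n + 1)" ?\<rho>] unfolding real_norm_def abs_abs by linarith
        qed
      qed (use VmM in measurable)
      have "(\<integral>\<omega>. \<bar>?Z n \<omega> / real n - ?\<rho>\<bar> \<partial>M)
         \<le> (\<integral>\<omega>. (2 / real n) * ?W \<omega> + (1 / real n) * ?I \<omega> + 2 / real n + \<bar>?V \<omega> / (real n + 1) - ?\<rho>\<bar> \<partial>M)"
      proof (rule integral_mono_AE)
        show "integrable M (\<lambda>\<omega>. \<bar>?Z n \<omega> / real n - ?\<rho>\<bar>)"
        proof (rule integrable_const_bound[where B="(real n + 1) / real n + \<bar>?\<rho>\<bar>"])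
          show "AE \<omega> in M. norm \<bar>?Z n \<omega> / real n - ?\<rho>\<bar> \<le> (real n + 1) / real n + \<bar>?\<rho>\<bar>"
          proof (rule AE_I2)
            fix \<omega>
            have "real (num_degree_ge (\<lambda>j. v j \<omega>) n k) \<le> real n + 1" using num_degree_ge_le[of "\<lambda>j. v j \<omega>" n k] by linarith
            then have "\<bar>?Z n \<omega> / real n\<bar> \<le> (real n + 1) / real n" using n by (simp add: divide_right_mono)
            then show "norm \<bar>?Z n \<omega> / real n - ?\<rho>\<bar> \<le> (real n + 1) / real n + \<bar>?\<rho>\<bar>"
              using abs_triangle_ineq4[of "?Z n \<omega> / real n" ?\<rho>] unfolding real_norm_def abs_abs by linarith
          qed
        qed (use num_degree_ge_meas in measurable)
        show "integrable M (\<lambda>\<omega>. (2 / real n) * ?W \<omega> + (1 / real n) * ?I \<omega> + 2 / real n + \<bar>?V \<omega> / (real n + 1) - ?\<rho>\<bar>)"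
          by (intro Bochner_Integration.integrable_add integrable_mult_right iW iI iV integrable_const)
        show "AE \<omega> in M. \<bar>?Z n \<omega> / real n - ?\<rho>\<bar> \<le> (2 / real n) * ?W \<omega> + (1 / real n) * ?I \<omega> + 2 / real n + \<bar>?V \<omega> / (real n + 1) - ?\<rho>\<bar>"
          using AE_no_ties AE_first_two_distinct AE_space
        proof eventually_elim
          case (elim \<omega>)
          have "\<bar>?Z n \<omega> - ?V \<omega>\<bar> \<le> 2 * ?W \<omega> + (1 + ?I \<omega>)"
            unfolding VX by (rule num_degree_ge_local[OF elim(3,1,2)])
          then have "\<bar>?Z n \<omega> - ?V \<omega>\<bar> / real n \<le> (2 * ?W \<omega> + (1 + ?I \<omega>)) / real n" using n by (intro divide_right_mono) auto
          moreover have "\<bar>?Z n \<omega> - ?V \<omega>\<bar> / real n = \<bar>?Z n \<omega> / real n - ?V \<omega> / real n\<bar>" using n by (simp add: diff_divide_distrib[symmetric])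
          moreover have "(2 * ?W \<omega> + (1 + ?I \<omega>)) / real n = (2 / real n) * ?W \<omega> + (1 / real n) * ?I \<omega> + 1 / real n" by (simp add: add_divide_distrib)
          moreover have "\<bar>?V \<omega> / real n - ?V \<omega> / (real n + 1)\<bar> \<le> 1 / real n"
          proof -
            have "?V \<omega> / real n - ?V \<omega> / (real n + 1) = (?V \<omega> / (real n + 1)) / real n" using n by (simp add: field_simps)
            moreover have y: "0 \<le> ?V \<omega> / (real n + 1)" "?V \<omega> / (real n + 1) \<le> 1" using Vb[of "\<lambda>l\<in>?J. X l \<omega>"] by auto
            moreover have "?V \<omega> / (real n + 1) / real n \<le> 1 / real n" using y(2) n by (intro divide_right_mono) auto
            moreover have "0 \<le> ?V \<omega> / (real n + 1) / real n" by (rule divide_nonneg_nonneg[OF y(1)]) simp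
            ultimately show ?thesis by linarith
          qed
          ultimately show ?case by linarith
        qed
      qed
      also have "\<dots> = (2 / real n) * (\<integral>\<omega>. ?W \<omega> \<partial>M) + (1 / real n) * (\<integral>\<omega>. ?I \<omega> \<partial>M) + 2 / real n + (\<integral>\<omega>. \<bar>?V \<omega> / (real n + 1) - ?\<rho>\<bar> \<partial>M)"
        using iW iI iV by (simp add: prob_space)
      also have "(2 / real n) * (\<integral>\<omega>. ?W \<omega> \<partial>M) = 2 * misattached_fraction n" by (simp add: misattached_fraction_def)
      also have "(\<integral>\<omega>. ?I \<omega> \<partial>M) = (\<Sum>i=1..n. prob (isolated i ?r))"
      proof -
        have "(\<integral>\<omega>. ?I \<omega> \<partial>M) = (\<Sum>i=1..n. (\<integral>\<omega>. indicator (isolated i ?r) \<omega> \<partial>M))"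
          by (intro Bochner_Integration.integral_sum integrable_real_indicator) (auto simp: emeasure_eq_measure)
        then show ?thesis by simp
      qed
      also have "(\<Sum>i=1..n. prob (isolated i ?r)) \<le> (\<Sum>i=1..n. exp (- (c * L / n) * real i))"
      proof (rule sum_mono)
        fix i
        have "prob (isolated i ?r) \<le> exp (- c * ?r ^ DIM('c) * real i)"
          unfolding isolated_def by (rule isolated_prob[OF r(1,2) c(1,2) c(3)[OF _ r(1,2)]])
        then show "prob (isolated i ?r) \<le> exp (- (c * L / n) * real i)" unfolding r(3) by simp
      qed
      also have "\<dots> \<le> 1 / (c * L / n)" using c(1) L n by (intro sum_exp_le) auto
      also have "(1 / real n) * (1 / (c * L / n)) = 1 / (c * L)" using n by simp
      also have "(\<integral>\<omega>. \<bar>?V \<omega> / (real n + 1) - ?\<rho>\<bar> \<partial>M) = (\<integral>w. \<bar>O.sample_count k L n w / (real n + 1) - ?\<rho>\<bar> \<partial>(\<Pi>\<^sub>M j\<in>?J. \<mu>))"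
      proof -
        have [measurable]: "(\<lambda>w. \<bar>O.sample_count k L n w / (real n + 1) - ?\<rho>\<bar>) \<in> borel_measurable (\<Pi>\<^sub>M j\<in>?J. \<mu>)" using Vm by measurable
        have "(\<integral>w. \<bar>O.sample_count k L n w / (real n + 1) - ?\<rho>\<bar> \<partial>distr M (\<Pi>\<^sub>M j\<in>?J. \<mu>) (\<lambda>\<omega>. \<lambda>l\<in>?J. X l \<omega>)) = (\<integral>\<omega>. \<bar>?V \<omega> / (real n + 1) - ?\<rho>\<bar> \<partial>M)"
          by (rule integral_distr[OF restrict_X_meas]) simp
        then show ?thesis unfolding joint_law[of ?J, simplified] by simp
      qed
      also have "\<dots> \<le> (?\<rho> - O.local_rho k (root DIM('c) (L * a))) + e" by (rule elim(2))
      finally show ?case using n by (simp add: mult_left_mono divide_right_mono)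
    qed
  qed
  have "eventually (\<lambda>n. (\<integral>\<omega>. \<bar>?Z n \<omega> / real n - ?\<rho>\<bar> \<partial>M) < \<epsilon>) sequentially" if \<epsilon>: "0 < \<epsilon>" for \<epsilon>
  proof -
    have e5: "?\<rho> - \<epsilon> / 5 < ?\<rho>" using \<epsilon> by simp
    obtain m where m: "?\<rho> - \<epsilon> / 5 < O.local_rho k (real (Suc m))"
      using order_tendstoD(1)[OF O.local_rho_tendsto[OF k] e5] unfolding eventually_sequentially by auto
    define L where "L = max (real (Suc m) ^ DIM('c) / a) (5 / (c * \<epsilon>))"
    have "0 < 5 / (c * \<epsilon>)" using c(1) \<epsilon> by simp
    moreover have L2: "5 / (c * \<epsilon>) \<le> L" "real (Suc m) ^ DIM('c) / a \<le> L"
      unfolding L_def by (rule max.cobounded2, rule max.cobounded1)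
    ultimately have L: "0 < L" by linarith
    have cL: "1 / (c * L) \<le> \<epsilon> / 5"
    proof -
      have "5 \<le> L * (c * \<epsilon>)" using L2(1) c(1) \<epsilon> by (simp only: pos_divide_le_eq mult_pos_pos)
      then have "1 \<le> \<epsilon> / 5 * (c * L)" by (simp add: mult_ac)
      then show ?thesis using c(1) L by (simp only: pos_divide_le_eq mult_pos_pos)
    qed
    have loc: "O.local_rho k (real (Suc m)) \<le> O.local_rho k (root DIM('c) (L * a))"
    proof (rule O.local_rho_mono)
      have "real (Suc m) ^ DIM('c) \<le> L * a" using L2(2) a_pos by (simp only: pos_divide_le_eq)
      then have "root DIM('c) (real (Suc m) ^ DIM('c)) \<le> root DIM('c) (L * a)" by (intro real_root_le_mono) auto
      then show "real (Suc m) \<le> root DIM('c) (L * a)" by (simp add: real_root_power_cancel)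
    qed simp
    have "(\<lambda>n. 2 * misattached_fraction n + 2 / real n) \<longlonglongrightarrow> 2 * 0 + 0"
      by (intro tendsto_add tendsto_mult_left misattached_fraction_tendsto[OF g]) real_asymp
    then have "eventually (\<lambda>n. 2 * misattached_fraction n + 2 / real n < \<epsilon> / 5) sequentially"
      using \<epsilon> by (intro order_tendstoD(2)) auto
    moreover have "0 < \<epsilon> / 5" using \<epsilon> by simp
    note bound[OF L this]
    ultimately show ?thesis
    proof eventually_elim
      case (elim n)
      then show ?case using cL loc m \<epsilon> by linarith
    qed
  qed
  moreover have "0 \<le> (\<integral>\<omega>. \<bar>?Z n \<omega> / real n - ?\<rho>\<bar> \<partial>M)" for n by (intro integral_nonneg_AE) auto
  ultimately show ?thesis by (intro tendsto_zero_nonneg)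
qed

theorem num_degree_ge_mean:
  fixes N :: "'n measure" and H :: "'n \<Rightarrow> ('c \<times> real) set"
  assumes g: "3 / 2 < \<gamma>" and marked: "marked_poisson_setup N H U" and k: "1 \<le> k"
  shows "(\<lambda>n. (\<integral>\<omega>. real (num_degree_ge (\<lambda>j. v j \<omega>) n k) \<partial>M) / real n) \<longlonglongrightarrow> ong_rho N H U k"
proof (rule LIM_zero_cancel, rule Lim_null_comparison)
  show "eventually (\<lambda>n. norm ((\<integral>\<omega>. real (num_degree_ge (\<lambda>j. v j \<omega>) n k) \<partial>M) / real n - ong_rho N H U k)
    \<le> (\<integral>\<omega>. \<bar>real (num_degree_ge (\<lambda>j. v j \<omega>) n k) / real n - ong_rho N H U k\<bar> \<partial>M)) sequentially"
  proof (rule always_eventually, rule allI)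
    fix n
    have i: "integrable M (\<lambda>\<omega>. real (num_degree_ge (\<lambda>j. v j \<omega>) n k))"
    proof (rule integrable_const_bound[where B="real n + 1"])
      have "real (num_degree_ge (\<lambda>j. v j \<omega>) n k) \<le> real n + 1" for \<omega> using num_degree_ge_le[of "\<lambda>j. v j \<omega>" n k] by linarith
      then show "AE \<omega> in M. norm (real (num_degree_ge (\<lambda>j. v j \<omega>) n k)) \<le> real n + 1" by (intro AE_I2) simp
    qed (rule num_degree_ge_meas)
    have "(\<integral>\<omega>. real (num_degree_ge (\<lambda>j. v j \<omega>) n k) \<partial>M) / real n - ong_rho N H U k
      = (\<integral>\<omega>. real (num_degree_ge (\<lambda>j. v j \<omega>) n k) / real n - ong_rho N H U k \<partial>M)"
      using i by (simp add: prob_space)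
    then show "norm ((\<integral>\<omega>. real (num_degree_ge (\<lambda>j. v j \<omega>) n k) \<partial>M) / real n - ong_rho N H U k)
      \<le> (\<integral>\<omega>. \<bar>real (num_degree_ge (\<lambda>j. v j \<omega>) n k) / real n - ong_rho N H U k\<bar> \<partial>M)"
      using integral_norm_bound[of M "\<lambda>\<omega>. real (num_degree_ge (\<lambda>j. v j \<omega>) n k) / real n - ong_rho N H U k"] by simp
  qed
qed (rule num_degree_ge_L1[OF assms])

end

theorem theorem2p3:
  fixes S :: "(real ^ 'd) set"
    and f :: "real ^ 'd \<Rightarrow> real"
    and \<gamma> :: real
    and M :: "'a measure"
    and X :: "nat \<Rightarrow> 'a \<Rightarrow> real ^ 'd"
    and v :: "nat \<Rightarrow> 'a \<Rightarrow> nat"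
  assumes S: "compact S" "convex S" "emeasure lborel S > 0"
    and f_density: "f \<in> borel_measurable borel" "\<And>x. 0 \<le> f x" "(\<integral>x. f x \<partial>lborel) = 1"
    and f_supp: "\<And>x. x \<notin> S \<Longrightarrow> f x = 0"
    and f_bounds: "0 < (INF x\<in>S. ereal (f x))" "(SUP x\<in>S. ereal (f x)) < \<infinity>"
    and M: "prob_space M"
    and X_indep: "prob_space.indep_vars M (\<lambda>_. borel) X UNIV"
    and X_density: "\<And>n. distributed M lborel (X n) (\<lambda>x. ennreal (f x))"
    and \<gamma>: "\<gamma> > 1"
    and gpa: "gpa_process M (F_attract \<gamma>) X v"
  shows "(\<forall>\<nu>. 0 < \<nu> \<and> \<nu> < 1 \<and> \<nu> > 2 - \<gamma> \<longrightarrow>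
            (AE \<omega> in M. \<forall>\<^sub>F n in sequentially.
               real (MAX i\<in>{0..n}. attachment_degree (\<lambda>j. v j \<omega>) n i)
                 \<le> exp ((ln (real n)) powr \<nu>)))
       \<and> (\<gamma> > 3 / 2 \<longrightarrow>
            ((\<lambda>n. measure M {\<omega> \<in> space M. v n \<omega> = online_nn (\<lambda>i. X i \<omega>) n}) \<longlonglongrightarrow> 1)
          \<and> ((\<lambda>n. (1 / real n) *
                (\<integral>\<omega>. (\<Sum>i=1..n. of_bool (v i \<omega> \<noteq> online_nn (\<lambda>j. X j \<omega>) i)) \<partial>M)) \<longlonglongrightarrow> (0::real))
          \<and> (\<forall>(N :: 'b measure) (H :: 'b \<Rightarrow> ((real ^ 'd) \<times> real) set) (U :: 'b \<Rightarrow> real) (k :: nat).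
               marked_poisson_setup N H U \<and> 1 \<le> k \<longrightarrow>
                 ((\<lambda>n. \<integral>\<omega>. \<bar>real (num_degree_ge (\<lambda>j. v j \<omega>) n k) / real n - ong_rho N H U k\<bar> \<partial>M)
                    \<longlonglongrightarrow> 0)
               \<and> ((\<lambda>n. (\<integral>\<omega>. real (num_degree_ge (\<lambda>j. v j \<omega>) n k) \<partial>M) / real n)
                    \<longlonglongrightarrow> ong_rho N H U k)))"
proof -
  have ne: "S \<noteq> {}" using S(3) by auto
  obtain a where a: "0 < ereal a" "ereal a < (INF x\<in>S. ereal (f x))"
    using ereal_dense2[OF f_bounds(1)] by blast
  have fa: "a \<le> f x" if "x \<in> S" for x
    using less_INF_D[OF a(2) that] by simp
  obtain B where B: "(SUP x\<in>S. ereal (f x)) < ereal B"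
    using ereal_dense2[OF f_bounds(2)] by blast
  have fb: "f x \<le> max B 0" for x
  proof (cases "x \<in> S")
    case True
    then have "ereal (f x) < ereal B" using SUP_lessD[OF B] by blast
    then show ?thesis by simp
  qed (simp add: f_supp)
  have "integrable lborel f" using f_density(3) not_integrable_integral_eq[of lborel f] by fastforce
  then have total: "(\<integral>\<^sup>+x. ennreal (f x) \<partial>lborel) = 1"
    using f_density by (simp add: nn_integral_eq_integral)
  have bd: "bounded_density f S a (max B 0)"
    using S f_density(1,2) total f_supp fa fb a(1) by (intro bounded_density.intro) auto
  then interpret bounded_density f S a "max B 0" .
  have law: "distr M borel (X n) = \<mu>" for n
  proof -
    have "distr M borel (X n) = distr M lborel (X n)" by (rule distr_cong) simp_all
    also have "\<dots> = density lborel (\<lambda>x. ennreal (f x))" using X_density by (rule distributed_distr_eq_density)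
    finally show ?thesis by (simp add: \<mu>_def)
  qed
  have "gpa_graph f S a (max B 0) M X v \<gamma>"
    by (intro gpa_graph.intro iid_sample.intro iid_sample_axioms.intro gpa_graph_axioms.intro bd M X_indep law \<gamma> gpa)
  then interpret gpa_graph f S a "max B 0" M X v \<gamma> .
  show ?thesis
  proof (intro conjI allI impI)
    fix \<nu> assume "0 < \<nu> \<and> \<nu> < 1 \<and> \<nu> > 2 - \<gamma>"
    then show "AE \<omega> in M. \<forall>\<^sub>F n in sequentially.
        real (MAX i\<in>{0..n}. attachment_degree (\<lambda>j. v j \<omega>) n i) \<le> exp ((ln (real n)) powr \<nu>)"
      by (intro AE_max_degree_le) simp_all
  next
    assume "\<gamma> > 3 / 2"
    then show "(\<lambda>n. measure M {\<omega> \<in> space M. v n \<omega> = online_nn (\<lambda>i. X i \<omega>) n}) \<longlonglongrightarrow> 1"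
      by (rule online_nn_prob_tendsto)
  next
    assume "\<gamma> > 3 / 2"
    then show "(\<lambda>n. (1 / real n) *
        (\<integral>\<omega>. (\<Sum>i=1..n. of_bool (v i \<omega> \<noteq> online_nn (\<lambda>j. X j \<omega>) i)) \<partial>M)) \<longlonglongrightarrow> (0::real)"
      by (rule misattached_fraction_tendsto[unfolded misattached_fraction_def])
  next
    fix N :: "'b measure" and H :: "'b \<Rightarrow> ((real ^ 'd) \<times> real) set" and U :: "'b \<Rightarrow> real" and k :: nat
    assume "\<gamma> > 3 / 2" "marked_poisson_setup N H U \<and> 1 \<le> k"
    then show "(\<lambda>n. \<integral>\<omega>. \<bar>real (num_degree_ge (\<lambda>j. v j \<omega>) n k) / real n - ong_rho N H U k\<bar> \<partial>M) \<longlonglongrightarrow> 0"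
      by (intro num_degree_ge_L1) simp_all
  next
    fix N :: "'b measure" and H :: "'b \<Rightarrow> ((real ^ 'd) \<times> real) set" and U :: "'b \<Rightarrow> real" and k :: nat
    assume "\<gamma> > 3 / 2" "marked_poisson_setup N H U \<and> 1 \<le> k"
    then show "(\<lambda>n. (\<integral>\<omega>. real (num_degree_ge (\<lambda>j. v j \<omega>) n k) \<partial>M) / real n) \<longlonglongrightarrow> ong_rho N H U k"
      by (intro num_degree_ge_mean) simp_all
  qed
qed

end
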